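(* Let $(T_n,V_n)_{n\ge 1}$ be covariant and local operator families in $\mathcal A=C(\Omega)\rtimes\mathbb Z^d$ with $V_n=V_n^*$, $T_n$ invertible, the pairs $(T_n,V_n)$ being independent and identically distributed under $\mathbb P$, and with $\Lambda=\sup_{n\ge1}\{\|T_n\|,\|T_n^{-1}\|,\|V_n\|\}<\infty$. Suppose moreover that there are finite volume approximants $T_{n,L},V_{n,L}$ of $T_n,V_n$ (as defined in the context) and an $L_0$ such that $$\Lambda_L=\sup_{n\ge 1}\{\|T_{n,L}\|,\|T_{n,L}^{-1}\|,\|V_{n,L}\|\}\le 2\Lambda\qquad\text{for all }L\ge L_0 .$$ Let $H_N$ be the Jacobi operator with these entries, $\mathcal N_N$ its integrated density of states, and $S^E_N$ the phase velocity operator. Then there exists a constant $C$ such that for all $N\ge 3$ and uniformly in $E\in\mathbb R$ $$\left|\,\mathcal N_N(E)-\frac1{2\pi}\int_{-\infty}^E de\;\mathcal T(S_N^e)\,\right|\le\frac CN .$$ In particular, the $(d+1)$-dimensional integrated density of states $\mathcal N(E)=\lim_{N\to\infty}\mathcal N_N(E)$ satisfies $$\mathcal N(E)=\lim_{N\to\infty}\frac1{2\pi}\int_{-\infty}^E de\;\mathcal T(S_N^e).$$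
   Context: Algebra. Let $\Omega$ be a compact space with a continuous action $\tau=(\tau_1,\dots,\tau_d)$ of $\mathbb Z^d$ and an invariant ergodic probability measure $\mathbb P$ (expectation $\mathbf E$). Let $S_1,\dots,S_d$ be the right shifts on $\ell^2(\mathbb Z^d)$. $\mathcal A_0$ is the algebra of strongly continuous families $A=(A_\omega)_{\omega\in\Omega}$ of bounded operators on $\ell^2(\mathbb Z^d)$ satisfying the covariance relation $S_jA_\omega S_j^*=A_{\tau_j\omega}$ ($j=1,\dots,d$) and of finite range (there is $R$ with $\langle n|A_\omega|m\rangle=0$ for $|n-m|>R$ and all $\omega$). $\mathcal A=C(\Omega)\rtimes\mathbb Z^d$ is the completion of $\mathcal A_0$ in the norm $\|A\|=\sup_{\omega}\|A_\omega\|$. Its elements are called covariant and local. The finite normalized trace on $\mathcal A$ is $\mathcal T(A)=\mathbf E\,\langle 0|A_\omega|0\rangle$. By convention $\mathbb Z^0$ is one point. Jacobi operator and IDOS. $H_N$ is the selfadjoint $N\times N$ tridiagonal block operator ($N\ge3$) on $\ell^2(\{1,\dots,N\}\times\mathbb Z^d)$ with diagonal entries $V_1,\dots,V_N$, entries $T_{n}$ in position $(n-1,n)$ and $T_n^*$ in position $(n,n-1)$, $n=2,\dots,N$, and zeros elsewhere. Its integrated density of states is $$\mathcal N_N(E)=\frac1N\,\mathrm{Tr}_N\otimes\mathcal T\big(\chi(H_N\le E)\big),$$ where $\chi$ is the characteristic function and $\mathrm{Tr}_N$ the trace over $\mathbb C^N$. Transfer operators, Prüfer phase, phase velocity. For $E\in\mathbb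 R$, $$\mathcal M_n^E=\begin{pmatrix}(E\mathbf 1-V_n)T_n^{-1}&-T_n^*\\ T_n^{-1}&0\end{pmatrix},\qquad n\ge1,$$ with the convention that here $T_1=\mathbf 1$ ($T_1$ does not occur in $H_N$), and $$U_N^E=\Big[\tbinom{\mathbf 1}{\imath\mathbf 1}^*\mathcal M_N^E\cdots\mathcal M_1^E\tbinom{\mathbf 1}{0}\Big]\Big[\tbinom{\mathbf 1}{-\imath\mathbf 1}^*\mathcal M_N^E\cdots\mathcal M_1^E\tbinom{\mathbf 1}{0}\Big]^{-1},$$ which is a well-defined unitary element of $\mathcal A$ (here $\binom{\mathbf 1}{\imath\mathbf 1}^*=(\mathbf 1,-\imath\mathbf 1)$). Further, $S_N^E=\frac1{\imath N}(U_N^E)^*\partial_EU_N^E\in\mathcal A$. Finite volume approximants. Let $\pi_L:\ell^2(\mathbb Z^d)\to\ell^2(\{-L,\dots,L\}^d)\cong\mathbb C^{(2L+1)^d}$ be the restriction. Approximants $T_{n,L}$ and $V_{n,L}=V_{n,L}^*$ are matrices of size $(2L+1)^d$ (depending measurably on $\omega$) which coincide with $\pi_LT_n\pi_L^*$ and $\pi_LV_n\pi_L^*$ up to boundary terms localized close to the boundary of the cube $\{-L,\dots,L\}^d$, that is, the differences have nonvanishing matrix elements only between sites within a fixed distance $r$ (independent of $L$) of the boundary. The norms in the bound on $\Lambda_L$ are understood uniformly in $\omega$. *)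

theory Defs
  imports "HOL-Probability.Probability"
begin

section \<open>The lattice \<open>\<int>\<^sup>d\<close>\<close>

text \<open>
  A type of this class is a free abelian group of finite rank with a distinguished basis
  \<open>dirs = {e\<^sub>1, \<dots>, e\<^sub>d}\<close>; \<open>coord n e\<close> is the coefficient of \<open>n\<close> at \<open>e\<close>.  The axioms force
  \<open>n \<mapsto> (coord n e)\<^bsub>e \<in> dirs\<^esub>\<close> to be an isomorphism onto \<open>\<int>\<^sup>d\<close>, \<open>d = card dirs\<close>.  In contrast to
  \<open>int ^ 'd\<close> alone this includes \<open>d = 0\<close> (the one-point lattice, type \<open>unit\<close>).
\<close>

class int_lattice = ab_group_add +
  fixes dirs :: "'a set"
    and coord :: "'a \<Rightarrow> 'a \<Rightarrow> int"
  assumes finite_dirs: "finite dirs"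
    and coord_add: "e \<in> dirs \<Longrightarrow> coord (n + m) e = coord n e + coord m e"
    and coord_dirs: "e \<in> dirs \<Longrightarrow> f \<in> dirs \<Longrightarrow> coord e f = (if e = f then 1 else 0)"
    and coord_eqI: "(\<And>e. e \<in> dirs \<Longrightarrow> coord n e = coord m e) \<Longrightarrow> n = m"

lemma coord_zero: "e \<in> dirs \<Longrightarrow> coord (0::'z::int_lattice) e = 0"
  using coord_add[of e 0 0] by simp

lemma coord_minus: "e \<in> dirs \<Longrightarrow> coord (- n) e = - coord (n::'z::int_lattice) e"
  using coord_add[of e n "- n"] by (simp add: coord_zero)

lemma coord_sum:
  assumes "e \<in> dirs"
  shows "finite A \<Longrightarrow> coord (\<Sum>x\<in>A. f x) e = (\<Sum>x\<in>A. coord (f x :: 'z::int_lattice) e)"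
  by (induction A rule: finite_induct) (use assms in \<open>simp_all add: coord_zero coord_add\<close>)

lemma coord_bij:
  "bij_betw (\<lambda>n::'z::int_lattice. restrict (coord n) dirs) UNIV (dirs \<rightarrow>\<^sub>E (UNIV :: int set))"
proof (rule bij_betwI')
  fix n m :: 'z
  show "(restrict (coord n) dirs = restrict (coord m) dirs) = (n = m)"
    by (metis coord_eqI restrict_apply')
next
  fix n :: 'z
  show "restrict (coord n) dirs \<in> dirs \<rightarrow>\<^sub>E UNIV" by simp
next
  fix c :: "'z \<Rightarrow> int"
  assume c: "c \<in> dirs \<rightarrow>\<^sub>E UNIV"
  define mult :: "int \<Rightarrow> 'z \<Rightarrow> 'z" where
    "mult k x = (if k \<ge> 0 then (((+) x) ^^ nat k) 0 else - (((+) x) ^^ nat (- k)) 0)" for k x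
  have pow: "coord ((((+) x) ^^ k) 0) e = int k * coord x e" if "e \<in> dirs" for k and x e :: 'z
    using that by (induction k) (simp_all add: coord_zero coord_add algebra_simps)
  have mult: "coord (mult k x) e = k * coord x e" if "e \<in> dirs" for k and x e :: 'z
    using that by (simp add: mult_def pow coord_minus)
  have "coord (\<Sum>x\<in>dirs. mult (c x) x) e = c e" if "e \<in> dirs" for e :: 'z
  proof -
    have "coord (\<Sum>x\<in>dirs. mult (c x) x) e = (\<Sum>x\<in>dirs. c x * coord x e)"
      using that by (simp add: coord_sum finite_dirs mult)
    also have "\<dots> = (\<Sum>x\<in>dirs. if x = e then c x else 0)"
      using that by (intro sum.cong) (auto simp: coord_dirs)
    also have "\<dots> = c e" using that by (simp add: finite_dirs)
    finally show ?thesis .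
  qed
  then have "c = restrict (coord (\<Sum>x\<in>dirs. mult (c x) x)) dirs"
    using c by (auto simp: PiE_def extensional_def restrict_def)
  then show "\<exists>n\<in>UNIV. c = restrict (coord n) dirs" by blast
qed

instantiation unit :: int_lattice
begin
definition "zero_unit = ()"
definition "plus_unit (x::unit) (y::unit) = ()"
definition "minus_unit (x::unit) (y::unit) = ()"
definition "uminus_unit (x::unit) = ()"
definition "dirs_unit = ({} :: unit set)"
definition "coord_unit (n::unit) (e::unit) = (0::int)"
instance by standard (auto simp: dirs_unit_def)
end

instantiation int :: int_lattice
begin
definition "dirs_int = {1 :: int}"
definition "coord_int (n::int) (e::int) = n"
instance by standard (auto simp: dirs_int_def coord_int_def)
end

instantiation vec :: (int_lattice, finite) int_lattice
begin
definition "dirs_vec = {axis i b | i b. b \<in> (dirs :: 'a set)}"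
definition "coord_vec (n :: 'a ^ 'b) e =
  (\<Sum>i\<in>UNIV. if e $ i \<in> dirs then coord (n $ i) (e $ i) else 0)"
instance
proof
  have "(dirs :: ('a ^ 'b) set) = (\<Union>i\<in>UNIV. axis i ` dirs)"
    by (auto simp: dirs_vec_def)
  then show "finite (dirs :: ('a ^ 'b) set)"
    by (metis finite_UN_I finite_imageI finite_dirs finite)
  show "coord (n + m) e = coord n e + coord m e" if "e \<in> dirs" for n m e :: "'a ^ 'b"
    unfolding coord_vec_def sum.distrib[symmetric] by (intro sum.cong) (auto simp: coord_add)
  have z: "(0::'a) \<notin> dirs"
    using coord_dirs[of "0::'a" 0] coord_zero[of "0::'a"] by auto
  have ax: "coord n (axis i b) = coord (n $ i) b" if "b \<in> dirs" for n :: "'a ^ 'b" and i b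
  proof -
    have "coord n (axis i b) = (\<Sum>j\<in>UNIV. if j = i then coord (n $ i) b else 0)"
      unfolding coord_vec_def using that z by (intro sum.cong) (auto simp: axis_def)
    then show ?thesis by simp
  qed
  show "coord e f = (if e = f then 1 else 0)" if "e \<in> dirs" "f \<in> dirs" for e f :: "'a ^ 'b"
  proof -
    from that obtain i b j c where *: "e = axis i b" "b \<in> dirs" "f = axis j c" "c \<in> dirs"
      unfolding dirs_vec_def by blast
    have "b \<noteq> 0" "c \<noteq> 0" using * z by auto
    then have "(axis i b = axis j c) = (i = j \<and> b = c)" by (auto simp: axis_eq_axis)
    then show ?thesis
      using * by (simp add: ax coord_dirs) (simp add: axis_def coord_dirs coord_zero)
  qed
  show "n = m" if "\<And>e. e \<in> dirs \<Longrightarrow> coord n e = coord m e" for n m :: "'a ^ 'b"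
  proof (rule vec_eq_iff[THEN iffD2], rule allI, rule coord_eqI)
    fix i and b :: 'a assume "b \<in> dirs"
    then show "coord (n $ i) b = coord (m $ i) b"
      using that[of "axis i b"] by (auto simp: dirs_vec_def ax)
  qed
qed
end

definition site_norm :: "'z::int_lattice \<Rightarrow> real" where
  "site_norm n = sqrt (\<Sum>e\<in>dirs. (real_of_int (coord n e))\<^sup>2)"

definition cube :: "nat \<Rightarrow> 'z::int_lattice set" where
  "cube L = {n. \<forall>e\<in>dirs. \<bar>coord n e\<bar> \<le> int L}"

definition cube_boundary :: "nat \<Rightarrow> 'z::int_lattice set" where
  "cube_boundary L = {n \<in> cube L. \<exists>e\<in>dirs. \<bar>coord n e\<bar> = int L}"

definition near_boundary :: "real \<Rightarrow> nat \<Rightarrow> 'z::int_lattice \<Rightarrow> bool" where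
  "near_boundary r L n \<longleftrightarrow> (\<exists>b\<in>cube_boundary L. site_norm (n - b) \<le> r)"


section \<open>The Hilbert space \<open>\<ell>\<^sup>2(I)\<close> over \<open>\<complex>\<close>\<close>

typedef 'i ell2 = "{u :: 'i \<Rightarrow> complex. (\<lambda>i. (cmod (u i))\<^sup>2) summable_on UNIV}"
  morphisms ell2_apply Abs_ell2
  by (intro exI[of _ "\<lambda>_. 0"]) simp

setup_lifting type_definition_ell2

lemma ell2_sq_summable: "(\<lambda>i. (cmod (ell2_apply u i))\<^sup>2) summable_on UNIV"
  using ell2_apply by blast

lemma ell2_summableI:
  assumes "f summable_on UNIV" "\<And>i. (cmod (u i))\<^sup>2 \<le> f i"
  shows "(\<lambda>i. (cmod (u i))\<^sup>2) summable_on UNIV"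
  by (rule summable_on_comparison_test[OF assms(1)]) (use assms(2) in auto)

lemma ell2_mult_summable:
  fixes u v :: "'i ell2"
  shows "(\<lambda>i. cnj (ell2_apply u i) * ell2_apply v i) summable_on UNIV"
proof (rule abs_summable_summable, rule abs_summable_product)
  show "(\<lambda>i. norm (cnj (ell2_apply u i) * cnj (ell2_apply u i))) summable_on UNIV"
    using ell2_sq_summable[of u] by (simp add: norm_mult power2_eq_square)
  show "(\<lambda>i. norm (ell2_apply v i * ell2_apply v i)) summable_on UNIV"
    using ell2_sq_summable[of v] by (simp add: norm_mult power2_eq_square)
qed

lemma cmod_add_sq: "(cmod (a + b))\<^sup>2 \<le> 2 * (cmod a)\<^sup>2 + 2 * (cmod b)\<^sup>2"
proof -
  have "(cmod (a + b))\<^sup>2 \<le> (cmod a + cmod b)\<^sup>2"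
    by (intro power_mono norm_triangle_ineq norm_ge_zero)
  also have "\<dots> \<le> 2 * (cmod a)\<^sup>2 + 2 * (cmod b)\<^sup>2"
    using zero_le_power2[of "cmod a - cmod b"] by (simp add: power2_eq_square algebra_simps)
  finally show ?thesis .
qed

lemma ell2_add_closed:
  assumes "(\<lambda>i. (cmod (u i))\<^sup>2) summable_on UNIV" "(\<lambda>i. (cmod (v i))\<^sup>2) summable_on UNIV"
  shows "(\<lambda>i. (cmod (u i + v i))\<^sup>2) summable_on UNIV"
proof (rule ell2_summableI)
  show "(\<lambda>i. 2 * (cmod (u i))\<^sup>2 + 2 * (cmod (v i))\<^sup>2) summable_on UNIV"
    by (intro summable_on_add summable_on_cmult_right assms)
qed (rule cmod_add_sq)

class complex_scale =
  fixes scaleC :: "complex \<Rightarrow> 'a \<Rightarrow> 'a"  (infixr "*\<^sub>C" 75)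

instantiation ell2 :: (type) "{real_vector, complex_scale}"
begin

lift_definition zero_ell2 :: "'a ell2" is "\<lambda>_. 0" by simp

lift_definition plus_ell2 :: "'a ell2 \<Rightarrow> 'a ell2 \<Rightarrow> 'a ell2" is "\<lambda>u v i. u i + v i"
  by (rule ell2_add_closed)

lift_definition uminus_ell2 :: "'a ell2 \<Rightarrow> 'a ell2" is "\<lambda>u i. - u i" by simp

lift_definition minus_ell2 :: "'a ell2 \<Rightarrow> 'a ell2 \<Rightarrow> 'a ell2" is "\<lambda>u v i. u i - v i"
  using ell2_add_closed[of _ "\<lambda>i. - v i" for v] by fastforce

lift_definition scaleR_ell2 :: "real \<Rightarrow> 'a ell2 \<Rightarrow> 'a ell2" is "\<lambda>r u i. of_real r * u i"
  by (simp add: norm_mult power_mult_distrib summable_on_cmult_right)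

lift_definition scaleC_ell2 :: "complex \<Rightarrow> 'a ell2 \<Rightarrow> 'a ell2" is "\<lambda>c u i. c * u i"
  by (simp add: norm_mult power_mult_distrib summable_on_cmult_right)

instance
  by standard (transfer; auto simp: algebra_simps fun_eq_iff)+

end

lift_definition cinner :: "'i ell2 \<Rightarrow> 'i ell2 \<Rightarrow> complex" is
  "\<lambda>u v. \<Sum>\<^sub>\<infinity>i. cnj (u i) * v i" .

text \<open>The norm is that of the complex inner product; its real part makes \<open>'i ell2\<close> a real Hilbert space.\<close>

instantiation ell2 :: (type) real_inner
begin

definition "inner_ell2 (u :: 'a ell2) v = Re (cinner u v)"
definition "norm_ell2 (u :: 'a ell2) = sqrt (u \<bullet> u)"
definition "sgn_ell2 (u :: 'a ell2) = u /\<^sub>R norm u"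
definition "dist_ell2 (u :: 'a ell2) v = norm (u - v)"
definition "(uniformity :: ('a ell2 \<times> 'a ell2) filter) =
  (INF e\<in>{0 <..}. principal {(x, y). dist x y < e})"
definition "open (S :: 'a ell2 set) \<longleftrightarrow>
  (\<forall>x\<in>S. \<forall>\<^sub>F (x', y) in uniformity. x' = x \<longrightarrow> y \<in> S)"

lemma inner_ell2_self: "(u :: 'a ell2) \<bullet> u = (\<Sum>\<^sub>\<infinity>i. (cmod (ell2_apply u i))\<^sup>2)"
proof -
  have "u \<bullet> u = (\<Sum>\<^sub>\<infinity>i. Re (cnj (ell2_apply u i) * ell2_apply u i))"
    unfolding inner_ell2_def cinner.rep_eq using ell2_mult_summable by (rule infsum_Re[symmetric])
  also have "\<dots> = (\<Sum>\<^sub>\<infinity>i. (cmod (ell2_apply u i))\<^sup>2)"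
    by (rule infsum_cong) (simp add: cmod_power2 flip: power2_eq_square)
  finally show ?thesis .
qed

instance
proof
  fix u v w :: "'a ell2" and r :: real
  show "u \<bullet> v = v \<bullet> u"
  proof -
    have "cinner u v = cnj (cinner v u)"
      unfolding cinner.rep_eq infsum_cnj[symmetric] by (rule infsum_cong) (simp add: mult.commute)
    then show ?thesis by (simp add: inner_ell2_def)
  qed
  show "(u + v) \<bullet> w = u \<bullet> w + v \<bullet> w"
    unfolding inner_ell2_def cinner.rep_eq plus_ell2.rep_eq complex_cnj_add distrib_right
    by (subst infsum_add[OF ell2_mult_summable ell2_mult_summable]) simp
  show "r *\<^sub>R u \<bullet> v = r * (u \<bullet> v)"
    unfolding inner_ell2_def cinner.rep_eq scaleR_ell2.rep_eq
    by (simp add: mult.assoc infsum_cmult_right')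
  show "0 \<le> u \<bullet> u"
    unfolding inner_ell2_self by (rule infsum_nonneg) simp
  show "(u \<bullet> u = 0) = (u = 0)"
  proof
    assume "u \<bullet> u = 0"
    then have *: "(\<Sum>\<^sub>\<infinity>i. (cmod (ell2_apply u i))\<^sup>2) \<le> 0" by (simp add: inner_ell2_self)
    have "(cmod (ell2_apply u i))\<^sup>2 = 0" for i
      using nonneg_infsum_le_0D[OF * ell2_sq_summable, of i] by simp
    then show "u = 0" by transfer auto
  qed (simp add: inner_ell2_self zero_ell2.rep_eq)
  show "norm u = sqrt (u \<bullet> u)" by (simp add: norm_ell2_def)
qed (simp_all add: sgn_ell2_def dist_ell2_def uniformity_ell2_def open_ell2_def)

end

lemma norm_ell2_sq: "(norm (u :: 'i ell2))\<^sup>2 = (\<Sum>\<^sub>\<infinity>i. (cmod (ell2_apply u i))\<^sup>2)"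
  by (simp add: power2_norm_eq_inner inner_ell2_self)

lemma ell2_sum_le: "finite F \<Longrightarrow> (\<Sum>i\<in>F. (cmod (ell2_apply u i))\<^sup>2) \<le> (norm u)\<^sup>2"
  unfolding norm_ell2_sq by (rule finite_sum_le_infsum) (simp_all add: ell2_sq_summable)

lemma ell2_coord_le: "cmod (ell2_apply u i) \<le> norm u"
  using ell2_sum_le[of "{i}" u] by (simp add: power2_le_iff_abs_le)

lemma ell2_norm_leI:
  assumes "\<And>F. finite F \<Longrightarrow> (\<Sum>i\<in>F. (cmod (ell2_apply u i))\<^sup>2) \<le> B\<^sup>2" "0 \<le> B"
  shows "norm u \<le> B"
proof -
  have "(norm u)\<^sup>2 \<le> B\<^sup>2"
    unfolding norm_ell2_sq by (rule infsum_le_finite_sums[OF ell2_sq_summable]) (use assms in auto)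
  then show ?thesis using assms(2) by (rule power2_le_imp_le)
qed

lemma norm_scaleC_ell2: "norm (c *\<^sub>C (u :: 'i ell2)) = cmod c * norm u"
proof -
  have "(norm (c *\<^sub>C u))\<^sup>2 = (cmod c * norm u)\<^sup>2"
    unfolding power_mult_distrib norm_ell2_sq scaleC_ell2.rep_eq
    by (simp add: norm_mult power_mult_distrib infsum_cmult_right')
  then show ?thesis by (simp add: power2_eq_iff_nonneg)
qed

instance ell2 :: (type) complete_space
proof
  fix X :: "nat \<Rightarrow> 'a ell2"
  assume C: "Cauchy X"
  have "Cauchy (\<lambda>n. ell2_apply (X n) i)" for i
  proof (rule CauchyI)
    fix e :: real assume "e > 0"
    then obtain M where "\<forall>m\<ge>M. \<forall>n\<ge>M. norm (X m - X n) < e"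
      using C CauchyD by blast
    then show "\<exists>M. \<forall>m\<ge>M. \<forall>n\<ge>M. norm (ell2_apply (X m) i - ell2_apply (X n) i) < e"
      using ell2_coord_le[of "X m - X n" i for m n]
      unfolding minus_ell2.rep_eq by (meson le_less_trans)
  qed
  then have "\<forall>i. \<exists>l. (\<lambda>n. ell2_apply (X n) i) \<longlonglongrightarrow> l"
    using Cauchy_convergent convergent_def by blast
  then obtain x where x: "\<And>i. (\<lambda>n. ell2_apply (X n) i) \<longlonglongrightarrow> x i" by metis
  have fin: "\<exists>M. \<forall>m\<ge>M. \<forall>F. finite F \<longrightarrow> (\<Sum>i\<in>F. (cmod (ell2_apply (X m) i - x i))\<^sup>2) \<le> e\<^sup>2"
    if e: "e > 0" for e
  proof -
    obtain M where M: "\<And>m n. m \<ge> M \<Longrightarrow> n \<ge> M \<Longrightarrow> norm (X m - X n) < e"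
      using C CauchyD e by metis
    have "(\<Sum>i\<in>F. (cmod (ell2_apply (X m) i - x i))\<^sup>2) \<le> e\<^sup>2" if "m \<ge> M" "finite F" for m F
    proof (rule tendsto_upperbound)
      show "(\<lambda>n. \<Sum>i\<in>F. (cmod (ell2_apply (X m) i - ell2_apply (X n) i))\<^sup>2)
        \<longlonglongrightarrow> (\<Sum>i\<in>F. (cmod (ell2_apply (X m) i - x i))\<^sup>2)"
        by (intro tendsto_intros x)
      show "\<forall>\<^sub>F n in sequentially.
          (\<Sum>i\<in>F. (cmod (ell2_apply (X m) i - ell2_apply (X n) i))\<^sup>2) \<le> e\<^sup>2"
      proof (rule eventually_sequentiallyI[of M])
        fix n assume "n \<ge> M"
        then have "(norm (X m - X n))\<^sup>2 \<le> e\<^sup>2"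
          using M[OF \<open>m \<ge> M\<close>, of n] by (intro power_mono) auto
        then show "(\<Sum>i\<in>F. (cmod (ell2_apply (X m) i - ell2_apply (X n) i))\<^sup>2) \<le> e\<^sup>2"
          using ell2_sum_le[OF \<open>finite F\<close>, of "X m - X n"] by (simp add: minus_ell2.rep_eq)
      qed
    qed simp
    then show ?thesis by blast
  qed
  have diff: "(\<lambda>i. (cmod (ell2_apply (X m) i - x i))\<^sup>2) summable_on UNIV"
    if "\<forall>F. finite F \<longrightarrow> (\<Sum>i\<in>F. (cmod (ell2_apply (X m) i - x i))\<^sup>2) \<le> e\<^sup>2" for m e
    using that by (intro nonneg_bdd_above_summable_on) (auto intro!: bdd_aboveI[where M = "e\<^sup>2"])
  have sx: "(\<lambda>i. (cmod (x i))\<^sup>2) summable_on UNIV"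
  proof -
    obtain m where "\<forall>F. finite F \<longrightarrow> (\<Sum>i\<in>F. (cmod (ell2_apply (X m) i - x i))\<^sup>2) \<le> 1\<^sup>2"
      using fin[of 1] by auto
    from diff[OF this]
    have d: "(\<lambda>i. (cmod (x i - ell2_apply (X m) i))\<^sup>2) summable_on UNIV"
      by (simp add: norm_minus_commute)
    show ?thesis
      using ell2_add_closed[OF d ell2_sq_summable[of "X m"]] by simp
  qed
  define l where "l = Abs_ell2 x"
  have l: "ell2_apply l = x" using sx by (simp add: l_def Abs_ell2_inverse)
  have "X \<longlonglongrightarrow> l"
  proof (rule LIMSEQ_I)
    fix e :: real assume "e > 0"
    then obtain M where M: "\<And>m F. m \<ge> M \<Longrightarrow> finite F \<Longrightarrow>
        (\<Sum>i\<in>F. (cmod (ell2_apply (X m) i - x i))\<^sup>2) \<le> (e/2)\<^sup>2"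
      using fin[of "e/2"] by auto
    have "norm (X m - l) \<le> e/2" if "m \<ge> M" for m
      using M[OF that] \<open>e > 0\<close> by (intro ell2_norm_leI) (auto simp: minus_ell2.rep_eq l)
    then show "\<exists>no. \<forall>n\<ge>no. norm (X n - l) < e"
      using \<open>e > 0\<close> by (intro exI[of _ M]) (auto intro: le_less_trans[of _ "e/2"])
  qed
  then show "convergent X" by (auto simp: convergent_def)
qed

instance ell2 :: (type) banach ..

lift_definition ket :: "'i \<Rightarrow> 'i ell2" is "\<lambda>j i. if i = j then 1 else 0"
proof -
  fix j :: 'i
  have "(\<lambda>i. (cmod (if i = j then 1 else 0))\<^sup>2) summable_on {j}" by (rule summable_on_finite) simp
  then show "(\<lambda>i. (cmod (if i = j then 1 else 0))\<^sup>2) summable_on UNIV"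
    by (rule summable_on_cong_neutral[THEN iffD1, rotated -1]) auto
qed

lemma norm_ket: "norm (ket j) = 1"
proof (rule antisym)
  show "norm (ket j) \<le> 1"
    by (rule ell2_norm_leI) (auto simp: ket.rep_eq if_distrib[of cmod] if_distrib[of "\<lambda>x. x\<^sup>2"] sum.If_cases
        Int_def card_le_Suc0_iff_eq cong: if_cong)
  show "1 \<le> norm (ket j)"
    using ell2_coord_le[of "ket j" j] by (simp add: ket.rep_eq)
qed


lemma scaleC_ell2_add: "c *\<^sub>C (u + v) = c *\<^sub>C u + c *\<^sub>C (v :: 'i ell2)"
  by transfer (simp add: algebra_simps)

lemma scaleC_ell2_diff: "c *\<^sub>C (u - v) = c *\<^sub>C u - c *\<^sub>C (v :: 'i ell2)"
  by transfer (simp add: algebra_simps)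

lemma scaleC_ell2_minus: "c *\<^sub>C (- u) = - (c *\<^sub>C (u :: 'i ell2))"
  by transfer simp

lemma scaleC_ell2_zero: "c *\<^sub>C 0 = (0 :: 'i ell2)"
  by transfer simp

lemma scaleC_ell2_scaleR: "c *\<^sub>C (r *\<^sub>R u) = r *\<^sub>R (c *\<^sub>C (u :: 'i ell2))"
  by transfer (simp add: algebra_simps)

lemma scaleC_ell2_scaleC: "c *\<^sub>C (d *\<^sub>C u) = d *\<^sub>C (c *\<^sub>C (u :: 'i ell2))"
  by transfer (simp add: algebra_simps)

lemma bounded_linear_scaleC_ell2: "bounded_linear (\<lambda>u :: 'i ell2. c *\<^sub>C u)"
  by (rule bounded_linear_intro[where K = "cmod c"])
    (simp_all add: scaleC_ell2_add scaleC_ell2_scaleR norm_scaleC_ell2)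

lift_definition translate :: "'z::ab_group_add \<Rightarrow> 'z ell2 \<Rightarrow> 'z ell2" is
  "\<lambda>e u n. u (n - e)"
proof -
  fix e :: 'z and u :: "'z \<Rightarrow> complex"
  assume "(\<lambda>n. (cmod (u n))\<^sup>2) summable_on UNIV"
  moreover have "bij (\<lambda>n. n - e)"
    by (rule bij_betw_byWitness[where f' = "\<lambda>n. n + e"]) auto
  ultimately show "(\<lambda>n. (cmod (u (n - e)))\<^sup>2) summable_on UNIV"
    using summable_on_reindex_bij_betw[of "\<lambda>n. n - e" UNIV UNIV "\<lambda>n. (cmod (u n))\<^sup>2"] by simp
qed

lift_definition restrict_ell2 :: "'i set \<Rightarrow> 'i ell2 \<Rightarrow> 'i ell2" is
  "\<lambda>X u i. if i \<in> X then u i else 0"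
  by (rule ell2_summableI) auto

lift_definition layer :: "'k \<Rightarrow> ('k \<times> 'i) ell2 \<Rightarrow> 'i ell2" is "\<lambda>k \<psi> i. \<psi> (k, i)"
proof -
  fix k :: 'k and \<psi> :: "'k \<times> 'i \<Rightarrow> complex"
  assume "(\<lambda>x. (cmod (\<psi> x))\<^sup>2) summable_on UNIV"
  then have "(\<lambda>x. (cmod (\<psi> x))\<^sup>2) summable_on (Pair k ` UNIV)"
    by (rule summable_on_subset_banach) simp
  then show "(\<lambda>i. (cmod (\<psi> (k, i)))\<^sup>2) summable_on UNIV"
    by (subst (asm) summable_on_reindex) (auto simp: inj_on_def o_def)
qed

lift_definition layer_embed :: "'k \<Rightarrow> 'i ell2 \<Rightarrow> ('k \<times> 'i) ell2" is
  "\<lambda>k u x. if fst x = k then u (snd x) else 0"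
proof -
  fix k :: 'k and u :: "'i \<Rightarrow> complex"
  assume "(\<lambda>i. (cmod (u i))\<^sup>2) summable_on UNIV"
  then have "(\<lambda>x. (cmod (u (snd x)))\<^sup>2) summable_on (Pair k ` UNIV)"
    by (subst summable_on_reindex) (auto simp: inj_on_def o_def)
  then show "(\<lambda>x. (cmod (if fst x = k then u (snd x) else 0))\<^sup>2) summable_on UNIV"
    by (rule summable_on_cong_neutral[THEN iffD1, rotated -1]) auto
qed

lemma norm_layer:
  fixes \<psi> :: "('a \<times> 'b) ell2"
  shows "norm (layer k \<psi>) \<le> norm \<psi>"
proof (rule ell2_norm_leI)
  fix F :: "'b set" assume F: "finite F"
  have "(\<Sum>i\<in>F. (cmod (ell2_apply (layer k \<psi>) i))\<^sup>2) =
      (\<Sum>x\<in>Pair k ` F. (cmod (ell2_apply \<psi> x))\<^sup>2)"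
    by (subst sum.reindex) (auto simp: layer.rep_eq inj_on_def)
  then show "(\<Sum>i\<in>F. (cmod (ell2_apply (layer k \<psi>) i))\<^sup>2) \<le> (norm \<psi>)\<^sup>2"
    using ell2_sum_le[of "Pair k ` F" \<psi>] F by simp
qed simp

lemma norm_layer_embed:
  fixes u :: "'b ell2" and k :: 'a
  shows "norm (layer_embed k u) \<le> norm u"
proof (rule ell2_norm_leI)
  fix F :: "('a \<times> 'b) set" assume F: "finite F"
  have "(\<Sum>x\<in>F. (cmod (ell2_apply (layer_embed k u) x))\<^sup>2) =
      (\<Sum>x\<in>F \<inter> {x. fst x = k}. (cmod (ell2_apply u (snd x)))\<^sup>2)"
    using F by (simp add: layer_embed.rep_eq sum.inter_restrict if_distrib[of cmod]
        if_distrib[of "\<lambda>x. x\<^sup>2"] cong: if_cong)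
  also have "\<dots> = (\<Sum>i\<in>snd ` (F \<inter> {x. fst x = k}). (cmod (ell2_apply u i))\<^sup>2)"
    by (subst sum.reindex) (auto simp: inj_on_def)
  also have "\<dots> \<le> (norm u)\<^sup>2" using F by (intro ell2_sum_le) simp
  finally show "(\<Sum>x\<in>F. (cmod (ell2_apply (layer_embed k u) x))\<^sup>2) \<le> (norm u)\<^sup>2" .
qed simp

lemma translate_linear:
  "translate e (u + v) = translate e u + translate e v"
  "translate e (c *\<^sub>C u) = c *\<^sub>C translate e u"
  "translate e (ket n) = ket (n + e)"
  by (transfer, auto simp: fun_eq_iff algebra_simps)+

lemma restrict_ell2_linear:
  "restrict_ell2 X (u + v) = restrict_ell2 X u + restrict_ell2 X v"
  "restrict_ell2 X (c *\<^sub>C u) = c *\<^sub>C restrict_ell2 X u"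
  by (transfer, auto simp: fun_eq_iff algebra_simps)+

lemma layer_linear:
  "layer_embed k (u + v) = layer_embed k u + layer_embed k v"
  "layer_embed k (c *\<^sub>C u) = c *\<^sub>C layer_embed k u"
  "layer l (\<phi> + \<psi>) = layer l \<phi> + layer l \<psi>"
  "layer l (c *\<^sub>C \<phi>) = c *\<^sub>C layer l \<phi>"
  by (transfer, auto simp: fun_eq_iff algebra_simps)+

lemma scaleC_of_real_ell2: "complex_of_real r *\<^sub>C u = r *\<^sub>R (u :: 'i ell2)"
  by transfer simp


section \<open>Bounded operators on \<open>\<ell>\<^sup>2(I)\<close>\<close>

typedef 'i bop =
  "{A :: 'i ell2 \<Rightarrow>\<^sub>L 'i ell2. \<forall>c u. blinfun_apply A (c *\<^sub>C u) = c *\<^sub>C blinfun_apply A u}"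
  morphisms blinfun_of_bop Abs_bop
  by (intro exI[of _ 0]) (simp add: scaleC_ell2_zero)

lifting_forget ell2.lifting

setup_lifting type_definition_bop

lift_definition bop_apply :: "'i bop \<Rightarrow> 'i ell2 \<Rightarrow> 'i ell2"  (infixr "*\<^sub>V" 75) is blinfun_apply .

lemma bop_eqI: "(\<And>u. A *\<^sub>V u = B *\<^sub>V u) \<Longrightarrow> A = B"
  by transfer (rule blinfun_eqI)

lift_definition scaleC_blinfun :: "complex \<Rightarrow> 'i ell2 \<Rightarrow>\<^sub>L 'i ell2" is "\<lambda>c u. c *\<^sub>C u"
  by (rule bounded_linear_scaleC_ell2)

instantiation bop :: (type) "{real_algebra_1, complex_scale}"
begin

lift_definition zero_bop :: "'a bop" is 0 by (simp add: scaleC_ell2_zero)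

lift_definition one_bop :: "'a bop" is id_blinfun by simp

lift_definition plus_bop :: "'a bop \<Rightarrow> 'a bop \<Rightarrow> 'a bop" is "(+)"
  by (simp add: blinfun.add_left scaleC_ell2_add)

lift_definition minus_bop :: "'a bop \<Rightarrow> 'a bop \<Rightarrow> 'a bop" is "(-)"
  by (simp add: blinfun.diff_left scaleC_ell2_diff)

lift_definition uminus_bop :: "'a bop \<Rightarrow> 'a bop" is uminus
  by (simp add: blinfun.minus_left scaleC_ell2_minus)

lift_definition times_bop :: "'a bop \<Rightarrow> 'a bop \<Rightarrow> 'a bop" is "(o\<^sub>L)" by simp

lift_definition scaleR_bop :: "real \<Rightarrow> 'a bop \<Rightarrow> 'a bop" is "(*\<^sub>R)"
  by (simp add: blinfun.scaleR_left scaleC_ell2_scaleR)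

lift_definition scaleC_bop :: "complex \<Rightarrow> 'a bop \<Rightarrow> 'a bop" is "\<lambda>c A. scaleC_blinfun c o\<^sub>L A"
  by (simp add: scaleC_blinfun.rep_eq scaleC_ell2_scaleC)

instance
proof
  fix A B C :: "'a bop" and r s :: real
  show "A + B + C = A + (B + C)" "A + B = B + A" "0 + A = A" "- A + A = 0" "A - B = A + - B"
    "r *\<^sub>R (A + B) = r *\<^sub>R A + r *\<^sub>R B" "(r + s) *\<^sub>R A = r *\<^sub>R A + s *\<^sub>R A"
    "r *\<^sub>R s *\<^sub>R A = (r * s) *\<^sub>R A" "1 *\<^sub>R A = A"
    by (transfer, simp add: algebra_simps)+
  show "A * B * C = A * (B * C)" "1 * A = A" "A * 1 = A"
    by (transfer, auto intro!: blinfun_eqI)+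
  show "(A + B) * C = A * C + B * C" "A * (B + C) = A * B + A * C"
    "r *\<^sub>R A * B = r *\<^sub>R (A * B)" "A * r *\<^sub>R B = r *\<^sub>R (A * B)"
    by (transfer, auto intro!: blinfun_eqI simp: blinfun.bilinear_simps)+
  show "(0 :: 'a bop) \<noteq> 1"
  proof transfer
    have "ket undefined \<noteq> (0 :: 'a ell2)"
      using norm_ket[of "undefined :: 'a"] by force
    moreover have "blinfun_apply (0 :: 'a ell2 \<Rightarrow>\<^sub>L 'a ell2) u = 0" "blinfun_apply id_blinfun u = u"
      for u :: "'a ell2" by simp_all
    ultimately show "(0 :: 'a ell2 \<Rightarrow>\<^sub>L 'a ell2) \<noteq> id_blinfun" by metis
  qed
qed

end

instantiation bop :: (type) real_normed_algebra_1
begin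

lift_definition norm_bop :: "'a bop \<Rightarrow> real" is norm .

definition "sgn_bop (A :: 'a bop) = A /\<^sub>R norm A"
definition "dist_bop (A :: 'a bop) B = norm (A - B)"
definition "(uniformity :: ('a bop \<times> 'a bop) filter) =
  (INF e\<in>{0 <..}. principal {(x, y). dist x y < e})"
definition "open (S :: 'a bop set) \<longleftrightarrow>
  (\<forall>x\<in>S. \<forall>\<^sub>F (x', y) in uniformity. x' = x \<longrightarrow> y \<in> S)"

instance
proof
  fix A B :: "'a bop" and r :: real
  show "dist A B = norm (A - B)" by (simp add: dist_bop_def)
  show "sgn A = A /\<^sub>R norm A" by (simp add: sgn_bop_def)
  show "(norm A = 0) = (A = 0)" "norm (A + B) \<le> norm A + norm B" "norm (r *\<^sub>R A) = \<bar>r\<bar> * norm A"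
    by (transfer, simp add: norm_triangle_ineq)+
  show "norm (A * B) \<le> norm A * norm B" by transfer (rule norm_blinfun_compose)
  show "norm (1 :: 'a bop) = 1"
  proof transfer
    show "norm (id_blinfun :: 'a ell2 \<Rightarrow>\<^sub>L 'a ell2) = 1"
      using norm_blinfun[of "id_blinfun :: 'a ell2 \<Rightarrow>\<^sub>L 'a ell2" "ket undefined"]
        norm_blinfun_id_le[where 'a = "'a ell2"]
      by (simp add: norm_ket)
  qed
qed (simp_all add: uniformity_bop_def open_bop_def)

end

lemma bop_apply_times: "(A * B) *\<^sub>V u = A *\<^sub>V B *\<^sub>V u"
  by transfer simp

lemma norm_bop_apply: "norm (A *\<^sub>V u) \<le> norm A * norm u"
  by transfer (rule norm_blinfun)

instance bop :: (type) complete_space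
proof
  fix X :: "nat \<Rightarrow> 'a bop"
  assume "Cauchy X"
  then have "Cauchy (\<lambda>n. blinfun_of_bop (X n))"
    unfolding Cauchy_def dist_norm minus_bop.rep_eq[symmetric] norm_bop.rep_eq[symmetric] .
  then obtain A where A: "(\<lambda>n. blinfun_of_bop (X n)) \<longlonglongrightarrow> A"
    using Cauchy_convergent convergent_def by blast
  have "blinfun_apply A (c *\<^sub>C u) = c *\<^sub>C blinfun_apply A u" for c u
  proof (rule LIMSEQ_unique)
    have lin: "blinfun_of_bop (X n) (c *\<^sub>C u) = c *\<^sub>C blinfun_of_bop (X n) u" for n
      using blinfun_of_bop[of "X n"] by simp
    show "(\<lambda>n. blinfun_of_bop (X n) (c *\<^sub>C u)) \<longlonglongrightarrow> blinfun_apply A (c *\<^sub>C u)"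
      by (intro tendsto_intros A)
    have "(\<lambda>n. c *\<^sub>C blinfun_of_bop (X n) u) \<longlonglongrightarrow> c *\<^sub>C blinfun_apply A u"
      by (intro bounded_linear.tendsto[OF bounded_linear_scaleC_ell2] tendsto_intros A)
    then show "(\<lambda>n. blinfun_of_bop (X n) (c *\<^sub>C u)) \<longlonglongrightarrow> c *\<^sub>C blinfun_apply A u"
      by (simp add: lin)
  qed
  then have A': "blinfun_of_bop (Abs_bop A) = A" by (simp add: Abs_bop_inverse)
  have "X \<longlonglongrightarrow> Abs_bop A"
    using A unfolding tendsto_iff dist_norm minus_bop.rep_eq norm_bop.rep_eq A' .
  then show "convergent X" by (auto simp: convergent_def)
qed

instance bop :: (type) banach ..

lemma bop_existsI:
  assumes "\<And>u v. f (u + v) = f u + f v" "\<And>c u. f (c *\<^sub>C u) = c *\<^sub>C f u"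
    "\<And>u. norm (f u) \<le> K * norm u"
  shows "\<exists>A. bop_apply A = f"
proof -
  have "bounded_linear f"
  proof (rule bounded_linear_intro[where K = K])
    show "f (r *\<^sub>R u) = r *\<^sub>R f u" for r u using assms(2)[of "of_real r" u] by (simp add: scaleC_of_real_ell2)
  qed (use assms in \<open>auto simp: mult.commute\<close>)
  then have "bop_apply (Abs_bop (Blinfun f)) = f"
    using assms(2) by (simp add: bop_apply.rep_eq Abs_bop_inverse bounded_linear_Blinfun_apply)
  then show ?thesis by blast
qed

definition bop_of :: "('i ell2 \<Rightarrow> 'i ell2) \<Rightarrow> 'i bop" where
  "bop_of f = (THE A. bop_apply A = f)"

lemma bop_of_apply:
  assumes "\<And>u v. f (u + v) = f u + f v" "\<And>c u. f (c *\<^sub>C u) = c *\<^sub>C f u"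
    "\<And>u. norm (f u) \<le> K * norm u"
  shows "bop_of f *\<^sub>V u = f u"
proof -
  obtain A where "bop_apply A = f" using bop_existsI[of f K] assms by blast
  then have "bop_apply (bop_of f) = f"
    unfolding bop_of_def by (rule theI) (metis \<open>bop_apply A = f\<close> bop_eqI)
  then show ?thesis by simp
qed

definition adj :: "'i bop \<Rightarrow> 'i bop" where
  "adj A = (THE B. \<forall>u v. cinner (B *\<^sub>V u) v = cinner u (A *\<^sub>V v))"

definition self_adjoint :: "'i bop \<Rightarrow> bool" where
  "self_adjoint A \<longleftrightarrow> (\<forall>u v. cinner (A *\<^sub>V u) v = cinner u (A *\<^sub>V v))"

definition mel :: "'i \<Rightarrow> 'i bop \<Rightarrow> 'i \<Rightarrow> complex" where
  "mel i A j = cinner (ket i) (A *\<^sub>V ket j)"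

text \<open>
  For a projection \<open>p\<close> the corner \<open>p B p = B\<close> is the algebra of operators on the range of \<open>p\<close>, with
  unit \<open>p\<close>.  For \<open>p = 1\<close> these are ordinary invertibility and the ordinary inverse.
\<close>

definition is_inverse_in :: "'i bop \<Rightarrow> 'i bop \<Rightarrow> 'i bop \<Rightarrow> bool" where
  "is_inverse_in p A B \<longleftrightarrow> p * B * p = B \<and> A * B = p \<and> B * A = p"

definition inverse_in :: "'i bop \<Rightarrow> 'i bop \<Rightarrow> 'i bop" where
  "inverse_in p A = (THE B. is_inverse_in p A B)"

abbreviation bop_inv :: "'i bop \<Rightarrow> 'i bop" where
  "bop_inv \<equiv> inverse_in 1"

text \<open>
  The \<open>\<sigma>\<close>-algebra generated by the matrix elements, i.e. the Borel \<open>\<sigma>\<close>-algebra of the weak operator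
  topology on bounded sets; the norm-Borel \<open>\<sigma>\<close>-algebra would be too fine for strongly continuous
  families.
\<close>

definition bop_borel :: "'i bop measure" where
  "bop_borel = sigma UNIV {{A. mel i A j \<in> B} | i j B. B \<in> sets (borel :: complex measure)}"


section \<open>Spectral projections\<close>

text \<open>
  \<open>F\<close> is the spectral family (resolution of the identity) of the bounded self-adjoint operator \<open>H\<close>:
  an increasing, strongly right-continuous family of orthogonal projections, \<open>0\<close> far left and \<open>1\<close>
  far right, with \<open>H = \<integral>\<lambda> dF(\<lambda>)\<close> as a quadratic form.  By the spectral theorem it is unique, and
  \<open>F(E)\<close> is the value \<open>\<chi>(H \<le> E)\<close> of the functional calculus at the indicator function.
\<close>

definition spectral_family :: "'i bop \<Rightarrow> (real \<Rightarrow> 'i bop) \<Rightarrow> bool" where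
  "spectral_family H F \<longleftrightarrow>
     (\<forall>x. self_adjoint (F x) \<and> F x * F x = F x) \<and>
     (\<forall>x y. x \<le> y \<longrightarrow> F x * F y = F x \<and> F y * F x = F x) \<and>
     (\<forall>x u. ((\<lambda>y. F y *\<^sub>V u) \<longlongrightarrow> F x *\<^sub>V u) (at_right x)) \<and>
     (\<exists>K. (\<forall>x < - K. F x = 0) \<and> (\<forall>x\<ge>K. F x = 1)) \<and>
     (\<forall>u. cinner u (H *\<^sub>V u) =
        of_real (LINT x|interval_measure (\<lambda>y. Re (cinner u (F y *\<^sub>V u))). x))"

definition spectral_proj :: "'i bop \<Rightarrow> real \<Rightarrow> 'i bop" where
  "spectral_proj H = (THE F. spectral_family H F)"


section \<open>Covariant local operator families\<close>

definition continuous_action :: "('z::int_lattice \<Rightarrow> 'w::topological_space \<Rightarrow> 'w) \<Rightarrow> bool" where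
  "continuous_action \<tau> \<longleftrightarrow>
     \<tau> 0 = id \<and> (\<forall>n m. \<tau> (n + m) = \<tau> n \<circ> \<tau> m) \<and> (\<forall>n. continuous_on UNIV (\<tau> n))"

definition invariant_ergodic :: "'w measure \<Rightarrow> ('z::int_lattice \<Rightarrow> 'w \<Rightarrow> 'w) \<Rightarrow> bool" where
  "invariant_ergodic P \<tau> \<longleftrightarrow>
     (\<forall>n. \<tau> n \<in> measurable P P \<and> distr P P (\<tau> n) = P) \<and>
     (\<forall>A\<in>sets P. (\<forall>n. \<tau> n -` A \<inter> space P = A) \<longrightarrow> measure P A = 0 \<or> measure P A = 1)"

definition shift :: "'z::ab_group_add \<Rightarrow> 'z bop" where
  "shift e = bop_of (translate e)"

lemma shift_apply: "shift e *\<^sub>V u = translate e u"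
  unfolding shift_def
proof (rule bop_of_apply[where K = 1])
  show "translate e (u + v) = translate e u + translate e v" for u v by (rule translate_linear)
  show "translate e (c *\<^sub>C u) = c *\<^sub>C translate e u" for c u by (rule translate_linear)
  show "norm (translate e u) \<le> 1 * norm u" for u
  proof (rule ell2_norm_leI)
    fix F :: "'a set" assume "finite F"
    have "(\<Sum>i\<in>F. (cmod (ell2_apply (translate e u) i))\<^sup>2) =
        (\<Sum>i\<in>(\<lambda>n. n - e) ` F. (cmod (ell2_apply u i))\<^sup>2)"
      by (subst sum.reindex) (auto simp: translate.rep_eq)
    then show "(\<Sum>i\<in>F. (cmod (ell2_apply (translate e u) i))\<^sup>2) \<le> (1 * norm u)\<^sup>2"
      using ell2_sum_le[of "(\<lambda>n. n - e) ` F" u] \<open>finite F\<close> by simp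
  qed simp
qed

lemma shift_ket: "shift e *\<^sub>V ket n = ket (n + e)"
  unfolding shift_apply by (rule translate_linear)

definition covariant :: "('z::int_lattice \<Rightarrow> 'w \<Rightarrow> 'w) \<Rightarrow> ('w \<Rightarrow> 'z bop) \<Rightarrow> bool" where
  "covariant \<tau> A \<longleftrightarrow> (\<forall>e\<in>dirs. \<forall>\<omega>. shift e * A \<omega> * adj (shift e) = A (\<tau> e \<omega>))"

definition finite_range :: "('w \<Rightarrow> 'z::int_lattice bop) \<Rightarrow> bool" where
  "finite_range A \<longleftrightarrow> (\<exists>R. \<forall>\<omega> n m. site_norm (n - m) > R \<longrightarrow> mel n (A \<omega>) m = 0)"

definition local_algebra0 ::
    "('z::int_lattice \<Rightarrow> 'w::topological_space \<Rightarrow> 'w) \<Rightarrow> ('w \<Rightarrow> 'z bop) set" where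
  "local_algebra0 \<tau> =
     {A. (\<forall>u. continuous_on UNIV (\<lambda>\<omega>. A \<omega> *\<^sub>V u)) \<and> covariant \<tau> A \<and> finite_range A}"

text \<open>
  The completion in the norm \<open>sup\<^sub>\<omega> \<parallel>A\<^sub>\<omega>\<parallel>\<close> is realised as the closure inside the (complete) space of
  bounded families, i.e. under limits uniform in \<open>\<omega>\<close>.
\<close>

definition local_algebra ::
    "('z::int_lattice \<Rightarrow> 'w::topological_space \<Rightarrow> 'w) \<Rightarrow> ('w \<Rightarrow> 'z bop) set" where
  "local_algebra \<tau> =
     {A. \<exists>B. (\<forall>k. B k \<in> local_algebra0 \<tau>) \<and> uniform_limit UNIV B A sequentially}"

definition family_norm :: "('w \<Rightarrow> 'i bop) \<Rightarrow> ereal" where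
  "family_norm A = (SUP \<omega>. ereal (norm (A \<omega>)))"

definition trace_per_site :: "'w measure \<Rightarrow> ('w \<Rightarrow> 'z::int_lattice bop) \<Rightarrow> complex" where
  "trace_per_site P A = (LINT \<omega>|P. mel 0 (A \<omega>) 0)"

definition family_deriv :: "(real \<Rightarrow> 'w \<Rightarrow> 'i bop) \<Rightarrow> real \<Rightarrow> 'w \<Rightarrow> 'i bop" where
  "family_deriv A E =
     (THE D. uniform_limit UNIV (\<lambda>h \<omega>. (A (E + h) \<omega> - A E \<omega>) /\<^sub>R h) D (at 0))"


section \<open>Finite volume approximants\<close>

text \<open>
  \<open>cube_proj L = \<pi>\<^sub>L\<^sup>* \<pi>\<^sub>L\<close>.  Matrices indexed by the cube are identified with the operators \<open>B\<close> such that
  \<open>cube_proj L * B * cube_proj L = B\<close>; this preserves products, adjoints and norms, and \<open>\<pi>\<^sub>L A \<pi>\<^sub>L\<^sup>*\<close>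
  becomes \<open>cube_proj L * A * cube_proj L\<close>.
\<close>

definition cube_proj :: "nat \<Rightarrow> 'z::int_lattice bop" where
  "cube_proj L = bop_of (restrict_ell2 (cube L))"

lemma cube_proj_apply: "cube_proj L *\<^sub>V u = restrict_ell2 (cube L) u"
  unfolding cube_proj_def
proof (rule bop_of_apply[where K = 1])
  fix u v :: "'a ell2" and c :: complex
  show "restrict_ell2 (cube L) (u + v) = restrict_ell2 (cube L) u + restrict_ell2 (cube L) v"
    by (rule restrict_ell2_linear)
  show "restrict_ell2 (cube L) (c *\<^sub>C u) = c *\<^sub>C restrict_ell2 (cube L) u"
    by (rule restrict_ell2_linear)
  show "norm (restrict_ell2 (cube L) u) \<le> 1 * norm u"
  proof (rule ell2_norm_leI)
    fix F :: "'a set" assume F: "finite F"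
    have "(\<Sum>i\<in>F. (cmod (ell2_apply (restrict_ell2 (cube L) u) i))\<^sup>2)
        \<le> (\<Sum>i\<in>F. (cmod (ell2_apply u i))\<^sup>2)"
      by (intro sum_mono) (simp add: restrict_ell2.rep_eq)
    also have "\<dots> \<le> (1 * norm u)\<^sup>2" using ell2_sum_le[OF F, of u] by simp
    finally show "(\<Sum>i\<in>F. (cmod (ell2_apply (restrict_ell2 (cube L) u) i))\<^sup>2) \<le> (1 * norm u)\<^sup>2" .
  qed simp
qed

definition finite_volume_approximant ::
    "'w measure \<Rightarrow> ('w \<Rightarrow> 'z::int_lattice bop) \<Rightarrow> (nat \<Rightarrow> 'w \<Rightarrow> 'z bop) \<Rightarrow> bool" where
  "finite_volume_approximant P A A' \<longleftrightarrow>
     (\<forall>L. A' L \<in> measurable P bop_borel) \<and>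
     (\<forall>L \<omega>. cube_proj L * A' L \<omega> * cube_proj L = A' L \<omega>) \<and>
     (\<exists>r. \<forall>L \<omega> n m. mel n (A' L \<omega> - cube_proj L * A \<omega> * cube_proj L) m \<noteq> 0 \<longrightarrow>
        near_boundary r L n \<and> near_boundary r L m)"


section \<open>Jacobi operator, integrated density of states and phase velocity\<close>

definition block :: "'k \<Rightarrow> 'k \<Rightarrow> 'i bop \<Rightarrow> ('k \<times> 'i) bop" where
  "block k l A = bop_of (\<lambda>\<psi>. layer_embed k (A *\<^sub>V layer l \<psi>))"

lemma bop_apply_add: "A *\<^sub>V (u + v) = A *\<^sub>V u + A *\<^sub>V v"
  by transfer (rule blinfun.add_right)

lemma bop_apply_scaleC: "A *\<^sub>V (c *\<^sub>C u) = c *\<^sub>C (A *\<^sub>V u)"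
  by transfer simp

lemma block_apply: "block k l A *\<^sub>V \<psi> = layer_embed k (A *\<^sub>V layer l \<psi>)"
  unfolding block_def
proof (rule bop_of_apply[where K = "norm A"])
  show "layer_embed k (A *\<^sub>V layer l (u + v)) = layer_embed k (A *\<^sub>V layer l u) + layer_embed k (A *\<^sub>V layer l v)" for u v
    by (simp add: layer_linear bop_apply_add)
  show "layer_embed k (A *\<^sub>V layer l (c *\<^sub>C u)) = c *\<^sub>C layer_embed k (A *\<^sub>V layer l u)" for c u
    by (simp add: layer_linear bop_apply_scaleC)
  show "norm (layer_embed k (A *\<^sub>V layer l u)) \<le> norm A * norm u" for u
  proof -
    have "norm (layer_embed k (A *\<^sub>V layer l u)) \<le> norm A * norm (layer l u)"
      using norm_layer_embed norm_bop_apply by (rule order_trans)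
    also have "\<dots> \<le> norm A * norm u" by (intro mult_left_mono norm_layer norm_ge_zero)
    finally show ?thesis .
  qed
qed

text \<open>
  \<open>H\<^sub>N\<close>, extended by zero from \<open>{1,\<dots>,N} \<times> \<int>\<^sup>d\<close> to \<open>\<nat> \<times> \<int>\<^sup>d\<close>.  Its spectral projections are block
  diagonal for this splitting, so the diagonal elements over \<open>{1,\<dots>,N} \<times> \<int>\<^sup>d\<close>, the only ones that
  enter the density of states, are those of \<open>\<chi>(H\<^sub>N \<le> E)\<close> on \<open>\<ell>\<^sup>2({1,\<dots>,N} \<times> \<int>\<^sup>d)\<close>.
\<close>

definition jacobi :: "(nat \<Rightarrow> 'i bop) \<Rightarrow> (nat \<Rightarrow> 'i bop) \<Rightarrow> nat \<Rightarrow> (nat \<times> 'i) bop" where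
  "jacobi T V N =
     (\<Sum>n=1..N. block n n (V n)) +
     (\<Sum>n=2..N. block (n - 1) n (T n) + block n (n - 1) (adj (T n)))"

definition idos ::
    "'w measure \<Rightarrow> (nat \<Rightarrow> 'w \<Rightarrow> 'z::int_lattice bop) \<Rightarrow> (nat \<Rightarrow> 'w \<Rightarrow> 'z bop) \<Rightarrow> nat \<Rightarrow> real \<Rightarrow> complex"
  where
  "idos P T V N E = 1 / of_nat N *
     (\<Sum>n=1..N. LINT \<omega>|P.
        mel (n, 0) (spectral_proj (jacobi (\<lambda>k. T k \<omega>) (\<lambda>k. V k \<omega>) N) E) (n, 0))"

definition transfer_op ::
    "(nat \<Rightarrow> 'i bop) \<Rightarrow> (nat \<Rightarrow> 'i bop) \<Rightarrow> real \<Rightarrow> nat \<Rightarrow> 'i bop ^ 2 ^ 2" where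
  "transfer_op T V E n =
     (let t = (if n = 1 then 1 else T n) in
      vector [vector [(E *\<^sub>R 1 - V n) * bop_inv t, - adj t],
              vector [bop_inv t, 0]])"

primrec transfer_prod ::
    "(nat \<Rightarrow> 'i bop) \<Rightarrow> (nat \<Rightarrow> 'i bop) \<Rightarrow> real \<Rightarrow> nat \<Rightarrow> 'i bop ^ 2 ^ 2" where
  "transfer_prod T V E 0 = mat 1"
| "transfer_prod T V E (Suc n) = transfer_op T V E (Suc n) ** transfer_prod T V E n"

text \<open>The adjoints of the columns \<open>(1, \<plusminus>\<i>)\<close> are the rows \<open>(1, \<mp>\<i>)\<close>.\<close>

definition prufer_phase ::
    "(nat \<Rightarrow> 'w \<Rightarrow> 'i bop) \<Rightarrow> (nat \<Rightarrow> 'w \<Rightarrow> 'i bop) \<Rightarrow> nat \<Rightarrow> real \<Rightarrow> 'w \<Rightarrow> 'i bop" where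
  "prufer_phase T V N E \<omega> =
     (let \<Phi> = transfer_prod (\<lambda>k. T k \<omega>) (\<lambda>k. V k \<omega>) E N *v vector [1, 0]
      in (\<Phi> $ 1 - \<i> *\<^sub>C \<Phi> $ 2) * bop_inv (\<Phi> $ 1 + \<i> *\<^sub>C \<Phi> $ 2))"

definition phase_velocity ::
    "(nat \<Rightarrow> 'w \<Rightarrow> 'i bop) \<Rightarrow> (nat \<Rightarrow> 'w \<Rightarrow> 'i bop) \<Rightarrow> nat \<Rightarrow> real \<Rightarrow> 'w \<Rightarrow> 'i bop" where
  "phase_velocity T V N E \<omega> =
     (1 / (\<i> * of_nat N)) *\<^sub>C
       (adj (prufer_phase T V N E \<omega>) * family_deriv (prufer_phase T V N) E \<omega>)"

text \<open>\<open>invert\<close> is the inverse to be used: that of operators or that of finite matrices.\<close>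

definition coeff_bound ::
    "('i bop \<Rightarrow> 'i bop) \<Rightarrow> (nat \<Rightarrow> 'w \<Rightarrow> 'i bop) \<Rightarrow> (nat \<Rightarrow> 'w \<Rightarrow> 'i bop) \<Rightarrow> ereal" where
  "coeff_bound invert T V =
     (SUP n\<in>{1..}. Sup {family_norm (T n), family_norm (\<lambda>\<omega>. invert (T n \<omega>)), family_norm (V n)})"

end

theory Submission
  imports Defs "HOL-Complex_Analysis.Cauchy_Integral_Theorem" "HOL-Real_Asymp.Real_Asymp"
begin

text \<open>
  Let \<open>P\<close> be the projection onto the last layer.  The transfer operators express \<open>U\<close> as \<open>1 - 2\<i>\<close> times the
  corner of the adjoint of \<open>G = (e - H - \<i>P)\<^sup>-\<^sup>1\<close> in the last layer, so by cyclicity of the trace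
  \<open>N \<T>(S\<^sup>e) = 2 Im tr G\<close>, whereas \<open>Im tr (e - \<i>s - H)\<^sup>-\<^sup>1\<close> tends to \<open>\<pi>\<close> times the density of states of \<open>H\<close> as
  \<open>s \<rightarrow> 0\<close>.  Along the path \<open>H + x\<i>P\<close> the \<open>x\<close>-derivative of the trace of the resolvent is an
  \<open>e\<close>-derivative, so that only boundary terms remain in the energy integral; in each layer these are path
  integrals of Herglotz functions of the coupling and hence bounded.  The two energy integrals thus differ by at most a
  constant per perturbed layer, uniformly in \<open>E\<close>, \<open>s\<close> and \<open>N\<close>; no finite volume approximation is
  needed.  Comparing in the same way \<open>H\<^bsub>N+M\<^esub>\<close> with the operator without coupling between the layers
  \<open>N\<close> and \<open>N + 1\<close> shows that \<open>N \<N>\<^sub>N\<close> is almost additive, and \<open>\<N>\<^sub>N\<close> converges.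
\<close>

subsection \<open>Hilbert space and operator calculus\<close>

text \<open>Two kinds of estimates have to be kept apart. At real energies the dissipation acts in
  the last layer of the sample only; e - H - i P is invertible because the invertible couplings
  carry its effect through the three-term recursion down to the first layer. The bound obtained in
  this way grows exponentially in N and serves only for continuity in e and s at fixed N. The bounds
  that survive in the result come from positivity: as a function of the coupling of a layer, the
  trace of the resolvent in that layer has nonnegative imaginary part and is at most 1 over the
  imaginary part of the coupling, so that the imaginary part of its primitive oscillates by at most
  4 on the upper half-plane, however small s is. The two ends of the energy interval give 8. Since
  the resolvent of H does not exist on the spectrum, the comparison is made for s > 0; the limit s =
  0 sees atoms of the density of states with half weight, and the passage to the right-continuous
  counting function costs 1 more. This is the origin of the constant 9. As E is just an end point of
  the energy interval, uniformity in E is automatic.\<close>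

lemmas ell2_rep = zero_ell2.rep_eq plus_ell2.rep_eq uminus_ell2.rep_eq minus_ell2.rep_eq
  scaleR_ell2.rep_eq scaleC_ell2.rep_eq ket.rep_eq

lemma ell2_eqI: "(\<And>i. ell2_apply u i = ell2_apply v i) \<Longrightarrow> u = v"
  by (metis ell2_apply_inject ext)

lemma scaleC_ell2_simps [simp]:
  fixes u :: "'i ell2"
  shows "a *\<^sub>C b *\<^sub>C u = (a * b) *\<^sub>C u" "1 *\<^sub>C u = u" "0 *\<^sub>C u = 0" "a *\<^sub>C (0 :: 'i ell2) = 0"
  by (rule ell2_eqI; simp add: ell2_rep)+

lemma scaleC_ell2_add_left: "(a + b) *\<^sub>C u = a *\<^sub>C u + b *\<^sub>C (u :: 'i ell2)"
  by (rule ell2_eqI) (simp add: ell2_rep algebra_simps)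

lemma scaleC_ell2_diff_left: "(a - b) *\<^sub>C u = a *\<^sub>C u - b *\<^sub>C (u :: 'i ell2)"
  by (rule ell2_eqI) (simp add: ell2_rep algebra_simps)

lemma scaleC_ell2_minus_left: "(- a) *\<^sub>C u = - (a *\<^sub>C (u :: 'i ell2))"
  by (rule ell2_eqI) (simp add: ell2_rep)

lemma cinner_commute: "cnj (cinner u v) = cinner v u"
  unfolding cinner.rep_eq infsum_cnj[symmetric] by (rule infsum_cong) (simp add: mult.commute)

lemma cinner_add_right: "cinner u (v + w) = cinner u v + cinner u w"
  unfolding cinner.rep_eq plus_ell2.rep_eq distrib_left
  by (rule infsum_add[OF ell2_mult_summable ell2_mult_summable])

lemma cinner_scaleC_right: "cinner u (c *\<^sub>C v) = c * cinner u v"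
proof -
  have "cinner u (c *\<^sub>C v) = (\<Sum>\<^sub>\<infinity>i. c * (cnj (ell2_apply u i) * ell2_apply v i))"
    unfolding cinner.rep_eq scaleC_ell2.rep_eq by (rule infsum_cong) simp
  then show ?thesis by (simp add: cinner.rep_eq infsum_cmult_right')
qed

lemma cinner_add_left: "cinner (u + v) w = cinner u w + cinner v w"
  by (metis cinner_commute cinner_add_right complex_cnj_add)

lemma cinner_scaleC_left: "cinner (c *\<^sub>C u) v = cnj c * cinner u v"
  by (metis cinner_commute cinner_scaleC_right complex_cnj_mult)

lemma cinner_scaleR_right: "cinner u (r *\<^sub>R v) = of_real r * cinner u v"
  by (metis cinner_scaleC_right scaleC_of_real_ell2)

lemma cinner_scaleR_left: "cinner (r *\<^sub>R u) v = of_real r * cinner u v"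
  by (metis cinner_scaleC_left scaleC_of_real_ell2 complex_cnj_complex_of_real)

lemma cinner_zero [simp]: "cinner u 0 = 0" "cinner 0 u = 0"
  using cinner_scaleC_right[of u 0 0] cinner_scaleC_left[of 0 0 u] by auto

lemma cinner_minus_right: "cinner u (- v) = - cinner u v"
  by (metis cinner_add_right cinner_zero(1) add.right_inverse add_eq_0_iff)

lemma cinner_minus_left: "cinner (- u) v = - cinner u v"
  by (metis cinner_add_left cinner_zero(2) add.right_inverse add_eq_0_iff)

lemma cinner_diff_right: "cinner u (v - w) = cinner u v - cinner u w"
  unfolding diff_conv_add_uminus cinner_add_right cinner_minus_right ..

lemma cinner_diff_left: "cinner (u - v) w = cinner u w - cinner v w"
  unfolding diff_conv_add_uminus cinner_add_left cinner_minus_left ..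

lemmas cinner_simps = cinner_add_left cinner_add_right cinner_diff_left cinner_diff_right
  cinner_minus_left cinner_minus_right cinner_scaleC_left cinner_scaleC_right
  cinner_scaleR_left cinner_scaleR_right

lemma cinner_self: "cinner u u = of_real ((norm u)\<^sup>2)"
proof -
  have "Im (cinner u u) = 0" using cinner_commute[of u u] by (simp add: complex_eq_iff)
  moreover have "Re (cinner u u) = (norm u)\<^sup>2"
    by (simp add: power2_norm_eq_inner inner_ell2_def)
  ultimately show ?thesis by (simp add: complex_eq_iff)
qed

lemma Re_cinner_le: "\<bar>Re (cinner u v)\<bar> \<le> norm u * norm v"
  using Cauchy_Schwarz_ineq2[of u v] by (simp add: inner_ell2_def)

lemma cmod_cinner_le: "cmod (cinner u v) \<le> norm u * norm v"
proof (cases "cinner u v = 0")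
  case False
  \<comment> \<open>The phase of the inner product is rotated into v, so that the real
    Cauchy-Schwarz inequality, which sees only real parts, bounds the modulus.\<close>
  define c where "c = cnj (sgn (cinner u v))"
  have "cinner u (c *\<^sub>C v) = of_real (cmod (cinner u v))"
    using False by (simp add: cinner_scaleC_right c_def sgn_div_norm scaleR_conv_of_real
        complex_norm_square[symmetric] power2_eq_square field_simps)
  then have "cmod (cinner u v) \<le> norm u * norm (c *\<^sub>C v)"
    using Re_cinner_le[of u "c *\<^sub>C v"] by simp
  also have "\<dots> = norm u * norm v"
    using False by (simp add: norm_scaleC_ell2 c_def norm_sgn)
  finally show ?thesis .
qed simp

lemma cinner_ket: "cinner (ket i) u = ell2_apply u i"
proof -
  have "cinner (ket i) u = (\<Sum>\<^sub>\<infinity>j\<in>{i}. cnj (ell2_apply (ket i) j) * ell2_apply u j)"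
    unfolding cinner.rep_eq by (rule infsum_cong_neutral) (auto simp: ket.rep_eq)
  then show ?thesis by (simp add: ket.rep_eq)
qed

lemma cinner_eqI: "(\<And>v. cinner v u = cinner v w) \<Longrightarrow> u = w"
  by (metis cinner_ket ell2_eqI)

lemma norm_sq_add: "(norm (u + v))\<^sup>2 = (norm u)\<^sup>2 + 2 * Re (cinner u v) + (norm (v :: 'i ell2))\<^sup>2"
  using cinner_commute[of u v]
  by (auto simp: power2_norm_eq_inner inner_ell2_def cinner_add_left cinner_add_right complex_eq_iff)

lemma norm_sq_diff: "(norm (u - v))\<^sup>2 = (norm u)\<^sup>2 - 2 * Re (cinner u v) + (norm (v :: 'i ell2))\<^sup>2"
  using norm_sq_add[of u "- v"] by (simp add: cinner_minus_right)

lemma bounded_linear_cinner_right: "bounded_linear (cinner u)"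
  by (rule bounded_linear_intro[where K = "norm u"])
    (auto simp: cinner_simps scaleR_conv_of_real mult.commute intro: order_trans[OF cmod_cinner_le])

lemma tendsto_cinner:
  fixes f g :: "'x \<Rightarrow> 'i ell2"
  assumes "(f \<longlongrightarrow> u) F" "(g \<longlongrightarrow> v) F"
  shows "((\<lambda>x. cinner (f x) (g x)) \<longlongrightarrow> cinner u v) F"
proof -
  have "bounded_bilinear (cinner :: 'i ell2 \<Rightarrow> _)"
    by standard (auto simp: cinner_simps scaleR_conv_of_real intro!: exI[of _ 1] cmod_cinner_le)
  then show ?thesis using assms by (rule bounded_bilinear.tendsto)
qed

lemma norm_restrict_ell2: "(norm (restrict_ell2 X u))\<^sup>2 = (\<Sum>\<^sub>\<infinity>i\<in>X. (cmod (ell2_apply u i))\<^sup>2)"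
  unfolding norm_ell2_sq restrict_ell2.rep_eq
  by (rule infsum_cong_neutral) auto

lemma norm_restrict_le: "norm (restrict_ell2 X u) \<le> norm u"
proof (rule power2_le_imp_le)
  show "(norm (restrict_ell2 X u))\<^sup>2 \<le> (norm u)\<^sup>2"
    unfolding norm_restrict_ell2 norm_ell2_sq[of u]
    by (rule infsum_mono_neutral)
      (auto intro: summable_on_subset_banach[OF ell2_sq_summable])
qed simp

text \<open>The restrictions of u to X and to its complement are orthogonal, so the squared error is
  the tail of a convergent sum. This is the density of finite combinations of kets, in the form in
  which identities are extended from kets to all vectors.\<close>

lemma restrict_ell2_tendsto:
  "((\<lambda>X. restrict_ell2 X u) \<longlongrightarrow> u) (finite_subsets_at_top UNIV)"
proof -
  have "((\<lambda>X. \<Sum>i\<in>X. (cmod (ell2_apply u i))\<^sup>2) \<longlongrightarrow> (norm u)\<^sup>2) (finite_subsets_at_top UNIV)"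
    using has_sum_infsum[OF ell2_sq_summable[of u]] unfolding norm_ell2_sq has_sum_def .
  then have *: "((\<lambda>X. (norm u)\<^sup>2 - (\<Sum>i\<in>X. (cmod (ell2_apply u i))\<^sup>2)) \<longlongrightarrow> 0)
      (finite_subsets_at_top UNIV)"
    by (auto intro: tendsto_eq_intros)
  have eq: "(norm (restrict_ell2 X u - u))\<^sup>2 = (norm u)\<^sup>2 - (\<Sum>i\<in>X. (cmod (ell2_apply u i))\<^sup>2)"
    if "finite X" for X
  proof -
    have d: "u = restrict_ell2 X u + restrict_ell2 (- X) u" "restrict_ell2 X u - u = - restrict_ell2 (- X) u"
      by (auto intro!: ell2_eqI simp: ell2_rep restrict_ell2.rep_eq)
    have "cinner (restrict_ell2 X u) (restrict_ell2 (- X) u) = 0"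
      unfolding cinner.rep_eq restrict_ell2.rep_eq by (rule infsum_0) auto
    then have "(norm u)\<^sup>2 = (norm (restrict_ell2 X u))\<^sup>2 + (norm (restrict_ell2 (- X) u))\<^sup>2"
      using norm_sq_add[of "restrict_ell2 X u" "restrict_ell2 (- X) u"] d(1) by simp
    then show ?thesis using that by (simp add: d(2) norm_restrict_ell2)
  qed
  have "((\<lambda>X. (norm (restrict_ell2 X u - u))\<^sup>2) \<longlongrightarrow> 0) (finite_subsets_at_top UNIV)"
    by (rule Lim_transform_eventually[OF *]) (use eq in \<open>auto simp: eventually_finite_subsets_at_top\<close>)
  then have "((\<lambda>X. norm (restrict_ell2 X u - u)) \<longlongrightarrow> 0) (finite_subsets_at_top UNIV)"
    using tendsto_real_sqrt[of _ 0] by fastforce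
  then show ?thesis using LIM_zero_iff tendsto_norm_zero_iff by blast
qed

lemma restrict_ell2_finite:
  assumes "finite X"
  shows "restrict_ell2 X u = (\<Sum>i\<in>X. ell2_apply u i *\<^sub>C ket i)"
proof -
  have ap: "ell2_apply (\<Sum>i\<in>X. f i) j = (\<Sum>i\<in>X. ell2_apply (f i) j)" for f :: "'a \<Rightarrow> 'a ell2" and j
    using assms by (induction X rule: finite_induct) (simp_all add: ell2_rep)
  show ?thesis
    using assms by (intro ell2_eqI)
      (simp add: ap restrict_ell2.rep_eq ell2_rep if_distrib[of "\<lambda>x. _ * x"] cong: if_cong)
qed

section \<open>Algebra of bounded operators\<close>

lemma bop_apply_simps [simp]:
  "(A + B) *\<^sub>V u = A *\<^sub>V u + B *\<^sub>V u" "(A - B) *\<^sub>V u = A *\<^sub>V u - B *\<^sub>V u" "(- A) *\<^sub>V u = - (A *\<^sub>V u)"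
  "(r *\<^sub>R A) *\<^sub>V u = r *\<^sub>R (A *\<^sub>V u)" "(c *\<^sub>C A) *\<^sub>V u = c *\<^sub>C (A *\<^sub>V u)" "1 *\<^sub>V u = u"
  "(A * B) *\<^sub>V u = A *\<^sub>V B *\<^sub>V u" "0 *\<^sub>V u = 0" "A *\<^sub>V 0 = 0"
  by (transfer; simp add: blinfun.bilinear_simps scaleC_blinfun.rep_eq)+

lemma bounded_linear_bop_apply: "bounded_linear (bop_apply A)"
  by transfer (rule blinfun.bounded_linear_right)

lemmas bop_apply_diff = bounded_linear.linear[OF bounded_linear_bop_apply, THEN linear_diff]
lemmas bop_apply_minus = bounded_linear.linear[OF bounded_linear_bop_apply, THEN linear_neg]
lemmas bop_apply_scaleR = bounded_linear.linear[OF bounded_linear_bop_apply, THEN linear_scale]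
lemmas bop_apply_sum = bounded_linear.linear[OF bounded_linear_bop_apply, THEN linear_sum]

lemmas bop_lin = bop_apply_add bop_apply_diff bop_apply_minus bop_apply_scaleR bop_apply_scaleC

lemma bop_sum_apply: "(\<Sum>i\<in>X. A i) *\<^sub>V u = (\<Sum>i\<in>X. A i *\<^sub>V u)"
  by (induction X rule: infinite_finite_induct) auto

lemma scaleC_bop_simps [simp]:
  fixes A B :: "'i bop"
  shows "(c *\<^sub>C A) * B = c *\<^sub>C (A * B)" "A * (c *\<^sub>C B) = c *\<^sub>C (A * B)" "1 *\<^sub>C A = A" "0 *\<^sub>C A = 0"
    "c *\<^sub>C d *\<^sub>C A = (c * d) *\<^sub>C A" "c *\<^sub>C (0 :: 'i bop) = 0"
  by (rule bop_eqI; simp add: bop_lin)+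

lemma scaleC_bop_distrib:
  fixes A B :: "'i bop"
  shows "c *\<^sub>C (A + B) = c *\<^sub>C A + c *\<^sub>C B" "c *\<^sub>C (A - B) = c *\<^sub>C A - c *\<^sub>C B"
    "(c + d) *\<^sub>C A = c *\<^sub>C A + d *\<^sub>C A" "(c - d) *\<^sub>C A = c *\<^sub>C A - d *\<^sub>C A"
    "(- c) *\<^sub>C A = - (c *\<^sub>C A)" "c *\<^sub>C (- A) = - (c *\<^sub>C A)"
  by (rule bop_eqI; simp add: scaleC_ell2_add scaleC_ell2_diff scaleC_ell2_add_left scaleC_ell2_diff_left
      scaleC_ell2_minus scaleC_ell2_minus_left)+

lemma scaleC_of_real_bop: "of_real r *\<^sub>C A = r *\<^sub>R (A :: 'i bop)"
  by (rule bop_eqI) (simp add: scaleC_of_real_ell2)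

lemma scaleR_scaleC_bop: "r *\<^sub>R c *\<^sub>C A = (of_real r * c) *\<^sub>C (A :: 'i bop)"
  "c *\<^sub>C r *\<^sub>R A = (c * of_real r) *\<^sub>C A"
  by (simp_all add: scaleC_of_real_bop[symmetric])

lemma norm_bop_leI:
  assumes "\<And>u. norm (A *\<^sub>V u) \<le> K * norm u" "0 \<le> K"
  shows "norm A \<le> K"
  using assms by transfer (auto intro: norm_blinfun_bound)

lemma norm_scaleC_bop: "norm (c *\<^sub>C (A :: 'i bop)) = cmod c * norm A"
proof -
  have *: "norm (c *\<^sub>C (A :: 'i bop)) \<le> cmod c * norm A" for c and A :: "'i bop"
    by (rule norm_bop_leI)
      (auto simp: norm_scaleC_ell2 mult.assoc intro!: mult_left_mono norm_bop_apply)
  show ?thesis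
  proof (cases "c = 0")
    case False
    have "norm A \<le> cmod (inverse c) * norm (c *\<^sub>C A)"
      using *[of "inverse c" "c *\<^sub>C A"] False by simp
    then have "cmod c * norm A \<le> cmod c * (cmod (inverse c) * norm (c *\<^sub>C A))"
      by (intro mult_left_mono) auto
    then have "cmod c * norm A \<le> norm (c *\<^sub>C A)"
      using False by (simp add: norm_inverse mult.assoc[symmetric])
    with * show ?thesis by (simp add: antisym)
  qed simp
qed

text \<open>Coordinate i of the adjoint at u can only be the inner product of
  \<open>A *\<^sub>V ket i\<close> with u. The square sum of these numbers over a finite set F is
  estimated by testing u against A w, where w is the truncation of the candidate to F; hence the
  candidate is square summable.\<close>

lemma ex_adj: "\<exists>B. \<forall>u v. cinner (B *\<^sub>V u) v = cinner u (A *\<^sub>V v)"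
proof -
  define f where "f u i = cinner (A *\<^sub>V ket i) u" for u i
  have part: "(\<Sum>i\<in>F. (cmod (f u i))\<^sup>2) \<le> (norm A * norm u)\<^sup>2" if F: "finite F" for F u
  proof -
    define w where "w = (\<Sum>i\<in>F. f u i *\<^sub>C ket i)"
    have apw: "ell2_apply w j = (if j \<in> F then f u j else 0)" for j
    proof -
      have "ell2_apply (\<Sum>i\<in>F. f u i *\<^sub>C ket i) j = (\<Sum>i\<in>F. ell2_apply (f u i *\<^sub>C ket i) j)"
        using F by (induction F rule: finite_induct) (simp_all add: ell2_rep)
      then show ?thesis using F by (simp add: w_def ell2_rep if_distrib[of "\<lambda>x. _ * x"] cong: if_cong)
    qed
    have nw: "(norm w)\<^sup>2 = (\<Sum>i\<in>F. (cmod (f u i))\<^sup>2)"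
    proof -
      have "(norm w)\<^sup>2 = (\<Sum>\<^sub>\<infinity>i\<in>F. (cmod (f u i))\<^sup>2)"
        unfolding norm_ell2_sq by (rule infsum_cong_neutral) (auto simp: apw)
      then show ?thesis using F by simp
    qed
    have "cinner (A *\<^sub>V w) u = (\<Sum>i\<in>F. cnj (f u i) * f u i)"
      unfolding w_def using F
      by (induction F rule: finite_induct) (simp_all add: bop_lin cinner_simps f_def)
    also have "\<dots> = of_real (\<Sum>i\<in>F. (cmod (f u i))\<^sup>2)"
      unfolding of_real_sum by (intro sum.cong refl) (simp add: complex_norm_square mult.commute del: of_real_power)
    finally have "cinner (A *\<^sub>V w) u = of_real ((norm w)\<^sup>2)" unfolding nw .
    then have "(norm w)\<^sup>2 = cmod (cinner (A *\<^sub>V w) u)"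
      by (metis abs_of_nonneg norm_of_real zero_le_power2)
    also have "\<dots> \<le> norm A * norm w * norm u"
      using cmod_cinner_le[of "A *\<^sub>V w" u] norm_bop_apply[of A w]
      by (meson mult_right_mono norm_ge_zero order_trans)
    finally have "norm w * norm w \<le> (norm A * norm u) * norm w" by (simp add: power2_eq_square ac_simps)
    then have "norm w \<le> norm A * norm u"
      by (cases "norm w = 0") (auto simp: mult_le_cancel_right)
    then show ?thesis unfolding nw[symmetric] by (intro power_mono) auto
  qed
  have "(\<lambda>i. (cmod (f u i))\<^sup>2) summable_on UNIV" for u
    using part[of _ u] by (intro nonneg_bdd_above_summable_on) (auto intro!: bdd_aboveI)
  then have ap: "ell2_apply (Abs_ell2 (f u)) = f u" for u by (simp add: Abs_ell2_inverse)
  obtain B where B: "bop_apply B = (\<lambda>u. Abs_ell2 (f u))"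
  proof -
    have "\<exists>B. bop_apply B = (\<lambda>u. Abs_ell2 (f u))"
    proof (rule bop_existsI)
      show "norm (Abs_ell2 (f u)) \<le> norm A * norm u" for u
        by (rule ell2_norm_leI) (auto simp: ap part)
    qed (auto intro!: ell2_eqI simp: ell2_rep ap, auto simp: f_def cinner_simps)
    then show ?thesis using that by blast
  qed
  have "cinner v (B *\<^sub>V u) = cinner (A *\<^sub>V v) u" for u v
  proof (rule tendsto_unique[where F = "finite_subsets_at_top UNIV"])
    let ?F = "finite_subsets_at_top UNIV"
    show "((\<lambda>X. cinner (restrict_ell2 X v) (B *\<^sub>V u)) \<longlongrightarrow> cinner v (B *\<^sub>V u)) ?F"
      by (intro tendsto_cinner restrict_ell2_tendsto tendsto_const)
    have "((\<lambda>X. cinner (A *\<^sub>V restrict_ell2 X v) u) \<longlongrightarrow> cinner (A *\<^sub>V v) u) ?F"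
      by (intro tendsto_cinner bounded_linear.tendsto[OF bounded_linear_bop_apply]
          restrict_ell2_tendsto tendsto_const)
    moreover have "cinner (restrict_ell2 X v) (B *\<^sub>V u) = cinner (A *\<^sub>V restrict_ell2 X v) u"
      if "finite X" for X
      unfolding restrict_ell2_finite[OF that] using that
      by (induction X rule: finite_induct)
         (auto simp: bop_lin cinner_simps cinner_ket B ap f_def)
    ultimately show "((\<lambda>X. cinner (restrict_ell2 X v) (B *\<^sub>V u)) \<longlongrightarrow> cinner (A *\<^sub>V v) u) ?F"
      by (subst filterlim_cong[OF refl refl]) (auto simp: eventually_finite_subsets_at_top)
  qed simp
  then show ?thesis by (metis cinner_commute)
qed

lemma cinner_adj: "cinner (adj A *\<^sub>V u) v = cinner u (A *\<^sub>V v)"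
proof -
  obtain B where B: "\<forall>u v. cinner (B *\<^sub>V u) v = cinner u (A *\<^sub>V v)" using ex_adj by blast
  have "adj A = B" unfolding adj_def
  proof (rule the_equality)
    fix C assume "\<forall>u v. cinner (C *\<^sub>V u) v = cinner u (A *\<^sub>V v)"
    then show "C = B" using B by (intro bop_eqI cinner_eqI) (metis cinner_commute)
  qed (use B in auto)
  then show ?thesis using B by simp
qed

lemma cinner_adj_right: "cinner u (adj A *\<^sub>V v) = cinner (A *\<^sub>V u) v"
  by (metis cinner_adj cinner_commute)

lemma adj_eqI: "(\<And>u v. cinner (B *\<^sub>V u) v = cinner u (A *\<^sub>V v)) \<Longrightarrow> adj A = B"
  by (intro bop_eqI cinner_eqI) (metis cinner_adj cinner_commute)

lemma adj_simps [simp]: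
  "adj (A + B) = adj A + adj B" "adj (A - B) = adj A - adj B" "adj (- A) = - adj A"
  "adj (A * B) = adj B * adj A" "adj (c *\<^sub>C A) = cnj c *\<^sub>C adj A" "adj (r *\<^sub>R A) = r *\<^sub>R adj A"
  "adj (adj A) = A" "adj 1 = 1" "adj 0 = 0"
  by (rule adj_eqI; simp add: cinner_simps cinner_adj cinner_adj_right)+

lemma adj_sum: "adj (\<Sum>i\<in>X. A i) = (\<Sum>i\<in>X. adj (A i))"
  by (induction X rule: infinite_finite_induct) auto

lemma self_adjoint_iff: "self_adjoint A \<longleftrightarrow> adj A = A"
  unfolding self_adjoint_def by (metis adj_eqI cinner_adj)

lemma norm_adj [simp]: "norm (adj A) = norm A"
proof -
  have "norm (adj A) \<le> norm A" for A :: "'i bop"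
  proof (rule norm_bop_leI)
    fix u
    have "(norm (adj A *\<^sub>V u))\<^sup>2 = cmod (cinner u (A *\<^sub>V adj A *\<^sub>V u))"
      using cinner_adj[of A u "adj A *\<^sub>V u"] cinner_self[of "adj A *\<^sub>V u"]
      by (metis norm_of_real abs_of_nonneg zero_le_power2)
    also have "\<dots> \<le> norm u * (norm A * norm (adj A *\<^sub>V u))"
      by (rule order_trans[OF cmod_cinner_le]) (intro mult_left_mono norm_bop_apply norm_ge_zero)
    finally have "norm (adj A *\<^sub>V u) * norm (adj A *\<^sub>V u) \<le> (norm A * norm u) * norm (adj A *\<^sub>V u)"
      by (simp add: power2_eq_square ac_simps)
    then show "norm (adj A *\<^sub>V u) \<le> norm A * norm u"
      by (cases "norm (adj A *\<^sub>V u) = 0") (auto simp: mult_le_cancel_right)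
  qed simp
  from this[of A] this[of "adj A"] show ?thesis by simp
qed

section \<open>Matrix elements and matrix products\<close>

lemma mel_apply: "mel i A j = ell2_apply (A *\<^sub>V ket j) i"
  by (simp add: mel_def cinner_ket)

lemma mel_simps [simp]:
  "mel i (A + B) j = mel i A j + mel i B j" "mel i (A - B) j = mel i A j - mel i B j"
  "mel i (- A) j = - mel i A j" "mel i (c *\<^sub>C A) j = c * mel i A j"
  "mel i (r *\<^sub>R A) j = of_real r * mel i A j" "mel i 0 j = 0"
  "mel i (adj A) j = cnj (mel j A i)"
  by (simp_all add: mel_def cinner_simps cinner_adj_right cinner_commute)

lemma mel_one [simp]: "mel i 1 j = (if i = j then 1 else 0)"
  by (simp add: mel_apply ket.rep_eq)

lemma mel_sum: "mel i (\<Sum>x\<in>X. A x) j = (\<Sum>x\<in>X. mel i (A x) j)"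
  by (induction X rule: infinite_finite_induct) auto

lemma cmod_mel_le: "cmod (mel i A j) \<le> norm A"
  unfolding mel_def using cmod_cinner_le[of "ket i" "A *\<^sub>V ket j"] norm_bop_apply[of A "ket j"]
  by (simp add: norm_ket)

lemma bounded_linear_mel: "bounded_linear (\<lambda>A. mel i A j)"
  by (rule bounded_linear_intro[where K = 1]) (auto simp: scaleR_conv_of_real[where 'a = complex] cmod_mel_le)

lemma bop_mel_eqI:
  assumes "\<And>i j. mel i A j = mel i B j"
  shows "A = B"
proof (rule bop_eqI, rule tendsto_unique[where F = "finite_subsets_at_top UNIV"])
  fix u :: "'a ell2"
  let ?F = "finite_subsets_at_top UNIV"
  have ket: "A *\<^sub>V ket j = B *\<^sub>V ket j" for j using assms by (intro ell2_eqI) (simp add: mel_apply)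
  show "((\<lambda>X. A *\<^sub>V restrict_ell2 X u) \<longlongrightarrow> A *\<^sub>V u) ?F"
    by (intro bounded_linear.tendsto[OF bounded_linear_bop_apply] restrict_ell2_tendsto)
  have "((\<lambda>X. B *\<^sub>V restrict_ell2 X u) \<longlongrightarrow> B *\<^sub>V u) ?F"
    by (intro bounded_linear.tendsto[OF bounded_linear_bop_apply] restrict_ell2_tendsto)
  moreover have "A *\<^sub>V restrict_ell2 X u = B *\<^sub>V restrict_ell2 X u" if "finite X" for X
    unfolding restrict_ell2_finite[OF that] by (simp add: bop_apply_sum bop_lin ket)
  ultimately show "((\<lambda>X. A *\<^sub>V restrict_ell2 X u) \<longlongrightarrow> B *\<^sub>V u) ?F"
    by (subst filterlim_cong[OF refl refl]) (auto simp: eventually_finite_subsets_at_top)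
qed simp

lemma mel_times_finite:
  assumes "finite X"
  shows "cinner (ket i) (A *\<^sub>V restrict_ell2 X (B *\<^sub>V ket j)) = (\<Sum>k\<in>X. mel i A k * mel k B j)"
  unfolding restrict_ell2_finite[OF assms]
  by (simp add: bop_apply_sum bop_lin bounded_linear.linear[OF bounded_linear_cinner_right, THEN linear_sum]
      cinner_simps mel_def[symmetric] mel_apply[symmetric] mult.commute)

lemma mel_times_has_sum: "((\<lambda>k. mel i A k * mel k B j) has_sum mel i (A * B) j) UNIV"
proof -
  have "((\<lambda>X. cinner (ket i) (A *\<^sub>V restrict_ell2 X (B *\<^sub>V ket j))) \<longlongrightarrow> cinner (ket i) (A *\<^sub>V B *\<^sub>V ket j))
      (finite_subsets_at_top UNIV)"
    by (intro tendsto_cinner bounded_linear.tendsto[OF bounded_linear_bop_apply]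
        restrict_ell2_tendsto tendsto_const)
  then show ?thesis unfolding has_sum_def mel_def[of i "A * B"] bop_apply_simps
    by (subst (asm) filterlim_cong[OF refl refl])
      (auto simp: eventually_finite_subsets_at_top mel_times_finite)
qed

text \<open>A partial sum of the matrix product is a matrix element with a truncation inserted
  between the factors, and truncations are contractions. The bound is the same for every X, which
  makes it the dominating constant in the proof of cyclicity.\<close>

lemma mel_times_finite_le:
  assumes "finite X"
  shows "cmod (\<Sum>k\<in>X. mel i A k * mel k B j) \<le> norm A * norm B"
  unfolding mel_times_finite[OF assms, symmetric]
proof -
  have "cmod (cinner (ket i) (A *\<^sub>V restrict_ell2 X (B *\<^sub>V ket j)))
      \<le> norm (A *\<^sub>V restrict_ell2 X (B *\<^sub>V ket j))"
    using cmod_cinner_le[of "ket i"] by (simp add: norm_ket)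
  also have "\<dots> \<le> norm A * norm (restrict_ell2 X (B *\<^sub>V ket j))" by (rule norm_bop_apply)
  also have "\<dots> \<le> norm A * norm B"
    using norm_restrict_le[of X "B *\<^sub>V ket j"] norm_bop_apply[of B "ket j"]
    by (intro mult_left_mono) (auto simp: norm_ket)
  finally show "cmod (cinner (ket i) (A *\<^sub>V restrict_ell2 X (B *\<^sub>V ket j))) \<le> norm A * norm B" .
qed

subsection \<open>Inverses\<close>

lemma is_inverse_in_one: "is_inverse_in 1 A B \<longleftrightarrow> A * B = 1 \<and> B * A = 1"
  by (simp add: is_inverse_in_def)

lemma bop_inv_eqI: "A * B = 1 \<Longrightarrow> B * A = 1 \<Longrightarrow> bop_inv A = (B :: 'i bop)"
  unfolding inverse_in_def is_inverse_in_one
  by (rule the_equality) (auto, metis mult.assoc mult.left_neutral mult.right_neutral)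

lemma neumann_bop:
  fixes D :: "'i bop"
  assumes "norm D \<le> r" "r < 1"
  shows "summable (\<lambda>n. D ^ n)" "(1 - D) * (\<Sum>n. D ^ n) = 1" "(\<Sum>n. D ^ n) * (1 - D) = 1"
proof -
  have n: "norm D < 1" using assms by simp
  have sn: "summable (\<lambda>n. norm (D ^ n))"
    by (rule summable_comparison_test'[OF summable_geometric[of "norm D"], of 0])
       (use n in \<open>auto intro: norm_power_ineq\<close>)
  then show s: "summable (\<lambda>n. D ^ n)" by (rule summable_norm_cancel)
  have eq: "(\<Sum>n. D ^ n) = 1 + (\<Sum>n. D ^ Suc n)"
    using suminf_split_head[OF s] by (simp add: algebra_simps)
  have "(\<Sum>n. D ^ Suc n) = D * (\<Sum>n. D ^ n)"
    using bounded_linear.suminf[OF bounded_linear_mult_right[of D] s] by simp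
  then show "(1 - D) * (\<Sum>n. D ^ n) = 1" using eq by (simp add: algebra_simps)
  have "(\<Sum>n. D ^ Suc n) = (\<Sum>n. D ^ n) * D"
    using bounded_linear.suminf[OF bounded_linear_mult_left[of D] s] by (simp add: power_commutes)
  then show "(\<Sum>n. D ^ n) * (1 - D) = 1" using eq by (simp add: algebra_simps)
qed

text \<open>The parameters of the Neumann series depend on the bounds \<open>s\<close> and \<open>K\<close> only, so that the
  inverse of a family is a uniform limit of polynomials in the family.\<close>

lemma coercive_neumann:
  fixes Z :: "'i bop"
  assumes "0 < s" "0 < K" "norm Z \<le> K" and co: "\<And>u. s * (norm u)\<^sup>2 \<le> Re (cinner u (Z *\<^sub>V u))"
  shows "norm (1 - (s / K\<^sup>2) *\<^sub>R Z) \<le> sqrt (1 - (s / K)\<^sup>2)" "s \<le> K"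
proof -
  \<comment> \<open>Tested on a single unit vector; this keeps the radicand below
    nonnegative.\<close>
  have sK: "s \<le> K"
  proof -
    have "s * (norm (ket undefined :: 'i ell2))\<^sup>2 \<le> norm (Z *\<^sub>V ket undefined)"
      using co[of "ket undefined"] Re_cinner_le[of "ket undefined" "Z *\<^sub>V ket undefined"]
      by (simp add: norm_ket)
    also have "\<dots> \<le> K" using norm_bop_apply[of Z "ket undefined"] assms(3) by (simp add: norm_ket)
    finally show ?thesis by (simp add: norm_ket)
  qed
  then show "s \<le> K" .
  have nn: "0 \<le> 1 - (s / K)\<^sup>2"
    using sK assms by (simp add: power_le_one)
  show "norm (1 - (s / K\<^sup>2) *\<^sub>R Z) \<le> sqrt (1 - (s / K)\<^sup>2)"
  proof (rule norm_bop_leI)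
    fix u
    have Zu: "(norm (Z *\<^sub>V u))\<^sup>2 \<le> (K * norm u)\<^sup>2"
      by (intro power_mono order_trans[OF norm_bop_apply] mult_right_mono assms) auto
    \<comment> \<open>The factor minimising 1 - 2 c s + c^2 K^2, the bound for the squared norm of 1
      - c Z; the minimum is 1 - (s/K)^2.\<close>
    define c where "c = s / K\<^sup>2"
    have c: "c > 0" "c * c * K\<^sup>2 = c * s" "c * s = (s / K)\<^sup>2"
      using assms by (auto simp: c_def power2_eq_square field_simps)
    have "(norm ((1 - c *\<^sub>R Z) *\<^sub>V u))\<^sup>2
        = (norm u)\<^sup>2 - 2 * c * Re (cinner u (Z *\<^sub>V u)) + c\<^sup>2 * (norm (Z *\<^sub>V u))\<^sup>2"
      using norm_sq_diff[of u "c *\<^sub>R (Z *\<^sub>V u)"] by (simp add: cinner_simps power_mult_distrib)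
    also have "\<dots> \<le> (norm u)\<^sup>2 - 2 * c * (s * (norm u)\<^sup>2) + c\<^sup>2 * (K * norm u)\<^sup>2"
      using mult_left_mono[OF co[of u], of "2 * c"] mult_left_mono[OF Zu, of "c\<^sup>2"] c(1)
        zero_le_power2[of c] by argo
    also have "\<dots> = (1 - c * s) * (norm u)\<^sup>2"
    proof -
      have "c\<^sup>2 * (K * norm u)\<^sup>2 = (c * c * K\<^sup>2) * (norm u)\<^sup>2" by (simp add: power2_eq_square)
      then show ?thesis unfolding c(2) by (simp add: algebra_simps)
    qed
    also have "\<dots> = (sqrt (1 - (s / K)\<^sup>2) * norm u)\<^sup>2"
      using nn c(3) by (simp add: power_mult_distrib)
    finally show "norm ((1 - (s / K\<^sup>2) *\<^sub>R Z) *\<^sub>V u) \<le> sqrt (1 - (s / K)\<^sup>2) * norm u"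
      unfolding c_def by (rule power2_le_imp_le) (use nn in auto)
  qed (use nn in auto)
qed

lemma inverse_norm_le:
  fixes Z :: "'i bop"
  assumes "Z * G = 1" "c > 0" and lb: "\<And>u. c * norm u \<le> norm (Z *\<^sub>V u)"
  shows "norm G \<le> 1 / c"
proof (rule norm_bop_leI)
  fix u
  have "c * norm (G *\<^sub>V u) \<le> norm ((Z * G) *\<^sub>V u)" using lb[of "G *\<^sub>V u"] by simp
  then show "norm (G *\<^sub>V u) \<le> 1 / c * norm u" using assms by (simp add: field_simps)
qed (use assms in auto)

text \<open>A Lax-Milgram argument by damped iteration. The last clause holds for every admissible K
  because a two-sided inverse is unique; with one K for a whole family it exhibits the inverses as
  limits of polynomials of a common form.\<close>

lemma coercive_inverse:
  fixes Z :: "'i bop"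
  assumes "0 < s" and co: "\<And>u. s * (norm u)\<^sup>2 \<le> Re (cinner u (Z *\<^sub>V u))"
  obtains G where "Z * G = 1" "G * Z = 1" "norm G \<le> 1 / s"
    "\<And>K. 0 < K \<Longrightarrow> norm Z \<le> K \<Longrightarrow>
      (\<lambda>n. (s / K\<^sup>2) *\<^sub>R (\<Sum>i<n. (1 - (s / K\<^sup>2) *\<^sub>R Z) ^ i)) \<longlonglongrightarrow> G"
proof -
  have *: "\<exists>G. Z * G = 1 \<and> G * Z = 1 \<and> (\<lambda>n. (s / K\<^sup>2) *\<^sub>R (\<Sum>i<n. (1 - (s / K\<^sup>2) *\<^sub>R Z) ^ i)) \<longlonglongrightarrow> G"
    if K: "0 < K" "norm Z \<le> K" for K
  proof -
    define D where "D = 1 - (s / K\<^sup>2) *\<^sub>R Z"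
    have D: "norm D \<le> sqrt (1 - (s / K)\<^sup>2)" "sqrt (1 - (s / K)\<^sup>2) < 1"
      using coercive_neumann[OF assms(1) K co] assms(1) K by (auto simp: D_def)
    note nm = neumann_bop[OF D]
    have Z: "(s / K\<^sup>2) *\<^sub>R Z = 1 - D" by (simp add: D_def)
    have "Z * ((s / K\<^sup>2) *\<^sub>R (\<Sum>n. D ^ n)) = 1" "((s / K\<^sup>2) *\<^sub>R (\<Sum>n. D ^ n)) * Z = 1"
      using nm(2,3) unfolding Z[symmetric] by simp_all
    moreover have "(\<lambda>n. (s / K\<^sup>2) *\<^sub>R (\<Sum>i<n. D ^ i)) \<longlonglongrightarrow> (s / K\<^sup>2) *\<^sub>R (\<Sum>n. D ^ n)"
      by (intro tendsto_intros summable_LIMSEQ nm)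
    ultimately show ?thesis unfolding D_def by blast
  qed
  obtain G where G: "Z * G = 1" "G * Z = 1"
    using *[of "norm Z + 1"] add_nonneg_pos[of "norm Z" 1] by auto
  have lb: "s * norm u \<le> norm (Z *\<^sub>V u)" for u
  proof (cases "norm u = 0")
    case False
    have "s * norm u * norm u \<le> norm (Z *\<^sub>V u) * norm u"
      using co[of u] Re_cinner_le[of u "Z *\<^sub>V u"] by (simp add: power2_eq_square ac_simps)
    then show ?thesis using False by (simp add: mult_le_cancel_right)
  qed simp
  show thesis
  proof (rule that[of G])
    show "norm G \<le> 1 / s" by (rule inverse_norm_le[OF G(1) assms(1) lb])
    fix K assume "0 < K" "norm Z \<le> K"
    from *[OF this] obtain G' where G': "Z * G' = 1"
      "(\<lambda>n. (s / K\<^sup>2) *\<^sub>R (\<Sum>i<n. (1 - (s / K\<^sup>2) *\<^sub>R Z) ^ i)) \<longlonglongrightarrow> G'" by blast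
    have "G' = G" using G G'(1) by (metis mult.assoc mult.left_neutral mult.right_neutral)
    then show "(\<lambda>n. (s / K\<^sup>2) *\<^sub>R (\<Sum>i<n. (1 - (s / K\<^sup>2) *\<^sub>R Z) ^ i)) \<longlonglongrightarrow> G" using G'(2) by simp
  qed (use G in auto)
qed

lemma dissipative_inverse:
  fixes Z :: "'i bop"
  assumes "0 < s" and co: "\<And>u. Im (cinner u (Z *\<^sub>V u)) \<le> - s * (norm u)\<^sup>2"
  obtains G where "Z * G = 1" "G * Z = 1" "norm G \<le> 1 / s" "bop_inv Z = G"
proof -
  \<comment> \<open>Multiplication by i turns dissipativity into coercivity.\<close>
  have "s * (norm u)\<^sup>2 \<le> Re (cinner u ((\<i> *\<^sub>C Z) *\<^sub>V u))" for u
    using co[of u] by (simp add: cinner_simps)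
  then obtain G where G: "(\<i> *\<^sub>C Z) * G = 1" "G * (\<i> *\<^sub>C Z) = 1" "norm G \<le> 1 / s"
    using coercive_inverse[OF assms(1), of "\<i> *\<^sub>C Z"] by metis
  show thesis
  proof (rule that[of "\<i> *\<^sub>C G"])
    show "norm (\<i> *\<^sub>C G) \<le> 1 / s" using G by (simp add: norm_scaleC_bop)
    show "Z * \<i> *\<^sub>C G = 1" "(\<i> *\<^sub>C G) * Z = 1" using G by simp_all
    then show "bop_inv Z = \<i> *\<^sub>C G" by (rule bop_inv_eqI)
  qed
qed

lemma inverse_commute:
  fixes Z :: "'i bop"
  assumes "Z * G = 1" "G * Z = 1" "X * Z = Z * X"
  shows "X * G = G * X"
  using assms by (metis mult.assoc mult.left_neutral mult.right_neutral)

subsection \<open>Spectral projections of self-adjoint operators\<close>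

lemma bounded_linear_adj: "bounded_linear (adj :: 'i bop \<Rightarrow> 'i bop)"
  by (rule bounded_linear_intro[where K = 1]) auto

lemma adj_limit:
  assumes "X \<longlonglongrightarrow> (A :: 'i bop)" "\<And>n. adj (X n) = X n"
  shows "adj A = A"
  using LIMSEQ_unique[OF bounded_linear.tendsto[OF bounded_linear_adj assms(1)]] assms by simp

lemma commute_limit:
  assumes "X \<longlonglongrightarrow> (A :: 'i bop)" "\<And>n. B * X n = X n * B"
  shows "B * A = A * B"
proof (rule LIMSEQ_unique)
  show "(\<lambda>n. B * X n) \<longlonglongrightarrow> B * A" by (intro tendsto_intros assms)
  show "(\<lambda>n. B * X n) \<longlonglongrightarrow> A * B" unfolding assms(2) by (intro tendsto_intros assms)
qed

lemma adj_power: "adj A = A \<Longrightarrow> adj (A ^ n) = A ^ n"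
  by (induction n) (auto simp: power_commutes)

lemma commute_power: "B * A = A * B \<Longrightarrow> B * A ^ n = A ^ n * (B :: 'i bop)"
  by (metis power_commuting_commutes)

lemma commute_mult: "X * A = A * X \<Longrightarrow> X * B = B * X \<Longrightarrow> X * (A * B) = A * B * (X :: 'i bop)"
  by (metis mult.assoc)

lemma commute_one_minus: "X * A = A * X \<Longrightarrow> X * (1 - A) = (1 - A) * (X :: 'i bop)"
  by (simp add: algebra_simps)

lemma sa_cinner: "adj A = A \<Longrightarrow> cinner (A *\<^sub>V u) v = cinner u (A *\<^sub>V v)"
  by (metis cinner_adj)

lemma Re_cinner_self [simp]: "Re (cinner u u) = (norm u)\<^sup>2"
  by (simp only: cinner_self Re_complex_of_real)

lemma sa_norm_sq: "adj A = A \<Longrightarrow> Re (cinner u (A *\<^sub>V A *\<^sub>V u)) = (norm (A *\<^sub>V u))\<^sup>2"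
  by (metis sa_cinner Re_cinner_self)

lemma sa_cinner_real: "adj A = A \<Longrightarrow> cinner u (A *\<^sub>V u) = of_real (Re (cinner u (A *\<^sub>V u)))"
  by (metis sa_cinner cinner_commute Reals_cnj_iff of_real_Re)

section \<open>Square roots and the modulus of a self-adjoint contraction\<close>

lemma one_minus_square:
  assumes A: "adj A = A" "norm A \<le> 1"
  shows "0 \<le> Re (cinner u ((1 - A * A) *\<^sub>V u))" "norm (1 - A * A) \<le> 1"
proof -
  have nA: "(norm (A *\<^sub>V v))\<^sup>2 \<le> (norm v)\<^sup>2" for v
    using norm_bop_apply[of A v] A(2) mult_right_mono[of "norm A" 1 "norm v"]
    by (intro power_mono) auto
  note eq = sa_norm_sq[OF A(1)]
  show "0 \<le> Re (cinner u ((1 - A * A) *\<^sub>V u))"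
    using nA[of u] by (simp add: cinner_simps eq cinner_self)
  show "norm (1 - A * A) \<le> 1"
  proof (rule norm_bop_leI)
    fix u
    have "(norm ((1 - A * A) *\<^sub>V u))\<^sup>2 = (norm u)\<^sup>2 - 2 * (norm (A *\<^sub>V u))\<^sup>2 + (norm (A *\<^sub>V A *\<^sub>V u))\<^sup>2"
      using norm_sq_diff[of u "A *\<^sub>V A *\<^sub>V u"] by (simp add: eq)
    also have "\<dots> \<le> (norm u)\<^sup>2" using nA[of "A *\<^sub>V u"] zero_le_power2[of "norm (A *\<^sub>V u)"] by linarith
    finally show "norm ((1 - A * A) *\<^sub>V u) \<le> 1 * norm u"
      by (simp add: power2_le_iff_abs_le)
  qed simp
qed

text \<open>The iteration \<open>Y \<mapsto> (B + Y\<^sup>2) / 2\<close> converges to \<open>1 - \<surd>(1 - B)\<close>; for \<open>\<parallel>B\<parallel> \<le> 1\<close> its increments are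
  dominated in norm by those of the scalar iteration with \<open>B = 1\<close>.\<close>

primrec sqrt_iter :: "'i bop \<Rightarrow> nat \<Rightarrow> 'i bop" where
  "sqrt_iter B 0 = 0"
| "sqrt_iter B (Suc n) = (1 / 2) *\<^sub>R (B + sqrt_iter B n * sqrt_iter B n)"

primrec sqrt_iter_real :: "nat \<Rightarrow> real" where
  "sqrt_iter_real 0 = 0"
| "sqrt_iter_real (Suc n) = (1 + sqrt_iter_real n * sqrt_iter_real n) / 2"

lemma sqrt_iter_real_bounds: "0 \<le> sqrt_iter_real n" "sqrt_iter_real n \<le> 1"
proof -
  have "0 \<le> sqrt_iter_real n \<and> sqrt_iter_real n \<le> 1"
    by (induction n) (auto simp: mult_le_one)
  then show "0 \<le> sqrt_iter_real n" "sqrt_iter_real n \<le> 1" by auto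
qed

lemma incseq_sqrt_iter_real: "incseq sqrt_iter_real"
proof (rule incseq_SucI)
  fix n
  show "sqrt_iter_real n \<le> sqrt_iter_real (Suc n)"
    using zero_le_power2[of "1 - sqrt_iter_real n"]
    unfolding sqrt_iter_real.simps power2_eq_square by argo
qed

lemma sqrt_iter_commute: "X * B = B * X \<Longrightarrow> X * sqrt_iter B n = sqrt_iter B n * (X :: 'i bop)"
proof (induction n)
  case (Suc n)
  show ?case using commute_mult[OF Suc.IH[OF Suc.prems] Suc.IH[OF Suc.prems]] Suc.prems
    by (simp add: distrib_left distrib_right)
qed simp

lemma sqrt_iter_norm:
  assumes "norm B \<le> 1"
  shows "norm (sqrt_iter B n) \<le> sqrt_iter_real n"
proof (induction n)
  case (Suc n)
  have "norm (sqrt_iter B n * sqrt_iter B n) \<le> sqrt_iter_real n * sqrt_iter_real n"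
    using Suc sqrt_iter_real_bounds by (intro order_trans[OF norm_mult_ineq] mult_mono) auto
  then show ?case using assms norm_triangle_ineq[of B "sqrt_iter B n * sqrt_iter B n"] by simp
qed simp

lemma sqrt_iter_diff:
  assumes "norm B \<le> 1"
  shows "n \<le> m \<Longrightarrow> norm (sqrt_iter B m - sqrt_iter B n) \<le> sqrt_iter_real m - sqrt_iter_real n"
proof (induction n arbitrary: m)
  case 0
  then show ?case using sqrt_iter_norm[OF assms] by simp
next
  case (Suc n)
  then obtain k where k: "m = Suc k" "n \<le> k" by (cases m) auto
  have comm: "sqrt_iter B k * sqrt_iter B n = sqrt_iter B n * sqrt_iter B k"
    by (intro sqrt_iter_commute sqrt_iter_commute[symmetric]) simp
  \<comment> \<open>The iterates commute, so the difference of squares factors; each factor is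
    dominated by its scalar counterpart.\<close>
  have "sqrt_iter B m - sqrt_iter B (Suc n)
      = (1 / 2) *\<^sub>R ((sqrt_iter B k - sqrt_iter B n) * (sqrt_iter B k + sqrt_iter B n))"
    using comm by (simp add: k algebra_simps)
  also have "norm \<dots> \<le> 1 / 2 * ((sqrt_iter_real k - sqrt_iter_real n) * (sqrt_iter_real k + sqrt_iter_real n))"
    using Suc.IH[OF k(2)] sqrt_iter_norm[OF assms, of k] sqrt_iter_norm[OF assms, of n]
      incseqD[OF incseq_sqrt_iter_real k(2)]
      norm_triangle_ineq[of "sqrt_iter B k" "sqrt_iter B n"]
    by (auto intro!: order_trans[OF norm_mult_ineq] mult_mono)
  also have "\<dots> = sqrt_iter_real m - sqrt_iter_real (Suc n)" by (simp add: k field_simps)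
  finally show ?case .
qed

text \<open>With B = 1 - A^2 the limit of the iteration is 1 minus the root of 1 - B. For a
  self-adjoint contraction A this is therefore the modulus of A, the positive root of A^2.\<close>

definition abs_op :: "'i bop \<Rightarrow> 'i bop" where
  "abs_op A = 1 - lim (sqrt_iter (1 - A * A))"

lemma abs_op:
  assumes A: "adj A = A" "norm A \<le> 1"
  shows "sqrt_iter (1 - A * A) \<longlonglongrightarrow> 1 - abs_op A" "adj (abs_op A) = abs_op A"
    "abs_op A * abs_op A = A * A" "0 \<le> Re (cinner u (abs_op A *\<^sub>V u))" "norm (abs_op A) \<le> 1"
    "X * A = A * X \<Longrightarrow> X * abs_op A = abs_op A * X"
proof -
  define B where "B = 1 - A * A"
  have B: "norm B \<le> 1" using one_minus_square[OF A] by (simp add: B_def)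
  have "Cauchy sqrt_iter_real"
    by (intro convergent_Cauchy Bseq_mono_convergent BseqI'[of _ 1])
       (use sqrt_iter_real_bounds incseqD[OF incseq_sqrt_iter_real] in \<open>auto simp: abs_of_nonneg\<close>)
  have "Cauchy (sqrt_iter B)"
  proof (rule CauchyI)
    fix e :: real assume "e > 0"
    then obtain M where M: "\<And>m n. m \<ge> M \<Longrightarrow> n \<ge> M \<Longrightarrow> norm (sqrt_iter_real m - sqrt_iter_real n) < e"
      using CauchyD[OF \<open>Cauchy sqrt_iter_real\<close>] by metis
    have "norm (sqrt_iter B m - sqrt_iter B n) < e" if "m \<ge> M" "n \<ge> M" for m n
      using M[OF that] sqrt_iter_diff[OF B, of n m] sqrt_iter_diff[OF B, of m n]
      by (cases "n \<le> m") (auto simp: norm_minus_commute)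
    then show "\<exists>M. \<forall>m\<ge>M. \<forall>n\<ge>M. norm (sqrt_iter B m - sqrt_iter B n) < e" by blast
  qed
  then obtain Y where Y: "sqrt_iter B \<longlonglongrightarrow> Y" using Cauchy_convergent convergent_def by blast
  then have ao: "abs_op A = 1 - Y" by (simp add: abs_op_def B_def[symmetric] limI)
  show "sqrt_iter (1 - A * A) \<longlonglongrightarrow> 1 - abs_op A" using Y by (simp add: ao B_def)
  have adjB: "adj B = B" using A by (simp add: B_def)
  have "adj (sqrt_iter B n) = sqrt_iter B n" for n
    by (induction n) (auto simp: adjB)
  then have adjY: "adj Y = Y" by (rule adj_limit[OF Y])
  then show sa: "adj (abs_op A) = abs_op A" by (simp add: ao)
  have "(\<lambda>n. sqrt_iter B (Suc n)) \<longlonglongrightarrow> (1 / 2) *\<^sub>R (B + Y * Y)"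
    unfolding sqrt_iter.simps by (intro tendsto_intros Y)
  \<comment> \<open>The fixed point equation is (1 - Y)^2 = 1 - B = A^2 in disguise.\<close>
  then have YY: "Y = (1 / 2) *\<^sub>R (B + Y * Y)"
    by (rule LIMSEQ_unique[OF LIMSEQ_Suc[OF Y]])
  have "(1 - Y) * (1 - Y) = 1 - (Y + Y) + Y * Y" by (simp add: algebra_simps)
  also have "Y + Y = 2 *\<^sub>R Y" by (simp add: scaleR_2)
  also have "2 *\<^sub>R Y = B + Y * Y" by (subst YY) simp
  finally show sq: "abs_op A * abs_op A = A * A" by (simp add: ao B_def)
  have nY: "norm Y \<le> 1"
    by (rule tendsto_upperbound[OF tendsto_norm[OF Y]])
       (auto intro!: always_eventually order_trans[OF sqrt_iter_norm[OF B] sqrt_iter_real_bounds(2)])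
  show "0 \<le> Re (cinner u (abs_op A *\<^sub>V u))"
  proof -
    have "Re (cinner u (Y *\<^sub>V u)) \<le> norm u * (norm Y * norm u)"
      using Re_cinner_le[of u "Y *\<^sub>V u"] norm_bop_apply[of Y u]
        mult_left_mono[OF norm_bop_apply[of Y u], of "norm u"] by simp
    also have "\<dots> \<le> norm u * (1 * norm u)" using nY by (intro mult_left_mono mult_right_mono) auto
    finally show ?thesis by (simp add: ao cinner_simps cinner_self power2_eq_square)
  qed
  show "norm (abs_op A) \<le> 1"
  proof (rule norm_bop_leI)
    fix u
    have "(norm (abs_op A *\<^sub>V u))\<^sup>2 = Re (cinner u ((abs_op A * abs_op A) *\<^sub>V u))"
      by (simp add: sa_norm_sq[OF sa])
    also have "\<dots> = (norm (A *\<^sub>V u))\<^sup>2"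
      unfolding sq by (simp add: sa_norm_sq[OF A(1)])
    finally have "norm (abs_op A *\<^sub>V u) = norm (A *\<^sub>V u)" by simp
    then show "norm (abs_op A *\<^sub>V u) \<le> 1 * norm u"
      using norm_bop_apply[of A u] A(2) mult_right_mono[of "norm A" 1 "norm u"] by simp
  qed simp
  show "X * abs_op A = abs_op A * X" if X: "X * A = A * X"
  proof -
    have "X * B = B * X" unfolding B_def by (intro commute_one_minus commute_mult X)
    then have "X * Y = Y * X" by (intro commute_limit[OF Y] sqrt_iter_commute)
    then show ?thesis by (simp add: ao algebra_simps)
  qed
qed

text \<open>The inequality T^2 \<le> c T for 0 \<le> T \<le> c, read off from c T (c - T) = (c - T)
  T (c - T) + T (c - T) T, where both terms on the right are nonnegative. The vector y carries the
  first term and w the second.\<close>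

lemma psd_norm_sq_le:
  assumes T: "adj T = T" and psd: "\<And>v. 0 \<le> Re (cinner v (T *\<^sub>V v))"
    and le: "\<And>v. Re (cinner v (T *\<^sub>V v)) \<le> c * (norm v)\<^sup>2" and c: "c > 0"
  shows "(norm (T *\<^sub>V u))\<^sup>2 \<le> c * Re (cinner u (T *\<^sub>V u))"
proof -
  define w where "w = T *\<^sub>V u"
  define y where "y = c *\<^sub>R u - w"
  have "0 \<le> Re (cinner y (T *\<^sub>V y)) + (c * (norm w)\<^sup>2 - Re (cinner w (T *\<^sub>V w)))"
    using psd[of y] le[of w] by simp
  also have "\<dots> = c * (c * Re (cinner u w) - (norm w)\<^sup>2)"
  proof -
    have 1: "cinner u (T *\<^sub>V w) = cinner w w" using sa_cinner[OF T, of u w] by (simp add: w_def)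
    have "cinner y (T *\<^sub>V y) = of_real c * of_real c * cinner u w - of_real c * cinner w w
        - of_real c * cinner w w + cinner w (T *\<^sub>V w)"
      by (simp add: y_def bop_lin cinner_simps 1 w_def[symmetric] algebra_simps)
    then have "Re (cinner y (T *\<^sub>V y)) = c * c * Re (cinner u w) - c * Re (cinner w w)
        - c * Re (cinner w w) + Re (cinner w (T *\<^sub>V w))"
      by (simp add: mult.assoc)
    then show ?thesis unfolding cinner_self[of w] Re_complex_of_real by (simp add: algebra_simps)
  qed
  finally have "0 \<le> c * Re (cinner u w) - (norm w)\<^sup>2" using c by (simp add: zero_le_mult_iff)
  then show ?thesis by (simp add: w_def)
qed

text \<open>For a self-adjoint contraction A the powers of 1 - A^2 converge strongly to the
  projection onto the kernel of A: they fix the kernel and die out on its complement. As a strong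
  limit of polynomials it inherits commutation and measurability.\<close>

definition ker_proj :: "'i bop \<Rightarrow> 'i bop" where
  "ker_proj A = bop_of (\<lambda>u. lim (\<lambda>n. (1 - A * A) ^ n *\<^sub>V u))"

lemma ker_proj:
  assumes A: "adj A = A" "norm A \<le> 1"
  shows "(\<lambda>n. (1 - A * A) ^ n *\<^sub>V u) \<longlonglongrightarrow> ker_proj A *\<^sub>V u" "adj (ker_proj A) = ker_proj A"
    "ker_proj A * ker_proj A = ker_proj A" "A * ker_proj A = 0" "A *\<^sub>V u = 0 \<Longrightarrow> ker_proj A *\<^sub>V u = u"
    "X * A = A * X \<Longrightarrow> X * ker_proj A = ker_proj A * X"
proof -
  define B where "B = 1 - A * A"
  have B: "adj B = B" "norm B \<le> 1" "\<And>v. 0 \<le> Re (cinner v (B *\<^sub>V v))"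
    using one_minus_square[OF A] A by (auto simp: B_def)
  have adjn: "cinner (B ^ n *\<^sub>V u) v = cinner u (B ^ n *\<^sub>V v)" for n u v
    by (intro sa_cinner adj_power B)
  \<comment> \<open>This sequence is nonnegative (odd exponents use B \<ge> 0) and decreasing, since
    its decrement is the same form at A u. As B is self-adjoint, squared distances between the
    vectors \<open>B ^ n *\<^sub>V u\<close> are combinations of its values, so its convergence
    makes these vectors a Cauchy sequence.\<close>
  define a where "a u n = Re (cinner u (B ^ n *\<^sub>V u))" for u n
  have split: "a u (m + n) = Re (cinner (B ^ m *\<^sub>V u) (B ^ n *\<^sub>V u))" for u m n
    by (simp add: a_def adjn power_add)
  have nonneg: "0 \<le> a u n" for u n
  proof (cases "even n")
    case True
    then obtain m where "n = m + m" by (metis evenE mult_2)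
    then show ?thesis unfolding \<open>n = m + m\<close> split by (simp add: cinner_self)
  next
    case False
    then obtain m where m: "n = m + Suc m" by (metis oddE mult_2 add_Suc_right Suc_eq_plus1)
    show ?thesis unfolding m split using B(3)[of "B ^ m *\<^sub>V u"] by simp
  qed
  have dec: "a u (Suc n) \<le> a u n" for u n
  proof -
    have "a u n - a u (Suc n) = Re (cinner u (B ^ n *\<^sub>V A *\<^sub>V A *\<^sub>V u))"
    proof -
      have "B ^ n *\<^sub>V u - B ^ Suc n *\<^sub>V u = B ^ n *\<^sub>V A *\<^sub>V A *\<^sub>V u"
        by (simp add: B_def power_Suc2 bop_lin del: power_Suc)
      then show ?thesis unfolding a_def minus_complex.sel[symmetric] cinner_diff_right[symmetric] by simp
    qed
    also have "B ^ n *\<^sub>V A *\<^sub>V A *\<^sub>V u = A *\<^sub>V B ^ n *\<^sub>V A *\<^sub>V u"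
    proof -
      have "A * B = B * A" unfolding B_def by (intro commute_one_minus commute_mult refl)
      then have "A * B ^ n = B ^ n * A" by (rule commute_power)
      then show ?thesis by (metis bop_apply_simps(7))
    qed
    also have "cinner u \<dots> = cinner (A *\<^sub>V u) (B ^ n *\<^sub>V A *\<^sub>V u)" by (simp add: sa_cinner A)
    finally show ?thesis using nonneg[of "A *\<^sub>V u" n] by (simp add: a_def)
  qed
  have conv: "convergent (\<lambda>n. B ^ n *\<^sub>V u)" for u
  proof -
    have mono: "a u m \<le> a u n" if "n \<le> m" for m n using lift_Suc_antimono_le[of "a u", OF dec that] .
    obtain l where l: "a u \<longlonglongrightarrow> l"
      using decseq_convergent[of "a u" 0] nonneg mono unfolding decseq_def by metis
    have ge: "l \<le> a u n" for n using decseq_ge[OF _ l] mono unfolding decseq_def by blast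
    have "Cauchy (\<lambda>n. B ^ n *\<^sub>V u)"
    proof (rule CauchyI)
      fix e :: real assume "e > 0"
      then have "\<forall>\<^sub>F n in sequentially. a u n < l + e\<^sup>2 / 2"
        using l by (intro order_tendstoD(2)) auto
      then obtain M where M: "\<And>n. n \<ge> M \<Longrightarrow> a u n < l + e\<^sup>2 / 2"
        unfolding eventually_sequentially by blast
      have "norm (B ^ m *\<^sub>V u - B ^ n *\<^sub>V u) < e" if "m \<ge> M" "n \<ge> M" for m n
      proof (rule power2_less_imp_less)
        have "(norm (B ^ m *\<^sub>V u - B ^ n *\<^sub>V u))\<^sup>2 = a u (m + m) - 2 * a u (m + n) + a u (n + n)"
          unfolding norm_sq_diff split by (simp add: cinner_self)
        also have "\<dots> < e\<^sup>2"
          using M[of "m + m"] M[of "n + n"] ge[of "m + n"] that by auto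
        finally show "(norm (B ^ m *\<^sub>V u - B ^ n *\<^sub>V u))\<^sup>2 < e\<^sup>2" .
      qed (use \<open>e > 0\<close> in simp)
      then show "\<exists>M. \<forall>m\<ge>M. \<forall>n\<ge>M. norm (B ^ m *\<^sub>V u - B ^ n *\<^sub>V u) < e" by blast
    qed
    then show ?thesis by (rule Cauchy_convergent)
  qed
  define q where "q u = lim (\<lambda>n. B ^ n *\<^sub>V u)" for u
  have q: "(\<lambda>n. B ^ n *\<^sub>V u) \<longlonglongrightarrow> q u" for u
    using conv[of u] by (simp add: q_def convergent_LIMSEQ_iff)
  have Q: "ker_proj A *\<^sub>V u = q u" for u
    unfolding ker_proj_def B_def[symmetric] q_def[symmetric]
  proof (rule bop_of_apply[where K = 1])
    fix u v :: "'a ell2" and c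
    show "q (u + v) = q u + q v"
      by (rule LIMSEQ_unique[OF q]) (unfold bop_lin, intro tendsto_add q)
    show "q (c *\<^sub>C u) = c *\<^sub>C q u"
      by (rule LIMSEQ_unique[OF q])
         (unfold bop_lin, intro bounded_linear.tendsto[OF bounded_linear_scaleC_ell2] q)
    show "norm (q u) \<le> 1 * norm u"
    proof (rule tendsto_upperbound[OF tendsto_norm[OF q]])
      have "norm (B ^ n) \<le> 1" for n
        using norm_power_ineq[of B n] power_mono[OF B(2), of n] by simp
      then have "norm (B ^ n *\<^sub>V u) \<le> 1 * norm u" for n
        using norm_bop_apply[of "B ^ n" u] by (meson mult_right_mono norm_ge_zero order_trans)
      then show "\<forall>\<^sub>F n in sequentially. norm (B ^ n *\<^sub>V u) \<le> 1 * norm u" by simp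
    qed simp
  qed
  show lim: "(\<lambda>n. (1 - A * A) ^ n *\<^sub>V u) \<longlonglongrightarrow> ker_proj A *\<^sub>V u" for u
    using q[of u] by (simp add: Q B_def)
  note lim' = lim[folded B_def]
  show "adj (ker_proj A) = ker_proj A"
  proof (rule adj_eqI, rule LIMSEQ_unique)
    fix u v
    show "(\<lambda>n. cinner (B ^ n *\<^sub>V u) v) \<longlonglongrightarrow> cinner (ker_proj A *\<^sub>V u) v"
      by (intro tendsto_cinner lim' tendsto_const)
    show "(\<lambda>n. cinner (B ^ n *\<^sub>V u) v) \<longlonglongrightarrow> cinner u (ker_proj A *\<^sub>V v)"
      unfolding adjn by (intro tendsto_cinner lim' tendsto_const)
  qed
  have comm: "X * ker_proj A = ker_proj A * X" if X: "X * A = A * X" for X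
  proof (rule bop_eqI, unfold bop_apply_simps, rule LIMSEQ_unique)
    fix u
    have "X * B = B * X" unfolding B_def by (intro commute_one_minus commute_mult X)
    then have XB: "X *\<^sub>V B ^ n *\<^sub>V u = B ^ n *\<^sub>V X *\<^sub>V u" for n
      by (metis commute_power bop_apply_simps(7))
    show "(\<lambda>n. X *\<^sub>V B ^ n *\<^sub>V u) \<longlonglongrightarrow> X *\<^sub>V ker_proj A *\<^sub>V u"
      by (intro bounded_linear.tendsto[OF bounded_linear_bop_apply] lim')
    show "(\<lambda>n. X *\<^sub>V B ^ n *\<^sub>V u) \<longlonglongrightarrow> ker_proj A *\<^sub>V X *\<^sub>V u"
      unfolding XB by (rule lim')
  qed
  then show "X * A = A * X \<Longrightarrow> X * ker_proj A = ker_proj A * X" .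
  have fixed: "ker_proj A *\<^sub>V u = u" if "A *\<^sub>V u = 0" for u
  proof (rule LIMSEQ_unique[OF lim'])
    have "B *\<^sub>V u = u" using that by (simp add: B_def)
    then have "B ^ n *\<^sub>V u = u" for n by (induction n) auto
    then show "(\<lambda>n. B ^ n *\<^sub>V u) \<longlonglongrightarrow> u" by simp
  qed
  then show "A *\<^sub>V u = 0 \<Longrightarrow> ker_proj A *\<^sub>V u = u" .
  \<comment> \<open>A vector fixed by 1 - A^2 is killed by A^2, hence by A because A is
    self-adjoint.\<close>
  have AQ: "A *\<^sub>V ker_proj A *\<^sub>V u = 0" for u
  proof -
    have "(\<lambda>n. B *\<^sub>V B ^ n *\<^sub>V u) \<longlonglongrightarrow> B *\<^sub>V ker_proj A *\<^sub>V u"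
      by (intro bounded_linear.tendsto[OF bounded_linear_bop_apply] lim')
    moreover have "(\<lambda>n. B *\<^sub>V B ^ n *\<^sub>V u) \<longlonglongrightarrow> ker_proj A *\<^sub>V u"
      using LIMSEQ_Suc[OF lim'[of u]] by simp
    ultimately have "B *\<^sub>V ker_proj A *\<^sub>V u = ker_proj A *\<^sub>V u" by (rule LIMSEQ_unique)
    then have 0: "A *\<^sub>V A *\<^sub>V ker_proj A *\<^sub>V u = 0" by (simp add: B_def)
    have "cinner (A *\<^sub>V ker_proj A *\<^sub>V u) (A *\<^sub>V ker_proj A *\<^sub>V u) = 0"
      by (simp add: sa_cinner[OF A(1)] 0)
    then show ?thesis by (simp add: cinner_self)
  qed
  then show "A * ker_proj A = 0" by (intro bop_eqI) simp
  show "ker_proj A * ker_proj A = ker_proj A"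
    by (rule bop_eqI) (simp add: fixed[OF AQ])
qed

definition pos_part :: "'i bop \<Rightarrow> 'i bop" where
  "pos_part A = (1 / 2) *\<^sub>R (abs_op A + A)"

text \<open>The kernel of the positive part is the spectral subspace of A for the closed half-line
  from minus infinity to 0. Including the eigenvalue 0 is what makes the family built from it
  continuous from the right.\<close>

definition neg_proj :: "'i bop \<Rightarrow> 'i bop" where
  "neg_proj A = ker_proj (pos_part A)"

lemma pos_part:
  assumes A: "adj A = A" "norm A \<le> 1"
  shows "adj (pos_part A) = pos_part A" "norm (pos_part A) \<le> 1"
    "X * A = A * X \<Longrightarrow> X * pos_part A = pos_part A * X"
proof -
  show "adj (pos_part A) = pos_part A" using abs_op(2)[OF A] A by (simp add: pos_part_def)
  show "norm (pos_part A) \<le> 1"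
    using abs_op(5)[OF A] A norm_triangle_ineq[of "abs_op A" A] by (simp add: pos_part_def)
  show "X * pos_part A = pos_part A * X" if "X * A = A * X"
    using abs_op(6)[OF A that] that by (simp add: pos_part_def distrib_left distrib_right)
qed

lemma neg_proj:
  assumes A: "adj A = A" "norm A \<le> 1"
  shows "adj (neg_proj A) = neg_proj A" "neg_proj A * neg_proj A = neg_proj A"
    "X * A = A * X \<Longrightarrow> X * neg_proj A = neg_proj A * X"
    "neg_proj A *\<^sub>V u = u \<Longrightarrow> Re (cinner u (A *\<^sub>V u)) \<le> 0"
    "neg_proj A *\<^sub>V u = 0 \<Longrightarrow> u \<noteq> 0 \<Longrightarrow> 0 < Re (cinner u (A *\<^sub>V u))"
proof -
  define p where "p = pos_part A"
  define q where "q = ker_proj p"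
  have q_eq: "neg_proj A = q" by (simp add: q_def p_def neg_proj_def)
  define N where "N = (1 / 2) *\<^sub>R (abs_op A - A)"
  note pp = pos_part[OF A, folded p_def]
  note kp = ker_proj[OF pp(1,2), folded q_def]
  note ao = abs_op[OF A]
  have Aabs: "A * abs_op A = abs_op A * A" by (rule ao(6)) simp
  show "adj (neg_proj A) = neg_proj A" "neg_proj A * neg_proj A = neg_proj A"
    unfolding q_eq by (fact kp)+
  show "X * neg_proj A = neg_proj A * X" if "X * A = A * X"
    unfolding q_eq by (rule kp(6)[OF pp(3)[OF that]])
  have dec: "A = p - N" "abs_op A = p + N"
    by (simp_all add: p_def pos_part_def N_def scaleR_diff_right scaleR_add_right flip: scaleR_add_left)
  \<comment> \<open>Positive and negative part annihilate each other because the modulus commutes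
    with A and has the same square. Hence q fixes the range of N, and A is minus its modulus on the
    range of q.\<close>
  have "p * N = 0"
    using ao(3) Aabs by (simp add: p_def pos_part_def N_def distrib_right right_diff_distrib)
  then have "q *\<^sub>V N *\<^sub>V v = N *\<^sub>V v" for v
    by (intro kp) (metis bop_apply_simps(7,8))
  then have qN: "q * N = N" by (intro bop_eqI) simp
  have "p * q = q * p" by (rule kp(6)) simp
  with kp(4) have qp: "q * p = 0" by simp
  have qA: "q * A = - (q * abs_op A)"
  proof -
    have "q * A = q * (p - N)" "q * abs_op A = q * (p + N)" using dec by simp_all
    then show ?thesis by (simp add: right_diff_distrib distrib_left qp)
  qed
  show "Re (cinner u (A *\<^sub>V u)) \<le> 0" if "neg_proj A *\<^sub>V u = u"
  proof -
    have u: "q *\<^sub>V u = u" using that by (simp add: q_eq)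
    have "cinner u (A *\<^sub>V u) = cinner u ((q * A) *\<^sub>V u)"
      using sa_cinner[OF kp(2), of u "A *\<^sub>V u"] u by simp
    also have "\<dots> = - cinner u (abs_op A *\<^sub>V u)"
      using sa_cinner[OF kp(2), of u "abs_op A *\<^sub>V u"] u by (simp add: qA cinner_simps)
    finally show ?thesis using ao(4)[of u] by simp
  qed
  show "0 < Re (cinner u (A *\<^sub>V u))" if "neg_proj A *\<^sub>V u = 0" "u \<noteq> 0"
  proof -
    have u: "q *\<^sub>V u = 0" using that by (simp add: q_eq)
    have "cinner u (N *\<^sub>V u) = cinner (q *\<^sub>V u) (N *\<^sub>V u)"
      using sa_cinner[OF kp(2), of u "N *\<^sub>V u"] qN by (metis bop_apply_simps(7))
    then have "cinner u (N *\<^sub>V u) = 0" using u by simp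
    then have eq: "cinner u (A *\<^sub>V u) = cinner u (abs_op A *\<^sub>V u)"
      using arg_cong[OF dec(1), of "\<lambda>X. cinner u (X *\<^sub>V u)"] arg_cong[OF dec(2), of "\<lambda>X. cinner u (X *\<^sub>V u)"]
      by (simp add: cinner_simps)
    \<comment> \<open>Strictness: a vanishing form forces the modulus and then A to kill u, which
      puts u into the range of q, contrary to q u = 0 and u \<noteq> 0.\<close>
    have "Re (cinner u (abs_op A *\<^sub>V u)) \<noteq> 0"
    proof
      assume 0: "Re (cinner u (abs_op A *\<^sub>V u)) = 0"
      have "(norm (abs_op A *\<^sub>V u))\<^sup>2 \<le> 1 * Re (cinner u (abs_op A *\<^sub>V u))"
      proof (rule psd_norm_sq_le[OF ao(2,4)])
        fix v
        have "Re (cinner v (abs_op A *\<^sub>V v)) \<le> norm v * (norm (abs_op A) * norm v)"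
          using Re_cinner_le[of v "abs_op A *\<^sub>V v"] mult_left_mono[OF norm_bop_apply[of "abs_op A" v], of "norm v"]
          by simp
        also have "\<dots> \<le> norm v * (1 * norm v)"
          using ao(5) by (intro mult_left_mono mult_right_mono) auto
        finally show "Re (cinner v (abs_op A *\<^sub>V v)) \<le> 1 * (norm v)\<^sup>2" by (simp add: power2_eq_square)
      qed simp
      then have au: "abs_op A *\<^sub>V u = 0" using 0 by simp
      then have "A *\<^sub>V A *\<^sub>V u = 0"
        using ao(3) by (metis bop_apply_simps(7,9))
      then have "cinner (A *\<^sub>V u) (A *\<^sub>V u) = 0" using sa_cinner[OF A(1), of u "A *\<^sub>V u"] by simp
      then have "A *\<^sub>V u = 0" by (simp add: cinner_self)
      then have "p *\<^sub>V u = 0" using au by (simp add: p_def pos_part_def)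
      then have "q *\<^sub>V u = u" by (rule kp(5))
      then show False using u that(2) by simp
    qed
    then show ?thesis using ao(4)[of u] eq by simp
  qed
qed

text \<open>The positive factor makes H - E a contraction without changing the sign of its form.
  Which factor is taken is immaterial, see \<open>spec_fam_eqI\<close>.\<close>

definition spec_fam :: "'i bop \<Rightarrow> real \<Rightarrow> 'i bop" where
  "spec_fam H E = neg_proj ((1 / (norm H + \<bar>E\<bar> + 1)) *\<^sub>R (H - E *\<^sub>R 1))"

text \<open>The last two items, a form bound on the range and a strict one on the kernel, are the
  working substitute for functional calculus: together with commutation they determine the
  projection, and monotonicity and right-continuity are drawn from them.\<close>

lemma spec_fam:
  assumes H: "adj H = H"
  shows "adj (spec_fam H E) = spec_fam H E" "spec_fam H E * spec_fam H E = spec_fam H E"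
    "X * H = H * X \<Longrightarrow> X * spec_fam H E = spec_fam H E * X"
    "spec_fam H E *\<^sub>V u = u \<Longrightarrow> Re (cinner u (H *\<^sub>V u)) \<le> E * (norm u)\<^sup>2"
    "spec_fam H E *\<^sub>V u = 0 \<Longrightarrow> u \<noteq> 0 \<Longrightarrow> E * (norm u)\<^sup>2 < Re (cinner u (H *\<^sub>V u))"
proof -
  define m where "m = norm H + \<bar>E\<bar> + 1"
  define A where "A = (1 / m) *\<^sub>R (H - E *\<^sub>R 1)"
  have m: "m > 0" unfolding m_def by (intro add_nonneg_pos add_nonneg_nonneg) auto
  have "norm (H - E *\<^sub>R 1) \<le> m"
    using norm_triangle_ineq4[of H "E *\<^sub>R 1"] by (simp add: m_def)
  then have A: "adj A = A" "norm A \<le> 1" using H m by (auto simp: A_def)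
  have F: "spec_fam H E = neg_proj A" by (simp add: spec_fam_def A_def m_def)
  note np = neg_proj[OF A, folded F]
  have Au: "Re (cinner u (A *\<^sub>V u)) = (Re (cinner u (H *\<^sub>V u)) - E * (norm u)\<^sup>2) / m" for u
    by (simp add: A_def cinner_simps cinner_self)
  show "adj (spec_fam H E) = spec_fam H E" "spec_fam H E * spec_fam H E = spec_fam H E"
    by (fact np)+
  show "X * spec_fam H E = spec_fam H E * X" if "X * H = H * X"
    by (rule np) (use that in \<open>simp add: A_def algebra_simps\<close>)
  show "Re (cinner u (H *\<^sub>V u)) \<le> E * (norm u)\<^sup>2" if "spec_fam H E *\<^sub>V u = u"
    using np(4)[OF that] m by (simp add: Au field_simps)
  show "E * (norm u)\<^sup>2 < Re (cinner u (H *\<^sub>V u))" if "spec_fam H E *\<^sub>V u = 0" "u \<noteq> 0"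
    using np(5)[OF that] m by (simp add: Au field_simps zero_less_mult_iff)
qed

lemma times_apply: "A * B = C \<Longrightarrow> A *\<^sub>V B *\<^sub>V u = C *\<^sub>V u"
  by auto

lemma commute_apply: "A * B = B * A \<Longrightarrow> A *\<^sub>V B *\<^sub>V u = B *\<^sub>V A *\<^sub>V u"
  by (metis bop_apply_simps(7))

lemma spec_fam_commute:
  assumes H: "adj H = H"
  shows "spec_fam H x * H = H * spec_fam H x" "spec_fam H x * spec_fam H y = spec_fam H y * spec_fam H x"
proof -
  show 1: "spec_fam H x * H = H * spec_fam H x" for x using spec_fam(3)[OF H, of H x] by simp
  show "spec_fam H x * spec_fam H y = spec_fam H y * spec_fam H x" using spec_fam(3)[OF H 1] .
qed

text \<open>A nonzero vector in the range of the lower projection and in the kernel of the upper one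
  would have a normalised form at most x and above y at once. Since the projections commute, p - p q
  maps into such vectors.\<close>

lemma spec_fam_mono:
  assumes H: "adj H = H" and "x \<le> y"
  shows "spec_fam H x * spec_fam H y = spec_fam H x" "spec_fam H y * spec_fam H x = spec_fam H x"
proof -
  define p q where "p = spec_fam H x" and "q = spec_fam H y"
  have comm: "p * q = q * p" unfolding p_def q_def by (rule spec_fam_commute[OF H])
  have pp: "p *\<^sub>V p *\<^sub>V v = p *\<^sub>V v" and qq: "q *\<^sub>V q *\<^sub>V v = q *\<^sub>V v" for v
    using spec_fam(2)[OF H, of x] spec_fam(2)[OF H, of y] by (auto simp: p_def q_def intro: times_apply)
  have "p *\<^sub>V u - p *\<^sub>V q *\<^sub>V u = 0" for u
  proof (rule ccontr)
    define w where "w = p *\<^sub>V u - p *\<^sub>V q *\<^sub>V u"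
    assume "p *\<^sub>V u - p *\<^sub>V q *\<^sub>V u \<noteq> 0"
    then have w: "w \<noteq> 0" by (simp add: w_def)
    have "p *\<^sub>V w = w" by (simp add: w_def bop_lin pp)
    then have le: "Re (cinner w (H *\<^sub>V w)) \<le> x * (norm w)\<^sup>2" unfolding p_def by (rule spec_fam(4)[OF H])
    have "q *\<^sub>V w = 0" by (simp add: w_def bop_lin qq commute_apply[OF comm[symmetric]])
    then have "y * (norm w)\<^sup>2 < Re (cinner w (H *\<^sub>V w))"
      unfolding q_def by (rule spec_fam(5)[OF H _ w])
    then show False using le mult_right_mono[OF assms(2), of "(norm w)\<^sup>2"] by simp
  qed
  then have "p * q = p" by (intro bop_eqI) simp
  then show "spec_fam H x * spec_fam H y = spec_fam H x" "spec_fam H y * spec_fam H x = spec_fam H x"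
    using comm by (auto simp: p_def q_def)
qed

lemma spec_fam_bounds:
  assumes H: "adj H = H" and K: "norm H \<le> K"
  shows "x < - K \<Longrightarrow> spec_fam H x = 0" "K \<le> x \<Longrightarrow> spec_fam H x = 1"
proof -
  have b: "\<bar>Re (cinner w (H *\<^sub>V w))\<bar> \<le> K * (norm w)\<^sup>2" for w
  proof -
    have "\<bar>Re (cinner w (H *\<^sub>V w))\<bar> \<le> norm w * (norm H * norm w)"
      using Re_cinner_le[of w "H *\<^sub>V w"] mult_left_mono[OF norm_bop_apply[of H w], of "norm w"] by simp
    also have "\<dots> \<le> norm w * (K * norm w)" by (intro mult_left_mono mult_right_mono K) auto
    finally show ?thesis by (simp add: power2_eq_square ac_simps)
  qed
  show "spec_fam H x = 0" if "x < - K"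
  proof (rule bop_eqI, rule ccontr)
    fix u
    define w where "w = spec_fam H x *\<^sub>V u"
    assume "spec_fam H x *\<^sub>V u \<noteq> 0 *\<^sub>V u"
    then have "(norm w)\<^sup>2 > 0" by (simp add: w_def)
    moreover have "spec_fam H x *\<^sub>V w = w" unfolding w_def by (intro times_apply spec_fam H)
    from spec_fam(4)[OF H this] b[of w] have "- K * (norm w)\<^sup>2 \<le> x * (norm w)\<^sup>2" by simp
    ultimately show False using that mult_strict_right_mono[of x "- K" "(norm w)\<^sup>2"] by simp
  qed
  show "spec_fam H x = 1" if "K \<le> x"
  proof (rule bop_eqI, rule ccontr)
    fix u
    define w where "w = u - spec_fam H x *\<^sub>V u"
    assume "spec_fam H x *\<^sub>V u \<noteq> 1 *\<^sub>V u"
    then have w: "w \<noteq> 0" by (simp add: w_def)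
    have "spec_fam H x *\<^sub>V w = 0" by (simp add: w_def bop_lin times_apply[OF spec_fam(2)[OF H]])
    from spec_fam(5)[OF H this w] b[of w] have "x * (norm w)\<^sup>2 < K * (norm w)\<^sup>2" by simp
    then show False using that mult_right_mono[of K x "(norm w)\<^sup>2"] by simp
  qed
qed

lemma proj_family:
  fixes F :: "real \<Rightarrow> 'i bop"
  assumes adj: "\<And>x. adj (F x) = F x" and mono: "\<And>x y. x \<le> y \<Longrightarrow> F x * F y = F x \<and> F y * F x = F x"
  shows "Re (cinner u (F x *\<^sub>V u)) = (norm (F x *\<^sub>V u))\<^sup>2"
    "x \<le> y \<Longrightarrow> (norm (F y *\<^sub>V u - F x *\<^sub>V u))\<^sup>2 = Re (cinner u (F y *\<^sub>V u)) - Re (cinner u (F x *\<^sub>V u))"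
    "x \<le> y \<Longrightarrow> F x *\<^sub>V (F y *\<^sub>V u - F x *\<^sub>V u) = 0"
    "x \<le> y \<Longrightarrow> F y *\<^sub>V (F y *\<^sub>V u - F x *\<^sub>V u) = F y *\<^sub>V u - F x *\<^sub>V u"
proof -
  have FF: "F x *\<^sub>V F y *\<^sub>V v = F x *\<^sub>V v" "F y *\<^sub>V F x *\<^sub>V v = F x *\<^sub>V v" if "x \<le> y" for x y v
    using mono[OF that] by (auto intro: times_apply)
  show n: "Re (cinner u (F x *\<^sub>V u)) = (norm (F x *\<^sub>V u))\<^sup>2" for x
    using sa_norm_sq[OF adj, of u x] FF(1)[of x x u] by simp
  show "F x *\<^sub>V (F y *\<^sub>V u - F x *\<^sub>V u) = 0" if "x \<le> y" using FF that by (simp add: bop_lin)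
  show "F y *\<^sub>V (F y *\<^sub>V u - F x *\<^sub>V u) = F y *\<^sub>V u - F x *\<^sub>V u" if "x \<le> y"
    using FF that by (simp add: bop_lin)
  show "(norm (F y *\<^sub>V u - F x *\<^sub>V u))\<^sup>2 = Re (cinner u (F y *\<^sub>V u)) - Re (cinner u (F x *\<^sub>V u))" if "x \<le> y"
    using FF[OF that, of u] n[of x] n[of y] unfolding norm_sq_diff sa_cinner[OF adj] by simp
qed

lemma spec_fam_proj:
  assumes H: "adj H = H"
  shows "Re (cinner u (spec_fam H x *\<^sub>V u)) = (norm (spec_fam H x *\<^sub>V u))\<^sup>2"
    "x \<le> y \<Longrightarrow> (norm (spec_fam H y *\<^sub>V u - spec_fam H x *\<^sub>V u))\<^sup>2
      = Re (cinner u (spec_fam H y *\<^sub>V u)) - Re (cinner u (spec_fam H x *\<^sub>V u))"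
    "x \<le> y \<Longrightarrow> spec_fam H x *\<^sub>V (spec_fam H y *\<^sub>V u - spec_fam H x *\<^sub>V u) = 0"
    "x \<le> y \<Longrightarrow> spec_fam H y *\<^sub>V (spec_fam H y *\<^sub>V u - spec_fam H x *\<^sub>V u)
      = spec_fam H y *\<^sub>V u - spec_fam H x *\<^sub>V u"
  by (rule proj_family; use spec_fam(1)[OF H] spec_fam_mono[OF H] in auto)+

text \<open>Monotone projections converge strongly, so only the limit has to be identified. The
  limit w of the differences lies in the range of every projection to the right of x and in the
  kernel of the one at x; its normalised form would be at most x and strictly above x, unless w =
  0.\<close>

lemma spec_fam_right_continuous:
  assumes H: "adj H = H"
  shows "((\<lambda>y. spec_fam H y *\<^sub>V u) \<longlongrightarrow> spec_fam H x *\<^sub>V u) (at_right x)"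
proof -
  define F where "F = spec_fam H"
  define a where "a y = Re (cinner u (F y *\<^sub>V u))" for y
  note pf = spec_fam_proj[OF H, folded F_def]
  have FF: "F x *\<^sub>V F y *\<^sub>V v = F x *\<^sub>V v" "F y *\<^sub>V F x *\<^sub>V v = F x *\<^sub>V v" if "x \<le> y" for x y v
    using spec_fam_mono[OF H that] by (auto simp: F_def intro: times_apply)
  have d: "(norm (F z *\<^sub>V u - F y *\<^sub>V u))\<^sup>2 = a z - a y" if "y \<le> z" for y z
    using pf(2)[OF that] by (simp add: a_def)
  have mono: "a y \<le> a z" if "y \<le> z" for y z using d[OF that] zero_le_power2 by (metis diff_ge_0_iff_ge)
  define s where "s n = x + 1 / real (Suc n)" for n
  have s: "x < s n" for n by (simp add: s_def)
  have s_dec: "s m \<le> s n" if "n \<le> m" for m n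
    using that by (auto simp: s_def intro!: frac_le)
  have "decseq (\<lambda>n. a (s n))" unfolding decseq_def using mono s_dec by blast
  moreover have "\<forall>n. a x \<le> a (s n)" using mono s by (simp add: less_imp_le)
  ultimately obtain l where l: "(\<lambda>n. a (s n)) \<longlonglongrightarrow> l" "\<forall>n. l \<le> a (s n)"
    by (rule decseq_convergent)
  have "Cauchy (\<lambda>n. F (s n) *\<^sub>V u)"
  proof (rule CauchyI)
    fix e :: real assume "e > 0"
    then have "\<forall>\<^sub>F n in sequentially. a (s n) < l + e\<^sup>2"
      using l by (intro order_tendstoD(2)) auto
    then obtain M where M: "\<And>n. n \<ge> M \<Longrightarrow> a (s n) < l + e\<^sup>2"
      unfolding eventually_sequentially by blast
    have *: "norm (F (s m) *\<^sub>V u - F (s n) *\<^sub>V u) < e" if "m \<ge> M" "n \<ge> m" for m n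
    proof (rule power2_less_imp_less)
      show "(norm (F (s m) *\<^sub>V u - F (s n) *\<^sub>V u))\<^sup>2 < e\<^sup>2"
        unfolding d[OF s_dec[OF that(2)]] using M[OF that(1)] l(2)[rule_format, of n] by simp
    qed (use \<open>e > 0\<close> in simp)
    have "norm (F (s m) *\<^sub>V u - F (s n) *\<^sub>V u) < e" if "m \<ge> M" "n \<ge> M" for m n
      using *[of m n] *[of n m] that by (cases "m \<le> n") (auto simp: norm_minus_commute)
    then show "\<exists>M. \<forall>m\<ge>M. \<forall>n\<ge>M. norm (F (s m) *\<^sub>V u - F (s n) *\<^sub>V u) < e" by blast
  qed
  then obtain v where v: "(\<lambda>n. F (s n) *\<^sub>V u) \<longlonglongrightarrow> v"
    using Cauchy_convergent convergent_def by blast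
  define w where "w = v - F x *\<^sub>V u"
  have wl: "(\<lambda>n. F (s n) *\<^sub>V u - F x *\<^sub>V u) \<longlonglongrightarrow> w"
    unfolding w_def by (intro tendsto_intros v)
  have s_lim: "s \<longlonglongrightarrow> x"
    unfolding s_def using tendsto_add[OF tendsto_const LIMSEQ_inverse_real_of_nat, of x]
    by (simp add: inverse_eq_divide)
  have "w = 0"
  proof (rule ccontr)
    assume w0: "w \<noteq> 0"
    have "F x *\<^sub>V w = 0"
    proof (rule LIMSEQ_unique)
      show "(\<lambda>n. F x *\<^sub>V (F (s n) *\<^sub>V u - F x *\<^sub>V u)) \<longlonglongrightarrow> F x *\<^sub>V w"
        by (intro bounded_linear.tendsto[OF bounded_linear_bop_apply] wl)
      show "(\<lambda>n. F x *\<^sub>V (F (s n) *\<^sub>V u - F x *\<^sub>V u)) \<longlonglongrightarrow> 0"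
        using pf(3)[OF less_imp_le[OF s]] by simp
    qed
    then have gt: "x * (norm w)\<^sup>2 < Re (cinner w (H *\<^sub>V w))"
      unfolding F_def by (rule spec_fam(5)[OF H _ w0])
    have "Re (cinner w (H *\<^sub>V w)) \<le> s m * (norm w)\<^sup>2" for m
    proof -
      have "F (s m) *\<^sub>V w = w"
      proof (rule LIMSEQ_unique)
        show "(\<lambda>n. F (s m) *\<^sub>V (F (s n) *\<^sub>V u - F x *\<^sub>V u)) \<longlonglongrightarrow> F (s m) *\<^sub>V w"
          by (intro bounded_linear.tendsto[OF bounded_linear_bop_apply] wl)
        have "F (s m) *\<^sub>V (F (s n) *\<^sub>V u - F x *\<^sub>V u) = F (s n) *\<^sub>V u - F x *\<^sub>V u" if "n \<ge> m" for n
          using FF(2)[OF s_dec[OF that]] FF(2)[OF less_imp_le[OF s]] by (simp add: bop_lin)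
        then show "(\<lambda>n. F (s m) *\<^sub>V (F (s n) *\<^sub>V u - F x *\<^sub>V u)) \<longlonglongrightarrow> w"
          by (intro Lim_transform_eventually[OF wl] eventually_sequentiallyI[of m]) simp
      qed
      then show ?thesis unfolding F_def by (rule spec_fam(4)[OF H])
    qed
    moreover have "(\<lambda>m. s m * (norm w)\<^sup>2) \<longlonglongrightarrow> x * (norm w)\<^sup>2" by (intro tendsto_intros s_lim)
    ultimately have "Re (cinner w (H *\<^sub>V w)) \<le> x * (norm w)\<^sup>2" by (intro LIMSEQ_le_const) auto
    then show False using gt by simp
  qed
  then have "(\<lambda>n. (norm (F (s n) *\<^sub>V u - F x *\<^sub>V u))\<^sup>2) \<longlonglongrightarrow> 0"
    using tendsto_power[OF tendsto_norm[OF wl], of 2] by simp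
  then have al: "(\<lambda>n. a (s n) - a x) \<longlonglongrightarrow> 0" unfolding d[OF less_imp_le[OF s]] .
  show ?thesis
  proof (rule tendstoI)
    fix e :: real assume e: "e > 0"
    then have "\<forall>\<^sub>F n in sequentially. a (s n) - a x < e\<^sup>2"
      using al by (intro order_tendstoD(2)) auto
    then obtain n where n: "a (s n) - a x < e\<^sup>2" unfolding eventually_sequentially by blast
    have "dist (F y *\<^sub>V u) (F x *\<^sub>V u) < e" if "x < y" "y < s n" for y
    proof -
      have "(norm (F y *\<^sub>V u - F x *\<^sub>V u))\<^sup>2 < e\<^sup>2"
        using d[of x y] mono[of y "s n"] that n by simp
      then show ?thesis using e by (auto simp: dist_norm intro: power2_less_imp_less)
    qed
    then show "\<forall>\<^sub>F y in at_right x. dist (spec_fam H y *\<^sub>V u) (spec_fam H x *\<^sub>V u) < e"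
      unfolding eventually_at_right_field F_def using s by blast
  qed
qed

subsection \<open>Stieltjes integrals with respect to compactly supported distribution functions\<close>

text \<open>Distribution function of a finite measure on the interval from -K to K. An atom at -K is
  allowed, which is why the half-open intervals below start at -K - 1.\<close>

definition bcdf :: "real \<Rightarrow> (real \<Rightarrow> real) \<Rightarrow> bool" where
  "bcdf K \<nu> \<longleftrightarrow> 0 \<le> K \<and> mono \<nu> \<and> (\<forall>a. continuous (at_right a) \<nu>) \<and> (\<forall>x < - K. \<nu> x = 0) \<and> (\<forall>x\<ge>K. \<nu> x = \<nu> K)"

lemma bcdf_nonneg: "bcdf K \<nu> \<Longrightarrow> 0 \<le> K"
  unfolding bcdf_def by blast

lemma bcdf_measure:
  assumes "bcdf K \<nu>"
  shows "measure (interval_measure \<nu>) {..x} = \<nu> x" "finite_measure (interval_measure \<nu>)"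
    "measure (interval_measure \<nu>) UNIV = \<nu> K"
    "a \<le> b \<Longrightarrow> measure (interval_measure \<nu>) {a<..b} = \<nu> b - \<nu> a"
    "AE x in interval_measure \<nu>. - K \<le> x" "AE x in interval_measure \<nu>. x \<le> K"
    "0 \<le> \<nu> x"
proof -
  have \<nu>: "\<And>x y. x \<le> y \<Longrightarrow> \<nu> x \<le> \<nu> y" "\<And>a. continuous (at_right a) \<nu>"
    "\<And>x. x < - K \<Longrightarrow> \<nu> x = 0" "\<And>x. K \<le> x \<Longrightarrow> \<nu> x = \<nu> K"
    using assms unfolding bcdf_def mono_def by blast+
  let ?M = "interval_measure \<nu>"
  have bot: "(\<nu> \<longlongrightarrow> 0) at_bot"
    by (rule tendsto_eventually) (use \<nu>(3) in \<open>auto simp: eventually_at_bot_linorder intro!: exI[of _ "- K - 1"]\<close>)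
  have Iic: "emeasure ?M {..x} = \<nu> x" "measure ?M {..x} = \<nu> x" for x
    by (rule emeasure_interval_measure_Iic measure_interval_measure_Iic; fact \<nu> bot)+
  show "measure ?M {..x} = \<nu> x" by (rule Iic)
  show "0 \<le> \<nu> x" using Iic(2)[of x] by (metis measure_nonneg)
  have un: "(\<Union>n::nat. {..real n}) = UNIV" by (auto simp: real_arch_simple)
  have U: "emeasure ?M UNIV = ennreal (\<nu> K)"
  proof (rule LIMSEQ_unique)
    show "(\<lambda>n. emeasure ?M {..real n}) \<longlonglongrightarrow> emeasure ?M UNIV"
      unfolding un[symmetric] by (rule Lim_emeasure_incseq) (auto simp: incseq_def)
    have "\<forall>\<^sub>F n in sequentially. emeasure ?M {..real n} = ennreal (\<nu> K)"
      unfolding Iic by (rule eventually_sequentiallyI[of "nat \<lceil>K\<rceil>"]) (auto simp: nat_ceiling_le_eq intro!: arg_cong[where f = ennreal] \<nu>(4))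
    then show "(\<lambda>n. emeasure ?M {..real n}) \<longlonglongrightarrow> ennreal (\<nu> K)" by (rule tendsto_eventually)
  qed
  then show fin: "finite_measure ?M" by (intro finite_measureI) simp
  interpret finite_measure ?M by (rule fin)
  have "0 \<le> \<nu> K" using Iic(2)[of K] by (metis measure_nonneg)
  then show UU: "measure ?M UNIV = \<nu> K" using U by (simp add: measure_def)
  show "measure ?M {a<..b} = \<nu> b - \<nu> a" if "a \<le> b"
    by (rule measure_interval_measure_Ioc[OF that \<nu>(1,2)])
  have "measure ?M {K<..} = 0"
  proof -
    have "measure ?M (UNIV - {..K}) = measure ?M UNIV - measure ?M {..K}"
      by (rule finite_measure_Diff) auto
    moreover have "UNIV - {..K} = {K<..}" by auto
    ultimately show ?thesis by (simp add: UU Iic)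
  qed
  then show "AE x in ?M. x \<le> K"
    by (intro AE_I[of _ _ "{K<..}"]) (auto simp: emeasure_eq_measure)
  \<comment> \<open>The distribution function gives the measure of closed half-lines; the open one
    is exhausted by closed ones, all of them null sets.\<close>
  have "{..< - K} = (\<Union>n::nat. {.. - K - 1 / real (Suc n)})"
  proof (intro set_eqI iffI)
    fix x assume "x \<in> {..< - K}"
    then obtain n where "1 / real (Suc n) < - K - x" using nat_approx_posE[of "- K - x"] by auto
    then show "x \<in> (\<Union>n::nat. {.. - K - 1 / real (Suc n)})" by (auto intro!: exI[of _ n])
  next
    fix x assume "x \<in> (\<Union>n::nat. {.. - K - 1 / real (Suc n)})"
    then obtain n where "x \<le> - K - 1 / real (Suc n)" by blast
    then have "x < - K" using divide_pos_pos[of 1 "real (Suc n)"] by linarith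
    then show "x \<in> {..< - K}" by simp
  qed
  moreover have "(\<Union>n::nat. {.. - K - 1 / real (Suc n)}) \<in> null_sets ?M"
    using \<nu>(3) by (intro null_sets_UN) (auto simp: null_sets_def Iic)
  ultimately show "AE x in ?M. - K \<le> x"
    by (intro AE_I'[of "{..< - K}"]) auto
qed

lemma norm_lebesgue_integral_le:
  fixes f :: "'a \<Rightarrow> 'b::{banach, second_countable_topology}"
  assumes "integrable M f" "integrable M g" "\<And>x. norm (f x) \<le> g x"
  shows "norm (LINT x|M. f x) \<le> (LINT x|M. g x)"
  using assms by (intro order_trans[OF Bochner_Integration.integral_norm_bound integral_mono]) auto

text \<open>On n equal pieces the bounds add up to D (B - A) / n times the total increment of \<nu>,
  which tends to 0: an increment bounded by length times \<nu>-mass is too small to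
  accumulate.\<close>

lemma telescoping_lipschitz:
  fixes \<Delta> :: "real \<Rightarrow> complex"
  assumes "A \<le> B" "0 \<le> D"
    and \<Delta>: "\<And>a b. A \<le> a \<Longrightarrow> a \<le> b \<Longrightarrow> b \<le> B \<Longrightarrow> cmod (\<Delta> b - \<Delta> a) \<le> D * (b - a) * (\<nu> b - \<nu> a)"
  shows "\<Delta> B = \<Delta> A"
proof -
  have "cmod (\<Delta> B - \<Delta> A) \<le> D * (B - A) * (\<nu> B - \<nu> A) * (1 / real (Suc m))" for m
  proof -
    define n where "n = Suc m"
    define x where "x j = A + (B - A) / real n * real j" for j
    have x0: "x 0 = A" "x n = B" by (auto simp: x_def n_def)
    have step: "x (Suc j) - x j = (B - A) / real n" for j
      by (simp add: x_def distrib_left)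
    have ge: "A \<le> x j" for j using assms(1) by (simp add: x_def)
    have le: "x j \<le> B" if "j \<le> n" for j
    proof -
      have "x j \<le> x n" unfolding x_def using that assms(1) by (intro add_left_mono mult_left_mono) auto
      then show ?thesis by (simp add: x0)
    qed
    have mono: "x j \<le> x (Suc j)" for j
      unfolding x_def using assms(1) by (intro add_left_mono mult_left_mono) auto
    have "cmod (\<Delta> (x n) - \<Delta> (x 0)) = cmod (\<Sum>j<n. \<Delta> (x (Suc j)) - \<Delta> (x j))"
      using sum_lessThan_telescope[of "\<lambda>j. \<Delta> (x j)" n] by (simp only:)
    also have "\<dots> \<le> (\<Sum>j<n. cmod (\<Delta> (x (Suc j)) - \<Delta> (x j)))" by (rule norm_sum)
    also have "\<dots> \<le> (\<Sum>j<n. D * ((B - A) / real n) * (\<nu> (x (Suc j)) - \<nu> (x j)))"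
    proof (rule sum_mono)
      fix j assume "j \<in> {..<n}"
      then show "cmod (\<Delta> (x (Suc j)) - \<Delta> (x j)) \<le> D * ((B - A) / real n) * (\<nu> (x (Suc j)) - \<nu> (x j))"
        using \<Delta>[OF ge[of j] _ le[of "Suc j"]] step[of j] mono by auto
    qed
    also have "\<dots> = D * ((B - A) / real n) * (\<Sum>j<n. \<nu> (x (Suc j)) - \<nu> (x j))"
      by (simp add: sum_distrib_left)
    also have "(\<Sum>j<n. \<nu> (x (Suc j)) - \<nu> (x j)) = \<nu> (x n) - \<nu> (x 0)" by (rule sum_lessThan_telescope)
    finally show ?thesis unfolding x0 by (simp add: n_def)
  qed
  moreover have "(\<lambda>m. D * (B - A) * (\<nu> B - \<nu> A) * (1 / real (Suc m))) \<longlonglongrightarrow> 0"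
    using tendsto_mult[OF tendsto_const LIMSEQ_inverse_real_of_nat, of "D * (B - A) * (\<nu> B - \<nu> A)"]
    by (simp add: inverse_eq_divide)
  ultimately have "cmod (\<Delta> B - \<Delta> A) \<le> 0" by (intro LIMSEQ_le_const) auto
  then show ?thesis by simp
qed

context
  fixes K C :: real and \<nu> :: "real \<Rightarrow> real" and f :: "real \<Rightarrow> complex"
  assumes \<nu>: "bcdf K \<nu>" and f: "f \<in> borel_measurable borel"
    and lip: "\<And>x y. - K - 1 \<le> x \<Longrightarrow> x \<le> K \<Longrightarrow> - K - 1 \<le> y \<Longrightarrow> y \<le> K \<Longrightarrow> cmod (f y - f x) \<le> C * \<bar>y - x\<bar>"
begin

private lemma C: "0 \<le> C"
proof -
  have "0 \<le> C * \<bar>K - (-K - 1)\<bar>"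
    using lip[of "-K-1" K] bcdf_nonneg[OF \<nu>] by (intro order_trans[OF norm_ge_zero]) auto
  then show ?thesis using bcdf_nonneg[OF \<nu>] by (simp add: zero_le_mult_iff)
qed

private lemma f_bound:
  assumes "- K - 1 \<le> x" "x \<le> K" shows "cmod (f x) \<le> cmod (f K) + C * (2 * K + 1)"
proof -
  note K0 = bcdf_nonneg[OF \<nu>]
  have "cmod (f x) \<le> cmod (f K) + cmod (f x - f K)" by (metis add.commute norm_triangle_sub)
  also have "\<dots> \<le> cmod (f K) + C * \<bar>x - K\<bar>" using lip[of K x] assms K0 by simp
  also have "\<dots> \<le> cmod (f K) + C * (2 * K + 1)" using assms C by (intro add_left_mono mult_left_mono) auto
  finally show ?thesis .
qed

lemma bcdf_integrable: "integrable (interval_measure \<nu>) f"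
proof -
  interpret finite_measure "interval_measure \<nu>" by (rule bcdf_measure(2)[OF \<nu>])
  show ?thesis
  proof (rule integrable_const_bound[where B = "cmod (f K) + C * (2 * K + 1)"])
    show "AE x in interval_measure \<nu>. cmod (f x) \<le> cmod (f K) + C * (2 * K + 1)"
      using bcdf_measure(5,6)[OF \<nu>] by eventually_elim (auto intro: f_bound)
  qed (use f in simp)
qed

lemma bcdf_integral_step:
  assumes "- K - 1 \<le> a" "a \<le> b" "b \<le> K"
  shows "cmod ((LINT x:{a<..b}|interval_measure \<nu>. f x) - f a * of_real (\<nu> b - \<nu> a)) \<le> C * (b - a) * (\<nu> b - \<nu> a)"
proof -
  let ?M = "interval_measure \<nu>"
  interpret finite_measure ?M by (rule bcdf_measure(2)[OF \<nu>])
  have m: "measure ?M {a<..b} = \<nu> b - \<nu> a" by (rule bcdf_measure(4)[OF \<nu> assms(2)])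
  have "(LINT x:{a<..b}|?M. f x) - f a * of_real (\<nu> b - \<nu> a) = (LINT x:{a<..b}|?M. f x - f a)"
  proof -
    have "(LINT x:{a<..b}|?M. f x - f a) = (LINT x:{a<..b}|?M. f x) - (LINT x:{a<..b}|?M. f a)"
      by (intro set_integral_diff) (auto simp: set_integrable_def intro!: integrable_mult_indicator bcdf_integrable)
    also have "(LINT x:{a<..b}|?M. f a) = f a * of_real (\<nu> b - \<nu> a)"
      by (simp add: set_integral_const m scaleR_conv_of_real mult.commute)
    finally show ?thesis by simp
  qed
  also have "cmod \<dots> \<le> (LINT x:{a<..b}|?M. C * (b - a))"
    unfolding set_lebesgue_integral_def
  proof (rule norm_lebesgue_integral_le)
    show "integrable ?M (\<lambda>x. indicat_real {a<..b} x *\<^sub>R (f x - f a))"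
      by (intro integrable_mult_indicator Bochner_Integration.integrable_diff bcdf_integrable) auto
    show "integrable ?M (\<lambda>x. indicat_real {a<..b} x *\<^sub>R (C * (b - a)))"
      by (intro integrable_mult_indicator) auto
    fix x
    have "C * \<bar>x - a\<bar> \<le> C * (b - a)" if "x \<in> {a<..b}"
    proof -
      have "0 \<le> C * \<bar>x - a\<bar>" using lip[of a x] that assms by (intro order_trans[OF norm_ge_zero]) auto
      then have "0 \<le> C" using that by (auto simp: zero_le_mult_iff)
      then show ?thesis using that by (intro mult_left_mono) auto
    qed
    then show "cmod (indicat_real {a<..b} x *\<^sub>R (f x - f a)) \<le> indicat_real {a<..b} x *\<^sub>R (C * (b - a))"
      using lip[of a x] assms by (auto simp: indicator_def intro: order_trans)
  qed
  also have "\<dots> = C * (b - a) * (\<nu> b - \<nu> a)" by (simp add: set_integral_const m)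
  finally show ?thesis .
qed

text \<open>A way to evaluate Stieltjes integrals without operator-valued integration: a function
  whose increments agree with f times the increments of \<nu>, up to an error of length times
  \<nu>-mass, can differ from the running integral only by a constant. It is applied to J b = <u,
  F(b) X u>, with X the operator itself or its resolvent.\<close>

lemma bcdf_integral_eqI:
  fixes J :: "real \<Rightarrow> complex"
  assumes J: "\<And>a b. - K - 1 \<le> a \<Longrightarrow> a \<le> b \<Longrightarrow> b \<le> K \<Longrightarrow>
      cmod (J b - J a - f a * of_real (\<nu> b - \<nu> a)) \<le> C * (b - a) * (\<nu> b - \<nu> a)"
  shows "(LINT x|interval_measure \<nu>. f x) = J K - J (- K - 1)"
proof -
  let ?M = "interval_measure \<nu>"
  interpret finite_measure ?M by (rule bcdf_measure(2)[OF \<nu>])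
  note K0 = bcdf_nonneg[OF \<nu>]
  define I where "I b = (LINT x:{-K-1<..b}|?M. f x)" for b
  have si: "set_integrable ?M A f" if "A \<in> sets borel" for A
    unfolding set_integrable_def using that by (intro integrable_mult_indicator bcdf_integrable) auto
  have I: "I b - I a = (LINT x:{a<..b}|?M. f x)" if "- K - 1 \<le> a" "a \<le> b" for a b
  proof -
    have "{-K-1<..b} = {-K-1<..a} \<union> {a<..b}" using that by auto
    then have "I b = I a + (LINT x:{a<..b}|?M. f x)"
      unfolding I_def by (simp only:) (rule set_integral_Un, auto intro: si)
    then show ?thesis by simp
  qed
  have 1: "J K - I K = J (- K - 1) - I (- K - 1)"
  proof (rule telescoping_lipschitz[where A = "- K - 1" and B = K and D = "2 * C" and \<nu> = \<nu> and \<Delta> = "\<lambda>b. J b - I b"])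
    fix a b assume ab: "- K - 1 \<le> a" "a \<le> b" "b \<le> K"
    have "J b - I b - (J a - I a) = (J b - J a - f a * of_real (\<nu> b - \<nu> a))
        - ((LINT x:{a<..b}|?M. f x) - f a * of_real (\<nu> b - \<nu> a))"
      using I[OF ab(1,2)] by (simp add: algebra_simps)
    also have "cmod \<dots> \<le> C * (b - a) * (\<nu> b - \<nu> a) + C * (b - a) * (\<nu> b - \<nu> a)"
      by (intro order_trans[OF norm_triangle_ineq4] add_mono J bcdf_integral_step ab)
    finally show "cmod (J b - I b - (J a - I a)) \<le> 2 * C * (b - a) * (\<nu> b - \<nu> a)" by simp
  qed (use K0 C in auto)
  have 2: "I (- K - 1) = 0" by (simp add: I_def set_lebesgue_integral_def)
  have 3: "I K = (LINT x|?M. f x)"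
    unfolding I_def set_lebesgue_integral_def
  proof (rule integral_cong_AE)
    show "AE x in ?M. indicat_real {- K - 1<..K} x *\<^sub>R f x = f x"
      using bcdf_measure(5,6)[OF \<nu>] by eventually_elim (auto simp: indicator_def)
  qed (use f in auto)
  show ?thesis using 1 unfolding 2 3 by (simp add: algebra_simps)
qed

end

subsection \<open>The spectral theorem\<close>

lemma bcdf_family:
  fixes F :: "real \<Rightarrow> 'i bop"
  assumes "0 \<le> K" and adj: "\<And>x. adj (F x) = F x"
    and mono: "\<And>x y. x \<le> y \<Longrightarrow> F x * F y = F x \<and> F y * F x = F x"
    and right: "\<And>x. ((\<lambda>y. F y *\<^sub>V u) \<longlongrightarrow> F x *\<^sub>V u) (at_right x)"
    and K: "\<And>x. x < - K \<Longrightarrow> F x = 0" "\<And>x. K \<le> x \<Longrightarrow> F x = 1"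
  shows "bcdf K (\<lambda>y. Re (cinner u (F y *\<^sub>V u)))"
  unfolding bcdf_def
proof (intro conjI allI impI)
  show "mono (\<lambda>y. Re (cinner u (F y *\<^sub>V u)))"
  proof (rule monoI)
    fix x y :: real assume "x \<le> y"
    then have "(norm (F y *\<^sub>V u - F x *\<^sub>V u))\<^sup>2 = Re (cinner u (F y *\<^sub>V u)) - Re (cinner u (F x *\<^sub>V u))"
      by (intro proj_family(2)) (use adj mono in auto)
    then show "Re (cinner u (F x *\<^sub>V u)) \<le> Re (cinner u (F y *\<^sub>V u))"
      by (metis diff_ge_0_iff_ge zero_le_power2)
  qed
  show "continuous (at_right a) (\<lambda>y. Re (cinner u (F y *\<^sub>V u)))" for a
    unfolding continuous_within by (intro tendsto_Re tendsto_cinner right tendsto_const)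
qed (simp_all add: assms(1) K)

lemma lip_of_real: "cmod (complex_of_real y - complex_of_real x) \<le> 1 * \<bar>y - x\<bar>"
  by (metis mult_1 norm_of_real of_real_diff order_refl)

lemma spec_fam_interval_bounds:
  assumes H: "adj H = H" and "a \<le> b" and w: "spec_fam H b *\<^sub>V w = w" "spec_fam H a *\<^sub>V w = 0"
  shows "a * (norm w)\<^sup>2 \<le> Re (cinner w (H *\<^sub>V w))" "Re (cinner w (H *\<^sub>V w)) \<le> b * (norm w)\<^sup>2"
proof -
  show "Re (cinner w (H *\<^sub>V w)) \<le> b * (norm w)\<^sup>2" by (rule spec_fam(4)[OF H w(1)])
  show "a * (norm w)\<^sup>2 \<le> Re (cinner w (H *\<^sub>V w))"
    using spec_fam(5)[OF H w(2)] by (cases "w = 0") auto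
qed

lemma spectral_family_spec_fam:
  assumes H: "adj H = H"
  shows "spectral_family H (spec_fam H)"
  unfolding spectral_family_def
proof (intro conjI allI impI)
  fix u
  define F where "F = spec_fam H"
  define K where "K = norm H"
  define \<nu> where "\<nu> y = Re (cinner u (F y *\<^sub>V u))" for y :: real
  have sb: "x < - K \<Longrightarrow> F x = 0" "K \<le> x \<Longrightarrow> F x = 1" for x
    using spec_fam_bounds[OF H, of K] by (auto simp: K_def F_def)
  have bc: "bcdf K \<nu>" unfolding \<nu>_def
    by (rule bcdf_family; use spec_fam(1)[OF H] spec_fam_mono[OF H] spec_fam_right_continuous[OF H] sb
        in \<open>auto simp: F_def K_def\<close>)
  \<comment> \<open>The increment of J from a to b is the form of H at w = F(b) u - F(a) u, hence
    between a and b times the squared norm of w, and this squared norm is the increment of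
    \<nu>.\<close>
  define J where "J b = cinner u (F b *\<^sub>V H *\<^sub>V u)" for b :: real
  have "(LINT x|interval_measure \<nu>. complex_of_real x) = J K - J (- K - 1)"
  proof (rule bcdf_integral_eqI[OF bc _ lip_of_real])
    fix a b :: real assume ab: "a \<le> b"
    define w where "w = F b *\<^sub>V u - F a *\<^sub>V u"
    have w: "F b *\<^sub>V w = w" "F a *\<^sub>V w = 0" "(norm w)\<^sup>2 = \<nu> b - \<nu> a"
      using spec_fam_proj(2,3,4)[OF H, of a b u] ab by (simp_all add: w_def F_def \<nu>_def)
    have "J b - J a = cinner w (H *\<^sub>V u)"
      by (simp add: J_def w_def cinner_simps F_def sa_cinner[OF spec_fam(1)[OF H]])
    also have "\<dots> = cinner (F b *\<^sub>V w) (H *\<^sub>V u) - cinner (F a *\<^sub>V w) (H *\<^sub>V u)" by (simp add: w)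
    also have "\<dots> = cinner w (H *\<^sub>V w)"
      unfolding F_def sa_cinner[OF spec_fam(1)[OF H]]
      by (simp add: commute_apply[OF spec_fam_commute(1)[OF H]] cinner_simps bop_lin w_def F_def)
    finally have eq: "J b - J a = of_real (Re (cinner w (H *\<^sub>V w)))" using sa_cinner_real[OF H] by metis
    have "a * (norm w)\<^sup>2 \<le> Re (cinner w (H *\<^sub>V w))" "Re (cinner w (H *\<^sub>V w)) \<le> b * (norm w)\<^sup>2"
      using spec_fam_interval_bounds[OF H ab, of w] w(1,2) by (auto simp: F_def)
    then have "\<bar>Re (cinner w (H *\<^sub>V w)) - a * (norm w)\<^sup>2\<bar> \<le> 1 * (b - a) * (norm w)\<^sup>2"
      by (simp add: left_diff_distrib)
    moreover have "J b - J a - of_real a * of_real (\<nu> b - \<nu> a)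
        = of_real (Re (cinner w (H *\<^sub>V w)) - a * (norm w)\<^sup>2)"
      unfolding eq w(3)[symmetric] by simp
    ultimately show "cmod (J b - J a - of_real a * of_real (\<nu> b - \<nu> a)) \<le> 1 * (b - a) * (\<nu> b - \<nu> a)"
      unfolding w(3)[symmetric] by (metis norm_of_real)
  qed simp
  also have "J K - J (- K - 1) = cinner u (H *\<^sub>V u)"
    using sb[of K] sb[of "- K - 1"] by (simp add: J_def)
  finally show "cinner u (H *\<^sub>V u)
      = of_real (LINT x|interval_measure (\<lambda>y. Re (cinner u (spec_fam H y *\<^sub>V u))). x)"
    by (simp add: \<nu>_def[abs_def] F_def)
next
  show "\<exists>K. (\<forall>x < - K. spec_fam H x = 0) \<and> (\<forall>x\<ge>K. spec_fam H x = 1)"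
    using spec_fam_bounds[OF H order_refl] by blast
qed (simp_all only: self_adjoint_iff spec_fam(1,2)[OF H] spec_fam_mono[OF H] spec_fam_right_continuous[OF H])

text \<open>The sum of the two running integrals passes the test of \<open>bcdf_integral_eqI\<close>
  for the summed distribution function. Used in the uniqueness proof, where the spectral measures of
  orthogonal vectors add up.\<close>

lemma bcdf_integral_add:
  assumes \<nu>: "bcdf K \<nu>1" "bcdf K \<nu>2" "bcdf K (\<lambda>y. \<nu>1 y + \<nu>2 y)"
  shows "(LINT x|interval_measure (\<lambda>y. \<nu>1 y + \<nu>2 y). x)
    = (LINT x|interval_measure \<nu>1. x) + (LINT x|interval_measure \<nu>2. x)"
proof -
  let ?f = "complex_of_real"
  define I where "I \<nu> b = (LINT x:{-K-1<..b}|interval_measure \<nu>. ?f x)" for \<nu> b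
  have si: "set_integrable (interval_measure \<nu>) A ?f" if "bcdf K \<nu>" "A \<in> sets borel" for \<nu> A
    unfolding set_integrable_def using that
    by (intro integrable_mult_indicator bcdf_integrable[OF _ _ lip_of_real]) auto
  have step: "cmod (I \<nu> b - I \<nu> a - ?f a * of_real (\<nu> b - \<nu> a)) \<le> 1 * (b - a) * (\<nu> b - \<nu> a)"
    if \<nu>: "bcdf K \<nu>" and ab: "- K - 1 \<le> a" "a \<le> b" "b \<le> K" for \<nu> a b
  proof -
    have "{-K-1<..b} = {-K-1<..a} \<union> {a<..b}" using that by auto
    then have "I \<nu> b = I \<nu> a + (LINT x:{a<..b}|interval_measure \<nu>. ?f x)"
      unfolding I_def by (simp only:) (rule set_integral_Un, auto intro: si \<nu>)
    then show ?thesis using bcdf_integral_step[OF \<nu> _ lip_of_real ab] by simp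
  qed
  have eq: "(LINT x|interval_measure \<nu>. ?f x) = I \<nu> K - I \<nu> (- K - 1)" if "bcdf K \<nu>" for \<nu>
    by (rule bcdf_integral_eqI[OF that _ lip_of_real step[OF that]]) auto
  define J where "J b = I \<nu>1 b + I \<nu>2 b" for b
  have "(LINT x|interval_measure (\<lambda>y. \<nu>1 y + \<nu>2 y). ?f x) = J K - J (- K - 1)"
  proof (rule bcdf_integral_eqI[OF \<nu>(3) _ lip_of_real])
    fix a b assume ab: "- K - 1 \<le> a" "a \<le> b" "b \<le> K"
    have "J b - J a - ?f a * of_real (\<nu>1 b + \<nu>2 b - (\<nu>1 a + \<nu>2 a))
        = (I \<nu>1 b - I \<nu>1 a - ?f a * of_real (\<nu>1 b - \<nu>1 a)) + (I \<nu>2 b - I \<nu>2 a - ?f a * of_real (\<nu>2 b - \<nu>2 a))"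
      by (simp add: J_def algebra_simps)
    also have "cmod \<dots> \<le> 1 * (b - a) * (\<nu>1 b - \<nu>1 a) + 1 * (b - a) * (\<nu>2 b - \<nu>2 a)"
      by (intro order_trans[OF norm_triangle_ineq] add_mono step \<nu> ab)
    finally show "cmod (J b - J a - ?f a * of_real (\<nu>1 b + \<nu>2 b - (\<nu>1 a + \<nu>2 a)))
        \<le> 1 * (b - a) * (\<nu>1 b + \<nu>2 b - (\<nu>1 a + \<nu>2 a))" by (simp add: algebra_simps)
  qed simp
  also have "\<dots> = (LINT x|interval_measure \<nu>1. ?f x) + (LINT x|interval_measure \<nu>2. ?f x)"
    unfolding eq[OF \<nu>(1)] eq[OF \<nu>(2)] J_def by simp
  finally show ?thesis unfolding integral_complex_of_real of_real_add[symmetric] of_real_eq_iff .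
qed

text \<open>A nonzero vector in the range of one of the two commuting projections and in the kernel
  of the other would violate one of the form bounds, so each projection absorbs the other.\<close>

lemma spec_fam_eqI:
  assumes H: "adj H = H" and p: "p * p = p" "p * H = H * p"
    and upper: "\<And>u. p *\<^sub>V u = u \<Longrightarrow> Re (cinner u (H *\<^sub>V u)) \<le> x * (norm u)\<^sup>2"
    and lower: "\<And>u. p *\<^sub>V u = 0 \<Longrightarrow> u \<noteq> 0 \<Longrightarrow> x * (norm u)\<^sup>2 < Re (cinner u (H *\<^sub>V u))"
  shows "p = spec_fam H x"
proof -
  have pp: "p *\<^sub>V p *\<^sub>V u = p *\<^sub>V u" for u using p(1) by (rule times_apply)
  define q where "q = spec_fam H x"
  have comm: "p * q = q * p" unfolding q_def by (rule spec_fam(3)[OF H]) (rule p(2))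
  have qq: "q *\<^sub>V q *\<^sub>V u = q *\<^sub>V u" for u using spec_fam(2)[OF H] by (auto simp: q_def intro: times_apply)
  have "p *\<^sub>V u = p *\<^sub>V q *\<^sub>V u" for u
  proof (rule ccontr)
    define w where "w = p *\<^sub>V u - p *\<^sub>V q *\<^sub>V u"
    assume "p *\<^sub>V u \<noteq> p *\<^sub>V q *\<^sub>V u"
    then have "w \<noteq> 0" by (simp add: w_def)
    moreover have "p *\<^sub>V w = w" by (simp add: w_def bop_lin pp)
    moreover have "q *\<^sub>V w = 0" by (simp add: w_def bop_lin commute_apply[OF comm[symmetric]] qq)
    ultimately show False using upper[of w] spec_fam(5)[OF H, of x w] by (simp add: q_def)
  qed
  moreover have "q *\<^sub>V u = p *\<^sub>V q *\<^sub>V u" for u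
  proof (rule ccontr)
    define w where "w = q *\<^sub>V u - p *\<^sub>V q *\<^sub>V u"
    assume "q *\<^sub>V u \<noteq> p *\<^sub>V q *\<^sub>V u"
    then have "w \<noteq> 0" by (simp add: w_def)
    moreover have "p *\<^sub>V w = 0" by (simp add: w_def bop_lin pp)
    moreover have "q *\<^sub>V w = w" by (simp add: w_def bop_lin commute_apply[OF comm[symmetric]] qq)
    ultimately show False using lower[of w] spec_fam(4)[OF H, of x w] by (simp add: q_def)
  qed
  ultimately show ?thesis unfolding q_def by (intro bop_eqI) metis
qed

text \<open>The defining conditions give H only through a quadratic form and do not mention
  commutation of F x with H; it has to be recovered before \<open>spec_fam_eqI\<close>
  applies.\<close>

lemma spectral_family_unique:
  assumes H: "adj H = H" and sf: "spectral_family H F"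
  shows "F = spec_fam H"
proof
  fix x
  have adjF: "adj (F y) = F y" and idem: "F y * F y = F y" for y
    using sf by (auto simp: spectral_family_def self_adjoint_iff)
  have mono: "F y * F z = F y \<and> F z * F y = F y" if "y \<le> z" for y z
    using sf that unfolding spectral_family_def by blast
  have right: "((\<lambda>y. F y *\<^sub>V u) \<longlongrightarrow> F x *\<^sub>V u) (at_right x)" for x u
    using sf unfolding spectral_family_def by blast
  obtain K0 where K0: "\<And>x. x < - K0 \<Longrightarrow> F x = 0" "\<And>x. K0 \<le> x \<Longrightarrow> F x = 1"
    using sf unfolding spectral_family_def by blast
  define K where "K = max K0 0"
  define \<nu> where "\<nu> u y = Re (cinner u (F y *\<^sub>V u))" for u y
  define S where "S u = (LINT x|interval_measure (\<nu> u). x)" for u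
  have S: "cinner u (H *\<^sub>V u) = of_real (S u)" for u
    using sf unfolding spectral_family_def S_def \<nu>_def by blast
  have KF: "y < - K \<Longrightarrow> F y = 0" "K \<le> y \<Longrightarrow> F y = 1" for y using K0 by (auto simp: K_def)
  have bc: "bcdf K (\<nu> u)" for u
    unfolding \<nu>_def by (rule bcdf_family[OF _ adjF mono right KF]) (auto simp: K_def)
  have FF: "F x *\<^sub>V F y *\<^sub>V v = F x *\<^sub>V v" "F y *\<^sub>V F x *\<^sub>V v = F x *\<^sub>V v" if "x \<le> y" for x y v
    using mono[OF that] by (auto intro: times_apply)
  define p where "p = F x"
  have UV: "measure (interval_measure (\<nu> u)) UNIV = (norm u)\<^sup>2" for u
    using bcdf_measure(3)[OF bc, of u] KF(2)[of K] by (simp add: \<nu>_def)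
  have int: "integrable (interval_measure (\<nu> u)) (\<lambda>y. y)" for u
    using integrable_Re[OF bcdf_integrable[OF bc[of u] _ lip_of_real]] by simp
  have upper: "Re (cinner u (H *\<^sub>V u)) \<le> x * (norm u)\<^sup>2" if "p *\<^sub>V u = u" for u
  proof -
    let ?M = "interval_measure (\<nu> u)"
    interpret finite_measure ?M by (rule bcdf_measure(2)[OF bc])
    have "F y *\<^sub>V u = u" if "x \<le> y" for y
      using FF(2)[OF that, of u] \<open>p *\<^sub>V u = u\<close> by (simp add: p_def)
    then have \<nu>y: "\<nu> u y = (norm u)\<^sup>2" if "x \<le> y" for y using that by (simp add: \<nu>_def)
    have "measure ?M (UNIV - {..x}) = measure ?M UNIV - measure ?M {..x}" by (rule finite_measure_Diff) auto
    then have "measure ?M (UNIV - {..x}) = 0" by (simp add: UV bcdf_measure(1)[OF bc] \<nu>y)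
    then have ae: "AE y in ?M. y \<le> x"
      by (intro AE_I[of _ _ "UNIV - {..x}"]) (auto simp: emeasure_eq_measure)
    have "S u \<le> (LINT y|?M. x)"
      unfolding S_def by (rule integral_mono_AE[OF int _ ae]) simp
    then show ?thesis by (simp add: S UV mult.commute)
  qed
  \<comment> \<open>The spectral measure of w lives strictly to the right of x and has the squared
    norm of w as its mass, so the integral of y - x against it is strictly positive.\<close>
  have lower: "x * (norm w)\<^sup>2 < Re (cinner w (H *\<^sub>V w))" if pw: "p *\<^sub>V w = 0" and w: "w \<noteq> 0" for w
  proof -
    let ?M = "interval_measure (\<nu> w)"
    interpret finite_measure ?M by (rule bcdf_measure(2)[OF bc])
    have "measure ?M {..x} = 0"
      using pw by (simp add: bcdf_measure(1)[OF bc]) (simp add: \<nu>_def p_def)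
    then have ae: "AE y in ?M. x < y"
      by (intro AE_I[of _ _ "{..x}"]) (auto simp: emeasure_eq_measure)
    have i: "integrable ?M (\<lambda>y. y - x)" by (intro Bochner_Integration.integrable_diff int) simp
    have eq: "(LINT y|?M. y - x) = S w - x * (norm w)\<^sup>2"
      unfolding S_def by (subst Bochner_Integration.integral_diff[OF int]) (auto simp: UV mult.commute)
    have ge: "0 \<le> (LINT y|?M. y - x)"
      by (rule integral_nonneg_AE) (use ae in \<open>eventually_elim, auto\<close>)
    have "(LINT y|?M. y - x) \<noteq> 0"
    proof
      assume "(LINT y|?M. y - x) = 0"
      then have "AE y in ?M. y - x = 0"
        using integral_nonneg_eq_0_iff_AE[OF i] ae by (metis (mono_tags, lifting) AE_mp AE_I2 diff_ge_0_iff_ge less_imp_le)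
      with ae have "AE y in ?M. False" by eventually_elim auto
      then have "measure ?M UNIV = 0"
        using AE_iff_null[of ?M "\<lambda>_. False"] by (simp add: null_sets_def emeasure_eq_measure)
      then show False using w by (simp add: UV)
    qed
    then show ?thesis using ge by (simp add: eq S)
  qed
  \<comment> \<open>For v in the range and w in the kernel of F x the cross terms of F y vanish for
    all y, so the spectral measures of v and w add up and the form of H is additive on v + w. The
    same for i w in place of w removes both mixed terms and not only their sum.\<close>
  have orth: "cinner v (H *\<^sub>V w) = 0" "cinner w (H *\<^sub>V v) = 0" if v: "p *\<^sub>V v = v" and w: "p *\<^sub>V w = 0" for v w
  proof -
    have add: "S (v + w) = S v + S w" if w: "p *\<^sub>V w = 0" for w
    proof -
      have "cinner v (F y *\<^sub>V w) = 0" "cinner w (F y *\<^sub>V v) = 0" for y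
      proof -
        have "F y *\<^sub>V w = 0 \<or> F y *\<^sub>V v = v"
          using FF(1)[of y x w] FF(2)[of x y v] v w by (cases "y \<le> x") (auto simp: p_def)
        moreover have vw: "cinner v w = 0"
          using sa_cinner[OF adjF, of x v w] v w by (simp add: p_def)
        moreover have "cinner v (F y *\<^sub>V w) = cinner (F y *\<^sub>V v) w" using sa_cinner[OF adjF] by metis
        ultimately show "cinner v (F y *\<^sub>V w) = 0" by auto
        then show "cinner w (F y *\<^sub>V v) = 0"
          by (metis cinner_commute complex_cnj_zero sa_cinner[OF adjF])
      qed
      then have eq: "\<nu> (v + w) = (\<lambda>y. \<nu> v y + \<nu> w y)"
        by (auto simp: \<nu>_def fun_eq_iff bop_lin cinner_simps)
      show ?thesis unfolding S_def eq
        by (rule bcdf_integral_add) (use bc bc[of "v + w"] in \<open>simp_all add: eq\<close>)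
    qed
    have sum: "cinner v (H *\<^sub>V w) + cinner w (H *\<^sub>V v) = 0" if "p *\<^sub>V w = 0" for w
      using add[OF that] S[of v] S[of w] S[of "v + w"] by (simp add: bop_lin cinner_simps add.commute)
    note sum[OF w]
    moreover have "\<i> * cinner v (H *\<^sub>V w) - \<i> * cinner w (H *\<^sub>V v) = 0"
    proof -
      have "p *\<^sub>V (\<i> *\<^sub>C w) = 0" using w by (simp add: bop_lin)
      from sum[OF this] show ?thesis by (simp add: bop_lin cinner_simps)
    qed
    ultimately show "cinner v (H *\<^sub>V w) = 0" "cinner w (H *\<^sub>V v) = 0"
      by (auto simp: complex_eq_iff)
  qed
  have pp: "p *\<^sub>V p *\<^sub>V u = p *\<^sub>V u" for u using idem by (auto simp: p_def intro: times_apply)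
  have "p * H = H * p"
  proof (rule bop_eqI, rule cinner_eqI)
    fix u v
    have 1: "cinner (p *\<^sub>V v) (H *\<^sub>V (u - p *\<^sub>V u)) = 0" by (rule orth) (simp_all add: bop_lin pp)
    have 2: "cinner (v - p *\<^sub>V v) (H *\<^sub>V (p *\<^sub>V u)) = 0" by (rule orth) (simp_all add: bop_lin pp)
    have "cinner v (p *\<^sub>V H *\<^sub>V u) = cinner (p *\<^sub>V v) (H *\<^sub>V u)"
      using sa_cinner[OF adjF] by (metis p_def)
    also have "\<dots> = cinner (p *\<^sub>V v) (H *\<^sub>V p *\<^sub>V u)" using 1 by (simp add: bop_lin cinner_simps)
    also have "\<dots> = cinner v (H *\<^sub>V p *\<^sub>V u)" using 2 by (simp add: cinner_simps)
    finally show "cinner v ((p * H) *\<^sub>V u) = cinner v ((H * p) *\<^sub>V u)" by simp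
  qed
  from idem[of x, folded p_def] this upper lower show "F x = spec_fam H x"
    unfolding p_def by (rule spec_fam_eqI[OF H])
qed


lemma spectral_proj_eq:
  assumes "adj H = H"
  shows "spectral_proj H = spec_fam H"
  unfolding spectral_proj_def
  using spectral_family_spec_fam[OF assms] spectral_family_unique[OF assms] by (rule the_equality)

subsection \<open>Measurability of operator families\<close>

lemma countable_int_lattice: "countable (UNIV :: 'z::int_lattice set)"
proof -
  have "countable (dirs \<rightarrow>\<^sub>E (UNIV :: int set) :: ('z \<Rightarrow> int) set)"
    by (intro countable_PiE finite_dirs) auto
  then show ?thesis using coord_bij by (metis bij_betw_def countable_image_inj_eq)
qed

lemma countable_layers: "countable (UNIV :: (nat \<times> 'z::int_lattice) set)"
proof -
  have "countable ((UNIV :: nat set) \<times> (UNIV :: 'z set))"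
    by (intro countable_SIGMA countable_int_lattice) auto
  then show ?thesis by simp
qed

definition mel_measurable :: "'w measure \<Rightarrow> ('w \<Rightarrow> 'i bop) \<Rightarrow> bool" where
  "mel_measurable M X \<longleftrightarrow> (\<forall>i j. (\<lambda>\<omega>. mel i (X \<omega>) j) \<in> borel_measurable M)"

lemma mel_measurableD: "mel_measurable M X \<Longrightarrow> (\<lambda>\<omega>. mel i (X \<omega>) j) \<in> borel_measurable M"
  by (simp add: mel_measurable_def)

lemma mel_measurable_const: "mel_measurable M (\<lambda>_. A)"
  by (simp add: mel_measurable_def)

lemma mel_measurable_add: "mel_measurable M X \<Longrightarrow> mel_measurable M Y \<Longrightarrow> mel_measurable M (\<lambda>\<omega>. X \<omega> + Y \<omega>)"
  unfolding mel_measurable_def mel_simps by (intro allI borel_measurable_add) blast+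

lemma mel_measurable_diff: "mel_measurable M X \<Longrightarrow> mel_measurable M Y \<Longrightarrow> mel_measurable M (\<lambda>\<omega>. X \<omega> - Y \<omega>)"
  unfolding mel_measurable_def mel_simps by (intro allI borel_measurable_diff) blast+

lemma mel_measurable_scaleC: "mel_measurable M X \<Longrightarrow> mel_measurable M (\<lambda>\<omega>. c *\<^sub>C X \<omega>)"
  unfolding mel_measurable_def mel_simps by (intro allI borel_measurable_times borel_measurable_const) blast+

lemma mel_measurable_scaleR: "mel_measurable M X \<Longrightarrow> mel_measurable M (\<lambda>\<omega>. r *\<^sub>R X \<omega>)"
  unfolding mel_measurable_def mel_simps by (intro allI borel_measurable_times borel_measurable_const) blast+

lemma mel_measurable_adj: "mel_measurable M X \<Longrightarrow> mel_measurable M (\<lambda>\<omega>. adj (X \<omega>))"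
  unfolding mel_measurable_def mel_simps
  by (intro allI measurable_compose[OF _ borel_measurable_continuous_onI[of cnj]] continuous_intros) blast

lemma mel_measurable_sum:
  "(\<And>x. x \<in> I \<Longrightarrow> mel_measurable M (X x)) \<Longrightarrow> mel_measurable M (\<lambda>\<omega>. \<Sum>x\<in>I. X x \<omega>)"
  unfolding mel_measurable_def mel_sum by (intro allI borel_measurable_sum) blast

lemma mel_measurable_limit:
  assumes "\<And>n. mel_measurable M (X n)" "\<And>\<omega> i j. (\<lambda>n. mel i (X n \<omega>) j) \<longlonglongrightarrow> mel i (Y \<omega>) j"
  shows "mel_measurable M Y"
  unfolding mel_measurable_def
proof (intro allI)
  fix i j
  show "(\<lambda>\<omega>. mel i (Y \<omega>) j) \<in> borel_measurable M"
    by (rule borel_measurable_LIMSEQ_metric[where f = "\<lambda>n \<omega>. mel i (X n \<omega>) j"])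
       (use assms in \<open>auto simp: mel_measurable_def\<close>)
qed

lemma mel_measurable_norm_limit:
  assumes "\<And>n. mel_measurable M (X n)" "\<And>\<omega>. (\<lambda>n. X n \<omega>) \<longlonglongrightarrow> Y \<omega>"
  shows "mel_measurable M Y"
  by (rule mel_measurable_limit[where X = X, OF assms(1)])
     (intro bounded_linear.tendsto[OF bounded_linear_mel] assms)

lemma mel_measurable_times:
  fixes X Y :: "'w \<Rightarrow> 'i bop"
  assumes "countable (UNIV :: 'i set)" "mel_measurable M X" "mel_measurable M Y"
  shows "mel_measurable M (\<lambda>\<omega>. X \<omega> * Y \<omega>)"
  unfolding mel_measurable_def
proof (intro allI)
  fix i j
  \<comment> \<open>A sequence of finite sets exhausting the countable index set turns the limit
    along the net of finite sets into a sequential one, as measurability of limits requires.\<close>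
  define A :: "nat \<Rightarrow> 'i set" where "A n = from_nat_into UNIV ` {..n}" for n
  have "filterlim A (finite_subsets_at_top UNIV) sequentially"
    unfolding filterlim_finite_subsets_at_top
  proof (intro allI impI)
    fix F :: "'i set" assume "finite F \<and> F \<subseteq> UNIV"
    then have "finite F" by simp
    have "\<forall>k\<in>F. k \<in> A (to_nat_on UNIV k)"
      using assms(1) by (auto simp: A_def image_iff intro!: bexI[of _ "to_nat_on UNIV k" for k])
    moreover have "A n \<subseteq> A m" if "n \<le> m" for n m using that by (auto simp: A_def)
    moreover have "to_nat_on UNIV k \<le> Max (to_nat_on UNIV ` F)" if "k \<in> F" for k
      using that \<open>finite F\<close> by (intro Max_ge) auto
    ultimately show "\<forall>\<^sub>F n in sequentially. finite (A n) \<and> F \<subseteq> A n \<and> A n \<subseteq> UNIV"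
      by (intro eventually_sequentiallyI[of "Max (to_nat_on UNIV ` F)"])
         (auto simp: A_def, meson order_trans subsetD)
  qed
  then have "(\<lambda>n. \<Sum>k\<in>A n. mel i (X \<omega>) k * mel k (Y \<omega>) j) \<longlonglongrightarrow> mel i (X \<omega> * Y \<omega>) j" for \<omega>
    using mel_times_has_sum[of i "X \<omega>" "Y \<omega>" j] unfolding has_sum_def by (rule filterlim_compose[rotated])
  then show "(\<lambda>\<omega>. mel i (X \<omega> * Y \<omega>) j) \<in> borel_measurable M"
    by (rule borel_measurable_LIMSEQ_metric[rotated])
       (intro borel_measurable_sum borel_measurable_times mel_measurableD assms)
qed

lemma mel_measurable_power:
  fixes X :: "'w \<Rightarrow> 'i bop"
  assumes "countable (UNIV :: 'i set)" "mel_measurable M X"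
  shows "mel_measurable M (\<lambda>\<omega>. X \<omega> ^ n)"
  by (induction n) (auto intro: mel_measurable_const mel_measurable_times assms)

text \<open>\<open>spec_fam\<close> rescales by the norm of H at the given \<omega>. A single scale
  taken from the common bound K gives the same projections by \<open>spec_fam_eqI\<close>, and then
  every stage (root iteration, kernel projection) is a pointwise limit of polynomials in one
  measurable family.\<close>

lemma mel_measurable_spec_fam:
  fixes H :: "'w \<Rightarrow> 'i bop"
  assumes c: "countable (UNIV :: 'i set)" and m: "mel_measurable M H"
    and H: "\<And>\<omega>. adj (H \<omega>) = H \<omega>" "\<And>\<omega>. norm (H \<omega>) \<le> K"
  shows "mel_measurable M (\<lambda>\<omega>. spec_fam (H \<omega>) E)"
proof -
  define r where "r = 1 / (K + \<bar>E\<bar> + 1)"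
  have K: "K \<ge> 0" using H(2)[of undefined] norm_ge_zero order_trans by blast
  have r: "r > 0" unfolding r_def by (intro divide_pos_pos add_nonneg_pos add_nonneg_nonneg K) auto
  define A where "A \<omega> = r *\<^sub>R (H \<omega> - E *\<^sub>R 1)" for \<omega>
  have A: "adj (A \<omega>) = A \<omega>" "norm (A \<omega>) \<le> 1" for \<omega>
  proof -
    show "adj (A \<omega>) = A \<omega>" by (simp add: A_def H)
    have "norm (H \<omega> - E *\<^sub>R 1) \<le> K + \<bar>E\<bar> + 1"
      using norm_triangle_ineq4[of "H \<omega>" "E *\<^sub>R 1"] H(2)[of \<omega>] by simp
    then have "r * norm (H \<omega> - E *\<^sub>R 1) \<le> r * (K + \<bar>E\<bar> + 1)" using r by (intro mult_left_mono) auto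
    also have "\<dots> = 1" using r by (simp add: r_def)
    finally show "norm (A \<omega>) \<le> 1" using r by (simp add: A_def)
  qed
  have eq: "spec_fam (H \<omega>) E = neg_proj (A \<omega>)" for \<omega>
  proof (rule spec_fam_eqI[OF H(1), symmetric])
    note np = neg_proj[OF A]
    have Au: "Re (cinner u (A \<omega> *\<^sub>V u)) = r * (Re (cinner u (H \<omega> *\<^sub>V u)) - E * (norm u)\<^sup>2)" for u
      by (simp add: A_def cinner_simps)
    show "neg_proj (A \<omega>) * neg_proj (A \<omega>) = neg_proj (A \<omega>)" by (rule np)
    show "neg_proj (A \<omega>) * H \<omega> = H \<omega> * neg_proj (A \<omega>)"
      by (rule np(3)[symmetric]) (simp add: A_def left_diff_distrib right_diff_distrib)
    show "Re (cinner u (H \<omega> *\<^sub>V u)) \<le> E * (norm u)\<^sup>2" if "neg_proj (A \<omega>) *\<^sub>V u = u" for u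
      using np(4)[OF that] r by (simp add: Au mult_le_0_iff)
    show "E * (norm u)\<^sup>2 < Re (cinner u (H \<omega> *\<^sub>V u))" if "neg_proj (A \<omega>) *\<^sub>V u = 0" "u \<noteq> 0" for u
      using np(5)[OF that] r by (simp add: Au zero_less_mult_iff)
  qed
  have mA: "mel_measurable M A"
    unfolding A_def by (intro mel_measurable_scaleR mel_measurable_diff m mel_measurable_const)
  have "mel_measurable M (\<lambda>\<omega>. sqrt_iter (1 - A \<omega> * A \<omega>) n)" for n
    by (induction n) (auto intro!: mel_measurable_const mel_measurable_scaleR mel_measurable_add
        mel_measurable_times[OF c] mel_measurable_diff mA)
  then have "mel_measurable M (\<lambda>\<omega>. 1 - abs_op (A \<omega>))"
    by (rule mel_measurable_norm_limit) (rule abs_op(1)[OF A])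
  then have "mel_measurable M (\<lambda>\<omega>. 1 - (1 - abs_op (A \<omega>)))"
    by (rule mel_measurable_diff[OF mel_measurable_const])
  then have mp: "mel_measurable M (\<lambda>\<omega>. pos_part (A \<omega>))"
    unfolding pos_part_def by (intro mel_measurable_scaleR mel_measurable_add mA) simp
  have "mel_measurable M (\<lambda>\<omega>. ker_proj (pos_part (A \<omega>)))"
  proof (rule mel_measurable_limit)
    show "mel_measurable M (\<lambda>\<omega>. (1 - pos_part (A \<omega>) * pos_part (A \<omega>)) ^ n)" for n
      by (intro mel_measurable_power c mel_measurable_diff mel_measurable_const mel_measurable_times mp)
    show "(\<lambda>n. mel i ((1 - pos_part (A \<omega>) * pos_part (A \<omega>)) ^ n) j) \<longlonglongrightarrow> mel i (ker_proj (pos_part (A \<omega>))) j"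
      for \<omega> i j
      unfolding mel_def by (intro tendsto_cinner tendsto_const ker_proj(1) pos_part A)
  qed
  then show ?thesis by (simp add: eq neg_proj_def)
qed

subsection \<open>Layers\<close>

lemma layer_embed_ket: "layer_embed k (ket a) = ket (k, a)"
  by (rule ell2_eqI) (auto simp: layer_embed.rep_eq ket.rep_eq)

lemma layer_layer_embed: "layer k (layer_embed l u) = (if k = l then u else 0)"
  by (rule ell2_eqI) (auto simp: layer_embed.rep_eq layer.rep_eq ell2_rep)

lemma layer_ket: "layer k (ket (l, a)) = (if k = l then ket a else 0)"
  by (rule ell2_eqI) (auto simp: layer.rep_eq ell2_rep)

lemma layer_zero [simp]: "layer k 0 = 0" "layer_embed k 0 = 0"
  by (rule ell2_eqI; simp add: layer.rep_eq layer_embed.rep_eq ell2_rep)+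

lemma mel_block: "mel i (block k l A) j = (if fst i = k \<and> fst j = l then mel (snd i) A (snd j) else 0)"
  by (cases j) (simp add: mel_apply block_apply layer_ket layer_embed.rep_eq ell2_rep)

lemma adj_block: "adj (block k l A) = block l k (adj A)"
  by (rule bop_mel_eqI) (auto simp: mel_block)

lemma block_zero [simp]: "block k l 0 = 0"
  by (rule bop_mel_eqI) (simp add: mel_block)

lemma norm_block_le: "norm (block k l A) \<le> norm A"
proof (rule norm_bop_leI)
  fix u
  have "norm (block k l A *\<^sub>V u) \<le> norm A * norm (layer l u)"
    unfolding block_apply by (rule order_trans[OF norm_layer_embed norm_bop_apply])
  also have "\<dots> \<le> norm A * norm u" by (intro mult_left_mono norm_layer norm_ge_zero)
  finally show "norm (block k l A *\<^sub>V u) \<le> norm A * norm u" .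
qed simp

definition corner :: "'k \<Rightarrow> 'k \<Rightarrow> ('k \<times> 'i) bop \<Rightarrow> 'i bop" where
  "corner k l X = bop_of (\<lambda>u. layer k (X *\<^sub>V layer_embed l u))"

lemma corner_apply: "corner k l X *\<^sub>V u = layer k (X *\<^sub>V layer_embed l u)"
  unfolding corner_def
proof (rule bop_of_apply[where K = "norm X"])
  show "norm (layer k (X *\<^sub>V layer_embed l u)) \<le> norm X * norm u" for u
  proof -
    have "norm (layer k (X *\<^sub>V layer_embed l u)) \<le> norm X * norm (layer_embed l u)"
      using norm_layer norm_bop_apply by (rule order_trans)
    also have "\<dots> \<le> norm X * norm u" by (intro mult_left_mono norm_layer_embed norm_ge_zero)
    finally show ?thesis .
  qed
qed (simp_all add: layer_linear bop_lin)

lemma mel_corner: "mel a (corner k l X) b = mel (k, a) X (l, b)"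
  by (simp add: mel_apply corner_apply layer_embed_ket layer.rep_eq)

lemma norm_corner_le: "norm (corner k l X) \<le> norm X"
proof (rule norm_bop_leI)
  fix u
  have "norm (corner k l X *\<^sub>V u) \<le> norm X * norm (layer_embed l u)"
    unfolding corner_apply by (rule order_trans[OF norm_layer norm_bop_apply])
  also have "\<dots> \<le> norm X * norm u" by (intro mult_left_mono norm_layer_embed norm_ge_zero)
  finally show "norm (corner k l X *\<^sub>V u) \<le> norm X * norm u" .
qed simp

lemma corner_simps [simp]:
  "corner k l (X + Y) = corner k l X + corner k l Y" "corner k l (X - Y) = corner k l X - corner k l Y"
  "corner k l (c *\<^sub>C X) = c *\<^sub>C corner k l X" "corner k l (r *\<^sub>R X) = r *\<^sub>R corner k l X"
  "corner k l (- X) = - corner k l X" "corner k l 0 = 0" "corner k l 1 = (if k = l then 1 else 0)"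
  by (rule bop_mel_eqI; simp add: mel_corner)+

lemma corner_adj: "adj (corner k l X) = corner l k (adj X)"
  by (rule bop_mel_eqI) (simp add: mel_corner)

definition lay :: "'k set \<Rightarrow> ('k \<times> 'i) bop" where
  "lay S = bop_of (restrict_ell2 (S \<times> UNIV))"

lemma lay_apply: "lay S *\<^sub>V u = restrict_ell2 (S \<times> UNIV) u"
  unfolding lay_def
  by (rule bop_of_apply[where K = 1]) (simp_all add: restrict_ell2_linear norm_restrict_le)

lemma mel_lay_times: "mel i (lay S * X) j = (if fst i \<in> S then mel i X j else 0)"
  by (cases i) (simp add: mel_apply lay_apply restrict_ell2.rep_eq)

lemma mel_times_lay: "mel i (X * lay S) j = (if fst j \<in> S then mel i X j else 0)"
proof -
  have "lay S *\<^sub>V ket j = (if fst j \<in> S then ket j else 0)"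
    by (cases j) (auto intro!: ell2_eqI simp: lay_apply restrict_ell2.rep_eq ell2_rep)
  then show ?thesis by (simp add: mel_apply ell2_rep)
qed

lemma mel_lay: "mel i (lay S) j = (if i = j \<and> fst i \<in> S then 1 else 0)"
  using mel_lay_times[of i S 1 j] by simp

lemma lay_times: "lay S * lay T = lay (S \<inter> T)"
  by (rule bop_mel_eqI) (auto simp: mel_lay_times mel_lay)

lemma adj_lay [simp]: "adj (lay S) = lay S"
  by (rule bop_mel_eqI) (auto simp: mel_lay)

lemma norm_lay_le: "norm (lay S) \<le> 1"
  by (rule norm_bop_leI) (simp_all add: lay_apply norm_restrict_le)

lemma lay_Compl: "lay (- S) = 1 - lay S"
  by (rule bop_mel_eqI) (auto simp: mel_lay)

lemma cinner_lay: "cinner u (lay S *\<^sub>V u) = of_real ((norm (lay S *\<^sub>V u))\<^sup>2)"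
  using cinner_adj[of "lay S" u "lay S *\<^sub>V u"] times_apply[OF lay_times[of S S], of u]
  by (simp add: cinner_self)

lemma norm_lay_apply_le: "norm (lay S *\<^sub>V u) \<le> norm u"
  by (simp add: lay_apply norm_restrict_le)

lemma lay_block: "lay S * block k l A = (if k \<in> S then block k l A else 0)"
  "block k l A * lay S = (if l \<in> S then block k l A else 0)"
  by (rule bop_mel_eqI; auto simp: mel_lay_times mel_times_lay mel_block)+

lemma lay_singleton: "lay {n} = block n n 1"
  by (rule bop_mel_eqI) (auto simp: mel_lay mel_block prod_eq_iff)

subsection \<open>Covariant families and the trace\<close>

text \<open>Covariance is expressed by matrix elements: translations act on the lattice site and
  leave the layer index alone. Continuity in \<omega> is replaced by measurability with a uniform
  bound, which suffices for the trace and passes to limits.\<close>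

definition fam ::
    "'w measure \<Rightarrow> ('z \<Rightarrow> 'w \<Rightarrow> 'w) \<Rightarrow> ('w \<Rightarrow> (nat \<times> 'z::int_lattice) bop) \<Rightarrow> bool" where
  "fam P \<tau> X \<longleftrightarrow> mel_measurable P X \<and> (\<exists>C. \<forall>\<omega>. norm (X \<omega>) \<le> C) \<and>
     (\<forall>e \<omega> n m a b. mel (n, a + e) (X (\<tau> e \<omega>)) (m, b + e) = mel (n, a) (X \<omega>) (m, b))"

lemma famD:
  assumes "fam P \<tau> X"
  shows "mel_measurable P X" "mel (n, a + e) (X (\<tau> e \<omega>)) (m, b + e) = mel (n, a) (X \<omega>) (m, b)"
  using assms by (auto simp: fam_def)

lemma fam_bound:
  assumes "fam P \<tau> X" obtains C where "0 < C" "\<And>\<omega>. norm (X \<omega>) \<le> C"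
proof -
  obtain C where "\<And>\<omega>. norm (X \<omega>) \<le> C" using assms by (auto simp: fam_def)
  then show thesis by (intro that[of "max C 1"]) (auto intro: max.coboundedI1)
qed

lemma fam_lay: "fam P \<tau> (\<lambda>_. lay S)"
  unfolding fam_def by (auto simp: mel_measurable_const mel_lay)

lemma fam_one: "fam P \<tau> (\<lambda>_. 1)"
  unfolding fam_def by (auto simp: mel_measurable_const)

lemma fam_add:
  assumes "fam P \<tau> X" "fam P \<tau> Y" shows "fam P \<tau> (\<lambda>\<omega>. X \<omega> + Y \<omega>)"
proof -
  obtain C D where "\<And>\<omega>. norm (X \<omega>) \<le> C" "\<And>\<omega>. norm (Y \<omega>) \<le> D" using assms fam_bound by metis
  then have "norm (X \<omega> + Y \<omega>) \<le> C + D" for \<omega> by (meson add_mono norm_triangle_ineq order_trans)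
  then show ?thesis using assms unfolding fam_def by (auto intro: mel_measurable_add)
qed

lemma fam_scaleC:
  assumes "fam P \<tau> X" shows "fam P \<tau> (\<lambda>\<omega>. c *\<^sub>C X \<omega>)"
proof -
  obtain C where "\<And>\<omega>. norm (X \<omega>) \<le> C" using assms fam_bound by metis
  then have "norm (c *\<^sub>C X \<omega>) \<le> cmod c * C" for \<omega> by (simp add: norm_scaleC_bop mult_left_mono)
  then show ?thesis using assms unfolding fam_def by (auto intro: mel_measurable_scaleC)
qed

lemma fam_scaleR: "fam P \<tau> X \<Longrightarrow> fam P \<tau> (\<lambda>\<omega>. r *\<^sub>R X \<omega>)"
  using fam_scaleC[of P \<tau> X "of_real r"] by (simp add: scaleC_of_real_bop)

lemma fam_diff:
  assumes "fam P \<tau> X" "fam P \<tau> Y" shows "fam P \<tau> (\<lambda>\<omega>. X \<omega> - Y \<omega>)"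
  using fam_add[OF assms(1) fam_scaleC[OF assms(2), of "- 1"]]
  by (simp add: scaleC_bop_distrib)

lemma fam_adj:
  assumes "fam P \<tau> X" shows "fam P \<tau> (\<lambda>\<omega>. adj (X \<omega>))"
  using assms unfolding fam_def by (auto intro: mel_measurable_adj)

lemma fam_sum:
  "(\<And>x. x \<in> I \<Longrightarrow> fam P \<tau> (X x)) \<Longrightarrow> fam P \<tau> (\<lambda>\<omega>. \<Sum>x\<in>I. X x \<omega>)"
proof (induction I rule: infinite_finite_induct)
  case (insert x F)
  then show ?case by (simp add: fam_add)
qed (auto simp: fam_def mel_measurable_const)

lemma fam_times:
  fixes X :: "'w \<Rightarrow> (nat \<times> 'z::int_lattice) bop"
  assumes "fam P \<tau> X" "fam P \<tau> Y" shows "fam P \<tau> (\<lambda>\<omega>. X \<omega> * Y \<omega>)"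
  unfolding fam_def
proof (intro conjI allI)
  show "mel_measurable P (\<lambda>\<omega>. X \<omega> * Y \<omega>)"
    by (intro mel_measurable_times countable_layers famD(1)[OF assms(1)] famD(1)[OF assms(2)])
  obtain C D where "0 < C" "\<And>\<omega>. norm (X \<omega>) \<le> C" "\<And>\<omega>. norm (Y \<omega>) \<le> D" using assms fam_bound by metis
  then have "norm (X \<omega> * Y \<omega>) \<le> C * D" for \<omega>
    by (intro order_trans[OF norm_mult_ineq] mult_mono) auto
  then show "\<exists>C. \<forall>\<omega>. norm (X \<omega> * Y \<omega>) \<le> C" by blast
  fix e \<omega> n m a b
  have bij: "bij_betw (\<lambda>(k::nat, c::'z). (k, c + e)) UNIV UNIV"
    by (rule bij_betw_byWitness[where f' = "\<lambda>(k, c). (k, c - e)"]) auto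
  have "mel (n, a + e) (X (\<tau> e \<omega>) * Y (\<tau> e \<omega>)) (m, b + e)
      = (\<Sum>\<^sub>\<infinity>k. mel (n, a + e) (X (\<tau> e \<omega>)) k * mel k (Y (\<tau> e \<omega>)) (m, b + e))"
    by (rule infsumI[OF mel_times_has_sum, symmetric])
  also have "\<dots> = (\<Sum>\<^sub>\<infinity>k. mel (n, a + e) (X (\<tau> e \<omega>)) (case k of (k, c) \<Rightarrow> (k, c + e)) *
      mel (case k of (k, c) \<Rightarrow> (k, c + e)) (Y (\<tau> e \<omega>)) (m, b + e))"
    by (rule infsum_reindex_bij_betw[OF bij, symmetric])
  also have "\<dots> = (\<Sum>\<^sub>\<infinity>k. mel (n, a) (X \<omega>) k * mel k (Y \<omega>) (m, b))"
    by (rule infsum_cong) (simp add: famD(2)[OF assms(1)] famD(2)[OF assms(2)] split: prod.split)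
  also have "\<dots> = mel (n, a) (X \<omega> * Y \<omega>) (m, b)" by (rule infsumI[OF mel_times_has_sum])
  finally show "mel (n, a + e) (X (\<tau> e \<omega>) * Y (\<tau> e \<omega>)) (m, b + e) = mel (n, a) (X \<omega> * Y \<omega>) (m, b)" .
qed

lemma fam_power: "fam P \<tau> X \<Longrightarrow> fam P \<tau> (\<lambda>\<omega>. X \<omega> ^ n)"
  by (induction n) (auto intro: fam_one fam_times)

lemma fam_limit:
  assumes X: "\<And>n. fam P \<tau> (X n)" and lim: "\<And>\<omega>. (\<lambda>n. X n \<omega>) \<longlonglongrightarrow> Y \<omega>" and "\<And>\<omega>. norm (Y \<omega>) \<le> C"
  shows "fam P \<tau> Y"
  unfolding fam_def
proof (intro conjI allI)
  show "mel_measurable P Y" by (rule mel_measurable_norm_limit[OF famD(1)[OF X] lim])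
  fix e \<omega> n m a b
  have l: "(\<lambda>k. mel i (X k \<omega>) j) \<longlonglongrightarrow> mel i (Y \<omega>) j" for \<omega> i j
    by (intro bounded_linear.tendsto[OF bounded_linear_mel] lim)
  show "mel (n, a + e) (Y (\<tau> e \<omega>)) (m, b + e) = mel (n, a) (Y \<omega>) (m, b)"
    by (rule LIMSEQ_unique[OF l]) (use l[of "(n, a)" \<omega> "(m, b)"] in \<open>simp add: famD(2)[OF X]\<close>)
qed (use assms(3) in auto)

text \<open>The inverse is \<open>Y * adj Y * adj X\<close>, and \<open>Y * adj Y\<close> inverts
  the coercive operator \<open>adj X * X\<close>. Its Neumann series has parameters depending on the
  uniform bounds only, so each partial sum is again a covariant family, and so is the limit.\<close>

lemma fam_inverse:
  assumes X: "fam P \<tau> X" and inv: "\<And>\<omega>. X \<omega> * Y \<omega> = 1" "\<And>\<omega>. Y \<omega> * X \<omega> = 1" and Y: "\<And>\<omega>. norm (Y \<omega>) \<le> C"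
  shows "fam P \<tau> Y"
proof -
  define D where "D = max C 1"
  have D: "D > 0" "\<And>\<omega>. norm (Y \<omega>) \<le> D" using Y by (auto simp: D_def intro: max.coboundedI1)
  obtain B where B: "0 < B" "\<And>\<omega>. norm (X \<omega>) \<le> B" using fam_bound[OF X] by metis
  \<comment> \<open>The coercivity constant: Y X = 1 bounds the norm of u by D times the norm of X
    u.\<close>
  define s where "s = 1 / D\<^sup>2"
  have s: "s > 0" using D by (simp add: s_def)
  define Z where "Z \<omega> = adj (X \<omega>) * X \<omega>" for \<omega>
  have fZ: "fam P \<tau> Z" unfolding Z_def by (intro fam_times fam_adj X)
  have nZ: "norm (Z \<omega>) \<le> B * B" for \<omega>
    unfolding Z_def using B by (intro order_trans[OF norm_mult_ineq] mult_mono) auto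
  have co: "s * (norm u)\<^sup>2 \<le> Re (cinner u (Z \<omega> *\<^sub>V u))" for \<omega> u
  proof -
    have "norm u = norm (Y \<omega> *\<^sub>V X \<omega> *\<^sub>V u)" using inv(2) by (metis bop_apply_simps(6,7))
    also have "\<dots> \<le> D * norm (X \<omega> *\<^sub>V u)"
      by (rule order_trans[OF norm_bop_apply]) (intro mult_right_mono D norm_ge_zero)
    finally have "(norm u)\<^sup>2 \<le> (D * norm (X \<omega> *\<^sub>V u))\<^sup>2" by (intro power_mono) auto
    then have "s * (norm u)\<^sup>2 \<le> (norm (X \<omega> *\<^sub>V u))\<^sup>2"
      using D by (simp add: s_def power_mult_distrib field_simps)
    also have "\<dots> = Re (cinner u (Z \<omega> *\<^sub>V u))" by (simp add: Z_def cinner_adj_right)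
    finally show ?thesis .
  qed
  define R where "R n \<omega> = (s / (B * B)\<^sup>2) *\<^sub>R (\<Sum>i<n. (1 - (s / (B * B)\<^sup>2) *\<^sub>R Z \<omega>) ^ i)" for n \<omega>
  have fR: "fam P \<tau> (R n)" for n
    unfolding R_def by (intro fam_scaleR fam_sum fam_power fam_diff fam_one fZ)
  have lim: "(\<lambda>n. R n \<omega>) \<longlonglongrightarrow> Y \<omega> * adj (Y \<omega>)" for \<omega>
  proof -
    obtain G where G: "Z \<omega> * G = 1" "(\<lambda>n. R n \<omega>) \<longlonglongrightarrow> G"
      using coercive_inverse[OF s co[of _ \<omega>]] nZ[of \<omega>] B(1) unfolding R_def by (metis mult_pos_pos)
    have "adj (X \<omega> * Y \<omega>) = 1" by (simp only: inv adj_simps)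
    then have "adj (Y \<omega>) * adj (X \<omega>) = 1" by simp
    then have XY: "adj (Y \<omega>) * adj (X \<omega>) = 1" by simp
    have "(Y \<omega> * adj (Y \<omega>)) * Z \<omega> = Y \<omega> * (adj (Y \<omega>) * adj (X \<omega>)) * X \<omega>"
      unfolding Z_def by (simp only: mult.assoc)
    also have "\<dots> = 1" unfolding XY using inv(2)[of \<omega>] by simp
    finally have 1: "(Y \<omega> * adj (Y \<omega>)) * Z \<omega> = 1" .
    have "G = ((Y \<omega> * adj (Y \<omega>)) * Z \<omega>) * G" unfolding 1 by simp
    also have "\<dots> = (Y \<omega> * adj (Y \<omega>)) * (Z \<omega> * G)" by (simp only: mult.assoc)
    also have "\<dots> = Y \<omega> * adj (Y \<omega>)" unfolding G(1) by simp
    finally have "G = Y \<omega> * adj (Y \<omega>)" .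
    then show ?thesis using G(2) by simp
  qed
  have "norm (Y \<omega> * adj (Y \<omega>)) \<le> D * D" for \<omega>
    using D by (intro order_trans[OF norm_mult_ineq] mult_mono) auto
  then have "fam P \<tau> (\<lambda>\<omega>. Y \<omega> * adj (Y \<omega>))" by (rule fam_limit[OF fR lim])
  then have f: "fam P \<tau> (\<lambda>\<omega>. (Y \<omega> * adj (Y \<omega>)) * adj (X \<omega>))" by (rule fam_times[OF _ fam_adj[OF X]])
  have eq: "(Y \<omega> * adj (Y \<omega>)) * adj (X \<omega>) = Y \<omega>" for \<omega>
    using arg_cong[OF inv(1)[of \<omega>], of adj] by (simp add: mult.assoc)
  show ?thesis using f unfolding eq .
qed

section \<open>Exhaustion of the lattice by cubes\<close>

lemma finite_cube: "finite (cube L :: 'z::int_lattice set)"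
proof -
  have "(\<lambda>n::'z. restrict (coord n) dirs) ` cube L \<subseteq> dirs \<rightarrow>\<^sub>E {- int L..int L}"
    by (auto simp: cube_def abs_le_iff)
  then have "finite ((\<lambda>n::'z. restrict (coord n) dirs) ` cube L)"
    by (rule finite_subset) (intro finite_PiE finite_dirs finite_atLeastAtMost_int)
  moreover have "inj_on (\<lambda>n::'z. restrict (coord n) dirs) (cube L)"
    using inj_on_subset[OF bij_betw_imp_inj_on[OF coord_bij]] by blast
  ultimately show ?thesis by (rule finite_imageD)
qed

lemma cube_mono: "L \<le> M \<Longrightarrow> cube L \<subseteq> (cube M :: 'z::int_lattice set)"
  by (force simp: cube_def)

lemma cube_exhaust: "\<exists>L. (n :: 'z::int_lattice) \<in> cube L"
proof -
  define L where "L = nat (\<Sum>e\<in>dirs. \<bar>coord n e\<bar>)"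
  have "\<bar>coord n e\<bar> \<le> int L" if "e \<in> dirs" for e
    unfolding L_def using member_le_sum[OF that, of "\<lambda>e. \<bar>coord n e\<bar>"] by (simp add: finite_dirs)
  then show ?thesis by (auto simp: cube_def)
qed

lemma uminus_cube: "uminus ` cube L = (cube L :: 'z::int_lattice set)"
proof -
  have *: "uminus ` cube L \<subseteq> (cube L :: 'z set)" by (auto simp: cube_def coord_minus)
  have "x \<in> uminus ` cube L" if "x \<in> cube L" for x :: 'z
    using * that by (metis image_subset_iff image_iff minus_minus)
  then show ?thesis using * by blast
qed

lemma filterlim_cubes:
  assumes "finite D"
  shows "filterlim (\<lambda>L. D \<times> (cube L :: 'z::int_lattice set)) (finite_subsets_at_top (D \<times> UNIV)) sequentially"
  unfolding filterlim_finite_subsets_at_top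
proof (intro allI impI)
  fix X :: "('a \<times> 'z) set" assume X: "finite X \<and> X \<subseteq> D \<times> UNIV"
  have "\<exists>L. \<forall>x\<in>X. snd x \<in> cube L" using X
  proof (induction X rule: infinite_finite_induct)
    case (insert x F)
    then obtain L where L: "\<forall>y\<in>F. snd y \<in> cube L" by auto
    obtain M where M: "snd x \<in> cube M" using cube_exhaust by blast
    show ?case
      by (rule exI[of _ "max L M"])
         (use L M cube_mono[of L "max L M"] cube_mono[of M "max L M"] in \<open>auto dest: subsetD\<close>)
  qed auto
  then obtain L where "\<forall>x\<in>X. snd x \<in> cube L" by blast
  then have "X \<subseteq> D \<times> cube M" if "L \<le> M" for M using X cube_mono[OF that] by fastforce
  then show "\<forall>\<^sub>F L in sequentially. finite (D \<times> cube L) \<and> X \<subseteq> D \<times> cube L \<and> D \<times> cube L \<subseteq> D \<times> UNIV"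
    using assms by (intro eventually_sequentiallyI[of L]) (auto simp: finite_cube)
qed

locale covariant_system = prob_space P for P :: "'w measure" +
  fixes \<tau> :: "'z::int_lattice \<Rightarrow> 'w \<Rightarrow> 'w"
  assumes \<tau>_measurable: "\<tau> e \<in> measurable P P" and \<tau>_invariant: "distr P P (\<tau> e) = P"
begin

text \<open>The trace over N layers tensored with the trace per unit volume, read off at the origin
  of each layer.\<close>

definition tr :: "nat \<Rightarrow> ('w \<Rightarrow> (nat \<times> 'z) bop) \<Rightarrow> complex" where
  "tr N X = (\<Sum>n=1..N. LINT \<omega>|P. mel (n, 0) (X \<omega>) (n, 0))"

lemma integrable_mel:
  assumes "fam P \<tau> X" shows "integrable P (\<lambda>\<omega>. mel i (X \<omega>) j)"
proof -
  obtain C where "\<And>\<omega>. norm (X \<omega>) \<le> C" using fam_bound[OF assms] by metis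
  then show ?thesis
    by (intro integrable_const_bound[of _ C] mel_measurableD famD(1)[OF assms])
       (auto intro: order_trans[OF cmod_mel_le])
qed

lemma tr_diff: "fam P \<tau> X \<Longrightarrow> fam P \<tau> Y \<Longrightarrow> tr N (\<lambda>\<omega>. X \<omega> - Y \<omega>) = tr N X - tr N Y"
  by (simp add: tr_def sum_subtractf integrable_mel)

lemma tr_scaleC: "tr N (\<lambda>\<omega>. c *\<^sub>C X \<omega>) = c * tr N X"
  by (simp add: tr_def sum_distrib_left)

lemma cmod_integral_mel_le:
  assumes "fam P \<tau> X" "\<And>\<omega>. cmod (mel i (X \<omega>) j) \<le> C"
  shows "cmod (LINT \<omega>|P. mel i (X \<omega>) j) \<le> C"
  using norm_lebesgue_integral_le[OF integrable_mel[OF assms(1)], of "\<lambda>_. C"] assms(2)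
  by (simp add: prob_space)

lemma tr_bound:
  assumes "fam P \<tau> X" "\<And>\<omega>. norm (X \<omega>) \<le> C"
  shows "cmod (tr N X) \<le> real N * C"
proof -
  have "cmod (tr N X) \<le> (\<Sum>n=1..N. C)"
    unfolding tr_def
    by (intro order_trans[OF norm_sum] sum_mono cmod_integral_mel_le assms(1))
       (rule order_trans[OF cmod_mel_le assms(2)])
  then show ?thesis by simp
qed

text \<open>Matrix products are expanded over the layers 1 to N and growing cubes, with dominated
  convergence. Since Y lives in the first N layers, no other layers contribute as intermediate
  indices; within them the translation invariance of P moves the base point, as for any trace per
  unit volume.\<close>

lemma tr_cyclic:
  assumes X: "fam P \<tau> X" and Y: "fam P \<tau> Y"
    and supp: "\<And>\<omega>. lay {1..N} * Y \<omega> = Y \<omega>" "\<And>\<omega>. Y \<omega> * lay {1..N} = Y \<omega>"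
  shows "tr N (\<lambda>\<omega>. X \<omega> * Y \<omega>) = tr N (\<lambda>\<omega>. Y \<omega> * X \<omega>)"
proof -
  have Y0: "mel i (Y \<omega>) j = 0" if "fst i \<notin> {1..N} \<or> fst j \<notin> {1..N}" for i j \<omega>
    using mel_lay_times[of i "{1..N}" "Y \<omega>" j] mel_times_lay[of i "Y \<omega>" "{1..N}" j] supp that by auto
  obtain BX where BX: "\<And>\<omega>. norm (X \<omega>) \<le> BX" "0 < BX" using fam_bound[OF X] by metis
  obtain BY where BY: "\<And>\<omega>. norm (Y \<omega>) \<le> BY" using fam_bound[OF Y] by metis
  have gen: "(\<lambda>L. \<Sum>k\<in>{1..N}. \<Sum>a\<in>cube L. LINT \<omega>|P. mel i (A \<omega>) (k, a) * mel (k, a) (B \<omega>) j)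
      \<longlonglongrightarrow> (LINT \<omega>|P. mel i (A \<omega> * B \<omega>) j)"
    if A: "fam P \<tau> A" and B: "fam P \<tau> B"
      and zero: "\<And>\<omega> k a. k \<notin> {1..N} \<Longrightarrow> mel i (A \<omega>) (k, a) * mel (k, a) (B \<omega>) j = 0" for A B i j
  proof -
    obtain CA CB where CA: "\<And>\<omega>. norm (A \<omega>) \<le> CA" "0 < CA" and CB: "\<And>\<omega>. norm (B \<omega>) \<le> CB"
      using fam_bound[OF A] fam_bound[OF B] by metis
    have meas: "(\<lambda>\<omega>. mel i (A \<omega>) k * mel k (B \<omega>) j) \<in> borel_measurable P" for k
      by (intro borel_measurable_times mel_measurableD famD(1)[OF A] famD(1)[OF B])
    have bnd: "cmod (\<Sum>k\<in>F. mel i (A \<omega>) k * mel k (B \<omega>) j) \<le> CA * CB" if "finite F" for F \<omega>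
      using CA CB by (intro order_trans[OF mel_times_finite_le[OF that]] mult_mono) auto
    have int: "integrable P (\<lambda>\<omega>. mel i (A \<omega>) k * mel k (B \<omega>) j)" for k
      by (rule integrable_const_bound[of _ "CA * CB"]) (use bnd[of "{k}"] meas in auto)
    have lim: "(\<lambda>L. \<Sum>k\<in>{1..N} \<times> cube L. mel i (A \<omega>) k * mel k (B \<omega>) j) \<longlonglongrightarrow> mel i (A \<omega> * B \<omega>) j" for \<omega>
    proof -
      have zero': "mel i (A \<omega>) x * mel x (B \<omega>) j = 0" if "x \<notin> {1..N} \<times> UNIV" for x
        using zero[of "fst x" \<omega> "snd x"] that by (cases x) auto
      have "((\<lambda>k. mel i (A \<omega>) k * mel k (B \<omega>) j) has_sum mel i (A \<omega> * B \<omega>) j) ({1..N} \<times> UNIV)"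
        using mel_times_has_sum[of i "A \<omega>" "B \<omega>" j]
        by (rule has_sum_cong_neutral[THEN iffD1, rotated -1]) (use zero' in blast)+
      then show ?thesis unfolding has_sum_def by (rule filterlim_compose[OF _ filterlim_cubes]) simp
    qed
    have "(\<lambda>L. LINT \<omega>|P. (\<Sum>k\<in>{1..N} \<times> cube L. mel i (A \<omega>) k * mel k (B \<omega>) j))
        \<longlonglongrightarrow> (LINT \<omega>|P. mel i (A \<omega> * B \<omega>) j)"
      by (rule integral_dominated_convergence[where w = "\<lambda>_. CA * CB"])
         (use lim bnd meas in \<open>auto intro!: borel_measurable_sum mel_measurableD[OF famD(1)[OF fam_times[OF A B]]] simp: finite_cube\<close>)
    then show ?thesis
      by (subst (asm) Bochner_Integration.integral_sum) (auto simp: int sum.cartesian_product split_beta)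
  qed
  \<comment> \<open>Translation by -a brings the site a to the origin and the origin to -a. The
    cubes are symmetric, so summing over a undoes the sign.\<close>
  have flip: "(LINT \<omega>|P. mel (n, 0) (X \<omega>) (k, a) * mel (k, a) (Y \<omega>) (n, 0))
      = (LINT \<omega>|P. mel (k, 0) (Y \<omega>) (n, - a) * mel (n, - a) (X \<omega>) (k, 0))" for n k a
  proof -
    define f where "f \<omega> = mel (k, 0) (Y \<omega>) (n, - a) * mel (n, - a) (X \<omega>) (k, 0)" for \<omega>
    have "f \<in> borel_measurable P"
      unfolding f_def by (intro borel_measurable_times mel_measurableD famD(1)[OF X] famD(1)[OF Y])
    then have "(LINT \<omega>|distr P P (\<tau> (- a)). f \<omega>) = (LINT \<omega>|P. f (\<tau> (- a) \<omega>))"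
      by (intro integral_distr \<tau>_measurable)
    moreover have "f (\<tau> (- a) \<omega>) = mel (n, 0) (X \<omega>) (k, a) * mel (k, a) (Y \<omega>) (n, 0)" for \<omega>
      using famD(2)[OF X, of n 0 "- a" \<omega> k a] famD(2)[OF Y, of k a "- a" \<omega> n 0]
      by (simp add: f_def mult.commute)
    ultimately show ?thesis by (simp add: \<tau>_invariant) (simp add: f_def)
  qed
  have 1: "(\<lambda>L. \<Sum>n=1..N. \<Sum>k=1..N. \<Sum>a\<in>cube L. LINT \<omega>|P. mel (n, 0) (X \<omega>) (k, a) * mel (k, a) (Y \<omega>) (n, 0))
      \<longlonglongrightarrow> tr N (\<lambda>\<omega>. X \<omega> * Y \<omega>)"
    unfolding tr_def by (intro tendsto_sum gen X Y) (simp add: Y0)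
  have 2: "(\<lambda>L. \<Sum>k=1..N. \<Sum>n=1..N. \<Sum>a\<in>cube L. LINT \<omega>|P. mel (k, 0) (Y \<omega>) (n, a) * mel (n, a) (X \<omega>) (k, 0))
      \<longlonglongrightarrow> tr N (\<lambda>\<omega>. Y \<omega> * X \<omega>)"
    unfolding tr_def by (intro tendsto_sum gen X Y) (simp add: Y0)
  have neg: "(\<Sum>a\<in>cube L. g (- a)) = (\<Sum>a\<in>cube L. g a)" for g :: "'z \<Rightarrow> complex" and L
    using sum.reindex[of uminus "cube L :: 'z set" g] by (simp add: uminus_cube)
  have "(\<Sum>n=1..N. \<Sum>k=1..N. \<Sum>a\<in>cube L. LINT \<omega>|P. mel (n, 0) (X \<omega>) (k, a) * mel (k, a) (Y \<omega>) (n, 0))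
      = (\<Sum>k=1..N. \<Sum>n=1..N. \<Sum>a\<in>cube L. LINT \<omega>|P. mel (k, 0) (Y \<omega>) (n, a) * mel (n, a) (X \<omega>) (k, 0))" for L
  proof -
    have "(\<Sum>a\<in>cube L. LINT \<omega>|P. mel (n, 0) (X \<omega>) (k, a) * mel (k, a) (Y \<omega>) (n, 0))
        = (\<Sum>a\<in>cube L. LINT \<omega>|P. mel (k, 0) (Y \<omega>) (n, a) * mel (n, a) (X \<omega>) (k, 0))" for n k
      unfolding flip
      by (rule neg[of "\<lambda>a. LINT \<omega>|P. mel (k, 0) (Y \<omega>) (n, a) * mel (n, a) (X \<omega>) (k, 0)"])
    then show ?thesis by (simp only:) (rule sum.swap)
  qed
  with 1 2 show ?thesis by (simp add: LIMSEQ_unique)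
qed

end

subsection \<open>Herglotz functions\<close>

lemma has_field_derivative_quadratic:
  fixes f :: "complex \<Rightarrow> complex"
  assumes "0 < r" and f: "\<And>h. cmod h < r \<Longrightarrow> cmod (f (x + h) - f x - h * D) \<le> C * (cmod h)\<^sup>2"
  shows "(f has_field_derivative D) (at x)"
proof -
  have "((\<lambda>h. (f (x + h) - f x) / h - D) \<longlongrightarrow> 0) (at 0)"
  proof (rule Lim_null_comparison)
    show "\<forall>\<^sub>F h in at 0. cmod ((f (x + h) - f x) / h - D) \<le> C * cmod h"
      unfolding eventually_at
    proof (intro exI[of _ r] conjI ballI impI)
      fix h :: complex assume h: "h \<noteq> 0 \<and> dist h 0 < r"
      have "(f (x + h) - f x) / h - D = (f (x + h) - f x - h * D) / h" using h by (simp add: field_simps)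
      then have "cmod ((f (x + h) - f x) / h - D) = cmod (f (x + h) - f x - h * D) / cmod h"
        by (simp add: norm_divide)
      also have "\<dots> \<le> C * (cmod h)\<^sup>2 / cmod h" using f[of h] h by (intro divide_right_mono) auto
      also have "\<dots> = C * cmod h" using h by (simp add: power2_eq_square)
      finally show "cmod ((f (x + h) - f x) / h - D) \<le> C * cmod h" .
    qed (rule assms(1))
    have "((\<lambda>h::complex. C * cmod h) \<longlongrightarrow> C * cmod 0) (at 0)" by (intro tendsto_intros)
    then show "((\<lambda>h::complex. C * cmod h) \<longlongrightarrow> 0) (at 0)" by simp
  qed
  then show ?thesis unfolding DERIV_def using LIM_zero_iff by blast
qed

lemma has_vector_derivative_quadratic:
  fixes f :: "real \<Rightarrow> complex"
  assumes f: "\<And>y. y \<in> S \<Longrightarrow> cmod (f y - f x - of_real (y - x) * D) \<le> C * (y - x)\<^sup>2"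
  shows "(f has_vector_derivative D) (at x within S)"
  unfolding has_vector_derivative_def
proof (rule has_derivativeI_sandwich[where e = 1])
  show "bounded_linear (\<lambda>h. h *\<^sub>R D)" by (rule bounded_linear_scaleR_left)
  fix y assume y: "y \<in> S" "y \<noteq> x"
  have "norm (f y - f x - (y - x) *\<^sub>R D) / norm (y - x) \<le> C * (y - x)\<^sup>2 / \<bar>y - x\<bar>"
    using f[OF y(1)] by (simp add: scaleR_conv_of_real divide_right_mono)
  also have "(y - x)\<^sup>2 = \<bar>y - x\<bar> * \<bar>y - x\<bar>" by (simp add: power2_eq_square)
  also have "C * (\<bar>y - x\<bar> * \<bar>y - x\<bar>) / \<bar>y - x\<bar> = C * \<bar>y - x\<bar>"
    using y(2) nonzero_mult_div_cancel_right[of "\<bar>y - x\<bar>" "C * \<bar>y - x\<bar>"]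
    by (simp only: mult.assoc abs_eq_0 right_minus_eq not_False_eq_True simp_thms)
  finally show "norm (f y - f x - (y - x) *\<^sub>R D) / norm (y - x) \<le> C * \<bar>y - x\<bar>" .
next
  have "((\<lambda>y. C * \<bar>y - x\<bar>) \<longlongrightarrow> C * \<bar>x - x\<bar>) (at x within S)" by (intro tendsto_intros)
  then show "((\<lambda>y. C * \<bar>y - x\<bar>) \<longlongrightarrow> 0) (at x within S)" by simp
qed simp

text \<open>Moving the end points horizontally to \<open>\<plusminus>K\<close> changes \<open>Im Q\<close> in the right direction because
  \<open>Im h \<ge> 0\<close>; the points \<open>\<plusminus>K\<close> are then joined by a rectangle of height \<open>K\<close>, on which \<open>h\<close> is of size \<open>p / K\<close>.\<close>

lemma herglotz_primitive:
  fixes h :: "complex \<Rightarrow> complex"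
  assumes "0 < s" and hol: "h holomorphic_on {\<zeta>. - s < Im \<zeta>}"
    and pos: "\<And>\<kappa>. 0 \<le> Im \<kappa> \<Longrightarrow> 0 \<le> Im (h \<kappa>)"
    and b1: "\<And>\<kappa>. 0 < Im \<kappa> \<Longrightarrow> cmod (h \<kappa>) \<le> p / Im \<kappa>"
    and b2: "\<And>\<kappa>. 0 \<le> Im \<kappa> \<Longrightarrow> M < cmod \<kappa> \<Longrightarrow> cmod (h \<kappa>) \<le> p / (cmod \<kappa> - M)"
  obtains Q where "\<And>\<kappa>. - s < Im \<kappa> \<Longrightarrow> (Q has_field_derivative h \<kappa>) (at \<kappa>)"
    "\<And>a b. 0 \<le> Im a \<Longrightarrow> 0 \<le> Im b \<Longrightarrow> \<bar>Im (Q b) - Im (Q a)\<bar> \<le> 4 * p"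
proof -
  have op: "open {\<zeta>. - s < Im \<zeta>}" by (simp add: open_halfspace_Im_gt)
  have "convex {\<zeta>. - s < Im \<zeta>}" by (simp add: convex_halfspace_Im_gt)
  then obtain Q where Q0: "\<And>\<kappa>. \<kappa> \<in> {\<zeta>. - s < Im \<zeta>} \<Longrightarrow> (Q has_field_derivative h \<kappa>) (at \<kappa> within {\<zeta>. - s < Im \<zeta>})"
    using holomorphic_convex_primitive'[OF _ op hol] by metis
  have Q: "(Q has_field_derivative h \<kappa>) (at \<kappa>)" if "- s < Im \<kappa>" for \<kappa>
    using Q0[of \<kappa>] that op by (simp add: at_within_open[of \<kappa> "{\<zeta>. - s < Im \<zeta>}"])
  have p0: "0 \<le> p" using b1[of \<i>] by (simp add: order_trans[OF norm_ge_zero])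
  have mono: "Im (Q (Complex x y)) \<le> Im (Q (Complex x' y))" if "x \<le> x'" "0 \<le> y" for x x' y
  proof (rule DERIV_nonneg_imp_nondecreasing[OF that(1)])
    fix t
    have "((\<lambda>t. Complex t y) has_vector_derivative 1) (at t)"
      by (auto simp: has_vector_derivative_complex_iff intro!: derivative_eq_intros)
    then have "((Q \<circ> (\<lambda>t. Complex t y)) has_vector_derivative 1 * h (Complex t y)) (at t)"
      using \<open>0 < s\<close> that by (intro field_vector_diff_chain_at Q) auto
    then have "((\<lambda>t. Im (Q (Complex t y))) has_field_derivative Im (h (Complex t y))) (at t)"
      by (simp add: has_vector_derivative_complex_iff o_def)
    then show "\<exists>d. ((\<lambda>t. Im (Q (Complex t y))) has_real_derivative d) (at t) \<and> 0 \<le> d"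
      using pos[of "Complex t y"] that by auto
  qed
  have seg: "cmod (Q w - Q v) \<le> B * cmod (w - v)"
    if "\<And>\<kappa>. \<kappa> \<in> closed_segment v w \<Longrightarrow> cmod (h \<kappa>) \<le> B" "0 \<le> Im v" "0 \<le> Im w" for v w B
  proof (rule field_differentiable_bound[OF convex_closed_segment _ that(1)])
    fix \<kappa> assume "\<kappa> \<in> closed_segment v w"
    then have "0 \<le> Im \<kappa>"
      using that(2,3) convex_halfspace_Im_ge[of 0] by (auto dest: convex_contains_segment[THEN iffD1])
    then show "(Q has_field_derivative h \<kappa>) (at \<kappa> within closed_segment v w)"
      using \<open>0 < s\<close> by (intro DERIV_subset[OF Q]) auto
  qed auto
  have main: "Im (Q b) - Im (Q a) \<le> 4 * p" if ab: "0 \<le> Im a" "0 \<le> Im b" for a b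
  proof -
    \<comment> \<open>For K \<ge> K0 the rectangle of height K over the segment from -K to K
      contains a and b, and its vertical sides stay outside the disc of radius M.\<close>
    define K0 where "K0 = \<bar>M\<bar> + \<bar>Re a\<bar> + \<bar>Re b\<bar> + Im a + Im b + 1"
    have bound: "Im (Q b) - Im (Q a) \<le> 2 * p + 2 * p * (K / (K - M))" if "K0 \<le> K" for K
    proof -
      have K: "M < K" "0 < K" "\<bar>Re a\<bar> \<le> K" "\<bar>Re b\<bar> \<le> K" "Im a \<le> K" "Im b \<le> K"
        using that ab unfolding K0_def by linarith+
      define T where "T = p * (K / (K - M))"
      have side: "cmod (Q (Complex x K) - Q (Complex x y)) \<le> T"
        if x: "\<bar>x\<bar> = K" and y: "0 \<le> y" "y \<le> K" for x y
      proof -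
        have "cmod (Q (Complex x K) - Q (Complex x y)) \<le> p / (K - M) * cmod (Complex x K - Complex x y)"
        proof (rule seg)
          fix \<kappa> assume "\<kappa> \<in> closed_segment (Complex x y) (Complex x K)"
          then have "Re \<kappa> = x" "y \<le> Im \<kappa>" using y
            by (auto simp: closed_segment_same_Re closed_segment_eq_real_ivl)
          then have k: "0 \<le> Im \<kappa>" "K \<le> cmod \<kappa>" using x y abs_Re_le_cmod[of \<kappa>] by auto
          have "cmod (h \<kappa>) \<le> p / (cmod \<kappa> - M)" using k K by (intro b2) auto
          also have "\<dots> \<le> p / (K - M)" using k K p0 by (intro divide_left_mono mult_pos_pos) auto
          finally show "cmod (h \<kappa>) \<le> p / (K - M)" .
        qed (use y K in auto)
        also have "Complex x K - Complex x y = of_real (K - y) * \<i>" by (simp add: complex_eq_iff)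
        also have "p / (K - M) * cmod (of_real (K - y) * \<i>) \<le> p / (K - M) * K"
          using y p0 K by (intro mult_left_mono) (auto simp: norm_mult simp del: of_real_diff)
        finally show ?thesis by (simp add: T_def)
      qed
      have top: "cmod (Q (Complex K K) - Q (Complex (- K) K)) \<le> 2 * p"
      proof -
        have "cmod (Q (Complex K K) - Q (Complex (- K) K)) \<le> p / K * cmod (Complex K K - Complex (- K) K)"
        proof (rule seg)
          fix \<kappa> assume "\<kappa> \<in> closed_segment (Complex (- K) K) (Complex K K)"
          then have "Im \<kappa> = K" by (auto simp: closed_segment_same_Im)
          then show "cmod (h \<kappa>) \<le> p / K" using b1[of \<kappa>] K by simp
        qed (use K in auto)
        also have "Complex K K - Complex (- K) K = of_real (2 * K)" by (simp add: complex_eq_iff)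
        also have "p / K * cmod (of_real (2 * K)) = 2 * p" using K by simp
        finally show ?thesis .
      qed
      have imle: "Im u - Im v \<le> c" if "cmod (u - v) \<le> c" for u v c
        using abs_Im_le_cmod[of "u - v"] that by simp
      have "Im (Q b) \<le> Im (Q (Complex K (Im b)))" using mono[of "Re b" K "Im b"] K ab by simp
      moreover have "Im (Q (Complex K (Im b))) - Im (Q (Complex K K)) \<le> T"
        by (rule imle) (use side[of K "Im b"] K ab in \<open>simp add: norm_minus_commute\<close>)
      moreover have "Im (Q (Complex K K)) - Im (Q (Complex (- K) K)) \<le> 2 * p" by (rule imle[OF top])
      moreover have "Im (Q (Complex (- K) K)) - Im (Q (Complex (- K) (Im a))) \<le> T"
        by (rule imle) (use side[of "- K" "Im a"] K ab in simp)
      moreover have "Im (Q (Complex (- K) (Im a))) \<le> Im (Q a)"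
        using mono[of "- K" "Re a" "Im a"] K ab by simp
      ultimately have "Im (Q b) - Im (Q a) \<le> 2 * p + 2 * (T)" by linarith
      then show ?thesis by (simp only: mult.assoc T_def)
    qed
    \<comment> \<open>The top side contributes p / K times its length 2 K, and each vertical side at
      most p K / (K - M), which tends to p: in total 4 p.\<close>
    have "((\<lambda>K. 2 * p + 2 * p * (K / (K - M))) \<longlongrightarrow> 2 * p + 2 * p * 1) at_top"
      by (intro tendsto_intros) real_asymp
    then have "Im (Q b) - Im (Q a) \<le> 2 * p + 2 * p * 1"
      by (rule tendsto_lowerbound) (use bound in \<open>auto simp: eventually_at_top_linorder\<close>)
    then show ?thesis by simp
  qed
  show thesis
    by (rule that[OF Q]) (use main in \<open>auto simp: abs_le_iff\<close>)
qed

subsection \<open>Resolvents of dissipative families\<close>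

definition dissip :: "real \<Rightarrow> 'i bop \<Rightarrow> bool" where
  "dissip \<delta> Z \<longleftrightarrow> (\<forall>u. Im (cinner u (Z *\<^sub>V u)) \<le> - \<delta> * (norm u)\<^sup>2)"

lemma dissip_inv:
  assumes "0 < \<delta>" "dissip \<delta> Z"
  shows "Z * bop_inv Z = 1" "bop_inv Z * Z = 1" "norm (bop_inv Z) \<le> 1 / \<delta>"
proof -
  have "Im (cinner u (Z *\<^sub>V u)) \<le> - \<delta> * (norm u)\<^sup>2" for u using assms(2) by (simp add: dissip_def)
  then obtain G where "Z * G = 1" "G * Z = 1" "norm G \<le> 1 / \<delta>" "bop_inv Z = G"
    using dissipative_inverse[OF assms(1)] by metis
  then show "Z * bop_inv Z = 1" "bop_inv Z * Z = 1" "norm (bop_inv Z) \<le> 1 / \<delta>" by auto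
qed

text \<open>The resolvent identity applied twice, with an exact remainder of second order in c. The
  left factor A lets the same formula differentiate the trace of a resolvent and the trace of a
  perturbation times a resolvent.\<close>

lemma inverse_expand:
  fixes Z Z' :: "'i bop"
  assumes inv: "Z * G = 1" "G * Z = 1" "Z' * G' = 1" "G' * Z' = 1" and D: "Z - Z' = c *\<^sub>C B"
  shows "A * G' - A * G - c *\<^sub>C (A * G * B * G) = c\<^sup>2 *\<^sub>C (A * G' * B * G * B * G)"
proof -
  define E where "E = c *\<^sub>C B"
  have 1: "G' - G = G' * E * G"
  proof -
    have "G' * (Z - Z') * G = G' * (Z * G) - (G' * Z') * G"
      by (simp only: right_diff_distrib left_diff_distrib mult.assoc)
    then show ?thesis using inv D by (simp add: E_def)
  qed
  have "A * G' - A * G - A * G * E * G = A * ((G' - G) - G * E * G)"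
    by (simp only: right_diff_distrib mult.assoc)
  also have "(G' - G) - G * E * G = (G' - G) * E * G" by (subst 1) (simp only: left_diff_distrib)
  also have "\<dots> = G' * E * G * E * G" by (simp only: 1)
  finally show ?thesis by (simp add: E_def power2_eq_square mult.assoc)
qed

lemma fam_dissip_inv:
  assumes "fam P \<tau> Z" "0 < \<delta>" "\<And>\<omega>. dissip \<delta> (Z \<omega>)"
  shows "fam P \<tau> (\<lambda>\<omega>. bop_inv (Z \<omega>))"
  by (rule fam_inverse[OF assms(1)]) (rule dissip_inv[OF assms(2) assms(3)])+

lemma sa_Im: "adj H = H \<Longrightarrow> Im (cinner u (H *\<^sub>V u)) = 0"
  using sa_cinner_real[of H u] by (metis Im_complex_of_real)

lemma dissip_sub:
  fixes H B :: "'i bop"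
  assumes "adj H = H" "\<And>u. 0 \<le> Im (cinner u (B *\<^sub>V u))" "\<delta> \<le> - Im z"
  shows "dissip \<delta> (z *\<^sub>C 1 - H - B)"
  unfolding dissip_def
proof
  fix u :: "'i ell2"
  have "\<delta> * (norm u)\<^sup>2 \<le> - Im z * (norm u)\<^sup>2" using assms(3) by (intro mult_right_mono) auto
  then show "Im (cinner u ((z *\<^sub>C 1 - H - B) *\<^sub>V u)) \<le> - \<delta> * (norm u)\<^sup>2"
    using assms(2)[of u] by (simp add: cinner_simps sa_Im[OF assms(1)] cinner_self)
qed

lemma Im_cinner_lay: "Im (cinner u ((c *\<^sub>C lay S) *\<^sub>V u)) = Im c * (norm (lay S *\<^sub>V u))\<^sup>2"
  by (simp add: cinner_simps cinner_lay del: of_real_power)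

context covariant_system begin

text \<open>Both sides are the integral of \<open>\<partial>\<^sub>x tr G = tr (B G\<^sup>2) = - \<partial>\<^sub>e tr (B G)\<close> over \<open>[a, b] \<times> [0, 1]\<close>.\<close>

lemma path_integral:
  assumes H: "fam P \<tau> H" and B: "fam P \<tau> B" and s: "0 < s"
    and supp: "\<And>\<omega>. lay {1..N} * B \<omega> = B \<omega>" "\<And>\<omega>. B \<omega> * lay {1..N} = B \<omega>"
    and comm: "\<And>\<omega>. lay {1..N} * H \<omega> = H \<omega> * lay {1..N}"
    and dis: "\<And>e x \<omega>. 0 \<le> x \<Longrightarrow> x \<le> 1 \<Longrightarrow> dissip s (Complex e (- s) *\<^sub>C 1 - H \<omega> - x *\<^sub>R B \<omega>)"
    and ab: "a \<le> b"
  defines "G \<equiv> \<lambda>e x \<omega>. bop_inv (Complex e (- s) *\<^sub>C 1 - H \<omega> - x *\<^sub>R B \<omega>)"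
  defines "g \<equiv> \<lambda>e x. tr N (G e x)"
  defines "k \<equiv> \<lambda>e x. tr N (\<lambda>\<omega>. B \<omega> * G e x \<omega>)"
  shows "((\<lambda>e. g e 1 - g e 0) has_integral (integral {0..1} (k a) - integral {0..1} (k b))) {a..b}"
    "k e integrable_on {0..1}"
proof -
  define Z where "Z e x \<omega> = Complex e (- s) *\<^sub>C 1 - H \<omega> - x *\<^sub>R B \<omega>" for e x \<omega>
  have G: "G e x \<omega> = bop_inv (Z e x \<omega>)" for e x \<omega> by (simp add: G_def Z_def)
  have Zf: "fam P \<tau> (Z e x)" for e x
    unfolding Z_def by (intro fam_diff fam_scaleC fam_scaleR fam_one H B)
  have dZ: "dissip s (Z e x \<omega>)" if "x \<in> {0..1}" for e x \<omega> using dis that by (simp add: Z_def)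
  note ZG = dissip_inv[OF s dZ, folded G]
  have Gf: "fam P \<tau> (G e x)" if "x \<in> {0..1}" for e x
    unfolding G by (rule fam_dissip_inv[OF Zf s dZ[OF that]])
  obtain \<beta> where \<beta>: "0 < \<beta>" "\<And>\<omega>. norm (B \<omega>) \<le> \<beta>" using fam_bound[OF B] by metis
  define r where "r = 1 / s"
  have nG: "norm (G e x \<omega>) \<le> r" if "x \<in> {0..1}" for e x \<omega> using ZG(3)[OF that] by (simp add: r_def)
  have r: "0 < r" using s by (simp add: r_def)
  have n2: "norm (X * Y) \<le> c * d" if "norm X \<le> c" "norm Y \<le> d" "0 \<le> c" for X Y :: "(nat \<times> 'z) bop" and c d
    using that by (intro order_trans[OF norm_mult_ineq] mult_mono) auto
  define m where "m e x = tr N (\<lambda>\<omega>. B \<omega> * G e x \<omega> * G e x \<omega>)" for e x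
  have BGf: "fam P \<tau> (\<lambda>\<omega>. B \<omega> * G e x \<omega>)" if "x \<in> {0..1}" for e x by (intro fam_times B Gf that)
  have commG: "lay {1..N} * G e x \<omega> = G e x \<omega> * lay {1..N}" if "x \<in> {0..1}" for e x \<omega>
  proof (rule inverse_commute[OF ZG(1,2)[OF that]])
    show "lay {1..N} * Z e x \<omega> = Z e x \<omega> * lay {1..N}"
      by (simp add: Z_def right_diff_distrib left_diff_distrib comm supp del: One_nat_def)
  qed
  \<comment> \<open>Cyclicity identifies tr (G B G), the derivative of tr G in x, with tr (B G G),
    which is minus the derivative of tr (B G) in e. It needs a factor supported in the sample, here
    B G, whence the commutation of G with the layer projection.\<close>
  have m: "m e x = tr N (\<lambda>\<omega>. G e x \<omega> * B \<omega> * G e x \<omega>)" if x: "x \<in> {0..1}" for e x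
  proof -
    have "tr N (\<lambda>\<omega>. G e x \<omega> * (B \<omega> * G e x \<omega>)) = tr N (\<lambda>\<omega>. (B \<omega> * G e x \<omega>) * G e x \<omega>)"
    proof (rule tr_cyclic[OF Gf[OF x] BGf[OF x]])
      show "lay {1..N} * (B \<omega> * G e x \<omega>) = B \<omega> * G e x \<omega>" for \<omega>
        by (simp add: mult.assoc[symmetric] supp del: One_nat_def)
      show "B \<omega> * G e x \<omega> * lay {1..N} = B \<omega> * G e x \<omega>" for \<omega>
        unfolding mult.assoc commG[OF x, symmetric] unfolding mult.assoc[symmetric] supp ..
    qed
    then show ?thesis by (simp add: m_def mult.assoc)
  qed
  have Zx: "Z e x \<omega> - Z e y \<omega> = of_real (y - x) *\<^sub>C B \<omega>" for e x y \<omega>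
    unfolding scaleC_of_real_bop by (simp add: Z_def scaleR_left_diff_distrib)
  have gx: "cmod (g e y - g e x - of_real (y - x) * m e x) \<le> (real N * (r * \<beta> * r * \<beta> * r)) * (y - x)\<^sup>2"
    if x: "x \<in> {0..1}" and y: "y \<in> {0..1}" for e x y
  proof -
    have exp: "G e y \<omega> - G e x \<omega> - of_real (y - x) *\<^sub>C (G e x \<omega> * B \<omega> * G e x \<omega>)
        = (of_real (y - x))\<^sup>2 *\<^sub>C (G e y \<omega> * B \<omega> * G e x \<omega> * B \<omega> * G e x \<omega>)" for \<omega>
      using inverse_expand[OF ZG(1,2)[OF x] ZG(1,2)[OF y] Zx, of 1] unfolding mult_1_left .
    have "g e y - g e x - of_real (y - x) * m e x
        = tr N (\<lambda>\<omega>. G e y \<omega> - G e x \<omega> - of_real (y - x) *\<^sub>C (G e x \<omega> * B \<omega> * G e x \<omega>))"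
      unfolding g_def m[OF x] tr_scaleC[symmetric]
      by (simp only: tr_diff fam_diff fam_scaleC fam_times Gf x y B)
    also have "\<dots> = (of_real (y - x))\<^sup>2 * tr N (\<lambda>\<omega>. G e y \<omega> * B \<omega> * G e x \<omega> * B \<omega> * G e x \<omega>)"
      unfolding exp tr_scaleC ..
    also have "cmod \<dots> \<le> (y - x)\<^sup>2 * (real N * (r * \<beta> * r * \<beta> * r))"
      unfolding norm_mult norm_power norm_of_real power2_abs
      by (intro mult_mono tr_bound fam_times Gf B x y n2 nG \<beta>) (use r \<beta> in auto)
    finally show ?thesis by (simp only: mult.commute)
  qed
  have kx: "cmod (k e' x - k e x + of_real (e' - e) * m e x) \<le> (real N * (\<beta> * r * r * r)) * (e' - e)\<^sup>2"
    if x: "x \<in> {0..1}" for e e' x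
  proof -
    have D: "Z e x \<omega> - Z e' x \<omega> = of_real (e - e') *\<^sub>C 1" for \<omega>
    proof -
      have "Complex e (- s) - Complex e' (- s) = of_real (e - e')" by (simp add: complex_eq_iff)
      then show ?thesis by (simp add: Z_def scaleC_bop_distrib(4)[symmetric] del: of_real_diff)
    qed
    have exp: "B \<omega> * G e' x \<omega> - B \<omega> * G e x \<omega> - of_real (e - e') *\<^sub>C (B \<omega> * G e x \<omega> * G e x \<omega>)
        = (of_real (e - e'))\<^sup>2 *\<^sub>C (B \<omega> * G e' x \<omega> * G e x \<omega> * G e x \<omega>)" for \<omega>
      using inverse_expand[OF ZG(1,2)[OF x] ZG(1,2)[OF x] D, where A = "B \<omega>"] unfolding mult_1_right .
    have "k e' x - k e x - of_real (e - e') * m e x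
        = tr N (\<lambda>\<omega>. B \<omega> * G e' x \<omega> - B \<omega> * G e x \<omega> - of_real (e - e') *\<^sub>C (B \<omega> * G e x \<omega> * G e x \<omega>))"
      unfolding k_def m_def tr_scaleC[symmetric]
      by (simp only: tr_diff fam_diff fam_scaleC fam_times Gf x B)
    also have "\<dots> = (of_real (e - e'))\<^sup>2 * tr N (\<lambda>\<omega>. B \<omega> * G e' x \<omega> * G e x \<omega> * G e x \<omega>)"
      unfolding exp tr_scaleC ..
    also have "cmod \<dots> \<le> (e' - e)\<^sup>2 * (real N * (\<beta> * r * r * r))"
      unfolding norm_mult norm_power norm_of_real power2_abs power2_commute[of e e']
      by (intro mult_mono tr_bound fam_times Gf B x n2 nG \<beta>) (use r \<beta> in auto)
    also have "k e' x - k e x - of_real (e - e') * m e x = k e' x - k e x + of_real (e' - e) * m e x"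
      by (simp add: algebra_simps)
    finally show ?thesis by (simp only: mult.commute)
  qed
  have k_cont: "continuous_on {0..1} (k e)" for e
  proof (rule continuous_on_vector_derivative)
    fix x :: real assume x: "x \<in> {0..1}"
    let ?D = "tr N (\<lambda>\<omega>. B \<omega> * G e x \<omega> * B \<omega> * G e x \<omega>)"
    show "(k e has_vector_derivative ?D) (at x within {0..1})"
    proof (rule has_vector_derivative_quadratic)
      fix y :: real assume y: "y \<in> {0..1}"
      have exp: "B \<omega> * G e y \<omega> - B \<omega> * G e x \<omega> - of_real (y - x) *\<^sub>C (B \<omega> * G e x \<omega> * B \<omega> * G e x \<omega>)
          = (of_real (y - x))\<^sup>2 *\<^sub>C (B \<omega> * G e y \<omega> * B \<omega> * G e x \<omega> * B \<omega> * G e x \<omega>)" for \<omega>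
        by (rule inverse_expand[OF ZG(1,2)[OF x] ZG(1,2)[OF y] Zx])
      have "k e y - k e x - of_real (y - x) * ?D = tr N (\<lambda>\<omega>. B \<omega> * G e y \<omega> - B \<omega> * G e x \<omega>
          - of_real (y - x) *\<^sub>C (B \<omega> * G e x \<omega> * B \<omega> * G e x \<omega>))"
        unfolding k_def tr_scaleC[symmetric]
        by (simp only: tr_diff fam_diff fam_scaleC fam_times Gf x y B)
      also have "\<dots> = (of_real (y - x))\<^sup>2 * tr N (\<lambda>\<omega>. B \<omega> * G e y \<omega> * B \<omega> * G e x \<omega> * B \<omega> * G e x \<omega>)"
        unfolding exp tr_scaleC ..
      also have "cmod \<dots> \<le> (y - x)\<^sup>2 * (real N * (\<beta> * r * \<beta> * r * \<beta> * r))"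
        unfolding norm_mult norm_power norm_of_real power2_abs
        by (intro mult_mono tr_bound fam_times Gf B x y n2 nG \<beta>) (use r \<beta> in auto)
      finally show "cmod (k e y - k e x - of_real (y - x) * ?D)
          \<le> (real N * (\<beta> * r * \<beta> * r * \<beta> * r)) * (y - x)\<^sup>2"
        by (simp only: mult.commute)
    qed
  qed
  then have k_int: "k e integrable_on {0..1}" for e by (rule integrable_continuous_real)
  then show "k e integrable_on {0..1}" .
  have m_int: "(m e has_integral (g e 1 - g e 0)) {0..1}" for e
    by (rule fundamental_theorem_of_calculus) (auto intro!: has_vector_derivative_quadratic[OF gx])
  define \<Psi> where "\<Psi> e = integral {0..1} (k e)" for e
  \<comment> \<open>Differentiation under the integral over x: the quadratic error in
    \<open>kx\<close> is uniform in x, and the integral of m over the path is the difference of g at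
    its ends.\<close>
  have "(\<Psi> has_vector_derivative - (g e 1 - g e 0)) (at e within {a..b})" for e
  proof (rule has_vector_derivative_quadratic)
    fix e'
    have i: "((\<lambda>x. k e' x - k e x + of_real (e' - e) * m e x) has_integral
        (\<Psi> e' - \<Psi> e + of_real (e' - e) * (g e 1 - g e 0))) {0..1}"
      unfolding \<Psi>_def
      by (intro has_integral_add has_integral_diff has_integral_mult_right m_int integrable_integral k_int)
    have "cmod (\<Psi> e' - \<Psi> e + of_real (e' - e) * (g e 1 - g e 0))
        \<le> (real N * (\<beta> * r * r * r)) * (e' - e)\<^sup>2 * measure lborel (cbox 0 (1::real))"
      by (rule has_integral_bound[where f = "\<lambda>x. k e' x - k e x + of_real (e' - e) * m e x"])
         (use i kx r \<beta> in auto)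
    then show "cmod (\<Psi> e' - \<Psi> e - of_real (e' - e) * - (g e 1 - g e 0)) \<le> (real N * (\<beta> * r * r * r)) * (e' - e)\<^sup>2"
      unfolding mult_minus_right diff_minus_eq_add by simp
  qed
  then have "((\<lambda>e. - (g e 1 - g e 0)) has_integral \<Psi> b - \<Psi> a) {a..b}"
    by (intro fundamental_theorem_of_calculus ab)
  from has_integral_neg[OF this]
  show "((\<lambda>e. g e 1 - g e 0) has_integral (integral {0..1} (k a) - integral {0..1} (k b))) {a..b}"
    by (simp add: \<Psi>_def)
qed

end

lemma lay_ket: "lay S *\<^sub>V ket j = (if fst j \<in> S then ket j else 0)"
  by (cases j) (auto intro!: ell2_eqI simp: lay_apply restrict_ell2.rep_eq ell2_rep)

lemma lay_idem_apply: "lay S *\<^sub>V lay S *\<^sub>V u = lay S *\<^sub>V u"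
  using times_apply[OF lay_times[of S S]] by simp

text \<open>The hypotheses of \<open>herglotz_primitive\<close> for one diagonal element, with p =
  1. All three come from the single equation Z w = \<open>ket (n, a)\<close>, paired with w, paired
  with the component y of w outside the layers S, or projected onto S.\<close>

lemma layer_resolvent_bounds:
  fixes H :: "('k \<times> 'i) bop"
  assumes H: "adj H = H" "norm H \<le> K" and s: "0 < s" "Im z = - s" and \<kappa>: "0 \<le> Im \<kappa>"
    and G: "(z *\<^sub>C 1 - H - \<kappa> *\<^sub>C lay S) * G = 1" and n: "n \<in> S"
  shows "0 \<le> Im (mel (n, a) G (n, a))" "0 < Im \<kappa> \<Longrightarrow> cmod (mel (n, a) G (n, a)) \<le> 1 / Im \<kappa>"
    "cmod z + K + K * K / s < cmod \<kappa> \<Longrightarrow>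
      cmod (mel (n, a) G (n, a)) \<le> 1 / (cmod \<kappa> - (cmod z + K + K * K / s))"
proof -
  define w where "w = G *\<^sub>V ket (n, a)"
  define v where "v = lay S *\<^sub>V w"
  define y where "y = w - v"
  define q where "q = mel (n, a) G (n, a)"
  have q: "q = cinner (ket (n, a)) w" by (simp add: q_def w_def mel_def)
  have Pk: "lay S *\<^sub>V ket (n, a) = ket (n, a)" using n by (simp add: lay_ket)
  have sw: "cinner (lay S *\<^sub>V u) u' = cinner u (lay S *\<^sub>V u')" for u u' :: "('k \<times> 'i) ell2"
    by (rule sa_cinner[OF adj_lay])
  have Zw: "z *\<^sub>C w - H *\<^sub>V w - \<kappa> *\<^sub>C v = ket (n, a)"
    using times_apply[OF G, of "ket (n, a)"] by (simp add: w_def v_def)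
  have "cinner w (ket (n, a)) = cnj q" by (simp add: q cinner_commute)
  then have "Im q = - Im (cinner w (z *\<^sub>C w - H *\<^sub>V w - \<kappa> *\<^sub>C v))" by (simp add: Zw)
  also have "\<dots> = s * (norm w)\<^sup>2 + Im \<kappa> * (norm v)\<^sup>2"
    using Im_cinner_lay[of w \<kappa> S] by (simp add: cinner_simps sa_Im[OF H(1)] s cinner_self v_def)
  finally have Imq: "Im q = s * (norm w)\<^sup>2 + Im \<kappa> * (norm v)\<^sup>2" .
  then show "0 \<le> Im (mel (n, a) G (n, a))" using s \<kappa> by (simp add: q_def[symmetric])
  have "q = cinner (ket (n, a)) v" using sw[of "ket (n, a)" w] by (simp add: q v_def Pk)
  then have qv: "cmod q \<le> norm v" using cmod_cinner_le[of "ket (n, a)" v] by (simp add: norm_ket)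
  show "cmod (mel (n, a) G (n, a)) \<le> 1 / Im \<kappa>" if "0 < Im \<kappa>"
  proof -
    have "Im \<kappa> * (norm v)\<^sup>2 \<le> Im q" using Imq s by simp
    also have "\<dots> \<le> norm v" using abs_Im_le_cmod[of q] qv by simp
    finally have "(Im \<kappa> * norm v) * norm v \<le> 1 * norm v" by (simp add: power2_eq_square)
    then have "Im \<kappa> * norm v \<le> 1" by (cases "norm v = 0") (auto simp: mult_le_cancel_right)
    then have "norm v \<le> 1 / Im \<kappa>" using that by (simp add: field_simps)
    then show ?thesis using qv by (simp add: q_def)
  qed
  have nH: "norm (H *\<^sub>V u) \<le> K * norm u" for u
    using norm_bop_apply[of H u] mult_right_mono[OF H(2), of "norm u"] by simp
  have K0: "0 \<le> K" using H(2) norm_ge_zero order_trans by blast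
  have Pv: "lay S *\<^sub>V v = v" by (simp add: v_def lay_idem_apply)
  have Py: "lay S *\<^sub>V y = 0" by (simp add: y_def bop_lin Pv) (simp add: v_def)
  have yv: "cinner y v = 0" using sw[of y v] by (simp add: Pv Py)
  \<comment> \<open>The coupling \<kappa> drops out of the part outside S. The imaginary part of
    what remains bounds y by v, as in a Schur complement: s times the norm of y is at most K times
    the norm of v.\<close>
  have "cinner y (ket (n, a)) = 0" using sw[of y "ket (n, a)"] by (simp add: Pk Py)
  then have "cinner y (z *\<^sub>C w - H *\<^sub>V w - \<kappa> *\<^sub>C v) = 0" by (simp add: Zw)
  moreover have w: "w = y + v" by (simp add: y_def)
  ultimately have "z * cinner y y - cinner y (H *\<^sub>V y) - cinner y (H *\<^sub>V v) = 0"
    by (simp add: cinner_simps bop_lin yv)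
  then have "Im (z * cinner y y - cinner y (H *\<^sub>V y) - cinner y (H *\<^sub>V v)) = 0"
    by (simp only: zero_complex.sel)
  then have "s * (norm y)\<^sup>2 = - Im (cinner y (H *\<^sub>V v))"
    by (simp add: cinner_self sa_Im[OF H(1)] s)
  also have "\<dots> \<le> norm y * (K * norm v)"
    using abs_Im_le_cmod[of "cinner y (H *\<^sub>V v)"] cmod_cinner_le[of y "H *\<^sub>V v"]
      mult_left_mono[OF nH[of v], of "norm y"] by simp
  finally have "(s * norm y) * norm y \<le> (K * norm v) * norm y" by (simp add: power2_eq_square ac_simps)
  then have sy: "s * norm y \<le> K * norm v"
    using K0 by (cases "norm y = 0") (auto simp: mult_le_cancel_right)
  then have y: "norm y \<le> K / s * norm v" using s by (simp add: field_simps)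
  have e1: "lay S *\<^sub>V (z *\<^sub>C w - H *\<^sub>V w - \<kappa> *\<^sub>C v) = z *\<^sub>C v - lay S *\<^sub>V H *\<^sub>V w - \<kappa> *\<^sub>C v"
    by (simp only: bop_lin Pv v_def[symmetric])
  have "\<kappa> *\<^sub>C v = (z *\<^sub>C v - lay S *\<^sub>V H *\<^sub>V w) - (z *\<^sub>C v - lay S *\<^sub>V H *\<^sub>V w - \<kappa> *\<^sub>C v)"
  proof -
    have "b = a - (a - b)" for a b :: "('k \<times> 'i) ell2" by simp
    then show ?thesis .
  qed
  also have "\<dots> = z *\<^sub>C v - lay S *\<^sub>V H *\<^sub>V w - ket (n, a)"
    unfolding e1[symmetric] Zw Pk ..
  finally have "norm (\<kappa> *\<^sub>C v) \<le> norm (z *\<^sub>C v) + norm (lay S *\<^sub>V H *\<^sub>V w) + norm (ket (n, a))"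
    using norm_triangle_ineq4[of "z *\<^sub>C v - lay S *\<^sub>V H *\<^sub>V w" "ket (n, a)"]
      norm_triangle_ineq4[of "z *\<^sub>C v" "lay S *\<^sub>V H *\<^sub>V w"] by simp
  then have "cmod \<kappa> * norm v \<le> cmod z * norm v + norm (lay S *\<^sub>V H *\<^sub>V w) + 1"
    by (simp add: norm_scaleC_ell2 norm_ket)
  also have "norm (lay S *\<^sub>V H *\<^sub>V w) \<le> K * norm w" using norm_lay_apply_le nH by (rule order_trans)
  also have "K * norm w \<le> K * (K / s * norm v + norm v)"
    using K0 w norm_triangle_ineq[of y v] y by (intro mult_left_mono) auto
  finally have le: "(cmod \<kappa> - (cmod z + K + K * K / s)) * norm v \<le> 1" by (simp add: algebra_simps)
  show "cmod (mel (n, a) G (n, a)) \<le> 1 / (cmod \<kappa> - (cmod z + K + K * K / s))"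
    if "cmod z + K + K * K / s < cmod \<kappa>"
  proof -
    have "norm v \<le> 1 / (cmod \<kappa> - (cmod z + K + K * K / s))"
      using le that by (simp add: pos_le_divide_eq mult.commute)
    then show ?thesis using qv by (simp add: q_def)
  qed
qed

context covariant_system begin

lemma tr_lay:
  assumes "S \<subseteq> {1..N}"
  shows "tr N (\<lambda>\<omega>. lay S * X \<omega>) = (\<Sum>n\<in>S. LINT \<omega>|P. mel (n, 0) (X \<omega>) (n, 0))"
  unfolding tr_def mel_lay_times
  by (rule sum.mono_neutral_cong_right) (use assms in auto)

text \<open>Summing the bounds for single elements over S gives p = card S, with no dependence on N,
  e or s: only the number of perturbed layers counts.\<close>

lemma lay_herglotz:
  fixes e :: real
  assumes H: "fam P \<tau> H" "\<And>\<omega>. adj (H \<omega>) = H \<omega>" and s: "0 < s" and S: "S \<subseteq> {1..N}"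
  defines "h \<equiv> \<lambda>\<kappa>. tr N (\<lambda>\<omega>. lay S * bop_inv (Complex e (- s) *\<^sub>C 1 - H \<omega> - \<kappa> *\<^sub>C lay S))"
  obtains Q where "\<And>\<kappa>. - s < Im \<kappa> \<Longrightarrow> (Q has_field_derivative h \<kappa>) (at \<kappa>)"
    "\<And>a b. 0 \<le> Im a \<Longrightarrow> 0 \<le> Im b \<Longrightarrow> \<bar>Im (Q b) - Im (Q a)\<bar> \<le> 4 * real (card S)"
proof -
  define z where "z = Complex e (- s)"
  define Z where "Z \<kappa> \<omega> = z *\<^sub>C 1 - H \<omega> - \<kappa> *\<^sub>C lay S" for \<kappa> \<omega>
  define G where "G \<kappa> \<omega> = bop_inv (Z \<kappa> \<omega>)" for \<kappa> \<omega>
  have h: "h \<kappa> = tr N (\<lambda>\<omega>. lay S * G \<kappa> \<omega>)" for \<kappa> by (simp add: h_def G_def Z_def z_def)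
  have Zf: "fam P \<tau> (Z \<kappa>)" for \<kappa> unfolding Z_def by (intro fam_diff fam_scaleC fam_one fam_lay H)
  \<comment> \<open>For Im \<kappa> < 0 the term with \<kappa> takes away at most |Im \<kappa>| of
    the dissipation s, so the operator stays dissipative as long as Im \<kappa> > -s. This open
    half-plane is the domain of holomorphy required for the primitive.\<close>
  have dZ: "dissip \<delta> (Z \<kappa> \<omega>)" if "\<delta> \<le> s" "\<delta> \<le> s + Im \<kappa>" for \<delta> \<kappa> \<omega>
    unfolding dissip_def
  proof
    fix u :: "(nat \<times> 'z) ell2"
    define v where "v = norm (lay S *\<^sub>V u)"
    have "Im (cinner u (Z \<kappa> \<omega> *\<^sub>V u)) = - s * (norm u)\<^sup>2 - Im \<kappa> * v\<^sup>2"
      using Im_cinner_lay[of u \<kappa> S] by (simp add: Z_def z_def cinner_simps sa_Im[OF H(2)] cinner_self v_def)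
    also have "\<dots> \<le> - \<delta> * (norm u)\<^sup>2"
    proof -
      have "v\<^sup>2 \<le> (norm u)\<^sup>2" unfolding v_def by (intro power_mono norm_lay_apply_le) auto
      moreover have "(\<delta> - s) * (norm u)\<^sup>2 \<le> Im \<kappa> * v\<^sup>2"
      proof (cases "0 \<le> Im \<kappa>")
        case True
        then show ?thesis using that by (intro order_trans[OF mult_nonpos_nonneg]) auto
      next
        case False
        have "(\<delta> - s) * (norm u)\<^sup>2 \<le> Im \<kappa> * (norm u)\<^sup>2" using that by (intro mult_right_mono) auto
        also have "\<dots> \<le> Im \<kappa> * v\<^sup>2" using False \<open>v\<^sup>2 \<le> (norm u)\<^sup>2\<close> by (intro mult_left_mono_neg) auto
        finally show ?thesis .
      qed
      ultimately show ?thesis by (simp add: left_diff_distrib)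
    qed
    finally show "Im (cinner u (Z \<kappa> \<omega> *\<^sub>V u)) \<le> - \<delta> * (norm u)\<^sup>2" .
  qed
  have Gf: "fam P \<tau> (G \<kappa>)" if "- s < Im \<kappa>" for \<kappa>
    unfolding G_def
    by (rule fam_dissip_inv[OF Zf, of "min s (s + Im \<kappa>)"]) (use that s in \<open>auto intro: dZ\<close>)
  obtain K where K: "0 < K" "\<And>\<omega>. norm (H \<omega>) \<le> K" using fam_bound[OF H(1)] by metis
  define M where "M = cmod z + K + K * K / s"
  have ZG: "Z \<kappa> \<omega> * G \<kappa> \<omega> = 1" if "0 \<le> Im \<kappa>" for \<kappa> \<omega>
    unfolding G_def by (rule dissip_inv(1)[OF s dZ]) (use that in auto)
  have Imz: "Im z = - s" by (simp add: z_def)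
  note lrb = layer_resolvent_bounds[OF H(2) K(2) s Imz _ ZG[unfolded Z_def]]
  have hs: "h \<kappa> = (\<Sum>n\<in>S. LINT \<omega>|P. mel (n, 0) (G \<kappa> \<omega>) (n, 0))" for \<kappa>
    unfolding h by (rule tr_lay[OF S])
  have hb: "cmod (h \<kappa>) \<le> real (card S) / r"
    if "- s < Im \<kappa>" "\<And>n \<omega>. n \<in> S \<Longrightarrow> cmod (mel (n, 0) (G \<kappa> \<omega>) (n, 0)) \<le> 1 / r" for \<kappa> r
  proof -
    have "cmod (h \<kappa>) \<le> (\<Sum>n\<in>S. 1 / r)"
      unfolding hs by (intro order_trans[OF norm_sum] sum_mono cmod_integral_mel_le Gf that)
    then show ?thesis by simp
  qed
  show thesis
  proof (rule herglotz_primitive[OF s, of h "real (card S)" M])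
    show "h holomorphic_on {\<zeta>. - s < Im \<zeta>}"
    proof (rule holomorphic_onI)
      fix \<kappa> assume "\<kappa> \<in> {\<zeta>. - s < Im \<zeta>}"
      then have \<kappa>: "- s < Im \<kappa>" by simp
      \<comment> \<open>Half of the available dissipation, so that a whole disc around \<kappa>
        keeps at least this much.\<close>
      define \<delta> where "\<delta> = min s (s + Im \<kappa>) / 2"
      have \<delta>: "0 < \<delta>" "\<delta> \<le> s / 2" "\<delta> \<le> (s + Im \<kappa>) / 2" using \<kappa> s by (auto simp: \<delta>_def)
      have near: "dissip \<delta> (Z (\<kappa> + \<eta>) \<omega>)" "- s < Im (\<kappa> + \<eta>)" if "cmod \<eta> < \<delta>" for \<eta> \<omega>
      proof -
        have "\<bar>Im \<eta>\<bar> < \<delta>" using that abs_Im_le_cmod[of \<eta>] by linarith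
        then have 1: "\<delta> \<le> s" "\<delta> \<le> s + Im (\<kappa> + \<eta>)" using \<delta> by auto
        then show "dissip \<delta> (Z (\<kappa> + \<eta>) \<omega>)" by (rule dZ)
        show "- s < Im (\<kappa> + \<eta>)" using 1 \<delta> by linarith
      qed
      note ZGn = dissip_inv[OF \<delta>(1) near(1), folded G_def]
      have Z0: "cmod 0 < \<delta>" using \<delta> by simp
      note ZG0 = ZGn[OF Z0, simplified]
      define m where "m = tr N (\<lambda>\<omega>. lay S * G \<kappa> \<omega> * lay S * G \<kappa> \<omega>)"
      have n2: "norm (X * Y) \<le> c * d" if "norm X \<le> c" "norm Y \<le> d" "0 \<le> c" for X Y :: "(nat \<times> 'z) bop" and c d
        using that by (intro order_trans[OF norm_mult_ineq] mult_mono) auto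
      have "(h has_field_derivative m) (at \<kappa>)"
      proof (rule has_field_derivative_quadratic[OF \<delta>(1)])
        fix \<eta> assume \<eta>: "cmod \<eta> < \<delta>"
        have D: "Z \<kappa> \<omega> - Z (\<kappa> + \<eta>) \<omega> = \<eta> *\<^sub>C lay S" for \<omega>
          by (simp add: Z_def scaleC_bop_distrib(3))
        have exp: "lay S * G (\<kappa> + \<eta>) \<omega> - lay S * G \<kappa> \<omega> - \<eta> *\<^sub>C (lay S * G \<kappa> \<omega> * lay S * G \<kappa> \<omega>)
            = \<eta>\<^sup>2 *\<^sub>C (lay S * G (\<kappa> + \<eta>) \<omega> * lay S * G \<kappa> \<omega> * lay S * G \<kappa> \<omega>)" for \<omega>
          by (rule inverse_expand[OF ZG0(1,2) ZGn(1,2)[OF \<eta>] D])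
        have "h (\<kappa> + \<eta>) - h \<kappa> - \<eta> * m = tr N (\<lambda>\<omega>. lay S * G (\<kappa> + \<eta>) \<omega> - lay S * G \<kappa> \<omega>
            - \<eta> *\<^sub>C (lay S * G \<kappa> \<omega> * lay S * G \<kappa> \<omega>))"
          unfolding h m_def tr_scaleC[symmetric]
          by (simp only: tr_diff fam_diff fam_scaleC fam_times fam_lay Gf \<kappa> near(2)[OF \<eta>])
        also have "\<dots> = \<eta>\<^sup>2 * tr N (\<lambda>\<omega>. lay S * G (\<kappa> + \<eta>) \<omega> * lay S * G \<kappa> \<omega> * lay S * G \<kappa> \<omega>)"
          unfolding exp tr_scaleC ..
        also have "cmod \<dots> \<le> (cmod \<eta>)\<^sup>2 * (real N * (1 * (1 / \<delta>) * 1 * (1 / \<delta>) * 1 * (1 / \<delta>)))"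
          unfolding norm_mult norm_power
          by (intro mult_mono tr_bound fam_times fam_lay Gf \<kappa> near(2)[OF \<eta>] n2 norm_lay_le ZG0(3) ZGn(3)[OF \<eta>])
             (use \<delta> in auto)
        finally show "cmod (h (\<kappa> + \<eta>) - h \<kappa> - \<eta> * m)
            \<le> (real N * (1 * (1 / \<delta>) * 1 * (1 / \<delta>) * 1 * (1 / \<delta>))) * (cmod \<eta>)\<^sup>2"
          by (simp only: mult.commute)
      qed
      then show "h field_differentiable at \<kappa> within {\<zeta>. - s < Im \<zeta>}"
        by (meson field_differentiable_at_within field_differentiable_def)
    qed
    show "0 \<le> Im (h \<kappa>)" if \<kappa>: "0 \<le> Im \<kappa>" for \<kappa>
    proof -
      have "Im (LINT \<omega>|P. mel (n, 0) (G \<kappa> \<omega>) (n, 0)) = (LINT \<omega>|P. Im (mel (n, 0) (G \<kappa> \<omega>) (n, 0)))" for n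
        using \<kappa> s by (intro integral_Im[symmetric] integrable_mel Gf) simp
      then show ?thesis unfolding hs Im_sum
        using lrb(1)[OF \<kappa> \<kappa>] by (auto intro!: sum_nonneg integral_nonneg)
    qed
    show "cmod (h \<kappa>) \<le> real (card S) / Im \<kappa>" if \<kappa>: "0 < Im \<kappa>" for \<kappa>
      by (rule hb) (use \<kappa> s lrb(2)[OF less_imp_le[OF \<kappa>] less_imp_le[OF \<kappa>] _ \<kappa>] in auto)
    show "cmod (h \<kappa>) \<le> real (card S) / (cmod \<kappa> - M)" if \<kappa>: "0 \<le> Im \<kappa>" "M < cmod \<kappa>" for \<kappa>
      by (rule hb) (use \<kappa> s lrb(3)[OF \<kappa>(1) \<kappa>(1) _ \<kappa>(2)[unfolded M_def]] in \<open>auto simp: M_def\<close>)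
  qed (rule that)
qed

text \<open>Along the straight path x c in the coupling, the integrand of a boundary term is the
  derivative of Q (x c), so the term equals Q c - Q 0, with imaginary part at most 4 card S in
  modulus. The two ends a and b of the energy interval give the factor 8.\<close>

lemma path_lay:
  assumes H: "fam P \<tau> H" "\<And>\<omega>. adj (H \<omega>) = H \<omega>" and s: "0 < s" and S: "S \<subseteq> {1..N}"
    and comm: "\<And>\<omega>. lay {1..N} * H \<omega> = H \<omega> * lay {1..N}" and c: "0 \<le> Im c" and ab: "a \<le> b"
  obtains I where "((\<lambda>e. tr N (\<lambda>\<omega>. bop_inv (Complex e (- s) *\<^sub>C 1 - H \<omega> - c *\<^sub>C lay S))
      - tr N (\<lambda>\<omega>. bop_inv (Complex e (- s) *\<^sub>C 1 - H \<omega>))) has_integral I) {a..b}"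
    "\<bar>Im I\<bar> \<le> 8 * real (card S)"
proof -
  define B where "B \<omega> = c *\<^sub>C (lay S :: (nat \<times> 'z) bop)" for \<omega> :: 'w
  define k where "k e x = tr N (\<lambda>\<omega>. B \<omega> * bop_inv (Complex e (- s) *\<^sub>C 1 - H \<omega> - x *\<^sub>R B \<omega>))" for e x
  have Bf: "fam P \<tau> B" unfolding B_def by (intro fam_scaleC fam_lay)
  have xB: "x *\<^sub>R B \<omega> = (of_real x * c) *\<^sub>C lay S" for x \<omega> by (simp add: B_def scaleR_scaleC_bop)
  have "lay {1..N} * lay S = (lay S :: (nat \<times> 'z) bop)" "lay S * lay {1..N} = (lay S :: (nat \<times> 'z) bop)"
    using S by (auto simp: lay_times Int_absorb1 Int_absorb2)
  then have "((\<lambda>e. tr N (\<lambda>\<omega>. bop_inv (Complex e (- s) *\<^sub>C 1 - H \<omega> - 1 *\<^sub>R B \<omega>))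
      - tr N (\<lambda>\<omega>. bop_inv (Complex e (- s) *\<^sub>C 1 - H \<omega> - 0 *\<^sub>R B \<omega>))) has_integral
      (integral {0..1} (k a) - integral {0..1} (k b))) {a..b}"
    unfolding k_def
  proof (intro path_integral(1)[OF H(1) Bf s _ _ comm _ ab])
    fix e x \<omega> assume x: "0 \<le> x" "x \<le> (1::real)"
    show "dissip s (Complex e (- s) *\<^sub>C 1 - H \<omega> - x *\<^sub>R B \<omega>)"
    proof (rule dissip_sub[OF H(2)])
      show "0 \<le> Im (cinner u ((x *\<^sub>R B \<omega>) *\<^sub>V u))" for u
        unfolding xB Im_cinner_lay using x c by simp
    qed simp
  qed (simp_all add: B_def del: One_nat_def)
  then have int: "((\<lambda>e. tr N (\<lambda>\<omega>. bop_inv (Complex e (- s) *\<^sub>C 1 - H \<omega> - c *\<^sub>C lay S))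
      - tr N (\<lambda>\<omega>. bop_inv (Complex e (- s) *\<^sub>C 1 - H \<omega>))) has_integral
      (integral {0..1} (k a) - integral {0..1} (k b))) {a..b}"
    by (simp add: B_def)
  have bound: "\<bar>Im (integral {0..1} (k e))\<bar> \<le> 4 * real (card S)" for e
  proof -
    define h where "h \<kappa> = tr N (\<lambda>\<omega>. lay S * bop_inv (Complex e (- s) *\<^sub>C 1 - H \<omega> - \<kappa> *\<^sub>C lay S))" for \<kappa>
    obtain Q where Q: "\<And>\<kappa>. - s < Im \<kappa> \<Longrightarrow> (Q has_field_derivative h \<kappa>) (at \<kappa>)"
      "\<And>a b. 0 \<le> Im a \<Longrightarrow> 0 \<le> Im b \<Longrightarrow> \<bar>Im (Q b) - Im (Q a)\<bar> \<le> 4 * real (card S)"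
      unfolding h_def using lay_herglotz[OF H s S] by metis
    have k: "k e x = c * h (of_real x * c)" for x
      unfolding k_def xB unfolding h_def B_def tr_scaleC[symmetric] by simp
    have "((\<lambda>x. Q (of_real x * c)) has_vector_derivative k e x) (at x within {0..1})"
      if "x \<in> {0..1}" for x
    proof -
      have "((\<lambda>x. of_real x * c) has_vector_derivative c) (at x within {0..1})"
        by (auto intro!: derivative_eq_intros has_vector_derivative_mult_left simp: has_vector_derivative_of_real)
      then have "((Q \<circ> (\<lambda>x. of_real x * c)) has_vector_derivative c * h (of_real x * c)) (at x within {0..1})"
        by (rule field_vector_diff_chain_within[OF _ has_field_derivative_at_within[OF Q(1)]])
           (use that c s in \<open>auto intro: less_le_trans[of _ 0]\<close>)
      then show ?thesis by (simp add: k o_def)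
    qed
    then have "(k e has_integral (Q (of_real 1 * c) - Q (of_real 0 * c))) {0..1}"
      by (intro fundamental_theorem_of_calculus) auto
    then have "integral {0..1} (k e) = Q c - Q 0" by (simp add: integral_unique)
    then show ?thesis using Q(2)[of 0 c] c by simp
  qed
  show thesis
    by (rule that[OF int]) (use bound[of a] bound[of b] in simp)
qed

end

subsection \<open>The density of states measure\<close>

lemma Complex_minus_of_real: "Complex e t - of_real x = Complex (e - x) t"
  by (simp add: complex_eq_iff)

lemma cmod_ge_Im: "\<bar>t\<bar> \<le> cmod (Complex x t)"
  using abs_Im_le_cmod[of "Complex x t"] by simp

lemma resolvent_lipschitz:
  assumes s: "0 < s"
  shows "cmod (1 / Complex y (- s) - 1 / Complex x (- s)) \<le> 1 / s\<^sup>2 * \<bar>y - x\<bar>"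
proof -
  have n: "s \<le> cmod (Complex x (- s))" for x using cmod_ge_Im[of "- s" x] s by simp
  have ne: "Complex x (- s) \<noteq> 0" for x using s by (simp add: complex_eq_iff)
  have "1 / Complex y (- s) - 1 / Complex x (- s) = (Complex x (- s) - Complex y (- s)) / (Complex y (- s) * Complex x (- s))"
    using ne by (simp add: diff_frac_eq)
  also have "Complex x (- s) - Complex y (- s) = of_real (x - y)" by (simp add: complex_eq_iff)
  also have "cmod (of_real (x - y) / (Complex y (- s) * Complex x (- s)))
      = \<bar>x - y\<bar> / (cmod (Complex y (- s)) * cmod (Complex x (- s)))"
    by (simp only: norm_divide norm_mult norm_of_real)
  also have "\<dots> \<le> \<bar>x - y\<bar> / (s * s)"
    using s n[of x] n[of y] by (intro divide_left_mono mult_mono mult_pos_pos) auto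
  finally show ?thesis by (simp add: power2_eq_square abs_minus_commute)
qed

text \<open>On the spectral subspace between a and b the form of H - a lies between 0 and b - a;
  \<open>psd_norm_sq_le\<close> upgrades this form bound to a norm bound.\<close>

lemma spec_interval_norm:
  fixes u :: "'i ell2"
  assumes H: "adj H = H" and ab: "a \<le> b"
  defines "w \<equiv> spec_fam H b *\<^sub>V u - spec_fam H a *\<^sub>V u"
  shows "norm (H *\<^sub>V w - a *\<^sub>R w) \<le> (b - a) * norm w"
proof (cases "a = b")
  case True
  then have "w = 0" by (simp add: w_def)
  then show ?thesis by simp
next
  case False
  define q where "q = spec_fam H b - spec_fam H a"
  have q: "adj q = q" by (simp add: q_def spec_fam(1)[OF H])
  have qv: "spec_fam H b *\<^sub>V q *\<^sub>V v = q *\<^sub>V v" "spec_fam H a *\<^sub>V q *\<^sub>V v = 0" for v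
    using spec_fam_proj(3,4)[OF H ab] by (auto simp: q_def)
  have qq: "q *\<^sub>V q *\<^sub>V v = q *\<^sub>V v" for v
    using qv[of v] by (metis q_def bop_apply_simps(2) diff_zero)
  have nq: "norm (q *\<^sub>V v) \<le> norm v" for v
  proof -
    have "(norm (q *\<^sub>V v))\<^sup>2 = Re (cinner v (q *\<^sub>V v))" using sa_norm_sq[OF q, of v] by (simp add: qq)
    also have "\<dots> \<le> norm v * norm (q *\<^sub>V v)" using Re_cinner_le[of v "q *\<^sub>V v"] by simp
    finally have "norm (q *\<^sub>V v) * norm (q *\<^sub>V v) \<le> norm v * norm (q *\<^sub>V v)" by (simp add: power2_eq_square)
    then show ?thesis by (cases "norm (q *\<^sub>V v) = 0") (auto simp: mult_le_cancel_right)
  qed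
  have comm: "q * H = H * q" by (simp add: q_def left_diff_distrib right_diff_distrib spec_fam_commute(1)[OF H])
  define T where "T = q * (H - a *\<^sub>R 1) * q"
  have T: "adj T = T" by (simp add: T_def q H mult.assoc)
  have Tv: "Re (cinner v (T *\<^sub>V v)) = Re (cinner (q *\<^sub>V v) (H *\<^sub>V q *\<^sub>V v)) - a * (norm (q *\<^sub>V v))\<^sup>2" for v
  proof -
    have "cinner v (T *\<^sub>V v) = cinner (q *\<^sub>V v) (H *\<^sub>V q *\<^sub>V v - a *\<^sub>R (q *\<^sub>V v))"
      using sa_cinner[OF q, of v "H *\<^sub>V q *\<^sub>V v - a *\<^sub>R (q *\<^sub>V v)"] by (simp add: T_def)
    then show ?thesis by (simp add: cinner_diff_right cinner_scaleR_right)
  qed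
  note ib = spec_fam_interval_bounds[OF H ab qv]
  have f1: "(norm (T *\<^sub>V w))\<^sup>2 \<le> (b - a) * Re (cinner w (T *\<^sub>V w))"
  proof (rule psd_norm_sq_le[OF T])
    show "0 \<le> Re (cinner v (T *\<^sub>V v))" for v using ib(1)[of v] by (simp add: Tv)
    show "Re (cinner v (T *\<^sub>V v)) \<le> (b - a) * (norm v)\<^sup>2" for v
    proof -
      have "Re (cinner v (T *\<^sub>V v)) \<le> (b - a) * (norm (q *\<^sub>V v))\<^sup>2"
        using ib(2)[of v] by (simp add: Tv left_diff_distrib)
      also have "\<dots> \<le> (b - a) * (norm v)\<^sup>2" using ab nq by (intro mult_left_mono power_mono) auto
      finally show ?thesis .
    qed
  qed (use ab False in auto)
  have wq: "q *\<^sub>V w = w" using qq[of u] by (simp add: w_def q_def)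
  then have Tw: "T *\<^sub>V w = H *\<^sub>V w - a *\<^sub>R w"
    using commute_apply[OF comm, of w] by (simp add: T_def bop_lin)
  have "Re (cinner w (T *\<^sub>V w)) \<le> (b - a) * (norm w)\<^sup>2"
    using ib(2)[of w] by (simp add: Tv wq left_diff_distrib)
  then have f2: "(b - a) * Re (cinner w (T *\<^sub>V w)) \<le> (b - a) * ((b - a) * (norm w)\<^sup>2)"
    using ab by (intro mult_left_mono) auto
  have f3: "(b - a) * ((b - a) * (norm w)\<^sup>2) = ((b - a) * norm w)\<^sup>2"
    by (simp only: power_mult_distrib power2_eq_square[of "b - a"] mult.assoc)
  have "(norm (T *\<^sub>V w))\<^sup>2 \<le> ((b - a) * norm w)\<^sup>2"
    using order_trans[OF f1 f2] unfolding f3 .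
  then have "(norm (H *\<^sub>V w - a *\<^sub>R w))\<^sup>2 \<le> ((b - a) * norm w)\<^sup>2" unfolding Tw .
  then show ?thesis by (rule power2_le_imp_le) (use ab in simp)
qed

text \<open>The increment of <u, F G u> is <w, G w>, and G (H - a) w = \<zeta> G w - w with \<zeta>
  = z - a. One factor 1/s is the norm of G, the other bounds 1/\<zeta>, and the length b - a comes
  from \<open>spec_interval_norm\<close>.\<close>

lemma resolvent_stieltjes_step:
  fixes e :: real
  assumes H: "adj H = H" and s: "0 < s" and ab: "a \<le> b"
  defines "F \<equiv> spec_fam H" and "G \<equiv> bop_inv (Complex e (- s) *\<^sub>C 1 - H)"
  shows "cmod (cinner u ((F b * G) *\<^sub>V u) - cinner u ((F a * G) *\<^sub>V u)
      - 1 / Complex (e - a) (- s) * of_real (Re (cinner u (F b *\<^sub>V u)) - Re (cinner u (F a *\<^sub>V u))))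
    \<le> 1 / s\<^sup>2 * (b - a) * (Re (cinner u (F b *\<^sub>V u)) - Re (cinner u (F a *\<^sub>V u)))"
proof -
  define z where "z = Complex e (- s)"
  define Z where "Z = z *\<^sub>C 1 - H"
  have "dissip s (Complex e (- s) *\<^sub>C 1 - H - 0)" by (rule dissip_sub[OF H]) auto
  then have ZG: "Z * G = 1" "G * Z = 1" "norm G \<le> 1 / s"
    using dissip_inv[OF s, of Z] by (simp_all add: Z_def z_def G_def)
  have comm: "F x * G = G * F x" for x
    by (rule inverse_commute[OF ZG(1,2)])
       (simp add: Z_def F_def left_diff_distrib right_diff_distrib spec_fam_commute(1)[OF H])
  define w where "w = F b *\<^sub>V u - F a *\<^sub>V u"
  have w: "F b *\<^sub>V w = w" "F a *\<^sub>V w = 0"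
    "(norm w)\<^sup>2 = Re (cinner u (F b *\<^sub>V u)) - Re (cinner u (F a *\<^sub>V u))"
    using spec_fam_proj(2,3,4)[OF H ab, of u] by (simp_all add: w_def F_def)
  have sw: "cinner (F x *\<^sub>V v) v' = cinner v (F x *\<^sub>V v')" for x v v'
    unfolding F_def by (rule sa_cinner[OF spec_fam(1)[OF H]])
  have "cinner u ((F b * G) *\<^sub>V u) - cinner u ((F a * G) *\<^sub>V u) = cinner w (G *\<^sub>V u)"
    by (simp add: w_def cinner_simps sw)
  also have "\<dots> = cinner (F b *\<^sub>V w) (G *\<^sub>V u) - cinner (F a *\<^sub>V w) (G *\<^sub>V u)" by (simp add: w)
  also have "\<dots> = cinner w (G *\<^sub>V w)"
    by (simp add: sw commute_apply[OF comm]) (simp add: w_def bop_lin cinner_simps)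
  finally have eq: "cinner u ((F b * G) *\<^sub>V u) - cinner u ((F a * G) *\<^sub>V u) = cinner w (G *\<^sub>V w)" .
  define \<zeta> where "\<zeta> = Complex (e - a) (- s)"
  have \<zeta>: "\<zeta> = z - of_real a" "s \<le> cmod \<zeta>" "\<zeta> \<noteq> 0"
    using cmod_ge_Im[of "- s" "e - a"] s by (auto simp: \<zeta>_def z_def complex_eq_iff)
  have "(H - a *\<^sub>R 1) *\<^sub>V w = \<zeta> *\<^sub>C w - Z *\<^sub>V w"
    by (simp add: Z_def \<zeta>(1) scaleC_ell2_diff_left scaleC_of_real_ell2)
  then have "G *\<^sub>V (H - a *\<^sub>R 1) *\<^sub>V w = \<zeta> *\<^sub>C (G *\<^sub>V w) - w"
    using times_apply[OF ZG(2), of w] by (simp add: bop_apply_diff bop_apply_scaleC)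
  then have "cinner w (G *\<^sub>V (H - a *\<^sub>R 1) *\<^sub>V w) = \<zeta> * cinner w (G *\<^sub>V w) - of_real ((norm w)\<^sup>2)"
    by (simp only: cinner_diff_right cinner_scaleC_right cinner_self)
  then have "cinner w (G *\<^sub>V w) - 1 / \<zeta> * of_real ((norm w)\<^sup>2) = cinner w (G *\<^sub>V (H - a *\<^sub>R 1) *\<^sub>V w) / \<zeta>"
    using \<zeta>(3) by (simp add: field_simps)
  also have "cmod \<dots> = cmod (cinner w (G *\<^sub>V (H - a *\<^sub>R 1) *\<^sub>V w)) / cmod \<zeta>" by (rule norm_divide)
  also have "\<dots> \<le> (norm w * (1 / s * ((b - a) * norm w))) / s"
  proof (rule frac_le)
    have "cmod (cinner w (G *\<^sub>V (H - a *\<^sub>R 1) *\<^sub>V w)) \<le> norm w * norm (G *\<^sub>V (H - a *\<^sub>R 1) *\<^sub>V w)"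
      by (rule cmod_cinner_le)
    also have "norm (G *\<^sub>V (H - a *\<^sub>R 1) *\<^sub>V w) \<le> norm G * norm ((H - a *\<^sub>R 1) *\<^sub>V w)" by (rule norm_bop_apply)
    also have "\<dots> \<le> 1 / s * ((b - a) * norm w)"
      using spec_interval_norm[OF H ab, of u, folded F_def, folded w_def] ZG(3) s
      by (intro mult_mono) auto
    finally show "cmod (cinner w (G *\<^sub>V (H - a *\<^sub>R 1) *\<^sub>V w)) \<le> norm w * (1 / s * ((b - a) * norm w))"
      by (simp add: mult_left_mono)
  qed (use s ab \<zeta> in auto)
  also have "\<dots> = 1 / s\<^sup>2 * (b - a) * (norm w)\<^sup>2" by (simp add: power2_eq_square)
  finally show ?thesis unfolding eq w(3) \<zeta>_def .
qed

context covariant_system begin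

definition dos :: "('w \<Rightarrow> (nat \<times> 'z) bop) \<Rightarrow> nat \<Rightarrow> real \<Rightarrow> real" where
  "dos H N x = (\<Sum>n=1..N. LINT \<omega>|P. Re (mel (n, 0) (spec_fam (H \<omega>) x) (n, 0)))"

text \<open>The distribution function of \<open>dos\<close> with half weight at atoms, which is what the
  Poisson-smoothed counting functions converge to.\<close>

definition dos_mid :: "('w \<Rightarrow> (nat \<times> 'z) bop) \<Rightarrow> nat \<Rightarrow> real \<Rightarrow> real" where
  "dos_mid H N b = (LINT x|interval_measure (dos H N). (sgn (b - x) + 1) / 2)"

context
  fixes H :: "'w \<Rightarrow> (nat \<times> 'z) bop" and K :: real
  assumes H: "fam P \<tau> H" "\<And>\<omega>. adj (H \<omega>) = H \<omega>" and K: "\<And>\<omega>. norm (H \<omega>) \<le> K"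
begin

lemma spec_fam_mel_integrable:
  "integrable P (\<lambda>\<omega>. mel i (spec_fam (H \<omega>) x) j)" "cmod (mel i (spec_fam (H \<omega>) x) j) \<le> 1"
proof -
  have n: "norm (spec_fam (H \<omega>) x *\<^sub>V u) \<le> norm u" for \<omega> x u
  proof -
    have "(norm (spec_fam (H \<omega>) x *\<^sub>V u))\<^sup>2 \<le> norm u * norm (spec_fam (H \<omega>) x *\<^sub>V u)"
      using spec_fam_proj(1)[OF H(2)[of \<omega>], of u x] Re_cinner_le[of u "spec_fam (H \<omega>) x *\<^sub>V u"] by simp
    then show ?thesis
      by (cases "norm (spec_fam (H \<omega>) x *\<^sub>V u) = 0") (auto simp: power2_eq_square mult_le_cancel_right)
  qed
  show c: "cmod (mel i (spec_fam (H \<omega>) x) j) \<le> 1" for \<omega>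
    by (rule order_trans[OF cmod_mel_le norm_bop_leI]) (use n in auto)
  show "integrable P (\<lambda>\<omega>. mel i (spec_fam (H \<omega>) x) j)"
    by (rule integrable_const_bound[of _ 1])
       (use c mel_measurableD[OF mel_measurable_spec_fam[OF countable_layers famD(1)[OF H(1)] H(2) K]] in auto)
qed

lemma K_nonneg: "0 \<le> K"
  using K norm_ge_zero order_trans by blast

lemma spec_fam_bcdf: "bcdf K (\<lambda>y. Re (cinner u (spec_fam (H \<omega>) y *\<^sub>V u)))"
  by (rule bcdf_family[OF K_nonneg spec_fam(1)[OF H(2)] _ spec_fam_right_continuous[OF H(2)]
        spec_fam_bounds[OF H(2) K]])
     (use spec_fam_mono[OF H(2)] in auto)

lemma bcdf_dos: "bcdf K (dos H N)"
  unfolding bcdf_def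
proof (intro conjI allI impI)
  note pw = spec_fam_bcdf[unfolded bcdf_def, of "ket (n, 0)" \<omega> for n \<omega>, folded mel_def]
  show "0 \<le> K" by (rule K_nonneg)
  show "mono (dos H N)"
    unfolding dos_def using pw
    by (intro monoI sum_mono integral_mono integrable_Re spec_fam_mel_integrable) (blast dest: monoD)
  show "dos H N x = 0" if "x < - K" for x
    unfolding dos_def using spec_fam_bounds(1)[OF H(2) K that] by simp
  show "dos H N x = dos H N K" if "K \<le> x" for x
    unfolding dos_def using spec_fam_bounds(2)[OF H(2) K that] spec_fam_bounds(2)[OF H(2) K order_refl] by simp
  fix a
  show "continuous (at_right a) (dos H N)"
    unfolding continuous_within dos_def
  proof (intro tendsto_sum)
    fix n
    show "((\<lambda>x. LINT \<omega>|P. Re (mel (n, 0) (spec_fam (H \<omega>) x) (n, 0)))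
      \<longlongrightarrow> (LINT \<omega>|P. Re (mel (n, 0) (spec_fam (H \<omega>) a) (n, 0)))) (at_right a)"
      unfolding tendsto_at_iff_sequentially o_def
    proof (intro allI impI)
      fix X assume X: "\<forall>i. X i \<in> {a<..} - {a}" "X \<longlonglongrightarrow> a"
      show "(\<lambda>i. LINT \<omega>|P. Re (mel (n, 0) (spec_fam (H \<omega>) (X i)) (n, 0)))
        \<longlonglongrightarrow> (LINT \<omega>|P. Re (mel (n, 0) (spec_fam (H \<omega>) a) (n, 0)))"
      proof (rule integral_dominated_convergence[where w = "\<lambda>_. 1"])
        show "AE \<omega> in P. (\<lambda>i. Re (mel (n, 0) (spec_fam (H \<omega>) (X i)) (n, 0)))
          \<longlonglongrightarrow> Re (mel (n, 0) (spec_fam (H \<omega>) a) (n, 0))"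
        proof (rule AE_I2)
          fix \<omega>
          have "((\<lambda>y. Re (mel (n, 0) (spec_fam (H \<omega>) y) (n, 0))) \<longlongrightarrow> Re (mel (n, 0) (spec_fam (H \<omega>) a) (n, 0))) (at_right a)"
            using pw[of n \<omega>] unfolding continuous_within by blast
          then show "(\<lambda>i. Re (mel (n, 0) (spec_fam (H \<omega>) (X i)) (n, 0))) \<longlonglongrightarrow> Re (mel (n, 0) (spec_fam (H \<omega>) a) (n, 0))"
            unfolding tendsto_at_iff_sequentially o_def using X by blast
        qed
        show "AE \<omega> in P. norm (Re (mel (n, 0) (spec_fam (H \<omega>) (X i)) (n, 0))) \<le> 1" for i
          by (intro AE_I2) (simp add: order_trans[OF abs_Re_le_cmod spec_fam_mel_integrable(2)])
        have "(\<lambda>\<omega>. Re (mel (n, 0) (spec_fam (H \<omega>) x) (n, 0))) \<in> borel_measurable P" for x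
          by (intro borel_measurable_integrable integrable_Re spec_fam_mel_integrable)
        then show "(\<lambda>\<omega>. Re (mel (n, 0) (spec_fam (H \<omega>) a) (n, 0))) \<in> borel_measurable P"
          "(\<lambda>\<omega>. Re (mel (n, 0) (spec_fam (H \<omega>) (X i)) (n, 0))) \<in> borel_measurable P" for i by auto
      qed simp
    qed
  qed
qed

text \<open>The estimates at fixed \<omega> integrate over \<omega> and sum over the layers to the
  test of \<open>bcdf_integral_eqI\<close> for \<open>dos\<close>; in this way the spectral measures
  at single \<omega> are never integrated themselves.\<close>

lemma tr_resolvent_stieltjes:
  assumes s: "0 < s"
  shows "tr N (\<lambda>\<omega>. bop_inv (Complex e (- s) *\<^sub>C 1 - H \<omega>))
    = (LINT x|interval_measure (dos H N). 1 / Complex (e - x) (- s))"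
proof -
  define G where "G \<omega> = bop_inv (Complex e (- s) *\<^sub>C 1 - H \<omega>)" for \<omega>
  have dZ: "dissip s (Complex e (- s) *\<^sub>C 1 - H \<omega>)" for \<omega>
    using dissip_sub[OF H(2), of 0 s "Complex e (- s)" \<omega>] by simp
  have Gf: "fam P \<tau> G"
    unfolding G_def by (rule fam_dissip_inv[OF _ s dZ]) (intro fam_diff fam_scaleC fam_one H)
  have nG: "norm (G \<omega>) \<le> 1 / s" for \<omega> unfolding G_def by (rule dissip_inv(3)[OF s dZ])
  have nF: "norm (spec_fam (H \<omega>) x) \<le> 1" for \<omega> x
  proof (rule norm_bop_leI)
    fix u
    have "(norm (spec_fam (H \<omega>) x *\<^sub>V u))\<^sup>2 \<le> norm u * norm (spec_fam (H \<omega>) x *\<^sub>V u)"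
      using spec_fam_proj(1)[OF H(2)[of \<omega>], of u x] Re_cinner_le[of u "spec_fam (H \<omega>) x *\<^sub>V u"] by simp
    then show "norm (spec_fam (H \<omega>) x *\<^sub>V u) \<le> 1 * norm u"
      by (cases "norm (spec_fam (H \<omega>) x *\<^sub>V u) = 0") (auto simp: power2_eq_square mult_le_cancel_right)
  qed simp
  have mFG: "(\<lambda>\<omega>. mel i (spec_fam (H \<omega>) x * G \<omega>) j) \<in> borel_measurable P" for i j x
    by (intro mel_measurableD mel_measurable_times countable_layers famD(1)[OF Gf]
        mel_measurable_spec_fam[OF countable_layers famD(1)[OF H(1)] H(2) K])
  have iFG: "integrable P (\<lambda>\<omega>. mel i (spec_fam (H \<omega>) x * G \<omega>) j)" for i j x
  proof (rule integrable_const_bound[of _ "1 * (1 / s)"])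
    have "norm (spec_fam (H \<omega>) x * G \<omega>) \<le> 1 * (1 / s)" for \<omega>
      by (intro order_trans[OF norm_mult_ineq] mult_mono nF nG) auto
    then show "AE \<omega> in P. cmod (mel i (spec_fam (H \<omega>) x * G \<omega>) j) \<le> 1 * (1 / s)"
      by (intro AE_I2 order_trans[OF cmod_mel_le])
  qed (rule mFG)
  define J where "J b = (\<Sum>n=1..N. LINT \<omega>|P. mel (n, 0) (spec_fam (H \<omega>) b * G \<omega>) (n, 0))" for b
  have "(LINT x|interval_measure (dos H N). 1 / Complex (e - x) (- s)) = J K - J (- K - 1)"
  proof (rule bcdf_integral_eqI[OF bcdf_dos])
    show "cmod (1 / Complex (e - y) (- s) - 1 / Complex (e - x) (- s)) \<le> 1 / s\<^sup>2 * \<bar>y - x\<bar>" for x y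
      using resolvent_lipschitz[OF s, of "e - y" "e - x"] by (simp add: abs_minus_commute)
    have "continuous_on UNIV (\<lambda>x. 1 / Complex (e - x) (- s))"
      unfolding Complex_minus_of_real[symmetric]
      by (intro continuous_intros) (use s in \<open>auto simp: complex_eq_iff\<close>)
    then show "(\<lambda>x. 1 / Complex (e - x) (- s)) \<in> borel_measurable borel"
      by (rule borel_measurable_continuous_onI)
    fix a b :: real assume ab: "a \<le> b"
    define \<mu> where "\<mu> n \<omega> x = Re (mel (n, 0) (spec_fam (H \<omega>) x) (n, 0))" for n \<omega> x
    have \<mu>i: "integrable P (\<lambda>\<omega>. \<mu> n \<omega> x)" for n x
      unfolding \<mu>_def by (intro integrable_Re spec_fam_mel_integrable)
    define f where "f = 1 / Complex (e - a) (- s)"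
    have "J b - J a - f * of_real (dos H N b - dos H N a)
        = (\<Sum>n=1..N. LINT \<omega>|P. (mel (n, 0) (spec_fam (H \<omega>) b * G \<omega>) (n, 0) - mel (n, 0) (spec_fam (H \<omega>) a * G \<omega>) (n, 0)
            - f * of_real (\<mu> n \<omega> b - \<mu> n \<omega> a)))"
      unfolding J_def dos_def \<mu>_def[symmetric]
      by (simp add: iFG \<mu>i sum_subtractf right_diff_distrib sum_distrib_left)
    also have "cmod \<dots> \<le> (\<Sum>n=1..N. LINT \<omega>|P. 1 / s\<^sup>2 * (b - a) * (\<mu> n \<omega> b - \<mu> n \<omega> a))"
    proof (intro order_trans[OF norm_sum] sum_mono norm_lebesgue_integral_le)
      fix n \<omega>
      show "cmod (mel (n, 0) (spec_fam (H \<omega>) b * G \<omega>) (n, 0) - mel (n, 0) (spec_fam (H \<omega>) a * G \<omega>) (n, 0)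
            - f * of_real (\<mu> n \<omega> b - \<mu> n \<omega> a)) \<le> 1 / s\<^sup>2 * (b - a) * (\<mu> n \<omega> b - \<mu> n \<omega> a)"
        unfolding mel_def \<mu>_def f_def G_def by (rule resolvent_stieltjes_step[OF H(2) s ab])
    qed (intro Bochner_Integration.integrable_diff integrable_mult_right integrable_of_real iFG \<mu>i)+
    also have "\<dots> = 1 / s\<^sup>2 * (b - a) * (dos H N b - dos H N a)"
    proof -
      have "(LINT \<omega>|P. 1 / s\<^sup>2 * (b - a) * (\<mu> n \<omega> b - \<mu> n \<omega> a))
          = 1 / s\<^sup>2 * (b - a) * ((LINT \<omega>|P. \<mu> n \<omega> b) - (LINT \<omega>|P. \<mu> n \<omega> a))" for n
        by (simp add: \<mu>i)
      then show ?thesis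
        unfolding dos_def \<mu>_def[symmetric] sum_subtractf[symmetric] sum_distrib_left by (simp only:)
    qed
    finally show "cmod (J b - J a - 1 / Complex (e - a) (- s) * of_real (dos H N b - dos H N a))
        \<le> 1 / s\<^sup>2 * (b - a) * (dos H N b - dos H N a)"
      unfolding f_def .
  qed
  also have "J (- K - 1) = 0"
    unfolding J_def using spec_fam_bounds(1)[OF H(2) K, of "- K - 1"] by simp
  also have "J K = tr N G"
    unfolding J_def tr_def using spec_fam_bounds(2)[OF H(2) K order_refl] by simp
  finally show ?thesis by (simp add: G_def[abs_def])
qed

text \<open>The imaginary part of 1 / (e - x - i s) is the Poisson kernel s / ((e - x)^2 + s^2),
  with primitive arctan ((e - x) / s) in e. Its Lipschitz bound 1/s^2 is uniform in x and allows
  differentiation under the integral.\<close>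

lemma integral_Im_tr_resolvent:
  assumes s: "0 < s" and ab: "a \<le> b"
  shows "((\<lambda>e. Im (tr N (\<lambda>\<omega>. bop_inv (Complex e (- s) *\<^sub>C 1 - H \<omega>)))) has_integral
    (LINT x|interval_measure (dos H N). arctan ((b - x) / s) - arctan ((a - x) / s))) {a..b}"
proof -
  let ?M = "interval_measure (dos H N)"
  interpret M: finite_measure ?M by (rule bcdf_measure(2)[OF bcdf_dos])
  define \<phi> where "\<phi> e = (LINT x|?M. arctan ((e - x) / s))" for e
  define d where "d e x = Im (1 / Complex (e - x) (- s))" for e x
  have d: "d e x = inverse (1 + ((e - x) / s)\<^sup>2) * (1 / s)" for e x
    using s by (simp add: d_def Im_divide power2_eq_square field_simps)
  have iarc: "integrable ?M (\<lambda>x. arctan ((e - x) / s))" for e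
  proof (rule M.integrable_const_bound[of _ "pi / 2"])
    have "\<bar>arctan y\<bar> \<le> pi / 2" for y using arctan_bounded[of y] by linarith
    then show "AE x in ?M. norm (arctan ((e - x) / s)) \<le> pi / 2" by simp
    have "(\<lambda>x. arctan ((e - x) / s)) \<in> borel_measurable borel"
      using s by (intro borel_measurable_continuous_onI continuous_intros) auto
    then show "(\<lambda>x. arctan ((e - x) / s)) \<in> borel_measurable ?M" by simp
  qed
  have meas: "(\<lambda>x. 1 / Complex (e - x) (- s)) \<in> borel_measurable borel" for e
  proof (rule borel_measurable_continuous_onI)
    show "continuous_on UNIV (\<lambda>x. 1 / Complex (e - x) (- s))"
      unfolding Complex_minus_of_real[symmetric]
      by (intro continuous_intros) (use s in \<open>auto simp: complex_eq_iff\<close>)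
  qed
  have ires: "integrable ?M (\<lambda>x. 1 / Complex (e - x) (- s))" for e
  proof (rule M.integrable_const_bound[of _ "1 / s"])
    have "cmod (1 / Complex (e - x) (- s)) \<le> 1 / s" for x
      using cmod_ge_Im[of "- s" "e - x"] s by (simp add: norm_divide frac_le)
    then show "AE x in ?M. cmod (1 / Complex (e - x) (- s)) \<le> 1 / s" by simp
  qed (use meas in simp)
  have id: "integrable ?M (d e)" for e unfolding d_def by (intro integrable_Im ires)
  have Imtr: "Im (tr N (\<lambda>\<omega>. bop_inv (Complex e (- s) *\<^sub>C 1 - H \<omega>))) = (LINT x|?M. d e x)" for e
    unfolding tr_resolvent_stieltjes[OF s] d_def by (rule integral_Im[OF ires, symmetric])
  have der: "((\<lambda>e. arctan ((e - x) / s)) has_field_derivative d e x) (at e within A)" for e x A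
    unfolding d using s by (auto intro!: derivative_eq_intros)
  have lip: "\<bar>d e' x - d e x\<bar> \<le> 1 / s\<^sup>2 * \<bar>e' - e\<bar>" for e e' x
  proof -
    have "\<bar>d e' x - d e x\<bar> \<le> cmod (1 / Complex (e' - x) (- s) - 1 / Complex (e - x) (- s))"
      unfolding d_def minus_complex.sel[symmetric] by (rule abs_Im_le_cmod)
    also have "\<dots> \<le> 1 / s\<^sup>2 * \<bar>(e' - x) - (e - x)\<bar>" by (rule resolvent_lipschitz[OF s])
    finally show ?thesis by simp
  qed
  have quad: "\<bar>arctan ((e' - x) / s) - arctan ((e - x) / s) - (e' - e) * d e x\<bar> \<le> 1 / s\<^sup>2 * (e' - e)\<^sup>2" for e e' x
  proof -
    have "norm ((arctan ((e' - x) / s) - e' * d e x) - (arctan ((e - x) / s) - e * d e x))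
        \<le> (1 / s\<^sup>2 * \<bar>e' - e\<bar>) * norm (e' - e)"
    proof (rule field_differentiable_bound[where S = "closed_segment e e'" and f' = "\<lambda>t. d t x - d e x"])
      fix t assume t: "t \<in> closed_segment e e'"
      show "((\<lambda>t. arctan ((t - x) / s) - t * d e x) has_field_derivative d t x - d e x) (at t within closed_segment e e')"
        by (intro DERIV_diff der DERIV_cmult_right[where x = t and c = "d e x", of "\<lambda>t. t" 1, simplified])
      have "\<bar>t - e\<bar> \<le> \<bar>e' - e\<bar>" using t by (auto simp: closed_segment_eq_real_ivl split: if_splits)
      then have "1 / s\<^sup>2 * \<bar>t - e\<bar> \<le> 1 / s\<^sup>2 * \<bar>e' - e\<bar>" by (intro mult_left_mono) auto
      then show "norm (d t x - d e x) \<le> 1 / s\<^sup>2 * \<bar>e' - e\<bar>" using lip[of t x e] by simp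
    qed auto
    also have "(1 / s\<^sup>2 * \<bar>e' - e\<bar>) * norm (e' - e) = 1 / s\<^sup>2 * (e' - e)\<^sup>2"
      by (simp add: power2_eq_square)
    finally show ?thesis by (simp add: left_diff_distrib algebra_simps)
  qed
  have "(\<phi> has_vector_derivative (LINT x|?M. d e x)) (at e within {a..b})" for e
  proof -
    have "((\<lambda>e. complex_of_real (\<phi> e)) has_vector_derivative of_real (LINT x|?M. d e x)) (at e within {a..b})"
    proof (rule has_vector_derivative_quadratic)
      fix e'
      have eq: "\<phi> e' - \<phi> e - (e' - e) * (LINT x|?M. d e x)
          = (LINT x|?M. arctan ((e' - x) / s) - arctan ((e - x) / s) - (e' - e) * d e x)"
        unfolding \<phi>_def by (simp add: iarc id)
      have "\<bar>\<phi> e' - \<phi> e - (e' - e) * (LINT x|?M. d e x)\<bar> \<le> (LINT x|?M. 1 / s\<^sup>2 * (e' - e)\<^sup>2)"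
        unfolding eq unfolding real_norm_def[symmetric]
      proof (rule norm_lebesgue_integral_le)
        show "integrable ?M (\<lambda>x. arctan ((e' - x) / s) - arctan ((e - x) / s) - (e' - e) * d e x)"
          by (intro Bochner_Integration.integrable_diff iarc integrable_mult_right id)
        show "integrable ?M (\<lambda>x. 1 / s\<^sup>2 * (e' - e)\<^sup>2)" by (rule M.integrable_const)
        show "norm (arctan ((e' - x) / s) - arctan ((e - x) / s) - (e' - e) * d e x) \<le> 1 / s\<^sup>2 * (e' - e)\<^sup>2" for x
          unfolding real_norm_def by (rule quad)
      qed
      then have "\<bar>\<phi> e' - \<phi> e - (e' - e) * (LINT x|?M. d e x)\<bar> \<le> measure ?M UNIV * (1 / s\<^sup>2) * (e' - e)\<^sup>2"
        unfolding lebesgue_integral_const space_interval_measure real_scaleR_def mult.assoc .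
      moreover have "complex_of_real (\<phi> e') - of_real (\<phi> e) - of_real (e' - e) * of_real (LINT x|?M. d e x)
          = of_real (\<phi> e' - \<phi> e - (e' - e) * (LINT x|?M. d e x))" by simp
      ultimately show "cmod (of_real (\<phi> e') - of_real (\<phi> e) - of_real (e' - e) * of_real (LINT x|?M. d e x))
          \<le> measure ?M UNIV * (1 / s\<^sup>2) * (e' - e)\<^sup>2" by (simp only: norm_of_real)
    qed
    then have "(\<phi> has_field_derivative (LINT x|?M. d e x)) (at e within {a..b})"
      unfolding has_vector_derivative_complex_iff by simp
    then show ?thesis unfolding has_real_derivative_iff_has_vector_derivative .
  qed
  then have "((\<lambda>e. LINT x|?M. d e x) has_integral (\<phi> b - \<phi> a)) {a..b}"
    by (intro fundamental_theorem_of_calculus ab)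
  moreover have "\<phi> b - \<phi> a = (LINT x|?M. arctan ((b - x) / s) - arctan ((a - x) / s))"
    unfolding \<phi>_def by (simp add: iarc)
  ultimately show ?thesis by (simp add: Imtr)
qed

lemma arctan_scaled_tendsto:
  "((\<lambda>j. arctan (t / (1 / real (Suc j)))) \<longlongrightarrow> pi / 2 * sgn t) sequentially"
proof -
  have lin: "filterlim (\<lambda>j. real (Suc j)) at_top sequentially"
    by (rule filterlim_compose[OF filterlim_real_sequentially filterlim_Suc])
  consider "t = 0" | "t > 0" | "t < 0" by linarith
  then show ?thesis
  proof cases
    case 2
    have "filterlim (\<lambda>j. t * real (Suc j)) at_top sequentially"
      by (rule filterlim_tendsto_pos_mult_at_top[OF tendsto_const 2 lin])
    then have "(\<lambda>j. arctan (t * real (Suc j))) \<longlonglongrightarrow> pi / 2"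
      by (rule filterlim_compose[OF tendsto_arctan_at_top])
    then show ?thesis using 2 by simp
  next
    case 3
    have "filterlim (\<lambda>j. t * real (Suc j)) at_bot sequentially"
      by (rule filterlim_tendsto_neg_mult_at_bot[OF tendsto_const 3 lin])
    then have "(\<lambda>j. arctan (t * real (Suc j))) \<longlonglongrightarrow> - (pi / 2)"
      by (rule filterlim_compose[OF tendsto_arctan_at_bot])
    then show ?thesis using 3 by simp
  qed simp
qed

text \<open>The lower end a lies to the left of the spectrum, so its arctan tends to -\<pi>/2 for
  almost every x. At an atom x = b the other arctan stays 0, which leaves half of the
  weight.\<close>

lemma dos_mid_limit:
  assumes a: "a < - K" "a \<le> b"
  shows "(\<lambda>j. integral {a..b} (\<lambda>e. Im (tr N (\<lambda>\<omega>. bop_inv (Complex e (- (1 / real (Suc j))) *\<^sub>C 1 - H \<omega>)))))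
    \<longlonglongrightarrow> pi * dos_mid H N b"
proof -
  let ?M = "interval_measure (dos H N)"
  interpret M: finite_measure ?M by (rule bcdf_measure(2)[OF bcdf_dos])
  have "(\<lambda>j. LINT x|?M. arctan ((b - x) / (1 / real (Suc j))) - arctan ((a - x) / (1 / real (Suc j))))
      \<longlonglongrightarrow> (LINT x|?M. pi * ((sgn (b - x) + 1) / 2))"
  proof (rule integral_dominated_convergence[where w = "\<lambda>_. pi"])
    show "AE x in ?M. (\<lambda>j. arctan ((b - x) / (1 / real (Suc j))) - arctan ((a - x) / (1 / real (Suc j))))
        \<longlonglongrightarrow> pi * ((sgn (b - x) + 1) / 2)"
      using bcdf_measure(5)[OF bcdf_dos]
    proof eventually_elim
      fix x assume "- K \<le> x"
      then have "sgn (a - x) = - 1" using a by simp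
      then have "pi * ((sgn (b - x) + 1) / 2) = pi / 2 * sgn (b - x) - pi / 2 * sgn (a - x)"
        by (simp add: algebra_simps)
      then show "(\<lambda>j. arctan ((b - x) / (1 / real (Suc j))) - arctan ((a - x) / (1 / real (Suc j))))
          \<longlonglongrightarrow> pi * ((sgn (b - x) + 1) / 2)"
        by (simp only:) (intro tendsto_diff arctan_scaled_tendsto)
    qed
    show "AE x in ?M. norm (arctan ((b - x) / (1 / real (Suc j))) - arctan ((a - x) / (1 / real (Suc j)))) \<le> pi" for j
    proof (rule AE_I2)
      fix x
      have "\<bar>arctan y\<bar> \<le> pi / 2" for y using arctan_bounded[of y] by linarith
      from this[of "(b - x) / (1 / real (Suc j))"] this[of "(a - x) / (1 / real (Suc j))"]
      show "norm (arctan ((b - x) / (1 / real (Suc j))) - arctan ((a - x) / (1 / real (Suc j)))) \<le> pi"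
        unfolding real_norm_def by linarith
    qed
  qed simp_all
  moreover have "integral {a..b} (\<lambda>e. Im (tr N (\<lambda>\<omega>. bop_inv (Complex e (- (1 / real (Suc j))) *\<^sub>C 1 - H \<omega>))))
      = (LINT x|?M. arctan ((b - x) / (1 / real (Suc j))) - arctan ((a - x) / (1 / real (Suc j))))" for j
    by (rule integral_unique[OF integral_Im_tr_resolvent[OF _ a(2)]]) simp
  ultimately show ?thesis by (simp add: dos_mid_def)
qed

lemma dos_mid_bounds: "dos_mid H N b \<le> dos H N b" "b' < b \<Longrightarrow> dos H N b' \<le> dos_mid H N b"
proof -
  let ?M = "interval_measure (dos H N)"
  interpret M: finite_measure ?M by (rule bcdf_measure(2)[OF bcdf_dos])
  have i: "integrable ?M (\<lambda>x. (sgn (b - x) + 1) / 2)"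
    by (rule M.integrable_const_bound[of _ 1]) (auto simp: sgn_if intro!: AE_I2)
  have I: "integrable ?M (\<lambda>x. indicat_real {..c} x)" for c
    by (rule M.integrable_const_bound[of _ 1]) (auto simp: indicator_def)
  have I2: "(LINT x|?M. indicat_real {..c} x) = dos H N c" for c
  proof -
    have "(LINT x|?M. indicat_real {..c} x) = measure ?M ({..c} \<inter> space ?M)"
      by (rule Bochner_Integration.integral_indicator)
    also have "{..c} \<inter> space ?M = {..c}" by simp
    also have "measure ?M {..c} = dos H N c" by (rule bcdf_measure(1)[OF bcdf_dos])
    finally show ?thesis .
  qed
  have "dos_mid H N b \<le> (LINT x|?M. indicat_real {..b} x)"
    unfolding dos_mid_def by (rule integral_mono[OF i I]) (auto simp: sgn_if indicator_def)
  then show "dos_mid H N b \<le> dos H N b" unfolding I2 .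
  show "dos H N b' \<le> dos_mid H N b" if "b' < b"
  proof -
    have "(LINT x|?M. indicat_real {..b'} x) \<le> dos_mid H N b"
      unfolding dos_mid_def by (rule integral_mono[OF I i]) (use that in \<open>auto simp: sgn_if indicator_def\<close>)
    then show ?thesis unfolding I2 .
  qed
qed

end

end

subsection \<open>Jacobi operators\<close>

lemma layer_sum: "layer n (\<Sum>k\<in>I. u k) = (\<Sum>k\<in>I. layer n (u k))"
  by (induction I rule: infinite_finite_induct) (auto simp: layer_linear)

lemma layer_minus: "layer n (u - w) = layer n u - layer n w"
  by (rule ell2_eqI) (simp add: layer.rep_eq ell2_rep)

lemma layer_lay: "layer n (lay S *\<^sub>V u) = (if n \<in> S then layer n u else 0)"
  by (rule ell2_eqI) (simp add: layer.rep_eq lay_apply restrict_ell2.rep_eq ell2_rep)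

lemma layer_eqI: "(\<And>n. layer n u = layer n w) \<Longrightarrow> u = w"
  by (rule ell2_eqI) (metis layer.rep_eq surj_pair)

lemma lay_eq_sum:
  assumes "finite S"
  shows "lay S = (\<Sum>n\<in>S. block n n 1)"
proof (rule bop_mel_eqI)
  fix i j :: "'a \<times> 'b"
  have "mel i (block n n 1) j = (if n = fst i then (if i = j then 1 else 0) else 0)" for n
    by (auto simp: mel_block prod_eq_iff)
  then show "mel i (lay S) j = mel i (\<Sum>n\<in>S. block n n 1) j"
    using assms by (simp add: mel_lay mel_sum)
qed

lemma layer_jacobi:
  "layer n (jacobi t v N *\<^sub>V u) = (if n \<in> {1..N} then
    v n *\<^sub>V layer n u + (if 2 \<le> n then adj (t n) *\<^sub>V layer (n - 1) u else 0)
    + (if n < N then t (Suc n) *\<^sub>V layer (Suc n) u else 0) else 0)"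
proof -
  have 1: "(\<Sum>k=1..N. layer n (block k k (v k) *\<^sub>V u)) = (if n \<in> {1..N} then v n *\<^sub>V layer n u else 0)"
    by (simp add: block_apply layer_layer_embed sum.delta' del: One_nat_def)
  have 2: "(\<Sum>k=2..N. layer n (block k (k - 1) (adj (t k)) *\<^sub>V u))
      = (if n \<in> {1..N} \<and> 2 \<le> n then adj (t n) *\<^sub>V layer (n - 1) u else 0)"
    by (simp add: block_apply layer_layer_embed sum.delta' del: One_nat_def)
  have 3: "(\<Sum>k=2..N. layer n (block (k - 1) k (t k) *\<^sub>V u))
      = (if n \<in> {1..N} \<and> n < N then t (Suc n) *\<^sub>V layer (Suc n) u else 0)"
  proof -
    have "(\<Sum>k=2..N. layer n (block (k - 1) k (t k) *\<^sub>V u))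
        = (\<Sum>k=2..N. if k = Suc n then t (Suc n) *\<^sub>V layer (Suc n) u else 0)"
      by (rule sum.cong) (auto simp: block_apply layer_layer_embed)
    also have "\<dots> = (if Suc n \<in> {2..N} then t (Suc n) *\<^sub>V layer (Suc n) u else 0)"
      by (simp add: sum.delta)
    finally show ?thesis by auto
  qed
  have "layer n (jacobi t v N *\<^sub>V u) = (\<Sum>k=1..N. layer n (block k k (v k) *\<^sub>V u))
      + ((\<Sum>k=2..N. layer n (block (k - 1) k (t k) *\<^sub>V u)) + (\<Sum>k=2..N. layer n (block k (k - 1) (adj (t k)) *\<^sub>V u)))"
    unfolding jacobi_def bop_apply_simps bop_sum_apply layer_linear layer_sum sum.distrib ..
  then show ?thesis unfolding 1 2 3 by auto
qed

lemma adj_jacobi: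
  assumes "\<And>n. n \<in> {1..N} \<Longrightarrow> adj (v n) = v n"
  shows "adj (jacobi t v N) = jacobi t v N"
proof -
  have "adj (\<Sum>n=1..N. block n n (v n)) = (\<Sum>n=1..N. block n n (v n))"
    unfolding adj_sum by (rule sum.cong) (auto simp: adj_block assms)
  moreover have "adj (\<Sum>n=2..N. block (n - 1) n (t n) + block n (n - 1) (adj (t n)))
      = (\<Sum>n=2..N. block (n - 1) n (t n) + block n (n - 1) (adj (t n)))"
    unfolding adj_sum by (rule sum.cong) (auto simp: adj_block add.commute)
  ultimately show ?thesis by (simp only: jacobi_def adj_simps)
qed

lemma lay_jacobi: "lay {1..N} * jacobi t v N = jacobi t v N" "jacobi t v N * lay {1..N} = jacobi t v N"
  unfolding jacobi_def distrib_left distrib_right sum_distrib_left sum_distrib_right lay_block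
  by (auto intro!: arg_cong2[where f = "(+)"] sum.cong)

text \<open>In terms of the roots p and r of x and y the hypothesis reads p^2 \<le> A (r^2 + p r),
  which fails once p > (A + 1) r.\<close>

lemma quadratic_bound:
  fixes x y A :: real
  assumes "0 \<le> x" "0 \<le> y" "1 \<le> A" "x \<le> A * (y + sqrt (x * y))"
  shows "x \<le> (A + 1)\<^sup>2 * y"
proof -
  define p r where "p = sqrt x" and "r = sqrt y"
  have p: "0 \<le> p" "x = p * p" and r: "0 \<le> r" "y = r * r" using assms by (simp_all add: p_def r_def)
  have xy: "sqrt (x * y) = p * r" by (simp add: p_def r_def real_sqrt_mult)
  have "p \<le> (A + 1) * r"
  proof (rule ccontr)
    assume "\<not> ?thesis"
    then have gt: "(A + 1) * r < p" by simp
    then have p0: "0 < p" using r assms(3) mult_nonneg_nonneg[of "A + 1" r] by linarith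
    have "p * ((A + 1) * r) < p * p" using gt p0 by (rule mult_strict_left_mono)
    moreover have "((A + 1) * r) * r \<le> p * r" using gt r by (intro mult_right_mono) auto
    moreover have "p * p \<le> A * (r * r + p * r)" using assms(4) unfolding xy unfolding p(2) r(2) .
    moreover have "0 \<le> r * r" by simp
    ultimately show False by (simp add: algebra_simps)
  qed
  then have "p * p \<le> ((A + 1) * r) * ((A + 1) * r)" using p r by (intro mult_mono) auto
  then show ?thesis by (simp add: p r power2_eq_square ac_simps)
qed

text \<open>The dissipation sits on the last layer and outside of the sample; the three-term recursion
  propagates its control of \<open>u\<close> down to the first layer.\<close>

lemma jacobi_lower_bound:
  fixes t v :: "nat \<Rightarrow> 'i bop"
  assumes N: "1 \<le> N" and L: "0 \<le> L"
    and t: "\<And>n. n \<in> {2..N} \<Longrightarrow> norm (t n) \<le> L" "\<And>n x. n \<in> {2..N} \<Longrightarrow> norm x \<le> L * norm (adj (t n) *\<^sub>V x)"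
    and v: "\<And>n. n \<in> {1..N} \<Longrightarrow> norm (v n) \<le> L" "\<And>n. n \<in> {1..N} \<Longrightarrow> adj (v n) = v n"
    and e: "\<bar>e\<bar> \<le> R" and s: "0 \<le> s" "s \<le> 1"
  defines "Z \<equiv> Complex e (- s) *\<^sub>C 1 - jacobi t v N - \<i> *\<^sub>C lay (- {1..<N})"
  defines "\<beta> \<equiv> 1 + L * (R + 3 + 2 * L)"
  shows "norm u \<le> (2 + real N * \<beta> ^ N)\<^sup>2 * norm (Z *\<^sub>V u)"
proof -
  have R0: "0 \<le> R" using e by simp
  \<comment> \<open>\<beta> is the growth per layer: when all known quantities are at most b, a step
    of the recursion yields at most L (1 + (R + 2 + L) + L) b.\<close>
  have \<beta>: "1 \<le> \<beta>" using L R0 by (simp add: \<beta>_def)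
  define y where "y = norm (Z *\<^sub>V u)"
  define q where "q = norm (lay (- {1..<N}) *\<^sub>V u)"
  \<comment> \<open>The imaginary part of the form bounds q^2 by the norm of u times y, so m
    dominates both the dissipated part q of u and the right-hand side y. It still contains u itself,
    which \<open>quadratic_bound\<close> removes at the end.\<close>
  define m where "m = y + sqrt (norm u * y)"
  have y0: "0 \<le> y" "0 \<le> m" "y \<le> m" by (auto simp: y_def m_def)
  have sa: "adj (jacobi t v N) = jacobi t v N" by (rule adj_jacobi) (rule v)
  have Imeq: "Im (cinner u (Z *\<^sub>V u)) = - s * (norm u)\<^sup>2 - q\<^sup>2"
    using Im_cinner_lay[of u \<i> "- {1..<N}"] by (simp add: Z_def cinner_simps sa_Im[OF sa] cinner_self q_def)
  have "0 \<le> s * (norm u)\<^sup>2" using s by simp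
  then have "q\<^sup>2 \<le> \<bar>Im (cinner u (Z *\<^sub>V u))\<bar>" unfolding Imeq by simp
  then have "q\<^sup>2 \<le> norm u * y"
    unfolding y_def using abs_Im_le_cmod[of "cinner u (Z *\<^sub>V u)"] cmod_cinner_le[of u "Z *\<^sub>V u"]
    by linarith
  then have q: "q \<le> m" using y0 real_le_rsqrt[of q "norm u * y"] by (simp add: m_def)
  have cz: "cmod (Complex e (- s)) \<le> R + 1"
    using cmod_le[of "Complex e (- s)"] e s by simp
  have uN: "norm (layer N u) \<le> m"
  proof -
    have "layer N u = layer N (lay (- {1..<N}) *\<^sub>V u)" by (simp add: layer_lay)
    then have "norm (layer N u) \<le> q" unfolding q_def by (metis norm_layer)
    then show ?thesis using q by simp
  qed
  have ve: "norm (v n *\<^sub>V x) \<le> L * norm x" if "n \<in> {1..N}" for n x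
    using norm_bop_apply[of "v n" x] mult_right_mono[OF v(1)[OF that], of "norm x"] by simp
  have te: "norm (t n *\<^sub>V x) \<le> L * norm x" if "n \<in> {2..N}" for n x
    using norm_bop_apply[of "t n" x] mult_right_mono[OF t(1)[OF that], of "norm x"] by simp
  \<comment> \<open>Row n of Z u solved for the layer n - 1. In the factor R + 2 + L, R + 1 bounds
    the complex energy, L the potential, and the remaining 1 the dissipation, present only in layer
    N.\<close>
  have step: "norm (layer (n - 1) u) \<le> L * (y + (R + 2 + L) * norm (layer n u)
      + L * (if n < N then norm (layer (Suc n) u) else 0))" if n: "n \<in> {2..N}" for n
  proof -
    define i where "i = (if n \<in> - {1..<N} then \<i> *\<^sub>C layer n u else 0)"
    define w where "w = (if n < N then t (Suc n) *\<^sub>V layer (Suc n) u else 0)"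
    have "layer n (Z *\<^sub>V u) = Complex e (- s) *\<^sub>C layer n u - (v n *\<^sub>V layer n u + adj (t n) *\<^sub>V layer (n - 1) u + w) - i"
      using n by (simp add: Z_def layer_minus layer_linear layer_jacobi layer_lay i_def w_def)
    then have "adj (t n) *\<^sub>V layer (n - 1) u = Complex e (- s) *\<^sub>C layer n u - v n *\<^sub>V layer n u - w - i - layer n (Z *\<^sub>V u)"
      by (simp add: algebra_simps)
    also have "norm \<dots> \<le> norm (Complex e (- s) *\<^sub>C layer n u) + norm (v n *\<^sub>V layer n u) + norm w + norm i + norm (layer n (Z *\<^sub>V u))"
      by (intro order_trans[OF norm_triangle_ineq4] add_mono order_refl)
    also have "\<dots> \<le> (R + 1) * norm (layer n u) + L * norm (layer n u)
        + L * (if n < N then norm (layer (Suc n) u) else 0) + norm (layer n u) + y"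
    proof (intro add_mono)
      show "norm (Complex e (- s) *\<^sub>C layer n u) \<le> (R + 1) * norm (layer n u)"
        unfolding norm_scaleC_ell2 by (intro mult_right_mono cz) auto
      show "norm (v n *\<^sub>V layer n u) \<le> L * norm (layer n u)" using n by (intro ve) auto
      show "norm w \<le> L * (if n < N then norm (layer (Suc n) u) else 0)"
        using n te[of "Suc n"] by (auto simp: w_def)
      show "norm i \<le> norm (layer n u)" by (auto simp: i_def norm_scaleC_ell2)
      show "norm (layer n (Z *\<^sub>V u)) \<le> y" unfolding y_def by (rule norm_layer)
    qed
    finally have "norm (adj (t n) *\<^sub>V layer (n - 1) u) \<le> y + (R + 2 + L) * norm (layer n u)
      + L * (if n < N then norm (layer (Suc n) u) else 0)" by (simp add: algebra_simps)
    then show ?thesis using t(2)[OF n, of "layer (n - 1) u"] L by (meson mult_left_mono order_trans)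
  qed
  have ind: "\<forall>j\<le>k. norm (layer (N - j) u) \<le> \<beta> ^ k * m" if "k < N" for k
    using that
  proof (induction k)
    case 0
    then show ?case using uN by simp
  next
    case (Suc k)
    then have IH: "norm (layer (N - j) u) \<le> \<beta> ^ k * m" if "j \<le> k" for j using that by simp
    define b where "b = \<beta> ^ k * m"
    have b: "m \<le> b" "0 \<le> b" using \<beta> y0 mult_right_mono[of 1 "\<beta> ^ k" m] by (auto simp: b_def)
    have grow: "b \<le> \<beta> ^ Suc k * m" using \<beta> b(2) mult_right_mono[of 1 \<beta> b] by (simp add: b_def mult.assoc)
    have n: "N - k \<in> {2..N}" using Suc.prems by auto
    have "norm (layer (N - k - 1) u) \<le> L * (y + (R + 2 + L) * norm (layer (N - k) u)
      + L * (if N - k < N then norm (layer (Suc (N - k)) u) else 0))" by (rule step[OF n])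
    also have "\<dots> \<le> L * (b + (R + 2 + L) * b + L * b)"
    proof (intro mult_left_mono add_mono L)
      show "norm (layer (N - k) u) \<le> b" using IH[of k] by (simp add: b_def)
      show "(if N - k < N then norm (layer (Suc (N - k)) u) else 0) \<le> b"
      proof (cases "N - k < N")
        case True
        then have "Suc (N - k) = N - (k - 1)" using Suc.prems by simp
        then show ?thesis using IH[of "k - 1"] True by (simp add: b_def)
      qed (use b in simp)
    qed (use y0 b R0 L in auto)
    also have "\<dots> \<le> \<beta> * b" using b by (simp add: \<beta>_def algebra_simps)
    finally have new: "norm (layer (N - Suc k) u) \<le> \<beta> ^ Suc k * m" by (simp add: b_def mult.assoc)
    show ?case
    proof (intro allI impI)
      fix j assume "j \<le> Suc k"
      then consider "j = Suc k" | "j \<le> k" by linarith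
      then show "norm (layer (N - j) u) \<le> \<beta> ^ Suc k * m"
      proof cases
        case 2
        show ?thesis by (rule order_trans[OF IH[OF 2] grow[unfolded b_def]])
      qed (use new in simp)
    qed
  qed
  have un: "norm (layer n u) \<le> \<beta> ^ N * m" if "n \<in> {1..<N}" for n
  proof -
    have "norm (layer (N - (N - n)) u) \<le> \<beta> ^ (N - n) * m" using ind[of "N - n"] that by auto
    also have "\<dots> \<le> \<beta> ^ N * m" using \<beta> y0 by (intro mult_right_mono power_increasing) auto
    finally show ?thesis using that by simp
  qed
  have "u = lay (- {1..<N}) *\<^sub>V u + (\<Sum>n\<in>{1..<N}. layer_embed n (layer n u))"
  proof -
    have "lay {1..<N} *\<^sub>V u = (\<Sum>n\<in>{1..<N}. layer_embed n (layer n u))"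
      unfolding lay_eq_sum[OF finite_atLeastLessThan] bop_sum_apply block_apply by simp
    then show ?thesis by (simp add: lay_Compl)
  qed
  then have "norm u \<le> q + norm (\<Sum>n\<in>{1..<N}. layer_embed n (layer n u))"
    unfolding q_def by (metis norm_triangle_ineq)
  also have "norm (\<Sum>n\<in>{1..<N}. layer_embed n (layer n u)) \<le> (\<Sum>n\<in>{1..<N}. \<beta> ^ N * m)"
    by (intro order_trans[OF norm_sum] sum_mono order_trans[OF norm_layer_embed] un)
  also have "\<dots> \<le> real N * (\<beta> ^ N * m)"
  proof -
    have "0 \<le> \<beta> ^ N * m" using \<beta> y0 by auto
    then show ?thesis by (auto intro!: mult_right_mono)
  qed
  finally have "norm u \<le> (1 + real N * \<beta> ^ N) * m"
    using q by (simp add: algebra_simps)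
  then have "norm u \<le> (1 + real N * \<beta> ^ N) * (y + sqrt (norm u * y))" unfolding m_def .
  from quadratic_bound[OF norm_ge_zero y0(1) _ this]
  show ?thesis using \<beta> by (simp add: y_def add.commute add.left_commute)
qed

text \<open>The lower bound holds down to s = 0, where dissipativity is no longer strict and
  surjectivity is in question; there the inverse is obtained by perturbation from a small positive
  value. The constant is chosen before the coefficients and the energy, so that it becomes uniform
  in \<omega>.\<close>

lemma jacobi_boundary_inverse:
  assumes N: "1 \<le> N" and L: "0 \<le> L" and R: "0 \<le> R"
  obtains C where "0 < C"
    "\<And>(t :: nat \<Rightarrow> 'i bop) v e s.
      (\<And>n. n \<in> {2..N} \<Longrightarrow> norm (t n) \<le> L) \<Longrightarrow> (\<And>n x. n \<in> {2..N} \<Longrightarrow> norm x \<le> L * norm (adj (t n) *\<^sub>V x)) \<Longrightarrow>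
      (\<And>n. n \<in> {1..N} \<Longrightarrow> norm (v n) \<le> L) \<Longrightarrow> (\<And>n. n \<in> {1..N} \<Longrightarrow> adj (v n) = v n) \<Longrightarrow>
      \<bar>e\<bar> \<le> R \<Longrightarrow> 0 \<le> s \<Longrightarrow> s \<le> 1 \<Longrightarrow>
      (let Z = Complex e (- s) *\<^sub>C 1 - jacobi t v N - \<i> *\<^sub>C lay (- {1..<N})
       in Z * bop_inv Z = 1 \<and> bop_inv Z * Z = 1 \<and> norm (bop_inv Z) \<le> C)"
proof -
  define C where "C = (2 + real N * (1 + L * (R + 3 + 2 * L)) ^ N)\<^sup>2"
  have "0 \<le> real N * (1 + L * (R + 3 + 2 * L)) ^ N" using L R by simp
  then have "0 < 2 + real N * (1 + L * (R + 3 + 2 * L)) ^ N" by linarith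
  then have C: "0 < C" unfolding C_def by (rule zero_less_power)
  show thesis
  proof (rule that[OF C])
    fix t v :: "nat \<Rightarrow> 'i bop" and e s :: real
    assume t: "\<And>n. n \<in> {2..N} \<Longrightarrow> norm (t n) \<le> L" "\<And>n x. n \<in> {2..N} \<Longrightarrow> norm x \<le> L * norm (adj (t n) *\<^sub>V x)"
      and v: "\<And>n. n \<in> {1..N} \<Longrightarrow> norm (v n) \<le> L" "\<And>n. n \<in> {1..N} \<Longrightarrow> adj (v n) = v n"
      and e: "\<bar>e\<bar> \<le> R" and s: "0 \<le> s" "s \<le> 1"
    define Z where "Z s = Complex e (- s) *\<^sub>C 1 - jacobi t v N - \<i> *\<^sub>C lay (- {1..<N})" for s
    have lb: "1 / C * norm u \<le> norm (Z s *\<^sub>V u)" if "0 \<le> s" "s \<le> 1" for s u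
    proof -
      have "norm u \<le> C * norm (Z s *\<^sub>V u)"
        using jacobi_lower_bound[OF N L t v e that] unfolding C_def Z_def .
      then show ?thesis using C by (simp add: field_simps)
    qed
    have sa: "adj (jacobi t v N) = jacobi t v N" by (rule adj_jacobi) (rule v)
    have ex: "Z s * bop_inv (Z s) = 1 \<and> bop_inv (Z s) * Z s = 1" if "0 < s" for s
    proof -
      have "dissip s (Z s)"
        unfolding Z_def by (rule dissip_sub[OF sa]) (simp_all add: Im_cinner_lay del: bop_apply_simps)
      then show ?thesis using dissip_inv[OF that] by blast
    qed
    have ex0: "\<exists>G. Z s * G = 1 \<and> G * Z s = 1"
    proof (cases "s = 0")
      case True
      \<comment> \<open>Small enough for the Neumann series in Z 0 = Z r (1 - D): the shift by i r
        gives D a norm of at most r C \<le> 1/2.\<close>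
      define r where "r = min 1 (1 / (2 * C))"
      have r: "0 < r" "r \<le> 1" "r * C \<le> 1 / 2" using C by (auto simp: r_def min_def field_simps)
      define G where "G = bop_inv (Z r)"
      have G: "Z r * G = 1" "G * Z r = 1" using ex[OF r(1)] by (auto simp: G_def)
      have "0 < 1 / C" using C by simp
      from inverse_norm_le[OF G(1) this lb] r have nG: "norm G \<le> C" by simp
      define D where "D = - (\<i> * of_real r) *\<^sub>C G"
      have "norm D = r * norm G" using r by (simp add: D_def norm_scaleC_bop norm_mult)
      also have "\<dots> \<le> r * C" using r nG by (intro mult_left_mono) auto
      finally have D: "norm D \<le> 1 / 2" using r by simp
      note nb = neumann_bop[OF D]
      have "Z 0 = Z r + (\<i> * of_real r) *\<^sub>C 1"
      proof -
        have "Complex e (- 0) = Complex e (- r) + \<i> * of_real r" by (simp add: complex_eq_iff)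
        then show ?thesis by (simp add: Z_def scaleC_bop_distrib)
      qed
      also have "\<dots> = Z r * (1 - D)"
        using G by (simp add: D_def distrib_left scaleC_bop_distrib)
      finally have Z0: "Z 0 = Z r * (1 - D)" .
      have "Z 0 * ((\<Sum>n. D ^ n) * G) = Z r * ((1 - D) * (\<Sum>n. D ^ n)) * G"
        unfolding Z0 by (simp only: mult.assoc)
      moreover have "((\<Sum>n. D ^ n) * G) * Z 0 = (\<Sum>n. D ^ n) * (G * Z r) * (1 - D)"
        unfolding Z0 by (simp only: mult.assoc)
      ultimately show ?thesis using nb G True by auto
    qed (use ex[of s] s in auto)
    then obtain G where G: "Z s * G = 1" "G * Z s = 1" by blast
    then have "bop_inv (Z s) = G" by (rule bop_inv_eqI)
    moreover have "norm G \<le> 1 / (1 / C)"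
      by (rule inverse_norm_le[OF G(1) _ lb[OF s]]) (use C in simp)
    ultimately show "let Z = Complex e (- s) *\<^sub>C 1 - jacobi t v N - \<i> *\<^sub>C lay (- {1..<N})
       in Z * bop_inv Z = 1 \<and> bop_inv Z * Z = 1 \<and> norm (bop_inv Z) \<le> C"
      using G by (simp add: Z_def)
  qed
qed

subsection \<open>Transfer operators and the Pruefer phase\<close>

lemma bop_inv_one: "bop_inv (1 :: 'i bop) = 1"
  by (rule bop_inv_eqI) auto

text \<open>Read along n, the second component is the solution in layer n, with value 1 in layer 1;
  for n \<ge> 1 the first component is the coupling to the next layer applied to the solution
  there.\<close>

lemma transfer_vector:
  fixes t v :: "nat \<Rightarrow> 'i bop" and E :: real
  defines "\<Phi> \<equiv> \<lambda>n. transfer_prod t v E n *v vector [1, 0]"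
  shows "\<Phi> 0 $ 1 = 1" "\<Phi> 0 $ 2 = 0"
    "\<Phi> (Suc n) $ 2 = bop_inv (if n = 0 then 1 else t (Suc n)) * \<Phi> n $ 1"
    "\<Phi> (Suc n) $ 1 = (E *\<^sub>R 1 - v (Suc n)) * \<Phi> (Suc n) $ 2 - adj (if n = 0 then 1 else t (Suc n)) * \<Phi> n $ 2"
proof -
  show "\<Phi> 0 $ 1 = 1" "\<Phi> 0 $ 2 = 0" by (simp_all add: \<Phi>_def)
  have "\<Phi> (Suc n) = transfer_op t v E (Suc n) *v \<Phi> n"
    by (simp add: \<Phi>_def matrix_vector_mul_assoc)
  then show 2: "\<Phi> (Suc n) $ 2 = bop_inv (if n = 0 then 1 else t (Suc n)) * \<Phi> n $ 1"
    and "\<Phi> (Suc n) $ 1 = (E *\<^sub>R 1 - v (Suc n)) * \<Phi> (Suc n) $ 2 - adj (if n = 0 then 1 else t (Suc n)) * \<Phi> n $ 2"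
    by (simp_all add: transfer_op_def matrix_vector_mult_def sum_2 mult.assoc Let_def)
qed

text \<open>\<open>\<Phi>\<close> solves the eigenvalue equation except in the last layer, where it produces
  \<open>\<Phi>\<^sub>1 + \<i> \<Phi>\<^sub>2\<close> once the boundary dissipation is added.  Hence \<open>(\<Phi>\<^sub>1 + \<i> \<Phi>\<^sub>2)\<^sup>-\<^sup>1\<close> is the corner of the
  resolvent between the first and the last layer.\<close>

lemma transfer_corner:
  fixes t v :: "nat \<Rightarrow> 'i bop" and E :: real
  assumes N: "1 \<le> N"
    and t: "\<And>n. n \<in> {2..N} \<Longrightarrow> t n * bop_inv (t n) = 1 \<and> bop_inv (t n) * t n = 1"
  defines "Z \<equiv> Complex E 0 *\<^sub>C 1 - jacobi t v N + \<i> *\<^sub>C lay (- {1..<N})"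
  assumes G: "Z * G = 1" "G * Z = 1"
  defines "\<Phi> \<equiv> transfer_prod t v E N *v vector [1, 0]"
  shows "corner 1 N G * (\<Phi> $ 1 + \<i> *\<^sub>C \<Phi> $ 2) = 1" "(\<Phi> $ 1 + \<i> *\<^sub>C \<Phi> $ 2) * corner 1 N G = 1"
    "\<Phi> $ 2 * corner 1 N G = corner N N G"
proof -
  define A where "A n = (transfer_prod t v E n *v vector [1, 0]) $ 1" for n
  define B where "B n = (transfer_prod t v E n *v vector [1, 0]) $ 2" for n
  have AB0: "A 0 = 1" "B 0 = 0" by (simp_all add: A_def B_def)
  have B1: "B (Suc 0) = 1"
    using transfer_vector(3)[of t v E 0] by (simp add: B_def A_def[of 0, symmetric] AB0 bop_inv_one)
  have tB: "t (Suc n) *\<^sub>V B (Suc n) *\<^sub>V x = A n *\<^sub>V x" if "0 < n" "Suc n \<le> N" for n x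
  proof -
    have "B (Suc n) = bop_inv (t (Suc n)) * A n"
      using transfer_vector(3)[of t v E n] that by (simp add: A_def B_def)
    then have "t (Suc n) * B (Suc n) = A n" using t[of "Suc n"] that by (simp add: mult.assoc[symmetric])
    then show ?thesis by (rule times_apply)
  qed
  have A: "A n *\<^sub>V x = E *\<^sub>R (B n *\<^sub>V x) - v n *\<^sub>V B n *\<^sub>V x - (if 2 \<le> n then adj (t n) *\<^sub>V B (n - 1) *\<^sub>V x else 0)"
    if n: "0 < n" for n x
  proof -
    obtain k where k: "n = Suc k" using n gr0_implies_Suc by blast
    show ?thesis
      using transfer_vector(4)[of t v E k] unfolding A_def[symmetric] B_def[symmetric] k
      by (cases "k = 0") (auto simp: AB0 bop_lin)
  qed
  have E: "Complex E 0 *\<^sub>C w = E *\<^sub>R w" for w :: "'i ell2"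
    by (metis complex_of_real_def scaleC_of_real_ell2)
  have lZ: "layer n (Z *\<^sub>V u) = E *\<^sub>R layer n u - layer n (jacobi t v N *\<^sub>V u)
      + (if n \<in> {1..<N} then 0 else \<i> *\<^sub>C layer n u)" for n u
    by (simp add: Z_def layer_linear layer_minus layer_lay E del: atLeastLessThan_iff One_nat_def)
  define M where "M = A N + \<i> *\<^sub>C B N"
  have M: "\<Phi> $ 1 + \<i> *\<^sub>C \<Phi> $ 2 = M" "\<Phi> $ 2 = B N" by (simp_all add: M_def A_def B_def \<Phi>_def)
  \<comment> \<open>The solution B n x, cut off after layer N, satisfies Z \<psi> = M x placed in
    layer N. Applying G and reading off layer 1, where B is 1, gives the left inverse.\<close>
  have left: "corner 1 N G *\<^sub>V M *\<^sub>V x = x" for x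
  proof -
    define \<psi> where "\<psi> = (\<Sum>n=1..N. layer_embed n (B n *\<^sub>V x))"
    have l\<psi>: "layer n \<psi> = (if n \<in> {1..N} then B n *\<^sub>V x else 0)" for n
      unfolding \<psi>_def layer_sum layer_layer_embed by (simp add: sum.delta' del: One_nat_def)
    have "Z *\<^sub>V \<psi> = layer_embed N (M *\<^sub>V x)"
    proof (rule layer_eqI)
      fix n
      consider "n \<in> {1..<N}" | "n = N" | "n \<notin> {1..N}" using N by force
      then show "layer n (Z *\<^sub>V \<psi>) = layer n (layer_embed N (M *\<^sub>V x))"
      proof cases
        case 1
        then have "layer n (Z *\<^sub>V \<psi>) = A n *\<^sub>V x - t (Suc n) *\<^sub>V B (Suc n) *\<^sub>V x"
          unfolding lZ layer_jacobi l\<psi> by (auto simp: A algebra_simps)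
        also have "\<dots> = 0" using 1 tB[of n x] by simp
        finally show ?thesis using 1 by (simp add: layer_layer_embed)
      next
        case 2
        then show ?thesis using N
          unfolding lZ layer_jacobi l\<psi> by (auto simp: A M_def layer_layer_embed algebra_simps)
      next
        case 3
        then show ?thesis using N unfolding lZ layer_jacobi l\<psi> by (auto simp: layer_layer_embed)
      qed
    qed
    then have "layer 1 (G *\<^sub>V layer_embed N (M *\<^sub>V x)) = layer 1 \<psi>"
      using times_apply[OF G(2), of \<psi>] by simp
    then show ?thesis using N by (simp add: corner_apply l\<psi> B1)
  qed
  then show "corner 1 N G * (\<Phi> $ 1 + \<i> *\<^sub>C \<Phi> $ 2) = 1" unfolding M(1) by (intro bop_eqI) simp
  \<comment> \<open>Conversely, if Z y is concentrated in layer N, then y obeys the recursion from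
    layer 1 on, and invertibility of the couplings determines it by its first layer: layer n of y is
    B n applied to layer 1.\<close>
  have right: "M *\<^sub>V corner 1 N G *\<^sub>V x = x \<and> B N *\<^sub>V corner 1 N G *\<^sub>V x = corner N N G *\<^sub>V x" for x
  proof -
    define y where "y = G *\<^sub>V layer_embed N x"
    have Zy: "Z *\<^sub>V y = layer_embed N x" using times_apply[OF G(1), of "layer_embed N x"] by (simp add: y_def)
    have row: "E *\<^sub>R layer n y - layer n (jacobi t v N *\<^sub>V y) + (if n \<in> {1..<N} then 0 else \<i> *\<^sub>C layer n y)
        = (if n = N then x else 0)" for n
      using lZ[of n y, symmetric] unfolding Zy layer_layer_embed .
    have rec: "layer n y = B n *\<^sub>V layer 1 y \<and> (n < N \<longrightarrow> t (Suc n) *\<^sub>V layer (Suc n) y = A n *\<^sub>V layer 1 y)"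
      if "1 \<le> n" "n \<le> N" for n
      using that
    proof (induction n rule: less_induct)
      case (less n)
      have prev: "layer (n - 1) y = B (n - 1) *\<^sub>V layer 1 y" if "2 \<le> n"
        using less.IH[of "n - 1"] less.prems that by auto
      have cur: "layer n y = B n *\<^sub>V layer 1 y"
      proof (cases "n = 1")
        case False
        then obtain k where k: "n = Suc k" "0 < k" using less.prems not0_implies_Suc[of n] by fastforce
        have IH: "t (Suc k) *\<^sub>V layer (Suc k) y = A k *\<^sub>V layer 1 y"
          using less.IH[of k] less.prems k by auto
        also have "\<dots> = t (Suc k) *\<^sub>V B (Suc k) *\<^sub>V layer 1 y" using tB[of k] k less.prems by simp
        finally have "bop_inv (t n) *\<^sub>V t n *\<^sub>V layer n y = bop_inv (t n) *\<^sub>V t n *\<^sub>V B n *\<^sub>V layer 1 y"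
          by (simp add: k)
        then show ?thesis
          using times_apply[of "bop_inv (t n)" "t n" 1] t[of n] k less.prems by auto
      qed (simp add: B1)
      moreover have "t (Suc n) *\<^sub>V layer (Suc n) y = A n *\<^sub>V layer 1 y" if "n < N"
      proof -
        have "t (Suc n) *\<^sub>V layer (Suc n) y = E *\<^sub>R layer n y - v n *\<^sub>V layer n y
            - (if 2 \<le> n then adj (t n) *\<^sub>V layer (n - 1) y else 0)"
          using row[of n] that less.prems by (auto simp: layer_jacobi algebra_simps)
        then show ?thesis using less.prems cur prev by (auto simp: A)
      qed
      ultimately show ?case by blast
    qed
    have BN: "B N *\<^sub>V layer 1 y = layer N y" using rec[of N] N by simp
    have "A N *\<^sub>V layer 1 y = E *\<^sub>R layer N y - v N *\<^sub>V layer N y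
        - (if 2 \<le> N then adj (t N) *\<^sub>V layer (N - 1) y else 0)"
      using rec[of N] rec[of "N - 1"] N by (auto simp: A)
    also have "\<dots> = x - \<i> *\<^sub>C layer N y"
      using row[of N] N by (auto simp: layer_jacobi algebra_simps)
    finally have "M *\<^sub>V layer 1 y = x" by (simp add: M_def BN[unfolded One_nat_def])
    then show ?thesis using BN by (simp add: corner_apply y_def)
  qed
  show "(\<Phi> $ 1 + \<i> *\<^sub>C \<Phi> $ 2) * corner 1 N G = 1" unfolding M(1) using right by (intro bop_eqI) simp
  show "\<Phi> $ 2 * corner 1 N G = corner N N G" unfolding M(2) using right by (intro bop_eqI) simp
qed

lemma prufer_phase_corner:
  assumes N: "1 \<le> N"
    and t: "\<And>n. n \<in> {2..N} \<Longrightarrow> T n \<omega> * bop_inv (T n \<omega>) = 1 \<and> bop_inv (T n \<omega>) * T n \<omega> = 1"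
    and G: "(Complex E 0 *\<^sub>C 1 - jacobi (\<lambda>k. T k \<omega>) (\<lambda>k. V k \<omega>) N + \<i> *\<^sub>C lay (- {1..<N})) * G = 1"
      "G * (Complex E 0 *\<^sub>C 1 - jacobi (\<lambda>k. T k \<omega>) (\<lambda>k. V k \<omega>) N + \<i> *\<^sub>C lay (- {1..<N})) = 1"
  shows "prufer_phase T V N E \<omega> = 1 - (2 * \<i>) *\<^sub>C corner N N G"
proof -
  define \<Phi> where "\<Phi> = transfer_prod (\<lambda>k. T k \<omega>) (\<lambda>k. V k \<omega>) E N *v vector [1, 0]"
  note tc = transfer_corner[OF N t G, folded \<Phi>_def]
  have inv: "bop_inv (\<Phi> $ 1 + \<i> *\<^sub>C \<Phi> $ 2) = corner 1 N G" by (rule bop_inv_eqI[OF tc(2,1)])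
  have "\<Phi> $ 1 - \<i> *\<^sub>C \<Phi> $ 2 = (\<Phi> $ 1 + \<i> *\<^sub>C \<Phi> $ 2) - (2 * \<i>) *\<^sub>C \<Phi> $ 2"
    by (simp add: scaleC_bop_distrib(3)[symmetric] algebra_simps)
  then have "(\<Phi> $ 1 - \<i> *\<^sub>C \<Phi> $ 2) * corner 1 N G = 1 - (2 * \<i>) *\<^sub>C corner N N G"
    by (simp only: left_diff_distrib tc scaleC_bop_simps(1))
  then show ?thesis by (simp add: prufer_phase_def Let_def inv \<Phi>_def[symmetric])
qed

text \<open>A rate linear in h and uniform in \<omega> gives the uniform limit, and pointwise
  uniqueness of limits makes the definite description in \<open>family_deriv\<close> pick D.\<close>

lemma family_deriv_eqI:
  assumes "0 < r" "\<And>h \<omega>. h \<noteq> 0 \<Longrightarrow> \<bar>h\<bar> < r \<Longrightarrow> norm ((A (E + h) \<omega> - A E \<omega>) /\<^sub>R h - D \<omega>) \<le> C * \<bar>h\<bar>"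
  shows "family_deriv A E = D"
proof -
  have D: "uniform_limit UNIV (\<lambda>h \<omega>. (A (E + h) \<omega> - A E \<omega>) /\<^sub>R h) D (at 0)"
  proof (rule uniform_limitI)
    fix \<epsilon> :: real assume \<epsilon>: "0 < \<epsilon>"
    define d where "d = min r (\<epsilon> / (\<bar>C\<bar> + 1))"
    have d: "0 < d" "d \<le> r" using \<epsilon> assms(1) by (auto simp: d_def)
    have "d \<le> \<epsilon> / (\<bar>C\<bar> + 1)" by (simp add: d_def)
    then have d3: "d * (\<bar>C\<bar> + 1) \<le> \<epsilon>" by (simp add: pos_le_divide_eq)
    show "\<forall>\<^sub>F h in at 0. \<forall>\<omega>\<in>UNIV. dist ((A (E + h) \<omega> - A E \<omega>) /\<^sub>R h) (D \<omega>) < \<epsilon>"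
      unfolding eventually_at
    proof (intro exI[of _ d] conjI ballI impI d(1))
      fix h :: real and \<omega> assume h: "h \<noteq> 0 \<and> dist h 0 < d"
      have "norm ((A (E + h) \<omega> - A E \<omega>) /\<^sub>R h - D \<omega>) \<le> C * \<bar>h\<bar>" using h d by (intro assms(2)) auto
      also have "\<dots> \<le> (\<bar>C\<bar> + 1) * \<bar>h\<bar>" by (intro mult_right_mono) auto
      also have "\<dots> < (\<bar>C\<bar> + 1) * d" using h by (intro mult_strict_left_mono) auto
      also have "\<dots> \<le> \<epsilon>" using d3 by (simp only: mult.commute)
      finally show "dist ((A (E + h) \<omega> - A E \<omega>) /\<^sub>R h) (D \<omega>) < \<epsilon>" by (simp add: dist_norm)
    qed
  qed
  show ?thesis unfolding family_deriv_def
  proof (rule the_equality, rule D)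
    fix D' assume "uniform_limit UNIV (\<lambda>h \<omega>. (A (E + h) \<omega> - A E \<omega>) /\<^sub>R h) D' (at 0)"
    then have "((\<lambda>h. (A (E + h) \<omega> - A E \<omega>) /\<^sub>R h) \<longlongrightarrow> D' \<omega>) (at 0)" for \<omega>
      by (rule tendsto_uniform_limitI) simp
    moreover have "((\<lambda>h. (A (E + h) \<omega> - A E \<omega>) /\<^sub>R h) \<longlongrightarrow> D \<omega>) (at 0)" for \<omega>
      by (rule tendsto_uniform_limitI[OF D]) simp
    ultimately show "D' = D" by (intro ext) (rule tendsto_unique[OF trivial_limit_at])
  qed
qed

locale jacobi_system = covariant_system P \<tau>
  for P :: "'w measure" and \<tau> :: "'z::int_lattice \<Rightarrow> 'w \<Rightarrow> 'w" +
  fixes T V :: "nat \<Rightarrow> 'w \<Rightarrow> 'z bop" and L :: real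
  assumes L: "0 < L"
    and T_measurable: "1 \<le> n \<Longrightarrow> mel_measurable P (T n)"
    and V_measurable: "1 \<le> n \<Longrightarrow> mel_measurable P (V n)"
    and T_covariant: "1 \<le> n \<Longrightarrow> mel (a + e) (T n (\<tau> e \<omega>)) (b + e) = mel a (T n \<omega>) b"
    and V_covariant: "1 \<le> n \<Longrightarrow> mel (a + e) (V n (\<tau> e \<omega>)) (b + e) = mel a (V n \<omega>) b"
    and T_norm: "1 \<le> n \<Longrightarrow> norm (T n \<omega>) \<le> L"
    and V_norm: "1 \<le> n \<Longrightarrow> norm (V n \<omega>) \<le> L"
    and T_inverse: "1 \<le> n \<Longrightarrow> T n \<omega> * bop_inv (T n \<omega>) = 1 \<and> bop_inv (T n \<omega>) * T n \<omega> = 1"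
    and T_inverse_norm: "1 \<le> n \<Longrightarrow> norm (bop_inv (T n \<omega>)) \<le> L"
    and V_adj: "1 \<le> n \<Longrightarrow> adj (V n \<omega>) = V n \<omega>"
begin

lemma fam_block:
  assumes "mel_measurable P A" "\<And>a b e \<omega>. mel (a + e) (A (\<tau> e \<omega>)) (b + e) = mel a (A \<omega>) b"
    "\<And>\<omega>. norm (A \<omega>) \<le> C"
  shows "fam P \<tau> (\<lambda>\<omega>. block k l (A \<omega>))"
  unfolding fam_def
proof (intro conjI allI)
  show "mel_measurable P (\<lambda>\<omega>. block k l (A \<omega>))"
    unfolding mel_measurable_def mel_block
  proof (intro allI)
    fix i j :: "nat \<times> 'z"
    show "(\<lambda>\<omega>. if fst i = k \<and> fst j = l then mel (snd i) (A \<omega>) (snd j) else 0) \<in> borel_measurable P"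
      using mel_measurableD[OF assms(1)] by (cases "fst i = k \<and> fst j = l") auto
  qed
  show "\<exists>C. \<forall>\<omega>. norm (block k l (A \<omega>)) \<le> C" by (intro exI[of _ C] allI order_trans[OF norm_block_le assms(3)])
qed (simp add: mel_block assms(2))

lemma fam_adj_block_T: "1 \<le> n \<Longrightarrow> fam P \<tau> (\<lambda>\<omega>. block k l (adj (T n \<omega>)))"
  by (rule fam_block[where C = L, OF mel_measurable_adj[OF T_measurable]]) (simp_all add: T_covariant T_norm)

lemma fam_block_T: "1 \<le> n \<Longrightarrow> fam P \<tau> (\<lambda>\<omega>. block k l (T n \<omega>))"
  by (rule fam_block[OF T_measurable T_covariant T_norm])

definition jac :: "nat \<Rightarrow> 'w \<Rightarrow> (nat \<times> 'z) bop" where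
  "jac N \<omega> = jacobi (\<lambda>k. T k \<omega>) (\<lambda>k. V k \<omega>) N"

lemma fam_jac: "fam P \<tau> (jac N)"
proof -
  have "fam P \<tau> (\<lambda>\<omega>. jac N \<omega>)"
    unfolding jac_def jacobi_def
    by (intro fam_add fam_sum fam_block[OF V_measurable V_covariant V_norm] fam_block_T fam_adj_block_T) auto
  then show ?thesis by simp
qed

lemma adj_jac: "adj (jac N \<omega>) = jac N \<omega>"
  unfolding jac_def by (rule adj_jacobi) (simp add: V_adj)

lemma jac_commute: "lay {1..N} * jac N \<omega> = jac N \<omega> * lay {1..N}"
  unfolding jac_def lay_jacobi ..

text \<open>The dissipation also covers layer 0 and the layers above N: \<open>jac N\<close>
  vanishes there, and without it the operator would not be invertible at e = s = 0.\<close>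

definition Zb :: "nat \<Rightarrow> real \<Rightarrow> real \<Rightarrow> 'w \<Rightarrow> (nat \<times> 'z) bop" where
  "Zb N e s \<omega> = Complex e (- s) *\<^sub>C 1 - jac N \<omega> - \<i> *\<^sub>C lay (- {1..<N})"

definition Gb :: "nat \<Rightarrow> real \<Rightarrow> real \<Rightarrow> 'w \<Rightarrow> (nat \<times> 'z) bop" where
  "Gb N e s \<omega> = bop_inv (Zb N e s \<omega>)"

lemma Gb_bound:
  assumes "1 \<le> N" "0 \<le> R"
  obtains C where "0 < C" "\<And>e s \<omega>. \<bar>e\<bar> \<le> R \<Longrightarrow> 0 \<le> s \<Longrightarrow> s \<le> 1 \<Longrightarrow>
    Zb N e s \<omega> * Gb N e s \<omega> = 1 \<and> Gb N e s \<omega> * Zb N e s \<omega> = 1 \<and> norm (Gb N e s \<omega>) \<le> C"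
proof -
  obtain C where C: "0 < C" "\<And>(t :: nat \<Rightarrow> 'z bop) v e s.
      (\<And>n. n \<in> {2..N} \<Longrightarrow> norm (t n) \<le> L) \<Longrightarrow> (\<And>n x. n \<in> {2..N} \<Longrightarrow> norm x \<le> L * norm (adj (t n) *\<^sub>V x)) \<Longrightarrow>
      (\<And>n. n \<in> {1..N} \<Longrightarrow> norm (v n) \<le> L) \<Longrightarrow> (\<And>n. n \<in> {1..N} \<Longrightarrow> adj (v n) = v n) \<Longrightarrow>
      \<bar>e\<bar> \<le> R \<Longrightarrow> 0 \<le> s \<Longrightarrow> s \<le> 1 \<Longrightarrow>
      (let Z = Complex e (- s) *\<^sub>C 1 - jacobi t v N - \<i> *\<^sub>C lay (- {1..<N})
       in Z * bop_inv Z = 1 \<and> bop_inv Z * Z = 1 \<and> norm (bop_inv Z) \<le> C)"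
    using jacobi_boundary_inverse[where 'i = 'z, OF assms(1) less_imp_le[OF L] assms(2)] by blast
  \<comment> \<open>The norm bound on the inverse of T, passed to adjoints, becomes the lower bound
    that the recursion needs.\<close>
  have adjT: "norm x \<le> L * norm (adj (T n \<omega>) *\<^sub>V x)" if "n \<in> {2..N}" for n x \<omega>
  proof -
    have "adj (T n \<omega> * bop_inv (T n \<omega>)) = adj 1" using T_inverse[of n \<omega>] that by simp
    then have "adj (bop_inv (T n \<omega>)) * adj (T n \<omega>) = 1" by simp
    then have "norm x = norm (adj (bop_inv (T n \<omega>)) *\<^sub>V adj (T n \<omega>) *\<^sub>V x)"
      using times_apply[of "adj (bop_inv (T n \<omega>))" "adj (T n \<omega>)" 1 x] by simp
    also have "\<dots> \<le> norm (bop_inv (T n \<omega>)) * norm (adj (T n \<omega>) *\<^sub>V x)"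
      using norm_bop_apply[of "adj (bop_inv (T n \<omega>))"] by simp
    also have "\<dots> \<le> L * norm (adj (T n \<omega>) *\<^sub>V x)"
      using T_inverse_norm[of n \<omega>] that by (intro mult_right_mono) auto
    finally show ?thesis .
  qed
  show thesis
  proof (rule that[OF C(1)])
    fix e s :: real and \<omega> assume es: "\<bar>e\<bar> \<le> R" "0 \<le> s" "s \<le> 1"
    show "Zb N e s \<omega> * Gb N e s \<omega> = 1 \<and> Gb N e s \<omega> * Zb N e s \<omega> = 1 \<and> norm (Gb N e s \<omega>) \<le> C"
      using C(2)[of "\<lambda>k. T k \<omega>" "\<lambda>k. V k \<omega>", OF _ adjT _ _ es] T_norm V_norm V_adj
      unfolding Let_def Gb_def Zb_def jac_def by auto
  qed
qed

lemma Gb_inverse: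
  assumes "1 \<le> N" "0 \<le> s" "s \<le> 1"
  shows "Zb N e s \<omega> * Gb N e s \<omega> = 1" "Gb N e s \<omega> * Zb N e s \<omega> = 1"
  using Gb_bound[OF assms(1), of "\<bar>e\<bar>"] assms by (metis abs_ge_zero order_refl)+

lemma fam_Zb: "fam P \<tau> (Zb N e s)"
proof -
  have "fam P \<tau> (\<lambda>\<omega>. Zb N e s \<omega>)"
    unfolding Zb_def by (intro fam_diff fam_scaleC fam_one fam_jac fam_lay)
  then show ?thesis by simp
qed

lemma fam_Gb:
  assumes "1 \<le> N" "0 \<le> s" "s \<le> 1"
  shows "fam P \<tau> (Gb N e s)"
proof -
  obtain C where "\<And>\<omega>. norm (Gb N e s \<omega>) \<le> C"
    using Gb_bound[OF assms(1), of "\<bar>e\<bar>"] assms by (metis abs_ge_zero order_refl)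
  then show ?thesis by (rule fam_inverse[OF fam_Zb Gb_inverse[OF assms]])
qed

lemma Gb_commute:
  assumes "1 \<le> N" "0 \<le> s" "s \<le> 1"
  shows "lay {1..N} * Gb N e s \<omega> = Gb N e s \<omega> * lay {1..N}"
  by (rule inverse_commute[OF Gb_inverse[OF assms]])
     (simp add: Zb_def left_diff_distrib right_diff_distrib jac_commute lay_times Int_commute del: One_nat_def)

lemma adj_Zb: "adj (Zb N e 0 \<omega>) = Complex e 0 *\<^sub>C 1 - jac N \<omega> + \<i> *\<^sub>C lay (- {1..<N})"
proof -
  have "cnj (Complex e (- 0)) = Complex e 0" "cnj \<i> = - \<i>" by (simp_all add: complex_eq_iff)
  then show ?thesis by (simp add: Zb_def adj_jac scaleC_bop_distrib)
qed

lemma lay_boundary: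
  fixes N :: nat assumes "1 \<le> N"
  shows "lay (- {1..<N}) = lay {N} + lay (- {1..N})"
  using assms by (intro bop_mel_eqI) (auto simp: mel_lay)

context
  fixes N :: nat assumes N: "1 \<le> N"
begin

lemma adj_Gb_inverse:
  "adj (Zb N e 0 \<omega>) * adj (Gb N e 0 \<omega>) = 1" "adj (Gb N e 0 \<omega>) * adj (Zb N e 0 \<omega>) = 1"
  using arg_cong[OF Gb_inverse(2)[OF N, of 0 e \<omega>], of adj] arg_cong[OF Gb_inverse(1)[OF N, of 0 e \<omega>], of adj]
  by simp_all

lemma prufer_phase_Gb: "prufer_phase T V N e \<omega> = 1 - (2 * \<i>) *\<^sub>C corner N N (adj (Gb N e 0 \<omega>))"
  by (rule prufer_phase_corner[OF N])
     (use T_inverse adj_Gb_inverse[of e \<omega>] in \<open>simp_all add: adj_Zb flip: jac_def\<close>)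

text \<open>Both orders of the resolvent identity occur: the first form simplifies the phase
  velocity, the second the trace of the imaginary part of G.\<close>

lemma Gb_minus_adj:
  "Gb N e 0 \<omega> - adj (Gb N e 0 \<omega>) = (2 * \<i>) *\<^sub>C (Gb N e 0 \<omega> * lay (- {1..<N}) * adj (Gb N e 0 \<omega>))"
  "Gb N e 0 \<omega> - adj (Gb N e 0 \<omega>) = (2 * \<i>) *\<^sub>C (adj (Gb N e 0 \<omega>) * lay (- {1..<N}) * Gb N e 0 \<omega>)"
proof -
  define Z G where "Z = Zb N e 0 \<omega>" and "G = Gb N e 0 \<omega>"
  have ZG: "Z * G = 1" "G * Z = 1" using Gb_inverse[OF N, of 0 e \<omega>] by (simp_all add: Z_def G_def)
  have aZG: "adj Z * adj G = 1" "adj G * adj Z = 1" using adj_Gb_inverse[of e \<omega>] by (simp_all add: Z_def G_def)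
  have "adj Z - Z = (\<i> + \<i>) *\<^sub>C lay (- {1..<N})"
    unfolding Z_def adj_Zb unfolding Zb_def scaleC_bop_distrib(3) by simp
  then have D: "adj Z - Z = (2 * \<i>) *\<^sub>C lay (- {1..<N})" by simp
  have "G - adj G = G * (adj Z * adj G) - (G * Z) * adj G" unfolding aZG ZG by simp
  also have "\<dots> = G * (adj Z - Z) * adj G" by (simp only: left_diff_distrib right_diff_distrib mult.assoc)
  finally show "G - adj G = (2 * \<i>) *\<^sub>C (G * lay (- {1..<N}) * adj G)" unfolding D by simp
  have "G - adj G = (adj G * adj Z) * G - adj G * (Z * G)" unfolding aZG ZG by simp
  also have "\<dots> = adj G * (adj Z - Z) * G" by (simp only: left_diff_distrib right_diff_distrib mult.assoc)
  finally show "G - adj G = (2 * \<i>) *\<^sub>C (adj G * lay (- {1..<N}) * G)" unfolding D by simp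
qed

text \<open>With W = adj G the e-derivative of W is -W^2, with a remainder of second order that is
  uniform in \<omega> because the bound on G is; the factor -2 i in front of the corner turns this
  into 2 i W^2.\<close>

lemma family_deriv_prufer:
  "family_deriv (prufer_phase T V N) e \<omega> = (2 * \<i>) *\<^sub>C corner N N (adj (Gb N e 0 \<omega>) * adj (Gb N e 0 \<omega>))"
proof -
  obtain C where C: "0 < C" "\<And>e' \<omega>. \<bar>e'\<bar> \<le> \<bar>e\<bar> + 1 \<Longrightarrow> norm (Gb N e' 0 \<omega>) \<le> C"
    using Gb_bound[OF N, of "\<bar>e\<bar> + 1"] by (metis abs_ge_zero add_nonneg_nonneg zero_le_one order_refl)
  define W where "W e \<omega> = adj (Gb N e 0 \<omega>)" for e \<omega>
  have "family_deriv (prufer_phase T V N) e = (\<lambda>\<omega>. (2 * \<i>) *\<^sub>C corner N N (W e \<omega> * W e \<omega>))"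
  proof (rule family_deriv_eqI[where r = 1 and C = "2 * (C * C * C)"])
    fix h :: real and \<omega> assume h: "h \<noteq> 0" "\<bar>h\<bar> < 1"
    have D: "adj (Zb N e 0 \<omega>) - adj (Zb N (e + h) 0 \<omega>) = of_real (- h) *\<^sub>C 1"
    proof -
      have "Complex e 0 - Complex (e + h) 0 = of_real (- h)" by (simp add: complex_eq_iff)
      then show ?thesis unfolding adj_Zb by (simp add: scaleC_bop_distrib(4)[symmetric])
    qed
    have exp: "W (e + h) \<omega> - W e \<omega> + of_real h *\<^sub>C (W e \<omega> * W e \<omega>) = (of_real h)\<^sup>2 *\<^sub>C (W (e + h) \<omega> * W e \<omega> * W e \<omega>)"
      using inverse_expand[OF adj_Gb_inverse(1,2) adj_Gb_inverse(1,2) D, where A = 1, folded W_def]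
      by (simp add: scaleC_bop_distrib)
    have "prufer_phase T V N (e + h) \<omega> - prufer_phase T V N e \<omega>
        = - ((2 * \<i>) *\<^sub>C corner N N (W (e + h) \<omega> - W e \<omega>))"
      by (simp add: prufer_phase_Gb W_def scaleC_bop_distrib)
    also have "W (e + h) \<omega> - W e \<omega> = (of_real h)\<^sup>2 *\<^sub>C (W (e + h) \<omega> * W e \<omega> * W e \<omega>) - of_real h *\<^sub>C (W e \<omega> * W e \<omega>)"
      unfolding exp[symmetric] by simp
    finally have diff: "prufer_phase T V N (e + h) \<omega> - prufer_phase T V N e \<omega>
        = - ((2 * \<i>) *\<^sub>C corner N N ((of_real h)\<^sup>2 *\<^sub>C (W (e + h) \<omega> * W e \<omega> * W e \<omega>) - of_real h *\<^sub>C (W e \<omega> * W e \<omega>)))" .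
    have c: "complex_of_real (inverse h) * (2 * \<i> * (of_real h)\<^sup>2) = 2 * \<i> * of_real h"
      "complex_of_real (inverse h) * (2 * \<i> * of_real h) = 2 * \<i>"
      using h by (simp_all add: power2_eq_square field_simps)
    have "(prufer_phase T V N (e + h) \<omega> - prufer_phase T V N e \<omega>) /\<^sub>R h - (2 * \<i>) *\<^sub>C corner N N (W e \<omega> * W e \<omega>)
        = - ((2 * \<i> * of_real h) *\<^sub>C corner N N (W (e + h) \<omega> * W e \<omega> * W e \<omega>))"
      unfolding diff corner_simps scaleC_bop_simps scaleC_bop_distrib(2) scaleR_minus_right scaleR_diff_right scaleR_scaleC_bop c by simp
    also have "norm \<dots> \<le> 2 * \<bar>h\<bar> * (C * C * C)"
    proof -
      have "norm (W (e + h) \<omega> * W e \<omega> * W e \<omega>) \<le> C * C * C"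
        using C h unfolding W_def
        by (intro order_trans[OF norm_mult_ineq] mult_mono) auto
      then have "norm (corner N N (W (e + h) \<omega> * W e \<omega> * W e \<omega>)) \<le> C * C * C"
        using norm_corner_le by (rule order_trans[rotated])
      then show ?thesis unfolding norm_minus_cancel norm_scaleC_bop
        by (intro mult_mono) (auto simp: norm_mult)
    qed
    finally show "norm ((prufer_phase T V N (e + h) \<omega> - prufer_phase T V N e \<omega>) /\<^sub>R h
        - (2 * \<i>) *\<^sub>C corner N N (W e \<omega> * W e \<omega>)) \<le> 2 * (C * C * C) * \<bar>h\<bar>" by (simp add: ac_simps)
  qed simp
  then show ?thesis by (simp add: W_def)
qed

lemma corner_lay_times: "corner k l (X * lay {m} * Y) = corner k m X * corner m l (Y :: ('k \<times> 'i) bop)"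
  unfolding lay_singleton mult.assoc
  by (rule bop_eqI) (simp add: corner_apply block_apply)

text \<open>A product of corners at N is a corner with the projection onto layer N in between. That
  projection may be enlarged to the whole dissipation P, since G does not connect the sample to the
  other layers; then adj G + 2 i G P adj G = G collapses the expression to G adj G.\<close>

lemma phase_velocity_Gb:
  "phase_velocity T V N e \<omega> = of_real (2 / real N) *\<^sub>C corner N N (Gb N e 0 \<omega> * adj (Gb N e 0 \<omega>))"
proof -
  define G where "G = Gb N e 0 \<omega>"
  have comm: "lay {1..N} * adj G = adj G * lay {1..N}"
    using arg_cong[OF Gb_commute[OF N, of 0 e \<omega>], of adj] by (simp add: G_def)
  have out: "corner N N (X * lay (- {1..N}) * (adj G * Y)) = 0"
    if "Y * lay {1..N} = lay {1..N} * Y" for X Y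
  proof (rule bop_mel_eqI)
    fix a b
    have "X * lay (- {1..N}) * (adj G * Y) = X * (adj G * Y) * lay (- {1..N})"
      using that unfolding lay_Compl
      by (simp add: left_diff_distrib right_diff_distrib comm mult.assoc del: One_nat_def)
         (simp add: mult.assoc[symmetric] comm del: One_nat_def)
    then show "mel a (corner N N (X * lay (- {1..N}) * (adj G * Y))) b = mel a 0 b"
      using N by (simp add: mel_corner mel_times_lay)
  qed
  have "adj (prufer_phase T V N e \<omega>) = 1 + (2 * \<i>) *\<^sub>C corner N N G"
    unfolding prufer_phase_Gb by (simp add: corner_adj G_def scaleC_bop_distrib)
  then have "adj (prufer_phase T V N e \<omega>) * family_deriv (prufer_phase T V N) e \<omega>
      = (2 * \<i>) *\<^sub>C (corner N N (adj G * adj G) + (2 * \<i>) *\<^sub>C (corner N N G * corner N N (adj G * adj G)))"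
    unfolding family_deriv_prufer G_def[symmetric] by (simp add: distrib_right scaleC_bop_distrib)
  also have "corner N N G * corner N N (adj G * adj G) = corner N N (G * lay {N} * (adj G * adj G))"
    by (rule corner_lay_times[symmetric])
  also have "\<dots> = corner N N (G * lay (- {1..<N}) * (adj G * adj G))"
    unfolding lay_boundary[OF N] distrib_left distrib_right
    using out[of "adj G" G] comm by simp
  also have "corner N N (adj G * adj G) + (2 * \<i>) *\<^sub>C corner N N (G * lay (- {1..<N}) * (adj G * adj G))
      = corner N N ((adj G + (2 * \<i>) *\<^sub>C (G * lay (- {1..<N}) * adj G)) * adj G)"
    by (simp add: distrib_right mult.assoc)
  also have "adj G + (2 * \<i>) *\<^sub>C (G * lay (- {1..<N}) * adj G) = G"
    unfolding G_def Gb_minus_adj(1)[symmetric] by simp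
  finally show ?thesis
    using N by (simp add: phase_velocity_def G_def field_simps)
qed

text \<open>Im tr G is the trace of the boundary dissipation G * P G, which by cyclicity is the phase velocity.\<close>

lemma trace_phase_velocity:
  "trace_per_site P (phase_velocity T V N e) = of_real (2 / real N * Im (tr N (Gb N e 0)))"
proof -
  define G where "G = Gb N e 0"
  have Gf: "fam P \<tau> G" unfolding G_def by (rule fam_Gb[OF N]) auto
  have comm: "lay {1..N} * G \<omega> = G \<omega> * lay {1..N}" for \<omega>
    unfolding G_def by (rule Gb_commute[OF N]) auto
  have im: "of_real (Im (mel (n, 0) (G \<omega>) (n, 0))) = mel (n, 0) (adj (G \<omega>) * (lay {N} * G \<omega>)) (n, 0)"
    if n: "n \<in> {1..N}" for n \<omega>
  proof -
    have out: "mel (n, 0) (adj (G \<omega>) * lay (- {1..N}) * G \<omega>) (n, 0) = 0"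
    proof -
      have "adj (G \<omega>) * lay (- {1..N}) * G \<omega> = adj (G \<omega>) * G \<omega> * lay (- {1..N})"
        unfolding lay_Compl
        by (simp add: left_diff_distrib right_diff_distrib mult.assoc comm del: One_nat_def)
      then show ?thesis using n by (simp only: mel_times_lay fst_conv) simp
    qed
    have "2 * \<i> * of_real (Im (mel (n, 0) (G \<omega>) (n, 0))) = mel (n, 0) (G \<omega> - adj (G \<omega>)) (n, 0)"
      by (simp add: complex_eq_iff)
    also have "\<dots> = 2 * \<i> * mel (n, 0) (adj (G \<omega>) * lay (- {1..<N}) * G \<omega>) (n, 0)"
      unfolding G_def Gb_minus_adj(2) by simp
    also have "\<dots> = 2 * \<i> * mel (n, 0) (adj (G \<omega>) * (lay {N} * G \<omega>)) (n, 0)"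
      unfolding lay_boundary[OF N] distrib_left distrib_right mel_simps out by (simp add: mult.assoc)
    finally show ?thesis by simp
  qed
  have "of_real (Im (tr N G)) = (\<Sum>n=1..N. LINT \<omega>|P. complex_of_real (Im (mel (n, 0) (G \<omega>) (n, 0))))"
    unfolding tr_def Im_sum of_real_sum integral_Im[OF integrable_mel[OF Gf], symmetric]
    by simp
  also have "\<dots> = tr N (\<lambda>\<omega>. adj (G \<omega>) * (lay {N} * G \<omega>))"
    unfolding tr_def using im by (intro sum.cong refl) (simp del: of_real_eq_iff)
  also have "\<dots> = tr N (\<lambda>\<omega>. (lay {N} * G \<omega>) * adj (G \<omega>))"
  proof (rule tr_cyclic[OF fam_adj[OF Gf] fam_times[OF fam_lay Gf]])
    have *: "lay {1..N} * lay {N} = (lay {N} :: (nat \<times> 'z) bop)" "lay {N} * lay {1..N} = (lay {N} :: (nat \<times> 'z) bop)"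
      using N by (auto simp: lay_times Int_absorb1 Int_absorb2)
    show "lay {1..N} * (lay {N} * G \<omega>) = lay {N} * G \<omega>" for \<omega> by (simp only: mult.assoc[symmetric] *)
    show "lay {N} * G \<omega> * lay {1..N} = lay {N} * G \<omega>" for \<omega>
      by (simp only: mult.assoc comm[symmetric]) (simp only: mult.assoc[symmetric] *)
  qed
  also have "\<dots> = (LINT \<omega>|P. mel (N, 0) (G \<omega> * adj (G \<omega>)) (N, 0))"
    unfolding mult.assoc using N by (subst tr_lay) auto
  finally show ?thesis
    unfolding trace_per_site_def phase_velocity_Gb G_def[symmetric] mel_simps mel_corner by simp
qed

end

end

subsection \<open>Phase velocity and density of states\<close>

lemma resolvent_difference:
  fixes Z Z' :: "'i bop"
  assumes "Z * G = 1" "G' * Z' = 1"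
  shows "G' - G = G' * (Z - Z') * G"
proof -
  have "G' * (Z - Z') * G = G' * (Z * G) - (G' * Z') * G"
    by (simp only: right_diff_distrib left_diff_distrib mult.assoc)
  then show ?thesis using assms by simp
qed

context covariant_system begin

lemma tr_diff_bound:
  assumes "fam P \<tau> X" "fam P \<tau> Y" "\<And>\<omega>. norm (X \<omega> - Y \<omega>) \<le> C"
  shows "cmod (tr N X - tr N Y) \<le> real N * C"
  unfolding tr_diff[OF assms(1,2), symmetric] by (rule tr_bound[OF fam_diff[OF assms(1,2)] assms(3)])

definition res :: "('w \<Rightarrow> (nat \<times> 'z) bop) \<Rightarrow> real \<Rightarrow> real \<Rightarrow> 'w \<Rightarrow> (nat \<times> 'z) bop" where
  "res H s e \<omega> = bop_inv (Complex e (- s) *\<^sub>C 1 - H \<omega>)"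

lemma res_props:
  assumes "fam P \<tau> H" "\<And>\<omega>. adj (H \<omega>) = H \<omega>" "0 < s"
  shows "(Complex e (- s) *\<^sub>C 1 - H \<omega>) * res H s e \<omega> = 1" "res H s e \<omega> * (Complex e (- s) *\<^sub>C 1 - H \<omega>) = 1"
    "norm (res H s e \<omega>) \<le> 1 / s" "fam P \<tau> (res H s e)"
proof -
  have d: "dissip s (Complex e (- s) *\<^sub>C 1 - H \<omega>)" for \<omega>
    using dissip_sub[OF assms(2), of 0 s "Complex e (- s)" \<omega>] by simp
  show "(Complex e (- s) *\<^sub>C 1 - H \<omega>) * res H s e \<omega> = 1" "res H s e \<omega> * (Complex e (- s) *\<^sub>C 1 - H \<omega>) = 1"
    "norm (res H s e \<omega>) \<le> 1 / s"
    unfolding res_def by (rule dissip_inv[OF assms(3) d])+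
  have "fam P \<tau> (\<lambda>\<omega>. bop_inv (Complex e (- s) *\<^sub>C 1 - H \<omega>))"
    by (rule fam_dissip_inv[OF _ assms(3) d]) (intro fam_diff fam_scaleC fam_one assms)
  then show "fam P \<tau> (res H s e)" by (simp add: res_def[abs_def])
qed

lemma res_integrable_on:
  assumes H: "fam P \<tau> H" "\<And>\<omega>. adj (H \<omega>) = H \<omega>" and s: "0 < s"
  shows "(\<lambda>e. tr N (res H s e)) integrable_on {a..b}"
proof (rule integrable_continuous_real, rule continuous_on_vector_derivative)
  fix e
  show "((\<lambda>e. tr N (res H s e)) has_vector_derivative tr N (\<lambda>\<omega>. - (1 *\<^sub>C (res H s e \<omega> * res H s e \<omega>)))) (at e within {a..b})"
  proof (rule has_vector_derivative_quadratic)
    fix e'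
    note r = res_props[OF H s]
    have D: "(Complex e (- s) *\<^sub>C 1 - H \<omega>) - (Complex e' (- s) *\<^sub>C 1 - H \<omega>) = of_real (e - e') *\<^sub>C 1" for \<omega>
    proof -
      have "Complex e (- s) - Complex e' (- s) = of_real (e - e')" by (simp add: complex_eq_iff)
      then show ?thesis by (simp add: scaleC_bop_distrib(4)[symmetric] del: of_real_diff)
    qed
    have exp: "res H s e' \<omega> - res H s e \<omega> - of_real (e - e') *\<^sub>C (res H s e \<omega> * res H s e \<omega>)
        = (of_real (e - e'))\<^sup>2 *\<^sub>C (res H s e' \<omega> * res H s e \<omega> * res H s e \<omega>)" for \<omega>
      using inverse_expand[OF r(1,2) r(1,2) D, where A = 1] unfolding mult_1_right mult_1_left .
    have m: "tr N (\<lambda>\<omega>. - (1 *\<^sub>C (res H s e \<omega> * res H s e \<omega>))) = - tr N (\<lambda>\<omega>. res H s e \<omega> * res H s e \<omega>)"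
      by (simp add: tr_def sum_negf)
    have "tr N (res H s e') - tr N (res H s e) - of_real (e - e') * tr N (\<lambda>\<omega>. res H s e \<omega> * res H s e \<omega>)
        = tr N (\<lambda>\<omega>. res H s e' \<omega> - res H s e \<omega> - of_real (e - e') *\<^sub>C (res H s e \<omega> * res H s e \<omega>))"
      unfolding tr_scaleC[symmetric] by (simp only: tr_diff fam_diff fam_scaleC fam_times r)
    also have "\<dots> = (of_real (e - e'))\<^sup>2 * tr N (\<lambda>\<omega>. res H s e' \<omega> * res H s e \<omega> * res H s e \<omega>)"
      unfolding exp tr_scaleC ..
    also have "cmod \<dots> \<le> (e' - e)\<^sup>2 * (real N * (1 / s * (1 / s) * (1 / s)))"
      unfolding norm_mult norm_power norm_of_real power2_abs power2_commute[of e e']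
      by (intro mult_left_mono tr_bound fam_times r order_trans[OF norm_mult_ineq] mult_mono) (use s in auto)
    also have "tr N (res H s e') - tr N (res H s e) - of_real (e - e') * tr N (\<lambda>\<omega>. res H s e \<omega> * res H s e \<omega>)
        = tr N (res H s e') - tr N (res H s e) - of_real (e' - e) * tr N (\<lambda>\<omega>. - (1 *\<^sub>C (res H s e \<omega> * res H s e \<omega>)))"
      unfolding m by (simp add: algebra_simps)
    finally show "cmod (tr N (res H s e') - tr N (res H s e) - of_real (e' - e) * tr N (\<lambda>\<omega>. - (1 *\<^sub>C (res H s e \<omega> * res H s e \<omega>))))
        \<le> (real N * (1 / s * (1 / s) * (1 / s))) * (e' - e)\<^sup>2" by (simp only: mult.commute)
  qed
qed

end

context jacobi_system begin

text \<open>The resolvent is block diagonal for the sample and its complement, so the dissipation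
  outside of the sample does not show in the trace over the first N layers. Removing it leaves a
  perturbation of the single layer N, which \<open>path_lay\<close> can treat.\<close>

lemma tr_Gb_eq:
  assumes N: "1 \<le> N" and s: "0 < s" "s \<le> 1"
  shows "tr N (Gb N e s) = tr N (\<lambda>\<omega>. bop_inv (Complex e (- s) *\<^sub>C 1 - jac N \<omega> - \<i> *\<^sub>C lay {N}))"
proof -
  have s0: "0 \<le> s" using s by simp
  have "mel (n, 0) (Gb N e s \<omega>) (n, 0) = mel (n, 0) (bop_inv (Complex e (- s) *\<^sub>C 1 - jac N \<omega> - \<i> *\<^sub>C lay {N})) (n, 0)"
    if n: "n \<in> {1..N}" for n \<omega>
  proof -
    define Z where "Z = Complex e (- s) *\<^sub>C 1 - jac N \<omega> - \<i> *\<^sub>C lay {N}"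
    define G where "G = bop_inv Z"
    have "dissip s Z"
      unfolding Z_def by (rule dissip_sub[OF adj_jac]) (simp_all add: Im_cinner_lay del: bop_apply_simps)
    then have GZ: "G * Z = 1" unfolding G_def by (rule dissip_inv(2)[OF s(1)])
    have "Z = Zb N e s \<omega> + \<i> *\<^sub>C lay (- {1..N})"
      unfolding Z_def Zb_def lay_boundary[OF N] by (simp add: scaleC_bop_distrib)
    then have "Z * (Gb N e s \<omega> * lay {1..N})
        = Zb N e s \<omega> * Gb N e s \<omega> * lay {1..N} + \<i> *\<^sub>C (lay (- {1..N}) * (Gb N e s \<omega> * lay {1..N}))"
      by (simp add: distrib_right mult.assoc del: One_nat_def)
    also have "lay (- {1..N}) * (Gb N e s \<omega> * lay {1..N}) = 0"
      unfolding Gb_commute[OF N s0 s(2), symmetric] mult.assoc[symmetric] lay_times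
      by (rule bop_mel_eqI) (simp add: mel_lay_times)
    finally have "Z * (Gb N e s \<omega> * lay {1..N}) = lay {1..N}"
      using Gb_inverse(1)[OF N s0 s(2)] by (simp del: One_nat_def)
    then have "G * lay {1..N} = G * Z * (Gb N e s \<omega> * lay {1..N})" by (simp only: mult.assoc)
    then have "G * lay {1..N} = Gb N e s \<omega> * lay {1..N}" unfolding GZ by simp
    then have "mel (n, 0) (G * lay {1..N}) (n, 0) = mel (n, 0) (Gb N e s \<omega> * lay {1..N}) (n, 0)" by simp
    then show ?thesis using n by (simp add: mel_times_lay G_def Z_def)
  qed
  then show ?thesis unfolding tr_def by (intro sum.cong refl) simp
qed

context
  fixes N :: nat assumes N: "1 \<le> N"
begin

text \<open>Continuity up to s = 0, locally in e. The constant depends on N and R, which does no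
  harm because it enters only at fixed N.\<close>

lemma tr_Gb_lipschitz:
  assumes "0 \<le> R"
  obtains C where "0 < C" "\<And>e e' s s'. \<bar>e\<bar> \<le> R \<Longrightarrow> \<bar>e'\<bar> \<le> R \<Longrightarrow> 0 \<le> s \<Longrightarrow> s \<le> 1 \<Longrightarrow> 0 \<le> s' \<Longrightarrow> s' \<le> 1 \<Longrightarrow>
      cmod (tr N (Gb N e' s') - tr N (Gb N e s)) \<le> C * cmod (Complex e (- s) - Complex e' (- s'))"
    "\<And>e. \<bar>e\<bar> \<le> R \<Longrightarrow> cmod (tr N (Gb N e 0)) \<le> C"
proof -
  obtain C where C: "0 < C" "\<And>e s \<omega>. \<bar>e\<bar> \<le> R \<Longrightarrow> 0 \<le> s \<Longrightarrow> s \<le> 1 \<Longrightarrow>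
    Zb N e s \<omega> * Gb N e s \<omega> = 1 \<and> Gb N e s \<omega> * Zb N e s \<omega> = 1 \<and> norm (Gb N e s \<omega>) \<le> C"
    using Gb_bound[OF N assms] by metis
  show thesis
  proof (rule that[of "real N * (C * C) + real N * C"])
    show "0 < real N * (C * C) + real N * C" using N C by (intro add_pos_pos mult_pos_pos) auto
    fix e e' s s' :: real
    assume e: "\<bar>e\<bar> \<le> R" "\<bar>e'\<bar> \<le> R" and s: "0 \<le> s" "s \<le> 1" "0 \<le> s'" "s' \<le> 1"
    define \<zeta> where "\<zeta> = Complex e (- s) - Complex e' (- s')"
    have "norm (Gb N e' s' \<omega> - Gb N e s \<omega>) \<le> C * C * cmod \<zeta>" for \<omega>
    proof -
      have "Zb N e s \<omega> - Zb N e' s' \<omega> = \<zeta> *\<^sub>C 1" by (simp add: Zb_def \<zeta>_def scaleC_bop_distrib)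
      moreover have "Gb N e' s' \<omega> - Gb N e s \<omega> = Gb N e' s' \<omega> * (Zb N e s \<omega> - Zb N e' s' \<omega>) * Gb N e s \<omega>"
        by (rule resolvent_difference) (use C(2) e s in auto)
      ultimately have "Gb N e' s' \<omega> - Gb N e s \<omega> = \<zeta> *\<^sub>C (Gb N e' s' \<omega> * Gb N e s \<omega>)" by simp
      moreover have "norm (Gb N e' s' \<omega> * Gb N e s \<omega>) \<le> C * C"
        using C e s by (intro order_trans[OF norm_mult_ineq] mult_mono) auto
      ultimately show ?thesis by (simp add: norm_scaleC_bop mult_left_mono mult.commute)
    qed
    then have "cmod (tr N (Gb N e' s') - tr N (Gb N e s)) \<le> real N * (C * C * cmod \<zeta>)"
      by (intro tr_diff_bound fam_Gb N s)
    also have "\<dots> \<le> (real N * (C * C) + real N * C) * cmod \<zeta>"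
      using C(1) by (simp add: distrib_right mult.assoc)
    finally show "cmod (tr N (Gb N e' s') - tr N (Gb N e s)) \<le> (real N * (C * C) + real N * C) * cmod (Complex e (- s) - Complex e' (- s'))"
      unfolding \<zeta>_def .
  next
    fix e assume "\<bar>e\<bar> \<le> R"
    then have "cmod (tr N (Gb N e 0)) \<le> real N * C" using C(2)[of e 0] by (intro tr_bound fam_Gb N) auto
    moreover have "0 \<le> real N * (C * C)" using C(1) by simp
    ultimately show "cmod (tr N (Gb N e 0)) \<le> real N * (C * C) + real N * C" by linarith
  qed
qed

lemma Gb_continuous: "0 \<le> s \<Longrightarrow> s \<le> 1 \<Longrightarrow> continuous_on {a..b} (\<lambda>e. tr N (Gb N e s))"
proof -
  assume s: "0 \<le> s" "s \<le> 1"
  obtain C where C: "0 < C" "\<And>e e' s s'. \<bar>e\<bar> \<le> \<bar>a\<bar> + \<bar>b\<bar> \<Longrightarrow> \<bar>e'\<bar> \<le> \<bar>a\<bar> + \<bar>b\<bar> \<Longrightarrow> 0 \<le> s \<Longrightarrow> s \<le> 1 \<Longrightarrow> 0 \<le> s' \<Longrightarrow> s' \<le> 1 \<Longrightarrow>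
      cmod (tr N (Gb N e' s') - tr N (Gb N e s)) \<le> C * cmod (Complex e (- s) - Complex e' (- s'))"
    using tr_Gb_lipschitz[of "\<bar>a\<bar> + \<bar>b\<bar>"] by (metis abs_ge_zero add_nonneg_nonneg)
  have "C-lipschitz_on {a..b} (\<lambda>e. tr N (Gb N e s))"
  proof (rule lipschitz_onI)
    fix x y assume "x \<in> {a..b}" "y \<in> {a..b}"
    then have "cmod (tr N (Gb N x s) - tr N (Gb N y s)) \<le> C * cmod (Complex y (- s) - Complex x (- s))"
      using s by (intro C) auto
    also have "Complex y (- s) - Complex x (- s) = of_real (y - x)" by (simp add: complex_eq_iff)
    finally show "dist (tr N (Gb N x s)) (tr N (Gb N y s)) \<le> C * dist x y"
      by (simp only: dist_norm norm_of_real real_norm_def abs_minus_commute)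
  qed (use C in auto)
  then show ?thesis by (rule lipschitz_on_continuous_on)
qed

text \<open>By \<open>trace_phase_velocity\<close> this is N/2 times the trace of the phase
  velocity.\<close>

definition rot :: "real \<Rightarrow> real" where
  "rot e = Im (tr N (Gb N e 0))"

lemma rot_continuous: "continuous_on {a..b} rot"
  unfolding rot_def[abs_def] by (intro continuous_intros Gb_continuous) auto

lemma rot_nonneg: "0 \<le> rot e"
proof -
  have "0 \<le> Im (mel (n, 0) (Gb N e 0 \<omega>) (n, 0))" for n \<omega>
  proof -
    define w where "w = Gb N e 0 \<omega> *\<^sub>V ket (n, 0)"
    have Zw: "Zb N e 0 \<omega> *\<^sub>V w = ket (n, 0)"
      unfolding w_def using times_apply[OF Gb_inverse(1)[OF N], of 0 e \<omega> "ket (n, 0)"] by simp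
    have "mel (n, 0) (Gb N e 0 \<omega>) (n, 0) = cinner (Zb N e 0 \<omega> *\<^sub>V w) w" unfolding Zw unfolding mel_def w_def ..
    also have "\<dots> = cnj (cinner w (Zb N e 0 \<omega> *\<^sub>V w))" by (simp add: cinner_commute)
    finally have "Im (mel (n, 0) (Gb N e 0 \<omega>) (n, 0)) = - Im (cinner w (Zb N e 0 \<omega> *\<^sub>V w))" by simp
    also have "\<dots> \<ge> 0"
      using Im_cinner_lay[of w \<i> "- {1..<N}"] by (simp add: Zb_def cinner_simps sa_Im[OF adj_jac] cinner_self)
    finally show ?thesis .
  qed
  then show ?thesis
    unfolding rot_def tr_def Im_sum integral_Im[OF integrable_mel[OF fam_Gb[OF N order_refl zero_le_one]], symmetric]
    by (intro sum_nonneg integral_nonneg) auto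
qed

lemma jac_bound: obtains K where "0 < K" "\<And>\<omega>. norm (jac N \<omega>) \<le> K"
  using fam_bound[OF fam_jac[of N]] by metis

text \<open>For s > 0 the energy integrals with and without dissipation differ by the boundary terms
  of \<open>path_lay\<close> for the coupling i in the single layer N, hence by at most 8, and both
  have limits as s tends to 0. The lower end -R lies to the left of the spectrum, as
  \<open>dos_mid_limit\<close> requires.\<close>

lemma rot_integral_bound:
  assumes K: "\<And>\<omega>. norm (jac N \<omega>) \<le> K" and R: "K < R" "- R \<le> E"
  shows "\<bar>integral {- R..E} rot - pi * dos_mid (jac N) N E\<bar> \<le> 8"
proof -
  define s where "s j = 1 / real (Suc j)" for j
  have s: "0 < s j" "s j \<le> 1" "0 \<le> s j" for j by (auto simp: s_def)
  define r where "r = R + \<bar>E\<bar>"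
  have K0: "0 \<le> K" using K norm_ge_zero order_trans by blast
  have r: "0 \<le> r" "e \<in> {- R..E} \<Longrightarrow> \<bar>e\<bar> \<le> r" for e using K0 R by (auto simp: r_def)
  obtain C where C: "0 < C" "\<And>e e' s s'. \<bar>e\<bar> \<le> r \<Longrightarrow> \<bar>e'\<bar> \<le> r \<Longrightarrow> 0 \<le> s \<Longrightarrow> s \<le> 1 \<Longrightarrow> 0 \<le> s' \<Longrightarrow> s' \<le> 1 \<Longrightarrow>
      cmod (tr N (Gb N e' s') - tr N (Gb N e s)) \<le> C * cmod (Complex e (- s) - Complex e' (- s'))"
    using tr_Gb_lipschitz[OF r(1)] by metis
  define \<rho> where "\<rho> t e = Im (tr N (Gb N e t))" for t e
  have \<rho>i: "\<rho> t integrable_on {- R..E}" if "0 \<le> t" "t \<le> 1" for t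
    unfolding \<rho>_def[abs_def] using that by (intro integrable_continuous_real continuous_intros Gb_continuous)
  have conv: "(\<lambda>j. integral {- R..E} (\<rho> (s j))) \<longlonglongrightarrow> integral {- R..E} (\<rho> 0)"
  proof (rule LIM_zero_cancel, rule Lim_null_comparison)
    show "\<forall>\<^sub>F j in sequentially. norm (integral {- R..E} (\<rho> (s j)) - integral {- R..E} (\<rho> 0)) \<le> (C * s j) * (E - - R)"
    proof (rule always_eventually, rule allI)
      fix j
      have "integral {- R..E} (\<rho> (s j)) - integral {- R..E} (\<rho> 0) = integral {- R..E} (\<lambda>e. \<rho> (s j) e - \<rho> 0 e)"
        by (rule Henstock_Kurzweil_Integration.integral_diff[symmetric]; intro \<rho>i s) auto
      also have "norm \<dots> \<le> (C * s j) * (E - - R)"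
      proof (rule integral_bound[OF R(2)])
        show "continuous_on {- R..E} (\<lambda>e. \<rho> (s j) e - \<rho> 0 e)"
          unfolding \<rho>_def using s by (intro continuous_intros Gb_continuous) auto
        fix e assume e: "e \<in> {- R..E}"
        have "norm (\<rho> (s j) e - \<rho> 0 e) \<le> cmod (tr N (Gb N e (s j)) - tr N (Gb N e 0))"
          unfolding \<rho>_def real_norm_def minus_complex.sel(2)[symmetric] by (rule abs_Im_le_cmod)
        also have "\<dots> \<le> C * cmod (Complex e (- 0) - Complex e (- s j))" using s r(2)[OF e] by (intro C) auto
        also have "Complex e (- 0) - Complex e (- s j) = of_real (s j) * \<i>" by (simp add: complex_eq_iff)
        also have "cmod (of_real (s j) * \<i>) = s j" using s[of j] by (simp add: norm_mult)
        finally show "norm (\<rho> (s j) e - \<rho> 0 e) \<le> C * s j" .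
      qed
      finally show "norm (integral {- R..E} (\<rho> (s j)) - integral {- R..E} (\<rho> 0)) \<le> (C * s j) * (E - - R)" .
    qed
    have "s \<longlonglongrightarrow> 0" unfolding s_def using LIMSEQ_inverse_real_of_nat by (simp add: inverse_eq_divide)
    then have "(\<lambda>j. (C * s j) * (E - - R)) \<longlonglongrightarrow> (C * 0) * (E - - R)" by (intro tendsto_intros)
    then show "(\<lambda>j. (C * s j) * (E - - R)) \<longlonglongrightarrow> 0" by simp
  qed
  have mid: "(\<lambda>j. integral {- R..E} (\<lambda>e. Im (tr N (res (jac N) (s j) e)))) \<longlonglongrightarrow> pi * dos_mid (jac N) N E"
    unfolding res_def s_def using R by (intro dos_mid_limit[OF fam_jac adj_jac K]) auto
  have close: "\<bar>integral {- R..E} (\<rho> (s j)) - integral {- R..E} (\<lambda>e. Im (tr N (res (jac N) (s j) e)))\<bar> \<le> 8" for j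
  proof -
    obtain I where I: "((\<lambda>e. tr N (\<lambda>\<omega>. bop_inv (Complex e (- s j) *\<^sub>C 1 - jac N \<omega> - \<i> *\<^sub>C lay {N}))
        - tr N (\<lambda>\<omega>. bop_inv (Complex e (- s j) *\<^sub>C 1 - jac N \<omega>))) has_integral I) {- R..E}"
      "\<bar>Im I\<bar> \<le> 8 * real (card {N})"
      using path_lay[OF fam_jac adj_jac s(1) _ jac_commute, of "{N}" N \<i> "- R" E] R(2) N by auto
    have "((\<lambda>e. Im (tr N (Gb N e (s j)) - tr N (res (jac N) (s j) e))) has_integral Im I) {- R..E}"
      using has_integral_linear[OF I(1) bounded_linear_Im] tr_Gb_eq[OF N s(1,2)]
      by (simp add: o_def res_def[abs_def])
    then have "integral {- R..E} (\<lambda>e. \<rho> (s j) e - Im (tr N (res (jac N) (s j) e))) = Im I"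
      by (simp add: \<rho>_def integral_unique)
    moreover have "(\<lambda>e. Im (tr N (res (jac N) (s j) e))) integrable_on {- R..E}"
      using integrable_linear[OF res_integrable_on[OF fam_jac adj_jac s(1)] bounded_linear_Im] by (simp add: o_def)
    ultimately show ?thesis
      using I(2) Henstock_Kurzweil_Integration.integral_diff[OF \<rho>i[OF s(3,2)]] by simp
  qed
  have "(\<lambda>j. \<bar>integral {- R..E} (\<rho> (s j)) - integral {- R..E} (\<lambda>e. Im (tr N (res (jac N) (s j) e)))\<bar>)
      \<longlonglongrightarrow> \<bar>integral {- R..E} (\<rho> 0) - pi * dos_mid (jac N) N E\<bar>"
    by (intro tendsto_intros conv mid)
  then have "\<bar>integral {- R..E} (\<rho> 0) - pi * dos_mid (jac N) N E\<bar> \<le> 8"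
    by (rule LIMSEQ_le_const2) (use close in auto)
  then show ?thesis by (simp add: \<rho>_def[abs_def] rot_def[abs_def])
qed

text \<open>The bound 8 does not depend on R and \<open>rot\<close> is nonnegative, so monotone
  convergence gives integrability on the half-line and keeps the bound.\<close>

lemma rot_lborel:
  shows "set_integrable lborel {..E} rot"
    "\<bar>(LINT e:{..E}|lborel. rot e) - pi * dos_mid (jac N) N E\<bar> \<le> 8"
proof -
  obtain K where K: "0 < K" "\<And>\<omega>. norm (jac N \<omega>) \<le> K" using jac_bound by metis
  define R where "R i = K + \<bar>E\<bar> + 1 + real i" for i
  have R: "K < R i" "- R i \<le> E" for i using K(1) by (auto simp: R_def)
  define f where "f i e = indicat_real {- R i..E} e * rot e" for i e
  have si: "set_integrable lborel {- R i..E} rot" for i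
    by (rule borel_integrable_atLeastAtMost'[OF rot_continuous])
  have fi: "integrable lborel (f i)" for i
    using si[of i] by (simp add: set_integrable_def f_def[abs_def])
  have fI: "(LINT e|lborel. f i e) = integral {- R i..E} rot" for i
    using set_borel_integral_eq_integral(2)[OF si[of i]] by (simp add: set_lebesgue_integral_def f_def)
  have mono_f: "mono (\<lambda>i. f i e)" for e
    by (rule monoI) (auto simp: f_def indicator_def R_def rot_nonneg)
  have lim_f: "(\<lambda>i. f i e) \<longlonglongrightarrow> indicat_real {..E} e * rot e" for e
  proof (rule tendsto_eventually, rule eventually_sequentiallyI[of "nat \<lceil>\<bar>e\<bar>\<rceil>"])
    fix i assume "nat \<lceil>\<bar>e\<bar>\<rceil> \<le> i"
    then have "\<bar>e\<bar> \<le> real i" by (simp add: nat_ceiling_le_eq)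
    then show "f i e = indicat_real {..E} e * rot e" using K(1) by (auto simp: f_def indicator_def R_def)
  qed
  have bnd: "\<bar>(LINT e|lborel. f i e) - pi * dos_mid (jac N) N E\<bar> \<le> 8" for i
    unfolding fI by (rule rot_integral_bound[OF K(2) R])
  have "incseq (\<lambda>i. LINT e|lborel. f i e)"
    by (rule incseq_SucI, rule integral_mono[OF fi fi]) (use mono_f in \<open>simp add: mono_iff_le_Suc\<close>)
  moreover have "\<forall>i. (LINT e|lborel. f i e) \<le> pi * dos_mid (jac N) N E + 8"
    using bnd by (auto simp: abs_le_iff algebra_simps)
  ultimately obtain l where l: "(\<lambda>i. LINT e|lborel. f i e) \<longlonglongrightarrow> l" by (rule incseq_convergent)
  have meas: "(\<lambda>e. indicat_real {..E} e * rot e) \<in> borel_measurable lborel"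
    by (rule borel_measurable_LIMSEQ_metric[OF _ lim_f]) (use fi in auto)
  have 1: "integrable lborel (\<lambda>e. indicat_real {..E} e * rot e)"
    by (rule integrable_monotone_convergence[OF fi _ _ l meas]) (use mono_f lim_f in auto)
  have 2: "(LINT e|lborel. indicat_real {..E} e * rot e) = l"
    by (rule integral_monotone_convergence[OF fi _ _ l meas]) (use mono_f lim_f in auto)
  show "set_integrable lborel {..E} rot" using 1 by (simp add: set_integrable_def)
  have "(\<lambda>i. \<bar>(LINT e|lborel. f i e) - pi * dos_mid (jac N) N E\<bar>) \<longlonglongrightarrow> \<bar>l - pi * dos_mid (jac N) N E\<bar>"
    by (intro tendsto_intros l)
  then have "\<bar>l - pi * dos_mid (jac N) N E\<bar> \<le> 8" by (rule LIMSEQ_le_const2) (use bnd in auto)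
  then show "\<bar>(LINT e:{..E}|lborel. rot e) - pi * dos_mid (jac N) N E\<bar> \<le> 8"
    using 2 by (simp add: set_lebesgue_integral_def)
qed

text \<open>An atom of \<open>dos\<close> at E is counted fully by \<open>dos_mid\<close> slightly
  to the right of E, and moving the end point by \<delta> changes the integral of the locally
  bounded function \<open>rot\<close> by at most 1. The size of \<delta> depends on N and E, the
  resulting 9 = 8 + 1 does not.\<close>

lemma dos_rot:
  "\<bar>(LINT e:{..E}|lborel. rot e) - pi * dos (jac N) N E\<bar> \<le> 9"
proof -
  obtain K where K: "0 < K" "\<And>\<omega>. norm (jac N \<omega>) \<le> K" using jac_bound by metis
  note mb = dos_mid_bounds[OF fam_jac adj_jac K(2)]
  obtain C where C: "0 < C" "\<And>e. \<bar>e\<bar> \<le> \<bar>E\<bar> + 1 \<Longrightarrow> cmod (tr N (Gb N e 0)) \<le> C"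
    using tr_Gb_lipschitz[of "\<bar>E\<bar> + 1"] by (metis abs_ge_zero add_nonneg_nonneg zero_le_one)
  define \<delta> where "\<delta> = min 1 (1 / C)"
  have \<delta>: "0 < \<delta>" "\<delta> \<le> 1" "C * \<delta> \<le> 1" using C(1) by (auto simp: \<delta>_def min_def field_simps)
  have "(LINT e:{..E + \<delta>}|lborel. rot e) = (LINT e:{..E}|lborel. rot e) + (LINT e:{E<..E + \<delta>}|lborel. rot e)"
  proof -
    have "{..E + \<delta>} = {..E} \<union> {E<..E + \<delta>}" using \<delta> by auto
    then show ?thesis
      by (simp only:) (rule set_integral_Un, auto intro: rot_lborel set_integrable_subset[OF rot_lborel(1)[of "E + \<delta>"]])
  qed
  also have "(LINT e:{E<..E + \<delta>}|lborel. rot e) \<le> (LINT e:{E<..E + \<delta>}|lborel. C)"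
  proof (rule set_integral_mono)
    show "set_integrable lborel {E<..E + \<delta>} rot"
      by (rule set_integrable_subset[OF rot_lborel(1)[of "E + \<delta>"]]) auto
    show "set_integrable lborel {E<..E + \<delta>} (\<lambda>e. C)"
      by (rule set_integrable_subset[OF borel_integrable_atLeastAtMost'[of E "E + \<delta>", OF continuous_on_const]]) auto
    fix e assume "e \<in> {E<..E + \<delta>}"
    then have "\<bar>e\<bar> \<le> \<bar>E\<bar> + 1" using \<delta> by auto
    then show "rot e \<le> C" unfolding rot_def using C(2)[of e] abs_Im_le_cmod[of "tr N (Gb N e 0)"] by simp
  qed
  also have "(LINT e:{E<..E + \<delta>}|lborel. C) \<le> 1" using \<delta> by (simp add: set_integral_const mult.commute)
  finally have "(LINT e:{..E + \<delta>}|lborel. rot e) \<le> (LINT e:{..E}|lborel. rot e) + 1" by simp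
  moreover have "pi * dos (jac N) N E \<le> pi * dos_mid (jac N) N (E + \<delta>)"
    using mb(2)[of E "E + \<delta>" N] \<delta> by simp
  moreover have "pi * dos_mid (jac N) N E \<le> pi * dos (jac N) N E" using mb(1) by simp
  ultimately show ?thesis using rot_lborel(2)[of E] rot_lborel(2)[of "E + \<delta>"] unfolding abs_le_iff by linarith
qed

text \<open>The sum of the bounds 9 and 8. The left-hand side is \<pi> times half of the jump of
  \<open>dos\<close> at E, so the atoms have mass bounded uniformly in N.\<close>

lemma dos_mid_dos: "\<bar>pi * dos (jac N) N E - pi * dos_mid (jac N) N E\<bar> \<le> 17"
  using dos_rot[of E] rot_lborel(2)[of E] unfolding abs_le_iff by linarith

lemma phase_velocity_integral:
  "set_integrable lborel {..E} (\<lambda>e. trace_per_site P (phase_velocity T V N e))"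
  "(LINT e:{..E}|lborel. trace_per_site P (phase_velocity T V N e)) = of_real (2 / real N * (LINT e:{..E}|lborel. rot e))"
proof -
  have eq: "trace_per_site P (phase_velocity T V N e) = of_real (2 / real N * rot e)" for e
    unfolding rot_def by (rule trace_phase_velocity[OF N])
  have "set_integrable lborel {..E} (\<lambda>e. 2 / real N * rot e)"
    by (intro set_integrable_mult_right rot_lborel)
  then show "set_integrable lborel {..E} (\<lambda>e. trace_per_site P (phase_velocity T V N e))"
    unfolding eq set_integrable_def by (drule_tac integrable_of_real[where 'a = complex]) (simp add: scaleR_conv_of_real)
  show "(LINT e:{..E}|lborel. trace_per_site P (phase_velocity T V N e)) = of_real (2 / real N * (LINT e:{..E}|lborel. rot e))"
    unfolding eq set_integral_complex_of_real by simp
qed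

lemma idos_dos: "idos P T V N E = of_real (dos (jac N) N E / real N)"
proof -
  have "mel (n, 0) (spec_fam (jac N \<omega>) E) (n, 0) = of_real (Re (mel (n, 0) (spec_fam (jac N \<omega>) E) (n, 0)))" for n \<omega>
    unfolding mel_def by (rule sa_cinner_real[OF spec_fam(1)[OF adj_jac]])
  then have "(LINT \<omega>|P. mel (n, 0) (spec_fam (jac N \<omega>) E) (n, 0))
      = of_real (LINT \<omega>|P. Re (mel (n, 0) (spec_fam (jac N \<omega>) E) (n, 0)))" for n
    by (metis (no_types, lifting) Bochner_Integration.integral_cong integral_complex_of_real)
  then show ?thesis
    unfolding idos_def jac_def[symmetric] spectral_proj_eq[OF adj_jac] by (simp add: dos_def)
qed

lemma idos_phase:
  "cmod (idos P T V N E - 1 / (2 * pi) * (LINT e:{..E}|lborel. trace_per_site P (phase_velocity T V N e))) \<le> 9 / real N"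
proof -
  define \<beta> where "\<beta> = (LINT e:{..E}|lborel. rot e)"
  have "idos P T V N E - 1 / (2 * pi) * (LINT e:{..E}|lborel. trace_per_site P (phase_velocity T V N e))
      = of_real ((pi * dos (jac N) N E - \<beta>) / (pi * real N))"
    unfolding idos_dos phase_velocity_integral(2) \<beta>_def[symmetric] using N by (simp add: field_simps)
  also have "cmod \<dots> = \<bar>pi * dos (jac N) N E - \<beta>\<bar> / (pi * real N)"
    unfolding norm_of_real using N by (simp add: abs_mult)
  also have "\<dots> \<le> 9 / (1 * real N)"
    using dos_rot[of E] N pi_gt3 unfolding \<beta>_def
    by (intro frac_le mult_mono mult_pos_pos) (auto simp: abs_minus_commute)
  finally show ?thesis by simp
qed

end

end

subsection \<open>Almost additivity\<close>

text \<open>Both a N / N and a M / M are compared with a (M N) / (M N), the block of length M N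
  being cut into M pieces or into N pieces; the errors C/N and C/M make the sequence Cauchy.\<close>

lemma almost_additive_convergent:
  fixes a :: "nat \<Rightarrow> real"
  assumes add: "\<And>N M. 1 \<le> N \<Longrightarrow> 1 \<le> M \<Longrightarrow> \<bar>a (N + M) - a N - a M\<bar> \<le> C"
  shows "convergent (\<lambda>N. a N / real N)"
proof -
  have C: "0 \<le> C" using add[of 1 1] abs_ge_zero order_trans by blast
  have mult: "\<bar>a (Suc m * N) - real (Suc m) * a N\<bar> \<le> real m * C" if "1 \<le> N" for m N
  proof (induction m)
    case (Suc m)
    have "\<bar>a (Suc m * N + N) - a (Suc m * N) - a N\<bar> \<le> C" using that by (intro add) auto
    moreover have "Suc (Suc m) * N = Suc m * N + N" by simp
    ultimately show ?case using Suc
      by (simp only: of_nat_Suc distrib_right mult_1_left abs_le_iff) linarith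
  qed simp
  have mult': "\<bar>a (M * N) / real (M * N) - a N / real N\<bar> \<le> C / real N" if N: "1 \<le> N" and M: "1 \<le> M" for M N
  proof -
    obtain m where m: "M = Suc m" using M by (cases M) auto
    have "a (M * N) / real (M * N) - a N / real N = (a (M * N) - real M * a N) / (real M * real N)"
      using N M by (simp add: field_simps)
    then have "\<bar>a (M * N) / real (M * N) - a N / real N\<bar> = \<bar>a (M * N) - real M * a N\<bar> / (real M * real N)"
      by (simp add: abs_mult)
    also have "\<dots> \<le> (real M * C) / (real M * real N)"
      using mult[OF N, of m] C m by (intro divide_right_mono) (auto simp: algebra_simps)
    also have "\<dots> = C / real N" using M by simp
    finally show ?thesis .
  qed
  have "Cauchy (\<lambda>N. a N / real N)"
  proof (rule metric_CauchyI)
    fix \<epsilon> :: real assume \<epsilon>: "0 < \<epsilon>"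
    obtain n where n: "2 * C / \<epsilon> < real n" using reals_Archimedean2 by blast
    have "dist (a N / real N) (a M / real M) < \<epsilon>" if "max n 1 \<le> N" "max n 1 \<le> M" for N M
    proof -
      have le: "C / real N < \<epsilon> / 2" if "max n 1 \<le> N" for N
      proof -
        have "2 * C / \<epsilon> < real N" using n that by linarith
        then show ?thesis using \<epsilon> that by (simp add: field_simps)
      qed
      have "\<bar>a (M * N) / real (M * N) - a N / real N\<bar> \<le> C / real N"
        "\<bar>a (M * N) / real (M * N) - a M / real M\<bar> \<le> C / real M"
        using mult'[of N M] mult'[of M N] that by (simp_all add: mult.commute)
      then show ?thesis unfolding dist_real_def using le[OF that(1)] le[OF that(2)] by linarith
    qed
    then show "\<exists>n0. \<forall>m\<ge>n0. \<forall>n\<ge>n0. dist (a m / real m) (a n / real n) < \<epsilon>" by blast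
  qed
  then show ?thesis by (rule Cauchy_convergent)
qed

lemma jacobi_cong:
  assumes "\<And>k. k \<in> {2..N} \<Longrightarrow> t k = t' k" "\<And>k. k \<in> {1..N} \<Longrightarrow> v k = v' k"
  shows "jacobi t v N = jacobi t' v' N"
proof -
  have "(\<Sum>n=1..N. block n n (v n)) = (\<Sum>n=1..N. block n n (v' n))"
    by (rule sum.cong) (simp_all only: assms(2))
  moreover have "(\<Sum>n=2..N. block (n - 1) n (t n) + block n (n - 1) (adj (t n)))
      = (\<Sum>n=2..N. block (n - 1) n (t' n) + block n (n - 1) (adj (t' n)))"
  proof (rule sum.cong)
    fix n assume "n \<in> {2..N}"
    then have "t n = t' n" by (intro assms(1)) auto
    then show "block (n - 1) n (t n) + block n (n - 1) (adj (t n))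
        = block (n - 1) n (t' n) + block n (n - 1) (adj (t' n))" by simp
  qed simp
  ultimately show ?thesis unfolding jacobi_def by simp
qed

lemma norm_jacobi_le:
  assumes "\<And>k. k \<in> {1..N} \<Longrightarrow> norm (t k) \<le> L" "\<And>k. k \<in> {1..N} \<Longrightarrow> norm (v k) \<le> L" "0 \<le> L"
  shows "norm (jacobi t v N) \<le> 3 * real N * L"
proof -
  have 1: "norm (\<Sum>n=1..N. block n n (v n)) \<le> (\<Sum>n=1..N. L)"
    by (rule sum_norm_le) (rule order_trans[OF norm_block_le assms(2)])
  have "norm (\<Sum>n=2..N. block (n - 1) n (t n) + block n (n - 1) (adj (t n))) \<le> (\<Sum>n=2..N. L + L)"
  proof (rule sum_norm_le, rule norm_triangle_mono)
    fix n assume "n \<in> {2..N}"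
    then have "norm (t n) \<le> L" using assms(1)[of n] by auto
    then show "norm (block (n - 1) n (t n)) \<le> L" "norm (block n (n - 1) (adj (t n))) \<le> L"
      using norm_block_le[of "n - 1" n "t n"] norm_block_le[of n "n - 1" "adj (t n)"] by auto
  qed
  moreover have "(\<Sum>n=2..N. L + L) \<le> (\<Sum>n=1..N. L + L)" using assms(3) by (intro sum_mono2) auto
  ultimately have "norm (jacobi t v N) \<le> (\<Sum>n=1..N. L) + (\<Sum>n=1..N. L + L)"
    unfolding jacobi_def by (intro norm_triangle_mono[OF 1]) (rule order_trans)
  then show ?thesis by (simp add: algebra_simps)
qed

text \<open>If the couplings at both ends of \<open>{a+1..a+M}\<close> vanish, the inclusion of these layers intertwines
  the two operators.\<close>

lemma decouple:
  fixes t v :: "nat \<Rightarrow> 'i bop"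
  assumes aM: "a + M \<le> K" and cut: "a = 0 \<or> t (Suc a) = 0" "a + M = K \<or> t (Suc (a + M)) = 0"
    and G: "G * (z *\<^sub>C 1 - jacobi t v K) = 1"
    and G': "(z *\<^sub>C 1 - jacobi (\<lambda>k. t (a + k)) (\<lambda>k. v (a + k)) M) * G' = 1"
    and k: "k \<in> {1..M}"
  shows "mel (a + k, b) G (a + k, c) = mel (k, b) G' (k, c)"
proof -
  \<comment> \<open>Written as an operator on the common space, so that G J = J G' follows from H J
    = J H' by multiplication with the two inverses.\<close>
  define J where "J = (\<Sum>k=1..M. block (a + k) k (1 :: 'i bop))"
  let ?H = "jacobi t v K" and ?H' = "jacobi (\<lambda>k. t (a + k)) (\<lambda>k. v (a + k)) M"
  have lJ: "layer n (J *\<^sub>V u) = (if n \<in> {a + 1..a + M} then layer (n - a) u else 0)" for n u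
  proof -
    have "layer n (J *\<^sub>V u) = (\<Sum>k=1..M. if k = n - a then (if a < n then layer k u else 0) else 0)"
      unfolding J_def bop_sum_apply layer_sum by (intro sum.cong) (auto simp: block_apply layer_layer_embed)
    then show ?thesis by (auto simp: sum.delta' simp del: One_nat_def)
  qed
  have HJ: "?H * J = J * ?H'"
  proof (rule bop_eqI, rule layer_eqI)
    fix u n
    show "layer n ((?H * J) *\<^sub>V u) = layer n ((J * ?H') *\<^sub>V u)"
    proof (cases "n \<in> {a + 1..a + M}")
      case True
      define k where "k = n - a"
      then have k: "n = a + k" "1 \<le> k" "k \<le> M" using True by auto
      have e1: "layer n (J *\<^sub>V u) = layer k u" unfolding lJ using k by simp
      have e2: "(if 2 \<le> n then adj (t n) *\<^sub>V layer (n - 1) (J *\<^sub>V u) else 0)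
          = (if 2 \<le> k then adj (t (a + k)) *\<^sub>V layer (k - 1) u else 0)"
      proof (cases "2 \<le> k")
        case True
        then have "n - 1 \<in> {a + 1..a + M}" "n - 1 - a = k - 1" "2 \<le> n" using k by auto
        then show ?thesis using True k(1) by (simp only: lJ if_True)
      next
        case False
        then have "k = 1" using k by simp
        then have "a = 0 \<or> t n = 0" using cut(1) k(1) by auto
        then show ?thesis using \<open>k = 1\<close> k(1) by auto
      qed
      have e3: "(if n < K then t (Suc n) *\<^sub>V layer (Suc n) (J *\<^sub>V u) else 0)
          = (if k < M then t (a + Suc k) *\<^sub>V layer (Suc k) u else 0)"
      proof (cases "k < M")
        case True
        then have "Suc n \<in> {a + 1..a + M}" "Suc n - a = Suc k" "n < K" "Suc n = a + Suc k" using k aM by auto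
        then show ?thesis using True by (simp only: lJ if_True)
      next
        case False
        then have "Suc n \<notin> {a + 1..a + M}" "\<not> k < M" using k by auto
        then show ?thesis by (simp only: lJ if_False if_cancel bop_apply_simps(9))
      qed
      have kM: "k \<in> {1..M}" "n \<in> {1..K}" using k aM by auto
      show ?thesis
        unfolding bop_apply_times layer_jacobi[of n] lJ[of n "_ *\<^sub>V u"] layer_jacobi[of "n - a"]
        unfolding e1 e2 e3 using True kM k(1) by (simp only: if_True add_diff_cancel_left')
    next
      case False
      have r: "layer n ((J * ?H') *\<^sub>V u) = 0" unfolding bop_apply_times lJ using False by (simp only: if_False)
      have e1: "layer n (J *\<^sub>V u) = 0" unfolding lJ using False by (simp only: if_False)
      have e2: "(if 2 \<le> n then adj (t n) *\<^sub>V layer (n - 1) (J *\<^sub>V u) else 0) = 0" if "n \<le> K"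
      proof (cases "n = Suc (a + M)")
        case True
        then have "t n = 0" using cut(2) that by auto
        then show ?thesis by simp
      next
        case False': False
        then have "n - 1 \<notin> {a + 1..a + M}" using False False' by auto
        then show ?thesis by (simp only: lJ if_False if_cancel bop_apply_simps(9))
      qed
      have e3: "(if n < K then t (Suc n) *\<^sub>V layer (Suc n) (J *\<^sub>V u) else 0) = 0" if "1 \<le> n"
      proof (cases "n = a")
        case True
        then have "t (Suc n) = 0" using cut(1) that by auto
        then show ?thesis by simp
      next
        case False': False
        then have "Suc n \<notin> {a + 1..a + M}" using False False' by auto
        then show ?thesis by (simp only: lJ if_False if_cancel bop_apply_simps(9))
      qed
      show ?thesis
        unfolding r unfolding bop_apply_times layer_jacobi[of n] e1 using e2 e3 by simp
    qed
  qed
  have "J * G' = G * (z *\<^sub>C 1 - ?H) * J * G'" unfolding G by simp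
  moreover have "(z *\<^sub>C 1 - ?H) * J = J * (z *\<^sub>C 1 - ?H')"
    by (simp only: left_diff_distrib right_diff_distrib scaleC_bop_simps mult_1_left mult_1_right HJ)
  then have "G * (z *\<^sub>C 1 - ?H) * J * G' = G * J * ((z *\<^sub>C 1 - ?H') * G')" by (simp only: mult.assoc[symmetric]) (simp only: mult.assoc)
  ultimately have GJ: "G * J = J * G'" unfolding G' by simp
  have Jk: "J *\<^sub>V ket (k, c) = ket (a + k, c)"
    by (rule layer_eqI) (use k in \<open>auto simp: lJ layer_ket\<close>)
  have "mel (a + k, b) G (a + k, c) = ell2_apply (layer (a + k) ((G * J) *\<^sub>V ket (k, c))) b"
    by (simp add: mel_apply Jk layer.rep_eq bop_apply_times)
  also have "\<dots> = ell2_apply (layer k (G' *\<^sub>V ket (k, c))) b"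
    unfolding GJ bop_apply_times lJ using k by simp
  finally show ?thesis by (simp add: mel_apply layer.rep_eq)
qed

subsection \<open>Comparison along a sign-definite path\<close>

context covariant_system begin

lemma tr_adj: "tr N (\<lambda>\<omega>. adj (X \<omega>)) = cnj (tr N X)"
  by (simp add: tr_def mel_simps)

text \<open>By cyclicity \<open>Im tr (B G)\<close> equals \<open>s Re tr (G* B G)\<close> and thus has the sign of \<open>B\<close>.\<close>

lemma tr_sign_path:
  assumes H: "fam P \<tau> H" "\<And>\<omega>. adj (H \<omega>) = H \<omega>" and B: "fam P \<tau> B" "\<And>\<omega>. adj (B \<omega>) = B \<omega>" and s: "0 < s"
    and supp: "\<And>\<omega>. lay {1..N} * B \<omega> = B \<omega>" "\<And>\<omega>. B \<omega> * lay {1..N} = B \<omega>"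
    and comm: "\<And>\<omega>. lay {1..N} * H \<omega> = H \<omega> * lay {1..N}"
    and sign: "\<And>\<omega> u. 0 \<le> r * Re (cinner u (B \<omega> *\<^sub>V u))" and r: "\<bar>r\<bar> = 1"
    and K: "\<And>\<omega>. norm (H \<omega>) \<le> K" "\<And>\<omega>. norm (B \<omega>) \<le> C"
    and a: "a \<le> - (K + C + real N * C + 1)" "a \<le> b"
  obtains I where "((\<lambda>e. tr N (res (\<lambda>\<omega>. H \<omega> + B \<omega>) s e) - tr N (res H s e)) has_integral I) {a..b}" "r * Im I \<le> 1"
proof -
  define Z where "Z e x \<omega> = Complex e (- s) *\<^sub>C 1 - H \<omega> - x *\<^sub>R B \<omega>" for e x \<omega>
  define G where "G e x \<omega> = bop_inv (Z e x \<omega>)" for e x \<omega>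
  define k where "k e x = tr N (\<lambda>\<omega>. B \<omega> * G e x \<omega>)" for e x
  have C0: "0 \<le> C" using K(2) norm_ge_zero order_trans by blast
  have aB: "adj (x *\<^sub>R B \<omega>) = x *\<^sub>R B \<omega>" for x \<omega> by (simp add: B)
  have d: "dissip s (Z e x \<omega>)" for e x \<omega>
    unfolding Z_def by (rule dissip_sub[OF H(2)]) (simp_all only: sa_Im[OF aB], simp)
  note ZG = dissip_inv[OF s d, folded G_def]
  have Zf: "fam P \<tau> (\<lambda>\<omega>. Z e x \<omega>)" for e x
    unfolding Z_def by (intro fam_diff fam_scaleC fam_scaleR fam_one H B)
  have Gf: "fam P \<tau> (G e x)" for e x
  proof -
    have "fam P \<tau> (\<lambda>\<omega>. bop_inv (Z e x \<omega>))" by (rule fam_dissip_inv[OF Zf s d])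
    then show ?thesis by (simp add: G_def[abs_def])
  qed
  have Gc: "lay {1..N} * G e x \<omega> = G e x \<omega> * lay {1..N}" for e x \<omega>
    by (rule inverse_commute[OF ZG(1,2)])
       (simp add: Z_def left_diff_distrib right_diff_distrib comm supp del: One_nat_def)
  have BG: "fam P \<tau> (\<lambda>\<omega>. B \<omega> * G e x \<omega>)" for e x by (rule fam_times[OF B(1) Gf])
  have sgn: "0 \<le> r * Im (k e x)" for e x
  proof -
    define w where "w = tr N (\<lambda>\<omega>. adj (G e x \<omega>) * (B \<omega> * G e x \<omega>))"
    \<comment> \<open>As B is symmetric, the operator stays self-adjoint along the path and s is the
      only source of an imaginary part.\<close>
    have GG: "G e x \<omega> - adj (G e x \<omega>) = (2 * \<i> * of_real s) *\<^sub>C (G e x \<omega> * adj (G e x \<omega>))" for \<omega>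
    proof -
      have "adj (Z e x \<omega>) * adj (G e x \<omega>) = adj 1" unfolding ZG(2)[of e x \<omega>, symmetric] by simp
      then have "G e x \<omega> - adj (G e x \<omega>) = G e x \<omega> * (adj (Z e x \<omega>) - Z e x \<omega>) * adj (G e x \<omega>)"
        by (intro resolvent_difference ZG(2)) simp
      also have "adj (Z e x \<omega>) - Z e x \<omega> = (cnj (Complex e (- s)) - Complex e (- s)) *\<^sub>C 1"
        by (simp add: Z_def H B scaleC_bop_distrib)
      also have "cnj (Complex e (- s)) - Complex e (- s) = 2 * \<i> * of_real s" by (simp add: complex_eq_iff)
      finally show ?thesis by simp
    qed
    have "k e x - tr N (\<lambda>\<omega>. B \<omega> * adj (G e x \<omega>)) = tr N (\<lambda>\<omega>. B \<omega> * G e x \<omega> - B \<omega> * adj (G e x \<omega>))"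
      unfolding k_def by (rule tr_diff[OF fam_times[OF B(1) Gf] fam_times[OF B(1) fam_adj[OF Gf]], symmetric])
    also have "\<dots> = (2 * \<i> * of_real s) * tr N (\<lambda>\<omega>. B \<omega> * G e x \<omega> * adj (G e x \<omega>))"
      unfolding right_diff_distrib[symmetric] GG scaleC_bop_simps tr_scaleC mult.assoc ..
    also have "tr N (\<lambda>\<omega>. B \<omega> * G e x \<omega> * adj (G e x \<omega>)) = w"
      unfolding w_def
    proof (rule tr_cyclic[OF fam_adj[OF Gf] BG, symmetric])
      show "lay {1..N} * (B \<omega> * G e x \<omega>) = B \<omega> * G e x \<omega>" for \<omega>
        by (simp only: mult.assoc[symmetric] supp)
      show "B \<omega> * G e x \<omega> * lay {1..N} = B \<omega> * G e x \<omega>" for \<omega>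
        by (simp only: mult.assoc Gc[symmetric]) (simp only: mult.assoc[symmetric] supp)
    qed
    also have "tr N (\<lambda>\<omega>. B \<omega> * adj (G e x \<omega>)) = cnj (k e x)"
    proof -
      have "tr N (\<lambda>\<omega>. B \<omega> * adj (G e x \<omega>)) = tr N (\<lambda>\<omega>. adj (G e x \<omega>) * B \<omega>)"
        by (rule tr_cyclic[OF fam_adj[OF Gf] B(1) supp, symmetric])
      also have "\<dots> = tr N (\<lambda>\<omega>. adj (B \<omega> * G e x \<omega>))" by (simp add: B)
      finally show ?thesis unfolding tr_adj k_def .
    qed
    finally have "Im (k e x) = s * Re w" by (simp add: complex_eq_iff)
    moreover have "0 \<le> r * Re w"
    proof -
      have f: "fam P \<tau> (\<lambda>\<omega>. adj (G e x \<omega>) * (B \<omega> * G e x \<omega>))" by (rule fam_times[OF fam_adj[OF Gf] BG])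
      have "r * Re w = (\<Sum>n=1..N. LINT \<omega>|P. r * Re (mel (n, 0) (adj (G e x \<omega>) * (B \<omega> * G e x \<omega>)) (n, 0)))"
        unfolding w_def tr_def Re_sum integral_Re[OF integrable_mel[OF f], symmetric] sum_distrib_left by simp
      also have "0 \<le> \<dots>"
        by (intro sum_nonneg Bochner_Integration.integral_nonneg)
           (simp only: mel_def bop_apply_times cinner_adj_right sign)
      finally show ?thesis .
    qed
    ultimately have "0 \<le> s * (r * Re w)" "r * Im (k e x) = s * (r * Re w)" using s by auto
    then show ?thesis by (simp only:)
  qed
  have ka: "r * Im (k a x) \<le> 1" if x: "0 \<le> x" "x \<le> 1" for x
  proof -
    \<comment> \<open>The left end a is so far from the spectrum that the resolvent there has norm
      at most 1/c, and N C / c \<le> 1 bounds the boundary term at a.\<close>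
    define c where "c = real N * C + 1"
    have c: "0 < c" using C0 by (simp add: c_def add_nonneg_pos)
    have "norm (G a x \<omega>) \<le> 1 / c" for \<omega>
    proof (rule inverse_norm_le[OF ZG(1) c])
      fix u
      have a': "- a \<le> cmod (Complex a (- s))" using abs_Re_le_cmod[of "Complex a (- s)"] by simp
      have "norm (H \<omega> *\<^sub>V u) \<le> K * norm u"
        using norm_bop_apply[of "H \<omega>" u] K(1) by (meson mult_right_mono norm_ge_zero order_trans)
      moreover have "norm (x *\<^sub>R (B \<omega> *\<^sub>V u)) \<le> C * norm u"
      proof -
        have "norm (x *\<^sub>R (B \<omega> *\<^sub>V u)) \<le> 1 * norm (B \<omega> *\<^sub>V u)"
          unfolding norm_scaleR using x by (intro mult_right_mono) auto
        then show ?thesis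
          using norm_bop_apply[of "B \<omega>" u] K(2) by (metis mult_1 mult_right_mono norm_ge_zero order_trans)
      qed
      moreover have "(- a) * norm u \<le> norm (Complex a (- s) *\<^sub>C u)"
        unfolding norm_scaleC_ell2 by (rule mult_right_mono[OF a' norm_ge_zero])
      moreover have "norm (Complex a (- s) *\<^sub>C u) \<le> norm (Z a x \<omega> *\<^sub>V u) + norm (H \<omega> *\<^sub>V u) + norm (x *\<^sub>R (B \<omega> *\<^sub>V u))"
      proof -
        have "Complex a (- s) *\<^sub>C u = Z a x \<omega> *\<^sub>V u + H \<omega> *\<^sub>V u + x *\<^sub>R (B \<omega> *\<^sub>V u)" by (simp add: Z_def bop_lin)
        then show ?thesis by (simp only: norm_triangle_mono[OF norm_triangle_mono[OF order_refl order_refl] order_refl])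
      qed
      moreover have "(K + C + c) * norm u \<le> (- a) * norm u"
        using a(1) by (intro mult_right_mono) (auto simp: c_def)
      ultimately show "c * norm u \<le> norm (Z a x \<omega> *\<^sub>V u)" by (simp add: distrib_right)
    qed
    then have "norm (B \<omega> * G a x \<omega>) \<le> C * (1 / c)" for \<omega>
      using K(2) C0 by (intro order_trans[OF norm_mult_ineq] mult_mono) auto
    then have "cmod (k a x) \<le> real N * (C * (1 / c))" unfolding k_def by (rule tr_bound[OF BG])
    also have "\<dots> \<le> 1" using c by (simp add: c_def)
    finally have "\<bar>Im (k a x)\<bar> \<le> 1" using abs_Im_le_cmod order_trans by blast
    moreover have "r * Im (k a x) \<le> \<bar>r\<bar> * \<bar>Im (k a x)\<bar>" by (metis abs_ge_self abs_mult)
    ultimately show ?thesis using r by simp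
  qed
  note pi = path_integral[OF H(1) B(1) s supp comm d[unfolded Z_def] a(2), folded Z_def, folded G_def, folded k_def]
  have im: "((\<lambda>x. r * Im (k e x)) has_integral r * Im (integral {0..1} (k e))) {0..1}" for e
    using has_integral_linear[OF integrable_integral[OF pi(2)] bounded_linear_Im]
    by (intro has_integral_mult_right) (simp add: o_def)
  have "r * Im (integral {0..1} (k a)) \<le> 1"
    by (rule has_integral_le[OF im has_integral_const_real[of 1 0 1, simplified]]) (use ka in auto)
  moreover have "0 \<le> r * Im (integral {0..1} (k b))"
    by (rule has_integral_nonneg[OF im]) (use sgn in auto)
  ultimately have "r * Im (integral {0..1} (k a) - integral {0..1} (k b)) \<le> 1" by (simp add: right_diff_distrib)
  moreover have "res H s e = G e 0" "res (\<lambda>\<omega>. H \<omega> + B \<omega>) s e = G e 1" for e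
    by (auto simp: res_def G_def Z_def fun_eq_iff diff_diff_eq)
  ultimately show thesis using that[of "integral {0..1} (k a) - integral {0..1} (k b)"] pi(1) by simp
qed

text \<open>A symmetric perturbation supported in the layers \<open>S\<close> is dominated by a multiple of \<open>lay S\<close>; going
  first to that multiple and then monotonically to the perturbation bounds the change from each side.\<close>

lemma tr_layer_perturbation:
  assumes H: "fam P \<tau> H" "\<And>\<omega>. adj (H \<omega>) = H \<omega>" and W: "fam P \<tau> W" "\<And>\<omega>. adj (W \<omega>) = W \<omega>"
    and S: "S \<subseteq> {1..N}" and supp: "\<And>\<omega>. lay S * W \<omega> = W \<omega>" "\<And>\<omega>. W \<omega> * lay S = W \<omega>"
    and comm: "\<And>\<omega>. lay {1..N} * H \<omega> = H \<omega> * lay {1..N}"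
  obtains R0 where "0 < R0" "\<And>R s E. R0 \<le> R \<Longrightarrow> 0 < s \<Longrightarrow> - R \<le> E \<Longrightarrow>
    \<bar>integral {- R..E} (\<lambda>e. Im (tr N (res (\<lambda>\<omega>. H \<omega> + W \<omega>) s e))) - integral {- R..E} (\<lambda>e. Im (tr N (res H s e)))\<bar>
      \<le> 8 * real (card S) + 1"
proof -
  obtain KH where KH: "0 < KH" "\<And>\<omega>. norm (H \<omega>) \<le> KH" using fam_bound[OF H(1)] by metis
  obtain C where C: "0 < C" "\<And>\<omega>. norm (W \<omega>) \<le> C" using fam_bound[OF W(1)] by metis
  \<comment> \<open>The threshold of \<open>tr_sign_path\<close> for the intermediate operator,
    bounded by KH + C, and the remaining perturbation, bounded by C + C.\<close>
  define R0 where "R0 = (KH + C) + (C + C) + real N * (C + C) + 1"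
  have lS: "lay {1..N} * lay S = (lay S :: (nat \<times> 'z) bop)" "lay S * lay {1..N} = (lay S :: (nat \<times> 'z) bop)"
    using S by (auto simp: lay_times Int_absorb1 Int_absorb2)
  have form: "\<bar>Re (cinner u (W \<omega> *\<^sub>V u))\<bar> \<le> C * (norm (lay S *\<^sub>V u))\<^sup>2" for \<omega> u
  proof -
    define w where "w = lay S *\<^sub>V u"
    have "W \<omega> *\<^sub>V u = lay S *\<^sub>V W \<omega> *\<^sub>V w"
      unfolding w_def by (simp only: bop_apply_times[symmetric] supp)
    then have "cinner u (W \<omega> *\<^sub>V u) = cinner w (W \<omega> *\<^sub>V w)"
      using cinner_adj_right[of u "lay S" "W \<omega> *\<^sub>V w"] by (simp add: w_def)
    then have "\<bar>Re (cinner u (W \<omega> *\<^sub>V u))\<bar> \<le> norm w * norm (W \<omega> *\<^sub>V w)" using Re_cinner_le by simp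
    also have "\<dots> \<le> norm w * (C * norm w)"
      using norm_bop_apply[of "W \<omega>" w] C(2) by (intro mult_left_mono) (meson mult_right_mono norm_ge_zero order_trans, simp)
    finally show ?thesis by (simp add: w_def power2_eq_square ac_simps)
  qed
  have HW: "fam P \<tau> (\<lambda>\<omega>. H \<omega> + W \<omega>)" "adj (H \<omega> + W \<omega>) = H \<omega> + W \<omega>" for \<omega>
    by (auto intro: fam_add H W simp: H W)
  show thesis
  proof (rule that[of R0])
    show "0 < R0" using KH C by (auto simp: R0_def intro!: add_nonneg_pos)
    fix R s E :: real assume R: "R0 \<le> R" "- R \<le> E" and s: "0 < s"
    define D where "D = integral {- R..E} (\<lambda>e. tr N (res (\<lambda>\<omega>. H \<omega> + W \<omega>) s e) - tr N (res H s e))"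
    \<comment> \<open>The case r = 1 goes through H - C lay S and then adds the nonnegative W + C
      lay S; the case r = -1 goes through H + C lay S and adds the nonpositive W - C lay S. Each
      yields one of the two inequalities contained in the absolute value.\<close>
    have side: "r * Im D \<le> 8 * real (card S) + 1" if r: "\<bar>r\<bar> = 1" for r
    proof -
      define H' where "H' \<omega> = H \<omega> + complex_of_real (- r * C) *\<^sub>C lay S" for \<omega>
      define B where "B \<omega> = W \<omega> - complex_of_real (- r * C) *\<^sub>C lay S" for \<omega>
      have nlS: "norm (lay S :: (nat \<times> 'z) bop) \<le> 1" by (rule norm_lay_le)
      have nl: "norm (complex_of_real (- r * C) *\<^sub>C (lay S :: (nat \<times> 'z) bop)) \<le> C"
        unfolding norm_scaleC_bop using r C(1) mult_left_mono[OF nlS, of C]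
        by (simp add: norm_mult abs_mult)
      have fl: "fam P \<tau> (\<lambda>\<omega>. complex_of_real (- r * C) *\<^sub>C lay S)" by (intro fam_scaleC fam_lay)
      have H': "fam P \<tau> H'" "adj (H' \<omega>) = H' \<omega>" "norm (H' \<omega>) \<le> KH + C" for \<omega>
        unfolding H'_def[abs_def] using fam_add[OF H(1) fl] norm_triangle_mono[OF KH(2) nl]
        by (simp_all add: H adj_lay)
      have B: "fam P \<tau> B" "adj (B \<omega>) = B \<omega>" "norm (B \<omega>) \<le> C + C" for \<omega>
        unfolding B_def[abs_def] using fam_diff[OF W(1) fl] order_trans[OF norm_triangle_ineq4 add_mono[OF C(2) nl]]
        by (simp_all add: W adj_lay)
      have Bs: "lay {1..N} * B \<omega> = B \<omega>" "B \<omega> * lay {1..N} = B \<omega>" for \<omega>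
      proof -
        have "lay {1..N} * (lay S * W \<omega>) = lay S * W \<omega>" by (simp only: mult.assoc[symmetric] lS)
        moreover have "W \<omega> * lay S * lay {1..N} = W \<omega> * lay S" by (simp only: mult.assoc lS)
        ultimately show "lay {1..N} * B \<omega> = B \<omega>" "B \<omega> * lay {1..N} = B \<omega>"
          unfolding B_def by (simp_all only: supp left_diff_distrib right_diff_distrib scaleC_bop_simps lS)
      qed
      have H'c: "lay {1..N} * H' \<omega> = H' \<omega> * lay {1..N}" for \<omega>
        unfolding H'_def by (simp only: distrib_left distrib_right scaleC_bop_simps lS comm)
      have sign: "0 \<le> r * Re (cinner u (B \<omega> *\<^sub>V u))" for \<omega> u
      proof -
        have rr: "r * r = 1" using r by (metis abs_mult_self_eq mult_1)
        have "Re (cinner u (B \<omega> *\<^sub>V u)) = Re (cinner u (W \<omega> *\<^sub>V u)) + r * C * (norm (lay S *\<^sub>V u))\<^sup>2"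
          by (simp add: B_def cinner_simps cinner_lay del: of_real_power)
        then have "r * Re (cinner u (B \<omega> *\<^sub>V u)) = r * Re (cinner u (W \<omega> *\<^sub>V u)) + (r * r) * (C * (norm (lay S *\<^sub>V u))\<^sup>2)"
          by (simp add: algebra_simps)
        moreover have "\<bar>r * Re (cinner u (W \<omega> *\<^sub>V u))\<bar> \<le> C * (norm (lay S *\<^sub>V u))\<^sup>2"
          unfolding abs_mult r using form by simp
        ultimately show ?thesis unfolding rr by simp
      qed
      obtain I1 where I1: "((\<lambda>e. tr N (\<lambda>\<omega>. bop_inv (Complex e (- s) *\<^sub>C 1 - H \<omega> - complex_of_real (- r * C) *\<^sub>C lay S))
          - tr N (\<lambda>\<omega>. bop_inv (Complex e (- s) *\<^sub>C 1 - H \<omega>))) has_integral I1) {- R..E}" "\<bar>Im I1\<bar> \<le> 8 * real (card S)"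
        by (rule path_lay[OF H s S comm, of "complex_of_real (- r * C)" "- R" E]) (use R(2) in auto)
      have I1': "((\<lambda>e. tr N (res H' s e) - tr N (res H s e)) has_integral I1) {- R..E}"
        using I1(1) by (simp add: res_def[abs_def] H'_def diff_diff_eq)
      obtain I2 where I2: "((\<lambda>e. tr N (res (\<lambda>\<omega>. H' \<omega> + B \<omega>) s e) - tr N (res H' s e)) has_integral I2) {- R..E}"
        "r * Im I2 \<le> 1"
        by (rule tr_sign_path[OF H'(1,2) B(1,2) s Bs H'c sign r H'(3) B(3) _ R(2)]) (use R(1) in \<open>auto simp: R0_def\<close>)
      have "((\<lambda>e. tr N (res (\<lambda>\<omega>. H \<omega> + W \<omega>) s e) - tr N (res H s e)) has_integral I1 + I2) {- R..E}"
        using has_integral_add[OF I1' I2(1)] by (simp add: H'_def B_def)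
      then have "D = I1 + I2" unfolding D_def by (rule integral_unique)
      moreover have "r * Im I1 \<le> 8 * real (card S)"
      proof -
        have "r * Im I1 \<le> \<bar>r\<bar> * \<bar>Im I1\<bar>" by (metis abs_ge_self abs_mult)
        then show ?thesis using I1(2) r by simp
      qed
      ultimately show ?thesis using I2(2) by (simp add: distrib_left)
    qed
    have i: "(\<lambda>e. tr N (res (\<lambda>\<omega>. H \<omega> + W \<omega>) s e)) integrable_on {- R..E}" "(\<lambda>e. tr N (res H s e)) integrable_on {- R..E}"
      by (rule res_integrable_on[OF HW s] res_integrable_on[OF H s])+
    have ii: "integral {- R..E} (\<lambda>e. Im (f e)) = Im (integral {- R..E} f)" if "f integrable_on {- R..E}" for f
      using integral_linear[OF that bounded_linear_Im] by (simp add: o_def)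
    have "Im D = integral {- R..E} (\<lambda>e. Im (tr N (res (\<lambda>\<omega>. H \<omega> + W \<omega>) s e))) - integral {- R..E} (\<lambda>e. Im (tr N (res H s e)))"
      unfolding D_def ii[OF i(1)] ii[OF i(2)] Henstock_Kurzweil_Integration.integral_diff[OF i] by simp
    then show "\<bar>integral {- R..E} (\<lambda>e. Im (tr N (res (\<lambda>\<omega>. H \<omega> + W \<omega>) s e))) - integral {- R..E} (\<lambda>e. Im (tr N (res H s e)))\<bar>
      \<le> 8 * real (card S) + 1"
      using side[of 1] side[of "- 1"] by (simp add: abs_le_iff)
  qed
qed

end

subsection \<open>Identical distribution of shifted coefficients\<close>

lemma (in prob_space) indep_vars_shift:
  assumes "indep_vars (\<lambda>_. B) X {1..}" shows "indep_vars (\<lambda>_. B) (\<lambda>k::nat. X (N + k)) {1..m}"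
proof -
  define F where "F i = {X i -` A \<inter> space M |A. A \<in> sets B}" for i
  have rv: "1 \<le> n \<Longrightarrow> random_variable B (X n)" for n
    using assms by (auto simp: indep_vars_def2)
  have F: "indep_sets F {1..}"
    using assms by (auto simp: indep_vars_def2 F_def[abs_def])
  have "indep_sets (\<lambda>i. F (N + i)) {1..m}"
  proof (rule indep_setsI)
    show "F (N + i) \<subseteq> events" if "i \<in> {1..m}" for i
      using rv[of "N + i"] that by (auto simp: F_def measurable_sets)
    fix A J assume J: "J \<noteq> {}" "J \<subseteq> {1..m}" "finite J" "\<forall>j\<in>J. A j \<in> F (N + j)"
    have "prob (\<Inter>j\<in>(+) N ` J. A (j - N)) = (\<Prod>j\<in>(+) N ` J. prob (A (j - N)))"
      by (rule indep_setsD[OF F]) (use J in auto)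
    then show "prob (\<Inter>j\<in>J. A j) = (\<Prod>j\<in>J. prob (A j))"
      by (simp add: prod.reindex image_image)
  qed
  then show ?thesis using rv by (auto simp: indep_vars_def2 F_def)
qed

text \<open>By independence the joint law of m consecutive variables is the product of the
  marginals, and these are all equal; the position of the block is therefore invisible.\<close>

lemma (in prob_space) iid_shift_integral:
  fixes f :: "(nat \<Rightarrow> 'b) \<Rightarrow> complex"
  assumes ind: "indep_vars (\<lambda>_. B) X {1..}" and id: "\<And>n. 1 \<le> n \<Longrightarrow> distr M B (X n) = distr M B (X 1)"
    and f: "f \<in> borel_measurable (PiM {1..m} (\<lambda>_. B))" and m: "1 \<le> m"
  shows "(LINT \<omega>|M. f (\<lambda>k\<in>{1..m}. X (N + k) \<omega>)) = (LINT \<omega>|M. f (\<lambda>k\<in>{1..m}. X k \<omega>))"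
proof -
  have rv: "random_variable B (X n)" if "1 \<le> n" for n
    using ind that by (auto simp: indep_vars_def)
  have D: "distr M (PiM {1..m} (\<lambda>_. B)) (\<lambda>\<omega>. \<lambda>k\<in>{1..m}. X (N + k) \<omega>) = PiM {1..m} (\<lambda>_. distr M B (X 1))" for N
  proof -
    have "indep_vars (\<lambda>_. B) (\<lambda>k. X (N + k)) {1..m}" by (rule indep_vars_shift[OF ind])
    then have "distr M (PiM {1..m} (\<lambda>_. B)) (\<lambda>\<omega>. \<lambda>k\<in>{1..m}. X (N + k) \<omega>) = PiM {1..m} (\<lambda>k. distr M B (X (N + k)))"
      by (subst (asm) indep_vars_iff_distr_eq_PiM') (use m rv in auto)
    also have "\<dots> = PiM {1..m} (\<lambda>_. distr M B (X 1))" by (intro PiM_cong refl id) simp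
    finally show ?thesis .
  qed
  have meas: "(\<lambda>\<omega>. \<lambda>k\<in>{1..m}. X (N + k) \<omega>) \<in> measurable M (PiM {1..m} (\<lambda>_. B))" for N
    by (rule measurable_restrict) (use rv in auto)
  have "(LINT \<omega>|M. f (\<lambda>k\<in>{1..m}. X (N + k) \<omega>)) = (LINT x|PiM {1..m} (\<lambda>_. distr M B (X 1)). f x)" for N
    unfolding D[of N, symmetric] by (rule integral_distr[OF meas f, symmetric])
  from this[of N] this[of 0] show ?thesis by simp
qed

lemma mel_bop_borel: "(\<lambda>A. mel i A j) \<in> borel_measurable bop_borel"
proof (rule measurableI)
  fix B :: "complex set" assume "B \<in> sets borel"
  then have "{A. mel i A j \<in> B} \<in> sets bop_borel" unfolding bop_borel_def by (subst sets_measure_of) auto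
  moreover have "space bop_borel = UNIV" unfolding bop_borel_def by (simp add: space_measure_of_conv)
  ultimately show "(\<lambda>A. mel i A j) -` B \<inter> space bop_borel \<in> sets bop_borel" by (simp add: vimage_def)
qed simp

lemma mel_measurable_block: "mel_measurable M A \<Longrightarrow> mel_measurable M (\<lambda>\<omega>. block k l (A \<omega>))"
  unfolding mel_measurable_def mel_block
proof (intro allI)
  fix i j assume "\<forall>i j. (\<lambda>\<omega>. mel i (A \<omega>) j) \<in> borel_measurable M"
  then show "(\<lambda>\<omega>. if fst i = k \<and> fst j = l then mel (snd i) (A \<omega>) (snd j) else 0) \<in> borel_measurable M"
    by (cases "fst i = k \<and> fst j = l") auto
qed

lemma mel_measurable_jacobi:
  assumes "\<And>k. k \<in> {1..m} \<Longrightarrow> mel_measurable M (t k)" "\<And>k. k \<in> {1..m} \<Longrightarrow> mel_measurable M (v k)"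
  shows "mel_measurable M (\<lambda>\<omega>. jacobi (\<lambda>k. t k \<omega>) (\<lambda>k. v k \<omega>) m)"
  unfolding jacobi_def
  by (intro mel_measurable_add mel_measurable_sum mel_measurable_block mel_measurable_adj assms) auto

text \<open>The resolvent as a limit of polynomials, which are measurable in the coefficients even where the
  limit does not exist.\<close>

lemma resolvent_polynomials:
  fixes J :: "'i bop"
  assumes J: "adj J = J" and s: "0 < s" and K: "norm (Complex e (- s) *\<^sub>C 1 - J) \<le> K" "0 < K"
  shows "(\<lambda>n. mel a (\<i> *\<^sub>C (s / K\<^sup>2) *\<^sub>R (\<Sum>i<n. (1 - (s / K\<^sup>2) *\<^sub>R (\<i> *\<^sub>C (Complex e (- s) *\<^sub>C 1 - J))) ^ i)) b)
    \<longlonglongrightarrow> mel a (bop_inv (Complex e (- s) *\<^sub>C 1 - J)) b"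
proof -
  define Z where "Z = Complex e (- s) *\<^sub>C 1 - J"
  have "s * (norm u)\<^sup>2 \<le> Re (cinner u ((\<i> *\<^sub>C Z) *\<^sub>V u))" for u
    by (simp add: Z_def cinner_simps sa_Im[OF J] cinner_self)
  from coercive_inverse[OF s this] obtain G where G: "\<i> *\<^sub>C Z * G = 1" "G * \<i> *\<^sub>C Z = 1"
    "(\<lambda>n. (s / K\<^sup>2) *\<^sub>R (\<Sum>i<n. (1 - (s / K\<^sup>2) *\<^sub>R (\<i> *\<^sub>C Z)) ^ i)) \<longlonglongrightarrow> G"
    using K by (metis Z_def norm_scaleC_bop norm_ii mult_1)
  have "bop_inv Z = \<i> *\<^sub>C G" using G(1,2) by (intro bop_inv_eqI) simp_all
  moreover have "(\<lambda>n. \<i> * mel a ((s / K\<^sup>2) *\<^sub>R (\<Sum>i<n. (1 - (s / K\<^sup>2) *\<^sub>R (\<i> *\<^sub>C Z)) ^ i)) b) \<longlonglongrightarrow> \<i> * mel a G b"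
    by (intro tendsto_mult tendsto_const bounded_linear.tendsto[OF bounded_linear_mel G(3)])
  ultimately show ?thesis unfolding Z_def[symmetric] by (simp only: mel_simps)
qed

locale iid_jacobi_system = jacobi_system P \<tau> T V L
  for P :: "'w measure" and \<tau> :: "'z::int_lattice \<Rightarrow> 'w \<Rightarrow> 'w" and T V :: "nat \<Rightarrow> 'w \<Rightarrow> 'z bop" and L :: real +
  assumes indep: "indep_vars (\<lambda>_. bop_borel \<Otimes>\<^sub>M bop_borel) (\<lambda>n \<omega>. (T n \<omega>, V n \<omega>)) {1..}"
    and ident: "1 \<le> n \<Longrightarrow> distr P (bop_borel \<Otimes>\<^sub>M bop_borel) (\<lambda>\<omega>. (T n \<omega>, V n \<omega>))
      = distr P (bop_borel \<Otimes>\<^sub>M bop_borel) (\<lambda>\<omega>. (T 1 \<omega>, V 1 \<omega>))"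
begin

text \<open>The matrix element becomes one measurable function f of a block of M coefficient pairs,
  to which \<open>iid_shift_integral\<close> applies. Where the polynomials do not converge, f is
  whatever \<open>lim\<close> returns; the actual coefficients satisfy the bounds that guarantee
  convergence.\<close>

lemma resolvent_shift:
  assumes M: "1 \<le> M" and s: "0 < s"
  shows "(LINT \<omega>|P. mel a (bop_inv (Complex e (- s) *\<^sub>C 1 - jacobi (\<lambda>k. T (N + k) \<omega>) (\<lambda>k. V (N + k) \<omega>) M)) b)
    = (LINT \<omega>|P. mel a (res (jac M) s e \<omega>) b)"
proof -
  define J where "J x = jacobi (\<lambda>k. fst (x k)) (\<lambda>k. snd (x k)) M" for x :: "nat \<Rightarrow> 'z bop \<times> 'z bop"
  define K where "K = cmod (Complex e (- s)) + 3 * real M * L"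
  define Q where "Q n x = \<i> *\<^sub>C (s / K\<^sup>2) *\<^sub>R (\<Sum>i<n. (1 - (s / K\<^sup>2) *\<^sub>R (\<i> *\<^sub>C (Complex e (- s) *\<^sub>C 1 - J x))) ^ i)" for n x
  define f where "f x = lim (\<lambda>n. mel a (Q n x) b)" for x
  define X where "X n \<omega> = (T n \<omega>, V n \<omega>)" for n \<omega>
  let ?PM = "PiM {1..M} (\<lambda>_. bop_borel \<Otimes>\<^sub>M bop_borel) :: (nat \<Rightarrow> 'z bop \<times> 'z bop) measure"
  have comp: "mel_measurable ?PM (\<lambda>x. fst (x k))" "mel_measurable ?PM (\<lambda>x. snd (x k))" if "k \<in> {1..M}" for k
    unfolding mel_measurable_def using measurable_component_singleton[OF that, of "\<lambda>_. bop_borel \<Otimes>\<^sub>M bop_borel"]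
    by (auto intro!: measurable_compose[OF _ mel_bop_borel] measurable_compose[OF _ measurable_fst] measurable_compose[OF _ measurable_snd])
  have "mel_measurable ?PM (Q n)" for n
    unfolding Q_def[abs_def] J_def
    by (intro mel_measurable_scaleC mel_measurable_scaleR mel_measurable_sum mel_measurable_power countable_layers
        mel_measurable_diff mel_measurable_const mel_measurable_jacobi comp)
  then have f: "f \<in> borel_measurable ?PM"
    unfolding f_def[abs_def] by (intro borel_measurable_lim_metric mel_measurableD)
  have fX: "f (\<lambda>k\<in>{1..M}. X (N + k) \<omega>)
      = mel a (bop_inv (Complex e (- s) *\<^sub>C 1 - jacobi (\<lambda>k. T (N + k) \<omega>) (\<lambda>k. V (N + k) \<omega>) M)) b" for N \<omega>
  proof -
    have JX: "J (\<lambda>k\<in>{1..M}. X (N + k) \<omega>) = jacobi (\<lambda>k. T (N + k) \<omega>) (\<lambda>k. V (N + k) \<omega>) M"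
      unfolding J_def by (rule jacobi_cong) (simp_all add: X_def)
    have "norm (jacobi (\<lambda>k. T (N + k) \<omega>) (\<lambda>k. V (N + k) \<omega>) M) \<le> 3 * real M * L"
      using L by (intro norm_jacobi_le T_norm V_norm) auto
    then have nK: "norm (Complex e (- s) *\<^sub>C 1 - jacobi (\<lambda>k. T (N + k) \<omega>) (\<lambda>k. V (N + k) \<omega>) M) \<le> K"
      unfolding K_def by (intro order_trans[OF norm_triangle_ineq4] add_mono) (simp_all add: norm_scaleC_bop)
    have K0: "0 < K" unfolding K_def using L M by (intro add_nonneg_pos) auto
    have aJ: "adj (jacobi (\<lambda>k. T (N + k) \<omega>) (\<lambda>k. V (N + k) \<omega>) M) = jacobi (\<lambda>k. T (N + k) \<omega>) (\<lambda>k. V (N + k) \<omega>) M"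
      by (rule adj_jacobi) (simp add: V_adj)
    show ?thesis unfolding f_def Q_def JX by (rule limI[OF resolvent_polynomials[OF aJ s nK K0]])
  qed
  show ?thesis
    using iid_shift_integral[OF indep ident f M, of N, folded X_def] fX[of N] fX[of 0]
    by (simp add: res_def jac_def)
qed

text \<open>The coupling between the layers N and N + 1 is cut, and \<open>decouple\<close> is
  applied to the layers up to N and to those above. The upper block has shifted coefficients and
  therefore, in expectation, the resolvent trace of \<open>jac M\<close>.\<close>

lemma tr_split:
  assumes N: "1 \<le> N" and M: "1 \<le> M" and s: "0 < s"
    and H: "\<And>\<omega>. H \<omega> = jacobi (\<lambda>k. if k = Suc N then 0 else T k \<omega>) (\<lambda>k. V k \<omega>) (N + M)"
  shows "tr (N + M) (res H s e) = tr N (res (jac N) s e) + tr M (res (jac M) s e)"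
proof -
  let ?z = "Complex e (- s)"
  let ?J = "\<lambda>a m \<omega>. jacobi (\<lambda>k. T (a + k) \<omega>) (\<lambda>k. V (a + k) \<omega>) m"
  have inv: "(?z *\<^sub>C 1 - J) * bop_inv (?z *\<^sub>C 1 - J) = 1" "bop_inv (?z *\<^sub>C 1 - J) * (?z *\<^sub>C 1 - J) = 1"
    if "adj J = J" for J :: "(nat \<times> 'z) bop"
    using dissip_inv[OF s, of "?z *\<^sub>C 1 - J"] dissip_sub[OF that, of 0 s ?z] by simp_all
  have aH: "adj (H \<omega>) = H \<omega>" for \<omega> unfolding H by (rule adj_jacobi) (simp add: V_adj)
  have aJ: "adj (?J a m \<omega>) = ?J a m \<omega>" for a m \<omega> by (rule adj_jacobi) (simp add: V_adj)
  have first: "mel (k, 0) (res H s e \<omega>) (k, 0) = mel (k, 0) (res (jac N) s e \<omega>) (k, 0)" if k: "k \<in> {1..N}" for k \<omega>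
  proof -
    have J0: "jac N \<omega> = jacobi (\<lambda>k. if 0 + k = Suc N then 0 else T (0 + k) \<omega>) (\<lambda>k. V (0 + k) \<omega>) N"
      unfolding jac_def by (rule jacobi_cong) auto
    show ?thesis
      using decouple[OF _ _ _ inv(2)[OF aH[of \<omega>], unfolded H] inv(1)[OF adj_jac[of N \<omega>], unfolded J0] k, where b = 0 and c = 0]
      unfolding res_def H J0 by simp
  qed
  have second: "mel (N + k, 0) (res H s e \<omega>) (N + k, 0) = mel (k, 0) (bop_inv (?z *\<^sub>C 1 - ?J N M \<omega>)) (k, 0)"
    if k: "k \<in> {1..M}" for k \<omega>
  proof -
    have JN: "?J N M \<omega> = jacobi (\<lambda>k. if N + k = Suc N then 0 else T (N + k) \<omega>) (\<lambda>k. V (N + k) \<omega>) M"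
      by (rule jacobi_cong) auto
    show ?thesis
      using decouple[OF _ _ _ inv(2)[OF aH[of \<omega>], unfolded H] inv(1)[OF aJ[of N \<omega> M], unfolded JN] k, where b = 0 and c = 0]
      unfolding res_def H JN by simp
  qed
  have split: "{1..N + M} = {1..N} \<union> (+) N ` {1..M}" by (auto simp: image_iff)
  have "tr (N + M) (res H s e) = (\<Sum>k=1..N. LINT \<omega>|P. mel (k, 0) (res H s e \<omega>) (k, 0))
      + (\<Sum>k=1..M. LINT \<omega>|P. mel (N + k, 0) (res H s e \<omega>) (N + k, 0))"
  proof -
    have "(\<Sum>n\<in>(+) N ` {1..M}. g n) = (\<Sum>k=1..M. g (N + k))" for g :: "nat \<Rightarrow> complex"
      by (subst sum.reindex) (simp_all only: o_def inj_on_def add_left_cancel, simp)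
    moreover have "{1..N} \<inter> (+) N ` {1..M} = {}" by auto
    ultimately show ?thesis
      unfolding tr_def split by (subst sum.union_disjoint) (simp_all only: finite_atLeastAtMost finite_imageI)
  qed
  also have "(\<Sum>k=1..N. LINT \<omega>|P. mel (k, 0) (res H s e \<omega>) (k, 0)) = tr N (res (jac N) s e)"
    unfolding tr_def by (intro sum.cong refl) (simp only: first)
  also have "(\<Sum>k=1..M. LINT \<omega>|P. mel (N + k, 0) (res H s e \<omega>) (N + k, 0)) = tr M (res (jac M) s e)"
    unfolding tr_def by (intro sum.cong refl) (simp only: second resolvent_shift[OF M s])
  finally show ?thesis .
qed

text \<open>Restoring the cut coupling perturbs the two layers N and N + 1, and 17 is 8 times 2 plus
  1. The estimate is made for the smoothed integrals and carried over to \<open>dos_mid\<close> by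
  letting s tend to 0.\<close>

lemma dos_mid_additive:
  assumes N: "1 \<le> N" and M: "1 \<le> M"
  shows "\<bar>pi * dos_mid (jac (N + M)) (N + M) E - pi * dos_mid (jac N) N E - pi * dos_mid (jac M) M E\<bar> \<le> 17"
proof -
  define W where "W \<omega> = block N (Suc N) (T (Suc N) \<omega>) + block (Suc N) N (adj (T (Suc N) \<omega>))" for \<omega>
  define H where "H \<omega> = jac (N + M) \<omega> - W \<omega>" for \<omega>
  define S where "S = {N, Suc N}"
  have W: "fam P \<tau> W" "adj (W \<omega>) = W \<omega>" "lay S * W \<omega> = W \<omega>" "W \<omega> * lay S = W \<omega>" for \<omega>
    unfolding W_def[abs_def] by (auto intro!: fam_add fam_block_T fam_adj_block_T
        simp: adj_block distrib_left distrib_right lay_block S_def)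
  have S: "S \<subseteq> {1..N + M}" "card S = 2" using N M by (auto simp: S_def)
  have lW: "lay {1..N + M} * W \<omega> = W \<omega>" "W \<omega> * lay {1..N + M} = W \<omega>" for \<omega>
    using S(1) unfolding W_def by (simp_all add: distrib_left distrib_right lay_block S_def)
  have H: "fam P \<tau> H" "adj (H \<omega>) = H \<omega>" "lay {1..N + M} * H \<omega> = H \<omega> * lay {1..N + M}" for \<omega>
  proof -
    have "fam P \<tau> (\<lambda>\<omega>. jac (N + M) \<omega> - W \<omega>)" by (intro fam_diff fam_jac W)
    then show "fam P \<tau> H" by (simp add: H_def[abs_def])
  qed (simp_all only: H_def adj_simps adj_jac W left_diff_distrib right_diff_distrib jac_commute lW)
  have cut: "H \<omega> = jacobi (\<lambda>k. if k = Suc N then 0 else T k \<omega>) (\<lambda>k. V k \<omega>) (N + M)" for \<omega>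
  proof -
    have mem: "Suc N \<in> {2..N + M}" using N M by simp
    let ?b = "\<lambda>t n. block (n - 1) n (t n) + block n (n - 1) (adj (t n))"
    let ?D = "\<Sum>n\<in>{2..N + M} - {Suc N}. ?b (\<lambda>k. T k \<omega>) n" and ?t = "\<lambda>k. if k = Suc N then 0 else T k \<omega>"
    have "(\<Sum>n=2..N + M. ?b (\<lambda>k. T k \<omega>) n) = ?b (\<lambda>k. T k \<omega>) (Suc N) + ?D"
      by (rule sum.remove[OF finite_atLeastAtMost mem])
    also have "?b (\<lambda>k. T k \<omega>) (Suc N) = W \<omega>" by (simp add: W_def)
    finally have 1: "(\<Sum>n=2..N + M. ?b (\<lambda>k. T k \<omega>) n) = W \<omega> + ?D" .
    have "(\<Sum>n=2..N + M. ?b ?t n) = ?b ?t (Suc N) + (\<Sum>n\<in>{2..N + M} - {Suc N}. ?b ?t n)"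
      by (rule sum.remove[OF finite_atLeastAtMost mem])
    moreover have "(\<Sum>n\<in>{2..N + M} - {Suc N}. ?b ?t n) = ?D"
    proof (rule sum.cong[OF refl])
      fix n assume "n \<in> {2..N + M} - {Suc N}"
      then have "?t n = T n \<omega>" by simp
      then show "?b ?t n = ?b (\<lambda>k. T k \<omega>) n" by (simp only:)
    qed
    moreover have "?b ?t (Suc N) = 0" by (simp add: block_zero)
    ultimately have 2: "(\<Sum>n=2..N + M. ?b ?t n) = ?D" by (simp only: add_0)
    show ?thesis unfolding H_def jac_def jacobi_def 1 2 by (simp only: add_diff_cancel_left' add.left_commute)
  qed
  obtain R0 where R0: "0 < R0" "\<And>R s E. R0 \<le> R \<Longrightarrow> 0 < s \<Longrightarrow> - R \<le> E \<Longrightarrow>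
    \<bar>integral {- R..E} (\<lambda>e. Im (tr (N + M) (res (\<lambda>\<omega>. H \<omega> + W \<omega>) s e)))
      - integral {- R..E} (\<lambda>e. Im (tr (N + M) (res H s e)))\<bar> \<le> 8 * real (card S) + 1"
    by (rule tr_layer_perturbation[OF H(1,2) W(1,2) S(1) W(3,4) H(3)]) (rule that)
  have HW: "(\<lambda>\<omega>. H \<omega> + W \<omega>) = jac (N + M)" by (simp add: H_def fun_eq_iff)
  obtain K1 where K1: "0 < K1" "\<And>\<omega>. norm (jac (N + M) \<omega>) \<le> K1" using fam_bound[OF fam_jac[of "N + M"]] by metis
  obtain K2 where K2: "0 < K2" "\<And>\<omega>. norm (jac N \<omega>) \<le> K2" using fam_bound[OF fam_jac[of N]] by metis
  obtain K3 where K3: "0 < K3" "\<And>\<omega>. norm (jac M \<omega>) \<le> K3" using fam_bound[OF fam_jac[of M]] by metis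
  define R where "R = R0 + K1 + K2 + K3 + \<bar>E\<bar> + 1"
  have R: "R0 \<le> R" "- R \<le> E" "- R < - K1" "- R < - K2" "- R < - K3"
    using R0(1) K1(1) K2(1) K3(1) by (auto simp: R_def)
  define s where "s j = 1 / real (Suc j)" for j
  have s: "0 < s j" for j by (simp add: s_def)
  define I where "I n j = integral {- R..E} (\<lambda>e. Im (tr n (res (jac n) (s j) e)))" for n j
  have lim: "I (N + M) \<longlonglongrightarrow> pi * dos_mid (jac (N + M)) (N + M) E" "I N \<longlonglongrightarrow> pi * dos_mid (jac N) N E"
    "I M \<longlonglongrightarrow> pi * dos_mid (jac M) M E"
    unfolding I_def[abs_def] res_def s_def
    using dos_mid_limit[OF fam_jac adj_jac K1(2) R(3,2)] dos_mid_limit[OF fam_jac adj_jac K2(2) R(4,2)]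
      dos_mid_limit[OF fam_jac adj_jac K3(2) R(5,2)] by blast+
  have "\<bar>I (N + M) j - I N j - I M j\<bar> \<le> 17" for j
  proof -
    have i: "(\<lambda>e. Im (tr n (res (jac n) (s j) e))) integrable_on {- R..E}" for n
      using integrable_linear[OF res_integrable_on[OF fam_jac adj_jac s] bounded_linear_Im] by (simp add: o_def)
    have "integral {- R..E} (\<lambda>e. Im (tr (N + M) (res H (s j) e))) = I N j + I M j"
      unfolding tr_split[OF N M s cut] plus_complex.sel I_def
      by (rule Henstock_Kurzweil_Integration.integral_add[OF i i])
    then show ?thesis using R0(2)[OF R(1) s R(2), of j] unfolding HW I_def[symmetric] S(2) by simp
  qed
  moreover have "(\<lambda>j. \<bar>I (N + M) j - I N j - I M j\<bar>)
      \<longlonglongrightarrow> \<bar>pi * dos_mid (jac (N + M)) (N + M) E - pi * dos_mid (jac N) N E - pi * dos_mid (jac M) M E\<bar>"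
    by (intro tendsto_intros lim)
  ultimately show ?thesis by (intro LIMSEQ_le_const2) auto
qed

lemma convergent_idos: "convergent (\<lambda>N. idos P T V N E)"
proof -
  have "convergent (\<lambda>N. (pi * dos (jac N) N E) / real N)"
  \<comment> \<open>68 is 17 for the additivity of \<open>dos_mid\<close> plus three times 17, one
    passage from \<open>dos\<close> to \<open>dos_mid\<close> for each of the three terms.\<close>
  proof (rule almost_additive_convergent[where C = 68])
    fix N M :: nat assume NM: "1 \<le> N" "1 \<le> M"
    then have "1 \<le> N + M" by simp
    from dos_mid_dos[OF this, of E] dos_mid_dos[OF NM(1), of E] dos_mid_dos[OF NM(2), of E] dos_mid_additive[OF NM, of E]
    show "\<bar>pi * dos (jac (N + M)) (N + M) E - pi * dos (jac N) N E - pi * dos (jac M) M E\<bar> \<le> 68"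
      unfolding abs_le_iff by linarith
  qed
  then obtain l where "(\<lambda>N. (pi * dos (jac N) N E) / real N) \<longlonglongrightarrow> l" by (auto simp: convergent_def)
  then have "(\<lambda>N. complex_of_real ((pi * dos (jac N) N E) / real N / pi)) \<longlonglongrightarrow> complex_of_real (l / pi)"
    by (intro tendsto_intros) simp_all
  then have "(\<lambda>N. complex_of_real (dos (jac N) N E / real N)) \<longlonglongrightarrow> complex_of_real (l / pi)" by simp
  moreover have "\<forall>\<^sub>F N in sequentially. complex_of_real (dos (jac N) N E / real N) = idos P T V N E"
    by (rule eventually_sequentiallyI[of 1]) (simp only: idos_dos)
  ultimately have "(\<lambda>N. idos P T V N E) \<longlonglongrightarrow> complex_of_real (l / pi)" by (rule Lim_transform_eventually)
  then show ?thesis by (rule convergentI)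
qed

lemma phase_velocity_limit:
  "(\<lambda>N. 1 / (2 * pi) * (LINT e:{..E}|lborel. trace_per_site P (phase_velocity T V N e)))
    \<longlonglongrightarrow> lim (\<lambda>N. idos P T V N E)"
proof -
  let ?J = "\<lambda>N. 1 / (2 * pi) * (LINT e:{..E}|lborel. trace_per_site P (phase_velocity T V N e))"
  have "(\<lambda>N. idos P T V N E - ?J N) \<longlonglongrightarrow> 0"
  proof (rule Lim_null_comparison)
    show "\<forall>\<^sub>F N in sequentially. cmod (idos P T V N E - ?J N) \<le> 9 / real N"
      by (rule eventually_sequentiallyI[of 1]) (rule idos_phase)
    show "(\<lambda>N. 9 / real N) \<longlonglongrightarrow> 0" by (rule lim_const_over_n)
  qed
  from tendsto_diff[OF convergent_LIMSEQ_iff[THEN iffD1, OF convergent_idos[of E]] this]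
  show ?thesis by (simp only: diff_diff_eq2 add_diff_cancel_left' diff_zero)
qed

end

subsection \<open>Covariance and the main theorem\<close>

text \<open>Induction on the sum of the absolute values of the coordinates. It carries covariance,
  which is given for the generators in \<open>dirs\<close>, to all translations.\<close>

lemma int_lattice_induct [case_names zero plus minus]:
  fixes n :: "'z::int_lattice"
  assumes "P 0" "\<And>n e. e \<in> dirs \<Longrightarrow> P n \<Longrightarrow> P (n + e)" "\<And>n e. e \<in> dirs \<Longrightarrow> P n \<Longrightarrow> P (n - e)"
  shows "P n"
proof (induction "\<Sum>e\<in>(dirs :: 'z set). nat \<bar>coord n e\<bar>" arbitrary: n rule: less_induct)
  case (less n)
  show ?case
  proof (cases "\<forall>e\<in>dirs. coord n e = 0")
    case True
    have "n = 0" by (rule coord_eqI) (use True in \<open>simp add: coord_zero\<close>)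
    then show ?thesis using assms(1) by simp
  next
    case False
    then obtain e where e: "e \<in> dirs" "coord n e \<noteq> 0" by blast
    have c: "coord (n + e) f = coord n f + (if e = f then 1 else 0)" "coord (n - e) f = coord n f - (if e = f then 1 else 0)"
      if "f \<in> dirs" for f
      using that e coord_add[of f n e] coord_add[of f n "- e"] coord_minus[of f e] coord_dirs[of e f] by simp_all
    have smaller: "P m" if "\<And>f. f \<in> dirs \<Longrightarrow> f \<noteq> e \<Longrightarrow> coord m f = coord n f" "\<bar>coord m e\<bar> < \<bar>coord n e\<bar>" for m
    proof (rule less)
      have "nat \<bar>coord m f\<bar> \<le> nat \<bar>coord n f\<bar>" if "f \<in> dirs" for f
        using that \<open>\<And>f. f \<in> dirs \<Longrightarrow> f \<noteq> e \<Longrightarrow> coord m f = coord n f\<close>[of f] \<open>\<bar>coord m e\<bar> < \<bar>coord n e\<bar>\<close>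
        by (cases "f = e") auto
      moreover have "nat \<bar>coord m e\<bar> < nat \<bar>coord n e\<bar>" using that(2) by simp
      ultimately show "(\<Sum>f\<in>(dirs :: 'z set). nat \<bar>coord m f\<bar>) < (\<Sum>f\<in>(dirs :: 'z set). nat \<bar>coord n f\<bar>)"
        using e(1) by (intro sum_strict_mono_ex1 finite_dirs) auto
    qed
    show ?thesis
    proof (cases "0 < coord n e")
      case True
      have "P (n - e)" by (rule smaller) (use c e True in auto)
      from assms(2)[OF e(1) this] show ?thesis by simp
    next
      case False
      have "P (n + e)" by (rule smaller) (use c e False in auto)
      from assms(3)[OF e(1) this] show ?thesis by simp
    qed
  qed
qed

lemma mel_shift: "mel (a + e) (shift e * A * adj (shift e)) (b + e) = mel a A b"
proof -
  have "adj (shift e) *\<^sub>V ket (b + e) = ket b"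
  proof (rule ell2_eqI)
    fix i
    have "ell2_apply (adj (shift e) *\<^sub>V ket (b + e)) i = cinner (ket (i + e)) (ket (b + e))"
      unfolding cinner_ket[symmetric] cinner_adj_right shift_ket ..
    then show "ell2_apply (adj (shift e) *\<^sub>V ket (b + e)) i = ell2_apply (ket b) i"
      by (simp add: cinner_ket ket.rep_eq)
  qed
  then show ?thesis by (simp add: mel_apply bop_apply_times shift_apply translate.rep_eq)
qed

text \<open>From generators to the lattice by induction, and from finite range families to their
  uniform limits by convergence of matrix elements.\<close>

lemma local_algebra_mel_covariant:
  fixes \<tau> :: "'z::int_lattice \<Rightarrow> 'w::topological_space \<Rightarrow> 'w"
  assumes \<tau>: "continuous_action \<tau>" and A: "A \<in> local_algebra \<tau>"
  shows "mel (a + e) (A (\<tau> e \<omega>)) (b + e) = mel a (A \<omega>) b"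
proof -
  have \<tau>0: "\<tau> 0 \<omega> = \<omega>" and \<tau>a: "\<tau> (n + m) \<omega> = \<tau> n (\<tau> m \<omega>)" for n m \<omega>
    using \<tau> by (auto simp: continuous_action_def)
  have cov: "mel (a + e) (B (\<tau> e \<omega>)) (b + e) = mel a (B \<omega>) b" if B: "B \<in> local_algebra0 \<tau>" for B a b \<omega>
  proof (induction e arbitrary: a b \<omega> rule: int_lattice_induct)
    case zero
    then show ?case by (simp add: \<tau>0)
  next
    case (plus n e)
    have "mel (a + n + e) (B (\<tau> e (\<tau> n \<omega>))) (b + n + e) = mel (a + n) (B (\<tau> n \<omega>)) (b + n)"
      using B plus(1) mel_shift[of "a + n" e "B (\<tau> n \<omega>)" "b + n"] by (simp add: local_algebra0_def covariant_def)
    moreover have "\<tau> (n + e) \<omega> = \<tau> e (\<tau> n \<omega>)" using \<tau>a[of e n \<omega>] by (simp only: add.commute)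
    ultimately show ?case using plus(2)[of a \<omega> b] by (simp only: add.assoc)
  next
    case (minus n e)
    \<comment> \<open>The relation for the inverse generator is the one for e at the point \<tau> (n
      - e) \<omega>, read backwards.\<close>
    have "\<tau> e (\<tau> (n - e) \<omega>) = \<tau> n \<omega>" using \<tau>a[of e "n - e" \<omega>] by simp
    then have "mel (a + n - e + e) (B (\<tau> n \<omega>)) (b + n - e + e) = mel (a + n - e) (B (\<tau> (n - e) \<omega>)) (b + n - e)"
      using B minus(1) mel_shift[of "a + n - e" e "B (\<tau> (n - e) \<omega>)" "b + n - e"]
      by (simp add: local_algebra0_def covariant_def)
    then show ?case using minus(2)[of a \<omega> b] by (simp only: diff_add_cancel add_diff_eq)
  qed
  obtain B where B: "\<And>k. B k \<in> local_algebra0 \<tau>" "uniform_limit UNIV B A sequentially"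
    using A by (auto simp: local_algebra_def)
  have lim: "(\<lambda>k. mel i (B k \<omega>) j) \<longlonglongrightarrow> mel i (A \<omega>) j" for i j \<omega>
    by (rule bounded_linear.tendsto[OF bounded_linear_mel tendsto_uniform_limitI[OF B(2) UNIV_I]])
  show ?thesis
    using LIMSEQ_unique[OF lim[of "a + e" "\<tau> e \<omega>" "b + e", unfolded cov[OF B(1)]] lim] .
qed

text \<open>Matrix elements of strongly continuous families are continuous functions of \<omega>,
  hence Borel, and uniform limits keep measurability.\<close>

lemma local_algebra_measurable:
  fixes \<tau> :: "'z::int_lattice \<Rightarrow> 'w::topological_space \<Rightarrow> 'w"
  assumes A: "A \<in> local_algebra \<tau>" and P: "sets P = sets borel"
  shows "mel_measurable P A"
proof -
  obtain B where B: "\<And>k. B k \<in> local_algebra0 \<tau>" "uniform_limit UNIV B A sequentially"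
    using A by (auto simp: local_algebra_def)
  show ?thesis
  proof (rule mel_measurable_norm_limit[where X = B])
    show "(\<lambda>k. B k \<omega>) \<longlonglongrightarrow> A \<omega>" for \<omega> by (rule tendsto_uniform_limitI[OF B(2) UNIV_I])
    show "mel_measurable P (B k)" for k
      unfolding mel_measurable_def mel_def
    proof (intro allI)
      fix i j
      have "continuous_on UNIV (\<lambda>\<omega>. B k \<omega> *\<^sub>V ket j)" using B(1) by (simp add: local_algebra0_def)
      then have "continuous_on UNIV (\<lambda>\<omega>. cinner (ket i) (B k \<omega> *\<^sub>V ket j))"
        by (rule bounded_linear.continuous_on[OF bounded_linear_cinner_right])
      then show "(\<lambda>\<omega>. cinner (ket i) (B k \<omega> *\<^sub>V ket j)) \<in> borel_measurable P"
        unfolding measurable_cong_sets[OF P refl] by (rule borel_measurable_continuous_onI)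
    qed
  qed
qed

lemma coeff_bound_le:
  fixes T V :: "nat \<Rightarrow> 'w \<Rightarrow> 'i bop"
  assumes "coeff_bound invert T V < \<infinity>"
  obtains L where "0 < L"
    "\<And>n \<omega>. 1 \<le> n \<Longrightarrow> norm (T n \<omega>) \<le> L \<and> norm (invert (T n \<omega>)) \<le> L \<and> norm (V n \<omega>) \<le> L"
proof -
  define \<Lambda> where "\<Lambda> = coeff_bound invert T V"
  \<comment> \<open>The maximum with 1 makes the bound strictly positive whatever the value of the
    supremum.\<close>
  define L where "L = max 1 (real_of_ereal \<Lambda>)"
  have fam: "family_norm (T n) \<le> \<Lambda>" "family_norm (\<lambda>\<omega>. invert (T n \<omega>)) \<le> \<Lambda>" "family_norm (V n) \<le> \<Lambda>" if "1 \<le> n" for n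
  proof -
    have "Sup {family_norm (T n), family_norm (\<lambda>\<omega>. invert (T n \<omega>)), family_norm (V n)} \<le> \<Lambda>"
      unfolding \<Lambda>_def coeff_bound_def by (rule SUP_upper) (use that in simp)
    then show "family_norm (T n) \<le> \<Lambda>" "family_norm (\<lambda>\<omega>. invert (T n \<omega>)) \<le> \<Lambda>" "family_norm (V n) \<le> \<Lambda>"
      by (simp_all add: Sup_le_iff)
  qed
  have le: "norm (A \<omega>) \<le> L" if "family_norm A \<le> \<Lambda>" for A :: "'w \<Rightarrow> 'i bop" and \<omega>
  proof -
    have "ereal (norm (A \<omega>)) \<le> \<Lambda>" using that unfolding family_norm_def by (meson SUP_upper UNIV_I order_trans)
    then have "norm (A \<omega>) \<le> real_of_ereal \<Lambda>" using assms unfolding \<Lambda>_def[symmetric] by (cases \<Lambda>) auto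
    then show ?thesis by (simp add: L_def)
  qed
  show thesis
    using le[OF fam(1)] le[OF fam(2)] le[OF fam(3)] by (intro that[of L]) (auto simp: L_def)
qed

theorem theorem2:
  fixes P :: "'w::topological_space measure"
    and \<tau> :: "'z::int_lattice \<Rightarrow> 'w \<Rightarrow> 'w"
    and T V :: "nat \<Rightarrow> 'w \<Rightarrow> 'z bop"
    and T_fin V_fin :: "nat \<Rightarrow> nat \<Rightarrow> 'w \<Rightarrow> 'z bop"
    and \<Lambda> :: ereal and L0 :: nat
  assumes "compact (UNIV :: 'w set)"
    and "continuous_action \<tau>"
    and "prob_space P" and "sets P = sets borel"
    and "invariant_ergodic P \<tau>"
    and "\<And>n. n \<ge> 1 \<Longrightarrow> T n \<in> local_algebra \<tau>"
    and "\<And>n. n \<ge> 1 \<Longrightarrow> V n \<in> local_algebra \<tau>"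
    and "\<And>n \<omega>. n \<ge> 1 \<Longrightarrow> self_adjoint (V n \<omega>)"
    and "\<And>n. n \<ge> 1 \<Longrightarrow> \<exists>B\<in>local_algebra \<tau>. \<forall>\<omega>. is_inverse_in 1 (T n \<omega>) (B \<omega>)"
    and "prob_space.indep_vars P (\<lambda>_. bop_borel \<Otimes>\<^sub>M bop_borel) (\<lambda>n \<omega>. (T n \<omega>, V n \<omega>)) {1..}"
    and "\<And>n. n \<ge> 1 \<Longrightarrow>
           distr P (bop_borel \<Otimes>\<^sub>M bop_borel) (\<lambda>\<omega>. (T n \<omega>, V n \<omega>)) =
           distr P (bop_borel \<Otimes>\<^sub>M bop_borel) (\<lambda>\<omega>. (T 1 \<omega>, V 1 \<omega>))"
    and "\<Lambda> = coeff_bound bop_inv T V" and "\<Lambda> < \<infinity>"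
    and "\<And>n. n \<ge> 1 \<Longrightarrow> finite_volume_approximant P (T n) (T_fin n)"
    and "\<And>n. n \<ge> 1 \<Longrightarrow> finite_volume_approximant P (V n) (V_fin n)"
    and "\<And>n L \<omega>. n \<ge> 1 \<Longrightarrow> self_adjoint (V_fin n L \<omega>)"
    and "\<And>n L \<omega>. n \<ge> 1 \<Longrightarrow> L \<ge> L0 \<Longrightarrow> \<exists>B. is_inverse_in (cube_proj L) (T_fin n L \<omega>) B"
    and "\<And>L. L \<ge> L0 \<Longrightarrow>
           coeff_bound (inverse_in (cube_proj L)) (\<lambda>n. T_fin n L) (\<lambda>n. V_fin n L) \<le> 2 * \<Lambda>"
  shows "(\<forall>N\<ge>3. \<forall>E. set_integrable lborel {..E} (\<lambda>e. trace_per_site P (phase_velocity T V N e))) \<and>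
     (\<exists>C::real. \<forall>N\<ge>3. \<forall>E.
        cmod (idos P T V N E -
              1 / (2 * pi) * (LINT e:{..E}|lborel. trace_per_site P (phase_velocity T V N e)))
        \<le> C / real N) \<and>
     (\<forall>E. convergent (\<lambda>N. idos P T V N E) \<and>
        (\<lambda>N. 1 / (2 * pi) * (LINT e:{..E}|lborel. trace_per_site P (phase_velocity T V N e)))
        \<longlonglongrightarrow> lim (\<lambda>N. idos P T V N E))"
proof -
  obtain L where L: "0 < L"
    "\<And>n \<omega>. 1 \<le> n \<Longrightarrow> norm (T n \<omega>) \<le> L \<and> norm (bop_inv (T n \<omega>)) \<le> L \<and> norm (V n \<omega>) \<le> L"
    by (rule coeff_bound_le[OF assms(13)[unfolded assms(12)]]) (rule that)
  interpret prob_space P by (rule assms(3))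
  have inv: "T n \<omega> * bop_inv (T n \<omega>) = 1 \<and> bop_inv (T n \<omega>) * T n \<omega> = 1" if n: "1 \<le> n" for n \<omega>
  proof -
    obtain B where "T n \<omega> * B \<omega> = 1" "B \<omega> * T n \<omega> = 1" using assms(9)[OF n] by (auto simp: is_inverse_in_one)
    then show ?thesis using bop_inv_eqI[of "T n \<omega>" "B \<omega>"] by simp
  qed
  interpret iid_jacobi_system P \<tau> T V L
  proof
    show "\<tau> e \<in> measurable P P" "distr P P (\<tau> e) = P" for e
      using assms(5) by (auto simp: invariant_ergodic_def)
    show "mel (a + e) (T n (\<tau> e \<omega>)) (b + e) = mel a (T n \<omega>) b" if "1 \<le> n" for n a e \<omega> b
      by (rule local_algebra_mel_covariant[OF assms(2) assms(6)[OF that]])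
    show "mel (a + e) (V n (\<tau> e \<omega>)) (b + e) = mel a (V n \<omega>) b" if "1 \<le> n" for n a e \<omega> b
      by (rule local_algebra_mel_covariant[OF assms(2) assms(7)[OF that]])
    show "mel_measurable P (T n)" if "1 \<le> n" for n by (rule local_algebra_measurable[OF assms(6)[OF that] assms(4)])
    show "mel_measurable P (V n)" if "1 \<le> n" for n by (rule local_algebra_measurable[OF assms(7)[OF that] assms(4)])
    show "adj (V n \<omega>) = V n \<omega>" if "1 \<le> n" for n \<omega> using assms(8)[OF that] by (simp only: self_adjoint_iff)
    show "distr P (bop_borel \<Otimes>\<^sub>M bop_borel) (\<lambda>\<omega>. (T n \<omega>, V n \<omega>))
      = distr P (bop_borel \<Otimes>\<^sub>M bop_borel) (\<lambda>\<omega>. (T 1 \<omega>, V 1 \<omega>))" if "1 \<le> n" for n by (rule assms(11)[OF that])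
    show "0 < L" by (rule L(1))
    show "norm (T n \<omega>) \<le> L" "norm (V n \<omega>) \<le> L" "norm (bop_inv (T n \<omega>)) \<le> L" if "1 \<le> n" for n \<omega>
      using L(2)[OF that, of \<omega>] by simp_all
    show "T n \<omega> * bop_inv (T n \<omega>) = 1 \<and> bop_inv (T n \<omega>) * T n \<omega> = 1" if "1 \<le> n" for n \<omega> by (rule inv[OF that])
    show "indep_vars (\<lambda>_. bop_borel \<Otimes>\<^sub>M bop_borel) (\<lambda>n \<omega>. (T n \<omega>, V n \<omega>)) {1..}" by (rule assms(10))
  qed
  have "set_integrable lborel {..E} (\<lambda>e. trace_per_site P (phase_velocity T V N e))" if "3 \<le> N" for N E
    by (rule phase_velocity_integral(1)) (use that in simp)
  moreover have "cmod (idos P T V N E -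
      1 / (2 * pi) * (LINT e:{..E}|lborel. trace_per_site P (phase_velocity T V N e))) \<le> 9 / real N"
    if "3 \<le> N" for N E
    by (rule idos_phase) (use that in simp)
  ultimately show ?thesis
    using convergent_idos phase_velocity_limit by (intro conjI exI[of _ 9]) simp_all
qed

end
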